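(* Let $\gamma_2>0$, $0<9\delta<2l-n$, $\gamma=\min\{\gamma_1,\gamma_2\}$, $2\gamma_1=2l-n-8\delta$. Then for each sufficiently large $k$, $k>k_0(V,\gamma_2,\delta)$, every $t$ in the $(k^{-n+1-7\delta})$-neighborhood in $K$ of $\chi_q(k,\delta)$ and every $A\in\mathbb C$ with $|\sigma||A|^2<k^{-\gamma_2}$, $$\big|\nabla_t\lambda^\pm(t)\big|=2lk^{2l-1}\big(1+O(k^{-\gamma})+O(k^{-1})\big).$$
   Context: Setting. $l,n$ are fixed positive integers with $2l>n$; $\sigma\in\mathbb R$; $Q=[0,2\pi]^n$; $K=[0,1)^n$. $V(x)=\sum_{m\in\mathbb Z^n,\,0<|m|\le R_0}v_me^{i\langle m,x\rangle}$ is a real-valued trigonometric polynomial, not identically zero, and $q\in\mathbb Z^n\setminus\{0\}$ is fixed with $v_q\neq0$. For a $2\pi$-periodic $W$ with Fourier coefficients $w_m$, $\|W\|_*=\sum_{m}|w_m|$. For $j\in\mathbb Z^n$: $P_j(t)=j+t$, $p_j(t)=|P_j(t)|$. $H_0(t)$ is $(-\Delta)^l$ in $L^2(Q)$ with the quasi-periodic conditions $\partial_{x_s}^ru(x_1,\dots,x_s+2\pi,\dots,x_n)=e^{2\pi i t_s}\partial_{x_s}^ru(x)$, $s=1,\dots,n$, $r=0,\dots,2l-1$. Operators are written as matrices in the basis $e^{i\langle P_s(t),x\rangle}$, $s\in\mathbb Z^n$: $H_0(t)=\mathrm{diag}(p_s^{2l}(t))$ and multiplication by $W$ is $(w_{s-r})_{s,r}$.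 Gradients $\nabla_t$ are taken with $k,\sigma,A,j$ fixed. Resonant set. $S(k)$ is the sphere of radius $k$ centered at $0$, $S_q(k,n-2+\delta)=\{x\in S(k):\big||x|^2-|x-q|^2\big|<4k^{-n+2-\delta}\}$, and $\mathcal K:\mathbb R^n\to K$, $\mathcal KP_m(t)=t$. $\chi_q(k,\delta)$ is a subset of $\mathcal KS_q(k,n-2+\delta)$ such that for each $t\in\chi_q(k,\delta)$: there is $j\in\mathbb Z^n$ with $P_j(t)\in S_q(k,n-2+\delta)$; $|p_{j-q}^2(t)-p_j^2(t)|<4k^{-n+2-\delta}$; and $\min_{i\ne j,j-q}|p_j^2(t)-p_i^2(t)|>2k^{-n+2-6\delta}$. It has asymptotically full measure in $\mathcal KS_q(k,n-2+\delta)$ (relative measure of the complement $O(k^{-\delta/2})$). For $t$ near $\chi_q(k,\delta)$, $j$ is the index attached to a nearby point of $\chi_q(k,\delta)$. For $t$ in the $(2k^{-n+1-7\delta})$-neighborhood of $\chi_q(k,\delta)$ and $z$ on either circle $C_1^\pm=\{z:|z-\hat\lambda^\pm(t)|=d\}$, $d=\frac1{10}|v_q|$, one has $2|p_m^{2l}(t)-z|\ge k^{2l-n-6\delta}$ for $m\neq j,j-q$. Model operator. $\hat\lambda^\pm(t)=a\pm b$, $2a=p_j^{2l}+p_{j-q}^{2l}$, $2b=(4|v_q|^2+(p_j^{2l}-p_{j-q}^{2l})^2)^{1/2}$, are the eigenvalues of $\begin{pmatrix}p_j^{2l}(t)&v_q\\ v_{-q}&p_{j-q}^{2l}(t)\end{pmatrix}$.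 $P_q$ is the diagonal projection onto coordinates $j,j-q$, $\hat H_q(t)=H_0(t)+P_qVP_q$, and $\hat E^\pm(t)$ is the rank-one spectral projection of $\hat H_q(t)$ for $\hat\lambda^\pm(t)$ (supported on coordinates $j,j-q$). Construction. For periodic $W$ with $\|W\|_*<\infty$ put $Y=W-P_qVP_q$ and (whenever the series converge) $\hat E^\pm_W=\hat E^\pm+\sum_{r\ge1}\hat G^\pm_{W,r}$, $\lambda_W^\pm=\hat\lambda^\pm+\sum_{r\ge1}\hat g^\pm_{W,r}$, where $\hat G^\pm_{W,r}=\frac{(-1)^{r+1}}{2\pi i}\oint_{C_1^\pm}((\hat H_q-z)^{-1}Y)^r(\hat H_q-z)^{-1}dz$, $\hat g^\pm_{W,r}=\frac{(-1)^r}{2\pi ir}\mathrm{Tr}\oint_{C_1^\pm}((\hat H_q-z)^{-1}Y)^rdz$. For $A\in\mathbb C$ put $u_W^\pm(x)=A\sum_{s}(\hat E_W^\pm)_{sj}e^{i\langle P_s(t),x\rangle}$, $\hat{\mathcal M}^\pm W=V+\sigma|u_W^\pm|^2$, $W_0^\pm=V$, $W_m^\pm=\hat{\mathcal M}^\pm W_{m-1}^\pm$. $W^\pm$ is the $\|\cdot\|_*$-limit of $W_m^\pm$ and $\lambda^\pm(t)=\lambda^\pm_{W^\pm}(t)$ is the corresponding eigenvalue of $H_0(t)+W^\pm$. *)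

theory Defs
  imports "HOL-Complex_Analysis.Complex_Analysis"
begin

section \<open>Lattice, quasimomenta, Fourier coefficients\<close>

definition lvec :: "int ^ 'n \<Rightarrow> real ^ 'n" where
  "lvec m = (\<chi> i. real_of_int (m $ i))"

definition mode :: "real ^ 'n \<Rightarrow> real ^ 'n \<Rightarrow> complex" where
  "mode y x = exp (\<i> * complex_of_real (y \<bullet> x))"

definition cellQ :: "(real ^ 'n) set" where
  "cellQ = {x. \<forall>i. 0 \<le> x $ i \<and> x $ i \<le> 2 * pi}"

definition cellK :: "(real ^ 'n) set" where
  "cellK = {t. \<forall>i. 0 \<le> t $ i \<and> t $ i < 1}"

definition Pv :: "int ^ 'n \<Rightarrow> real ^ 'n \<Rightarrow> real ^ 'n" where
  "Pv j t = lvec j + t"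

definition pn :: "int ^ 'n \<Rightarrow> real ^ 'n \<Rightarrow> real" where
  "pn j t = norm (Pv j t)"

definition fcoeff :: "(real ^ 'n \<Rightarrow> complex) \<Rightarrow> int ^ 'n \<Rightarrow> complex" where
  "fcoeff W m = (LINT x:cellQ|lborel. W x * mode (- lvec m) x) / of_real ((2 * pi) ^ CARD('n))"

definition star_norm :: "(real ^ 'n \<Rightarrow> complex) \<Rightarrow> real" where
  "star_norm W = (\<Sum>\<^sub>\<infinity>m. norm (fcoeff W m))"

text \<open>Periodic functions of finite star norm. As usual these matter only up to null sets.\<close>

definition star_fun :: "(real ^ 'n \<Rightarrow> complex) \<Rightarrow> bool" where
  "star_fun W \<longleftrightarrow>
     (\<forall>x m. W (x + (2 * pi) *\<^sub>R lvec m) = W x) \<and>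
     set_integrable lborel cellQ W \<and>
     (\<lambda>m. norm (fcoeff W m)) summable_on UNIV"

definition star_lim :: "(nat \<Rightarrow> real ^ 'n \<Rightarrow> complex) \<Rightarrow> (real ^ 'n \<Rightarrow> complex) \<Rightarrow> bool" where
  "star_lim X W \<longleftrightarrow>
     (\<forall>m. star_fun (X m)) \<and> star_fun W \<and>
     (\<lambda>m. star_norm (\<lambda>x. X m x - W x)) \<longlonglongrightarrow> 0"

definition trig_poly :: "real \<Rightarrow> (int ^ 'n \<Rightarrow> complex) \<Rightarrow> real ^ 'n \<Rightarrow> complex" where
  "trig_poly R0 v x = (\<Sum>m | 0 < norm (lvec m) \<and> norm (lvec m) \<le> R0. v m * mode (lvec m) x)"


section \<open>Operators as matrices indexed by the integer lattice\<close>

text \<open>The entry \<open>M s r\<close> is the coefficient at the basis exponential \<open>mode (Pv s t)\<close> of the image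
  of \<open>mode (Pv r t)\<close>.\<close>

type_synonym 'n mat = "int ^ 'n \<Rightarrow> int ^ 'n \<Rightarrow> complex"

definition mone :: "'n mat" where
  "mone s r = (if s = r then 1 else 0)"

definition mmul :: "'n mat \<Rightarrow> 'n mat \<Rightarrow> 'n mat" where
  "mmul M N s r = (\<Sum>\<^sub>\<infinity>m. M s m * N m r)"

primrec mpow :: "'n mat \<Rightarrow> nat \<Rightarrow> 'n mat" where
  "mpow M 0 = mone"
| "mpow M (Suc r) = mmul M (mpow M r)"

text \<open>Only applied to block diagonal matrices with finite blocks, where a two-sided inverse is unique.\<close>

definition minv :: "'n mat \<Rightarrow> 'n mat" where
  "minv M = (THE N. mmul M N = mone \<and> mmul N M = mone)"

definition H0 :: "nat \<Rightarrow> real ^ 'n \<Rightarrow> 'n mat" where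
  "H0 l t s r = (if s = r then of_real (pn s t ^ (2 * l)) else 0)"

definition multop :: "(real ^ 'n \<Rightarrow> complex) \<Rightarrow> 'n mat" where
  "multop W s r = fcoeff W (s - r)"

definition Pq :: "int ^ 'n \<Rightarrow> int ^ 'n \<Rightarrow> 'n mat" where
  "Pq q j s r = (if s = r \<and> s \<in> {j, j - q} then 1 else 0)"

definition PVP :: "(real ^ 'n \<Rightarrow> complex) \<Rightarrow> int ^ 'n \<Rightarrow> int ^ 'n \<Rightarrow> 'n mat" where
  "PVP V q j = mmul (Pq q j) (mmul (multop V) (Pq q j))"


section \<open>The model operator\<close>

text \<open>The sign in the superscript \<open>\<plusminus>\<close> is the real parameter \<open>e\<close>, used with values \<open>1\<close> and \<open>-1\<close>.\<close>

definition lam_hat :: "nat \<Rightarrow> (real ^ 'n \<Rightarrow> complex) \<Rightarrow> int ^ 'n \<Rightarrow> int ^ 'n \<Rightarrow> real \<Rightarrow> real ^ 'n \<Rightarrow> real" where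
  "lam_hat l V q j e t =
     (pn j t ^ (2 * l) + pn (j - q) t ^ (2 * l)) / 2 +
     e * (sqrt (4 * (norm (fcoeff V q))\<^sup>2 + (pn j t ^ (2 * l) - pn (j - q) t ^ (2 * l))\<^sup>2) / 2)"

definition Hq :: "nat \<Rightarrow> (real ^ 'n \<Rightarrow> complex) \<Rightarrow> int ^ 'n \<Rightarrow> int ^ 'n \<Rightarrow> real ^ 'n \<Rightarrow> 'n mat" where
  "Hq l V q j t s r = H0 l t s r + PVP V q j s r"

definition resolv :: "nat \<Rightarrow> (real ^ 'n \<Rightarrow> complex) \<Rightarrow> int ^ 'n \<Rightarrow> int ^ 'n \<Rightarrow> real ^ 'n \<Rightarrow> complex \<Rightarrow> 'n mat" where
  "resolv l V q j t z = minv (\<lambda>s r. Hq l V q j t s r - z * mone s r)"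

text \<open>The orthogonal projection onto the line spanned by a unit eigenvector \<open>w\<close> supported on
  the coordinates \<open>j\<close>, \<open>j - q\<close>; when \<open>fcoeff V q \<noteq> 0\<close> and \<open>V\<close> is real, \<open>w\<close> is unique up to a phase.\<close>

definition E_hat :: "nat \<Rightarrow> (real ^ 'n \<Rightarrow> complex) \<Rightarrow> int ^ 'n \<Rightarrow> int ^ 'n \<Rightarrow> real \<Rightarrow> real ^ 'n \<Rightarrow> 'n mat" where
  "E_hat l V q j e t = (THE E. \<exists>w.
      (\<forall>s. s \<notin> {j, j - q} \<longrightarrow> w s = 0) \<and>
      (\<Sum>s\<in>{j, j - q}. (norm (w s))\<^sup>2) = 1 \<and>
      (\<forall>s. (\<Sum>\<^sub>\<infinity>r. Hq l V q j t s r * w r) = of_real (lam_hat l V q j e t) * w s) \<and>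
      E = (\<lambda>s r. w s * cnj (w r)))"

definition C1 :: "nat \<Rightarrow> (real ^ 'n \<Rightarrow> complex) \<Rightarrow> int ^ 'n \<Rightarrow> int ^ 'n \<Rightarrow> real \<Rightarrow> real ^ 'n \<Rightarrow> real \<Rightarrow> complex" where
  "C1 l V q j e t = circlepath (of_real (lam_hat l V q j e t)) (norm (fcoeff V q) / 10)"


section \<open>Perturbation series\<close>

definition RY :: "nat \<Rightarrow> (real ^ 'n \<Rightarrow> complex) \<Rightarrow> int ^ 'n \<Rightarrow> int ^ 'n \<Rightarrow> real ^ 'n
    \<Rightarrow> (real ^ 'n \<Rightarrow> complex) \<Rightarrow> complex \<Rightarrow> 'n mat" where
  "RY l V q j t W z = mmul (resolv l V q j t z) (\<lambda>s r. multop W s r - PVP V q j s r)"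

text \<open>Contour integrals of matrices are taken entrywise.\<close>

definition G_hat :: "nat \<Rightarrow> (real ^ 'n \<Rightarrow> complex) \<Rightarrow> int ^ 'n \<Rightarrow> int ^ 'n \<Rightarrow> real \<Rightarrow> real ^ 'n
    \<Rightarrow> (real ^ 'n \<Rightarrow> complex) \<Rightarrow> nat \<Rightarrow> 'n mat" where
  "G_hat l V q j e t W r s s' = (-1) ^ (r + 1) / (2 * of_real pi * \<i>) *
     contour_integral (C1 l V q j e t)
       (\<lambda>z. mmul (mpow (RY l V q j t W z) r) (resolv l V q j t z) s s')"

definition g_hat :: "nat \<Rightarrow> (real ^ 'n \<Rightarrow> complex) \<Rightarrow> int ^ 'n \<Rightarrow> int ^ 'n \<Rightarrow> real \<Rightarrow> real ^ 'n
    \<Rightarrow> (real ^ 'n \<Rightarrow> complex) \<Rightarrow> nat \<Rightarrow> complex" where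
  "g_hat l V q j e t W r = (-1) ^ r / (2 * of_real pi * \<i> * of_nat r) *
     (\<Sum>\<^sub>\<infinity>s. contour_integral (C1 l V q j e t) (\<lambda>z. mpow (RY l V q j t W z) r s s))"

definition E_pert :: "nat \<Rightarrow> (real ^ 'n \<Rightarrow> complex) \<Rightarrow> int ^ 'n \<Rightarrow> int ^ 'n \<Rightarrow> real \<Rightarrow> real ^ 'n
    \<Rightarrow> (real ^ 'n \<Rightarrow> complex) \<Rightarrow> 'n mat" where
  "E_pert l V q j e t W s s' = E_hat l V q j e t s s' + (\<Sum>i. G_hat l V q j e t W (Suc i) s s')"

definition lam_pert :: "nat \<Rightarrow> (real ^ 'n \<Rightarrow> complex) \<Rightarrow> int ^ 'n \<Rightarrow> int ^ 'n \<Rightarrow> real \<Rightarrow> real ^ 'n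
    \<Rightarrow> (real ^ 'n \<Rightarrow> complex) \<Rightarrow> complex" where
  "lam_pert l V q j e t W = of_real (lam_hat l V q j e t) + (\<Sum>i. g_hat l V q j e t W (Suc i))"


section \<open>The nonlinear iteration\<close>

definition u_fun :: "nat \<Rightarrow> (real ^ 'n \<Rightarrow> complex) \<Rightarrow> int ^ 'n \<Rightarrow> int ^ 'n \<Rightarrow> real \<Rightarrow> complex \<Rightarrow> real ^ 'n
    \<Rightarrow> (real ^ 'n \<Rightarrow> complex) \<Rightarrow> real ^ 'n \<Rightarrow> complex" where
  "u_fun l V q j e A t W x = A * (\<Sum>\<^sub>\<infinity>s. E_pert l V q j e t W s j * mode (Pv s t) x)"

definition M_map :: "nat \<Rightarrow> (real ^ 'n \<Rightarrow> complex) \<Rightarrow> int ^ 'n \<Rightarrow> int ^ 'n \<Rightarrow> real \<Rightarrow> real \<Rightarrow> complex \<Rightarrow> real ^ 'n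
    \<Rightarrow> (real ^ 'n \<Rightarrow> complex) \<Rightarrow> real ^ 'n \<Rightarrow> complex" where
  "M_map l V q j e \<sigma> A t W x = V x + of_real (\<sigma> * (norm (u_fun l V q j e A t W x))\<^sup>2)"

definition W_iter :: "nat \<Rightarrow> (real ^ 'n \<Rightarrow> complex) \<Rightarrow> int ^ 'n \<Rightarrow> int ^ 'n \<Rightarrow> real \<Rightarrow> real \<Rightarrow> complex \<Rightarrow> real ^ 'n
    \<Rightarrow> nat \<Rightarrow> real ^ 'n \<Rightarrow> complex" where
  "W_iter l V q j e \<sigma> A t m = (M_map l V q j e \<sigma> A t ^^ m) V"

text \<open>The limit is determined up to null sets, and \<open>lam_pert\<close> depends on it only through its
  Fourier coefficients, so the choice of representative is immaterial.\<close>

definition W_lim :: "nat \<Rightarrow> (real ^ 'n \<Rightarrow> complex) \<Rightarrow> int ^ 'n \<Rightarrow> int ^ 'n \<Rightarrow> real \<Rightarrow> real \<Rightarrow> complex \<Rightarrow> real ^ 'n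
    \<Rightarrow> real ^ 'n \<Rightarrow> complex" where
  "W_lim l V q j e \<sigma> A t = (SOME W. star_lim (W_iter l V q j e \<sigma> A t) W)"

definition lam :: "nat \<Rightarrow> (real ^ 'n \<Rightarrow> complex) \<Rightarrow> int ^ 'n \<Rightarrow> int ^ 'n \<Rightarrow> real \<Rightarrow> real \<Rightarrow> complex \<Rightarrow> real ^ 'n
    \<Rightarrow> complex" where
  "lam l V q j e \<sigma> A t = lam_pert l V q j e t (W_lim l V q j e \<sigma> A t)"

text \<open>At \<open>t\<close> the perturbation series, the Fourier series of \<open>u_fun\<close>, the iteration and the trace sums
  converge, so that \<open>suminf\<close>, \<open>infsum\<close> and \<open>SOME\<close> above do not take default values there.\<close>

definition lam_well_defined :: "nat \<Rightarrow> (real ^ 'n \<Rightarrow> complex) \<Rightarrow> int ^ 'n \<Rightarrow> int ^ 'n \<Rightarrow> real \<Rightarrow> real \<Rightarrow> complex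
    \<Rightarrow> real ^ 'n \<Rightarrow> bool" where
  "lam_well_defined l V q j e \<sigma> A t \<longleftrightarrow>
     (\<forall>m s s'. summable (\<lambda>i. G_hat l V q j e t (W_iter l V q j e \<sigma> A t m) (Suc i) s s')) \<and>
     (\<forall>m. (\<lambda>s. norm (E_pert l V q j e t (W_iter l V q j e \<sigma> A t m) s j)) summable_on UNIV) \<and>
     (\<exists>W. star_lim (W_iter l V q j e \<sigma> A t) W) \<and>
     (\<forall>r\<ge>1. (\<lambda>s. contour_integral (C1 l V q j e t)
        (\<lambda>z. mpow (RY l V q j t (W_lim l V q j e \<sigma> A t) z) r s s)) summable_on UNIV) \<and>
     summable (\<lambda>i. g_hat l V q j e t (W_lim l V q j e \<sigma> A t) (Suc i))"


section \<open>The resonant set\<close>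

definition Sq :: "int ^ 'n \<Rightarrow> real \<Rightarrow> real \<Rightarrow> (real ^ 'n) set" where
  "Sq q k \<xi> = {x \<in> sphere 0 k. \<bar>(norm x)\<^sup>2 - (norm (x - lvec q))\<^sup>2\<bar> < 4 * k powr (- \<xi>)}"

definition Kmap :: "real ^ 'n \<Rightarrow> real ^ 'n" where
  "Kmap x = (\<chi> i. frac (x $ i))"

text \<open>The index \<open>j\<close> is attached to the point \<open>t\<close> of the resonant set.\<close>

definition attached :: "int ^ 'n \<Rightarrow> real \<Rightarrow> real \<Rightarrow> real ^ 'n \<Rightarrow> int ^ 'n \<Rightarrow> bool" where
  "attached q \<delta> k t j \<longleftrightarrow>
     Pv j t \<in> Sq q k (real CARD('n) - 2 + \<delta>) \<and>
     \<bar>(pn (j - q) t)\<^sup>2 - (pn j t)\<^sup>2\<bar> < 4 * k powr (- real CARD('n) + 2 - \<delta>) \<and>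
     (\<forall>i. i \<noteq> j \<and> i \<noteq> j - q \<longrightarrow>
        \<bar>(pn j t)\<^sup>2 - (pn i t)\<^sup>2\<bar> > 2 * k powr (- real CARD('n) + 2 - 6 * \<delta>))"

text \<open>The \<open>d\<close>-dimensional Hausdorff measure up to a constant factor, which cancels in relative
  measures. Empty covering sets are counted as \<open>0\<close> also for \<open>d = 0\<close>.\<close>

definition hausdorff_pre :: "nat \<Rightarrow> real \<Rightarrow> (real ^ 'n) set \<Rightarrow> ennreal" where
  "hausdorff_pre d r B =
     (INF U \<in> {U :: nat \<Rightarrow> (real ^ 'n) set.
                 B \<subseteq> (\<Union>i. U i) \<and> (\<forall>i. bounded (U i) \<and> diameter (U i) \<le> r)}.
        \<Sum>i. if U i = {} then 0 else ennreal (diameter (U i) ^ d))"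

definition hausdorff :: "nat \<Rightarrow> (real ^ 'n) set \<Rightarrow> ennreal" where
  "hausdorff d B = (SUP r \<in> {0<..}. hausdorff_pre d r B)"

definition resonant_family ::
    "nat \<Rightarrow> (real ^ 'n \<Rightarrow> complex) \<Rightarrow> int ^ 'n \<Rightarrow> real \<Rightarrow> (real \<Rightarrow> (real ^ 'n) set) \<Rightarrow> bool" where
  "resonant_family l V q \<delta> X \<longleftrightarrow>
     (\<forall>k>0. X k \<subseteq> Kmap ` Sq q k (real CARD('n) - 2 + \<delta>) \<and>
        (\<forall>t\<in>X k. \<exists>j. attached q \<delta> k t j) \<and>
        (\<forall>t\<^sub>0\<in>X k. \<forall>j. attached q \<delta> k t\<^sub>0 j \<longrightarrow>
          (\<forall>t. dist t t\<^sub>0 < 2 * k powr (- real CARD('n) + 1 - 7 * \<delta>) \<longrightarrow>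
            (\<forall>e\<in>{1, -1}. \<forall>z \<in> path_image (C1 l V q j e t). \<forall>m. m \<noteq> j \<and> m \<noteq> j - q \<longrightarrow>
               2 * norm (of_real (pn m t ^ (2 * l)) - z)
                 \<ge> k powr (2 * real l - real CARD('n) - 6 * \<delta>))))) \<and>
     (\<exists>C. \<forall>\<^sub>F k in at_top.
        hausdorff (CARD('n) - 1) (Kmap ` Sq q k (real CARD('n) - 2 + \<delta>) - X k)
          \<le> ennreal (C * k powr (- \<delta> / 2))
             * hausdorff (CARD('n) - 1) (Kmap ` Sq q k (real CARD('n) - 2 + \<delta>)))"

end

theory Submission
  imports Defs
begin

text \<open>Infinite matrices with uniformly bounded absolute row and column sums form a Banach algebra, in
  which multiplication by \<open>W\<close> has norm at most its star norm. On the circle around \<open>lam_hat\<close> the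
  resolvent \<open>R\<close> of the model operator is bounded, and it is of the order of the inverse gap
  \<open>k powr - (2 l - n - 6 \<delta>)\<close> off the block \<open>{j, j - q}\<close>. Up to the small term \<open>\<sigma>|u|\<^sup>2\<close> the
  perturbation \<open>Y\<close> vanishes on this block, so \<open>R Y\<close> need not be small but \<open>(R Y)\<^sup>2\<close> is, and the
  perturbation series converge.

  The Fourier coefficients of \<open>|u|\<^sup>2\<close> are an autocorrelation of the column of the spectral
  projection, so the iteration for the potential becomes a contraction \<open>Y \<mapsto> F(t, Y)\<close> that
  is continuously differentiable in \<open>(t, Y)\<close>. If \<open>R\<close> is Lipschitz in \<open>t\<close> with constant \<open>\<kappa>\<close>, then so
  are the fixed point and, up to a constant factor, \<open>lam - lam_hat\<close>, whose gradient is therefore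
  \<open>O(\<kappa>)\<close>. The block of \<open>R\<close> depends on \<open>t\<close> only through \<open>p_j^{2l} - p_{j-q}^{2l}\<close>, whose gradient is
  \<open>O(k^{2l-2})\<close>; the remaining entries contribute \<open>O(k^{2l-1})\<close> times the square of the inverse gap.
  Hence \<open>\<kappa>\<close> is of lower order than the gradient of \<open>lam_hat\<close>, which differs from that of \<open>p_j^{2l}\<close>
  by \<open>O(k^{2l-2})\<close>.\<close>

section \<open>A Banach algebra of matrices\<close>

text \<open>The trace is the obstacle in the series for the eigenvalue: in this algebra it is
  neither defined everywhere nor continuous. Without the block the resolvent is holomorphic inside
  the circle, so by Cauchy's theorem the contour integral of each power of \<open>RQ Y\<close>
  vanishes entrywise and may be subtracted. The difference of the powers of \<open>R Y\<close> and
  \<open>RQ Y\<close> telescopes into terms with a finite-rank factor, whose traces reduce to sums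
  over two indices; the weights \<open>1 / r\<close> become an integral over an auxiliary parameter
  in the unit interval. Lipschitz bounds are preferred to derivative formulas: differentiability is
  established qualitatively, and the size of the gradient is read off the Lipschitz constant, with
  its factor \<kappa>. The eigenvalue is a complex number by definition, so its correction is shown
  to be real separately, by reflecting the circle in the real axis. The definite descriptions and
  the choice operator in the definitions are resolved by explicit formulas or through Fourier
  coefficients.\<close>

text \<open>Bounds on finite partial sums are used so that no summability has to be assumed
  beforehand. Controlling columns as well as rows makes the class closed under adjoints.\<close>

definition mat_bound :: "('i \<Rightarrow> 'i \<Rightarrow> complex) \<Rightarrow> real \<Rightarrow> bool" where
  "mat_bound M c \<longleftrightarrow>
     (\<forall>F r. finite F \<longrightarrow> (\<Sum>s\<in>F. norm (M s r)) \<le> c \<and> (\<Sum>s\<in>F. norm (M r s)) \<le> c)"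

section \<open>Absolute row and column sums under matrix operations\<close>

lemma nonneg_bounded_sums:
  fixes f :: "'a \<Rightarrow> real"
  assumes "\<And>F. finite F \<Longrightarrow> sum f F \<le> c" and "\<And>x. 0 \<le> f x"
  shows "f summable_on UNIV" and "infsum f UNIV \<le> c"
proof -
  show s: "f summable_on UNIV"
    using assms by (intro nonneg_bdd_above_summable_on bdd_aboveI2[of _ _ c]) auto
  show "infsum f UNIV \<le> c"
    using assms s by (intro infsum_le_finite_sums) auto
qed

lemma infsum_finite_sum:
  fixes f :: "'a \<Rightarrow> 'b \<Rightarrow> 'c::{topological_comm_monoid_add, t2_space}"
  assumes "finite F" and "\<And>s. s \<in> F \<Longrightarrow> f s summable_on A"
  shows "infsum (\<lambda>m. \<Sum>s\<in>F. f s m) A = (\<Sum>s\<in>F. infsum (f s) A)"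
    and "(\<lambda>m. \<Sum>s\<in>F. f s m) summable_on A"
  using assms
proof (induction F rule: finite_induct)
  case (insert s F)
  case 1
  with insert show ?case by (simp add: infsum_add)
  case 2
  with insert show ?case by (simp add: summable_on_add)
qed auto

lemma mat_bound_nonneg: "mat_bound M c \<Longrightarrow> 0 \<le> c"
  unfolding mat_bound_def by (metis finite.emptyI sum.empty)

lemma mat_bound_mono: "mat_bound M c \<Longrightarrow> c \<le> d \<Longrightarrow> mat_bound M d"
  unfolding mat_bound_def by (meson order_trans)

lemma mat_bound_summable:
  assumes "mat_bound M c"
  shows "(\<lambda>s. norm (M s r)) summable_on UNIV" "(\<lambda>s. norm (M r s)) summable_on UNIV"
    and "(\<Sum>\<^sub>\<infinity>s. norm (M s r)) \<le> c" "(\<Sum>\<^sub>\<infinity>s. norm (M r s)) \<le> c"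
  using assms nonneg_bounded_sums[of "\<lambda>s. norm (M s r)" c] nonneg_bounded_sums[of "\<lambda>s. norm (M r s)" c]
  unfolding mat_bound_def by auto

lemma mat_bound_entry: "mat_bound M c \<Longrightarrow> norm (M s r) \<le> c"
  unfolding mat_bound_def by (drule spec[of _ "{s}"]) auto

lemma mat_bound_swap: "mat_bound M c \<Longrightarrow> mat_bound (\<lambda>s r. M r s) c"
  unfolding mat_bound_def by auto

lemma mat_bound_prod_summable:
  assumes "mat_bound M a" "mat_bound N b"
  shows "(\<lambda>m. norm (M s m * N m r)) summable_on UNIV"
    and "(\<lambda>m. M s m * N m r) summable_on UNIV"
proof -
  have "(\<lambda>m. a * norm (N m r)) summable_on UNIV"
    by (intro summable_on_cmult_right mat_bound_summable(1)[OF assms(2)])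
  then show "(\<lambda>m. norm (M s m * N m r)) summable_on UNIV"
    by (rule Infinite_Sum.abs_summable_on_comparison_test')
       (simp add: norm_mult mult_right_mono mat_bound_entry[OF assms(1)])
  then show "(\<lambda>m. M s m * N m r) summable_on UNIV"
    by (rule abs_summable_summable)
qed

lemma mat_bound_prod_aux:
  assumes M: "mat_bound M a" and N: "mat_bound N b" and F: "finite F"
  shows "(\<Sum>s\<in>F. norm (\<Sum>\<^sub>\<infinity>m. M s m * N m r)) \<le> a * b"
proof -
  have "(\<Sum>s\<in>F. norm (\<Sum>\<^sub>\<infinity>m. M s m * N m r)) \<le> (\<Sum>s\<in>F. (\<Sum>\<^sub>\<infinity>m. norm (M s m * N m r)))"
    by (intro sum_mono norm_infsum_bound mat_bound_prod_summable[OF M N])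
  also have "\<dots> = (\<Sum>\<^sub>\<infinity>m. \<Sum>s\<in>F. norm (M s m * N m r))"
    by (rule infsum_finite_sum(1)[symmetric, OF F]) (rule mat_bound_prod_summable[OF M N])
  also have "\<dots> \<le> (\<Sum>\<^sub>\<infinity>m. a * norm (N m r))"
  proof (rule infsum_mono)
    show "(\<lambda>m. \<Sum>s\<in>F. norm (M s m * N m r)) summable_on UNIV"
      by (intro infsum_finite_sum(2) F mat_bound_prod_summable[OF M N])
    show "(\<lambda>m. a * norm (N m r)) summable_on UNIV"
      by (intro summable_on_cmult_right mat_bound_summable(1)[OF N])
    fix m
    have "(\<Sum>s\<in>F. norm (M s m * N m r)) = (\<Sum>s\<in>F. norm (M s m)) * norm (N m r)"
      by (simp add: norm_mult sum_distrib_right)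
    also have "\<dots> \<le> a * norm (N m r)"
      using M F unfolding mat_bound_def by (intro mult_right_mono) auto
    finally show "(\<Sum>s\<in>F. norm (M s m * N m r)) \<le> a * norm (N m r)" .
  qed
  also have "\<dots> = a * (\<Sum>\<^sub>\<infinity>m. norm (N m r))"
    by (rule infsum_cmult_right')
  also have "\<dots> \<le> a * b"
    by (intro mult_left_mono mat_bound_summable(3)[OF N] mat_bound_nonneg[OF M])
  finally show ?thesis .
qed

lemma mat_bound_prod:
  assumes M: "mat_bound M a" and N: "mat_bound N b"
  shows "mat_bound (\<lambda>s r. \<Sum>\<^sub>\<infinity>m. M s m * N m r) (a * b)"
  unfolding mat_bound_def
proof (intro allI impI conjI)
  fix F :: "'a set" and r assume F: "finite F"
  show "(\<Sum>s\<in>F. norm (\<Sum>\<^sub>\<infinity>m. M s m * N m r)) \<le> a * b"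
    by (rule mat_bound_prod_aux[OF M N F])
  show "(\<Sum>s\<in>F. norm (\<Sum>\<^sub>\<infinity>m. M r m * N m s)) \<le> a * b"
    \<comment> \<open>Row sums of the product are column sums of the transposes multiplied in the
      opposite order.\<close>
    using mat_bound_prod_aux[OF mat_bound_swap[OF N] mat_bound_swap[OF M] F, of r]
    by (simp add: mult.commute)
qed

lemma mat_bound_add:
  assumes M: "mat_bound M a" and N: "mat_bound N b"
  shows "mat_bound (\<lambda>s r. M s r + N s r) (a + b)"
proof -
  have "(\<Sum>s\<in>F. norm (f s + g s)) \<le> a + b"
    if "(\<Sum>s\<in>F. norm (f s)) \<le> a" "(\<Sum>s\<in>F. norm (g s)) \<le> b" for f g :: "'a \<Rightarrow> complex" and F
    using sum_mono[of F "\<lambda>s. norm (f s + g s)" "\<lambda>s. norm (f s) + norm (g s)"] that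
    by (simp add: norm_triangle_ineq sum.distrib)
  then show ?thesis using M N unfolding mat_bound_def by auto
qed

lemma mat_bound_cmult:
  assumes M: "mat_bound M a"
  shows "mat_bound (\<lambda>s r. c * M s r) (norm c * a)"
  using M unfolding mat_bound_def by (auto simp: norm_mult sum_distrib_left[symmetric] mult_left_mono)

lemma mat_bound_one: "mat_bound (\<lambda>s r. if s = r then 1 else 0) 1"
proof -
  have "(\<Sum>s\<in>F. norm (if s = r then 1 else 0 :: complex)) \<le> 1"
    "(\<Sum>s\<in>F. norm (if r = s then 1 else 0 :: complex)) \<le> 1" if "finite F" for F :: "'a set" and r
    using that by (simp_all add: if_distrib[of norm] cong: if_cong)
  then show ?thesis unfolding mat_bound_def by auto
qed

text \<open>An exchange of two infinite sums. The family \<open>L s m * M m p * N p r\<close> is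
  absolutely summable over the pairs: a finite set of pairs sits in a rectangle, where the entries
  of \<open>N\<close>, the rows of \<open>M\<close> and row \<open>s\<close> of \<open>L\<close> are
  bounded in turn.\<close>

lemma mat_prod_assoc:
  assumes L: "mat_bound L a" and M: "mat_bound M b" and N: "mat_bound N c"
  shows "(\<Sum>\<^sub>\<infinity>p. (\<Sum>\<^sub>\<infinity>m. L s m * M m p) * N p r) = (\<Sum>\<^sub>\<infinity>m. L s m * (\<Sum>\<^sub>\<infinity>p. M m p * N p r))"
proof -
  have nn: "0 \<le> a" "0 \<le> b" "0 \<le> c"
    using assms mat_bound_nonneg by auto
  have "(\<lambda>(m, p). norm (L s m * M m p * N p r)) summable_on UNIV"
  proof (rule nonneg_bounded_sums(1)[where c = "a * (b * c)"])
    fix F :: "('a \<times> 'a) set" assume F: "finite F"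
    let ?A = "fst ` F" and ?B = "snd ` F"
    have "(\<Sum>(m, p)\<in>F. norm (L s m * M m p * N p r)) \<le> (\<Sum>(m, p)\<in>?A \<times> ?B. norm (L s m * M m p * N p r))"
      using F by (intro sum_mono2) (auto simp: rev_image_eqI)
    also have "\<dots> = (\<Sum>m\<in>?A. \<Sum>p\<in>?B. norm (L s m) * (norm (M m p) * norm (N p r)))"
      by (simp add: sum.cartesian_product norm_mult mult.assoc)
    also have "\<dots> \<le> (\<Sum>m\<in>?A. \<Sum>p\<in>?B. norm (L s m) * (norm (M m p) * c))"
      by (intro sum_mono mult_left_mono mat_bound_entry[OF N]) auto
    also have "\<dots> = (\<Sum>m\<in>?A. norm (L s m) * ((\<Sum>p\<in>?B. norm (M m p)) * c))"
      by (simp add: sum_distrib_left sum_distrib_right)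
    also have "\<dots> \<le> (\<Sum>m\<in>?A. norm (L s m) * (b * c))"
      using M F nn unfolding mat_bound_def by (intro sum_mono mult_left_mono mult_right_mono) auto
    also have "\<dots> = (\<Sum>m\<in>?A. norm (L s m)) * (b * c)"
      by (simp add: sum_distrib_right)
    also have "\<dots> \<le> a * (b * c)"
      using L F nn unfolding mat_bound_def by (intro mult_right_mono) auto
    finally show "(\<Sum>(m, p)\<in>F. norm (L s m * M m p * N p r)) \<le> a * (b * c)" .
  qed auto
  then have "(\<lambda>(m, p). L s m * M m p * N p r) summable_on UNIV"
    by (rule abs_summable_summable[OF back_subst[of "\<lambda>f. f summable_on UNIV"]]) auto
  then have sw: "(\<Sum>\<^sub>\<infinity>m. \<Sum>\<^sub>\<infinity>p. L s m * M m p * N p r) = (\<Sum>\<^sub>\<infinity>p. \<Sum>\<^sub>\<infinity>m. L s m * M m p * N p r)"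
    by (intro infsum_swap_banach) simp
  have "(\<Sum>\<^sub>\<infinity>m. L s m * M m p) * N p r = (\<Sum>\<^sub>\<infinity>m. L s m * M m p * N p r)" for p
    by (rule infsum_cmult_left'[symmetric])
  moreover have "L s m * (\<Sum>\<^sub>\<infinity>p. M m p * N p r) = (\<Sum>\<^sub>\<infinity>p. L s m * M m p * N p r)" for m
    unfolding mult.assoc by (rule infsum_cmult_right'[symmetric])
  ultimately show ?thesis
    using sw by simp
qed

section \<open>Bounded matrices as a Banach algebra\<close>

text \<open>A type of its own gives access to the type classes of Banach algebras, hence to limits,
  derivatives and integrals of matrix-valued maps.\<close>

typedef 'i bmat = "{M :: 'i \<Rightarrow> 'i \<Rightarrow> complex. \<exists>c. mat_bound M c}"
  morphisms ent Bmat
  by (rule exI[of _ "\<lambda>s r. if s = r then 1 else 0"]) (auto intro: mat_bound_one)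

setup_lifting type_definition_bmat

lemma ent_bound: "\<exists>c. mat_bound (ent M) c"
  using ent[of M] by simp

lemma ent_Bmat: "mat_bound M c \<Longrightarrow> ent (Bmat M) = M"
  by (rule Bmat_inverse) auto

lemma bmat_eqI: "(\<And>s r. ent M s r = ent N s r) \<Longrightarrow> M = N"
  by (metis ent_inject ext)

instantiation bmat :: (type) real_normed_algebra_1
begin

lift_definition zero_bmat :: "'a bmat" is "\<lambda>s r. 0"
  by (rule exI[of _ 0]) (simp add: mat_bound_def)

lift_definition one_bmat :: "'a bmat" is "\<lambda>s r. if s = r then 1 else 0"
  using mat_bound_one by blast

lift_definition plus_bmat :: "'a bmat \<Rightarrow> 'a bmat \<Rightarrow> 'a bmat" is "\<lambda>M N s r. M s r + N s r"
  using mat_bound_add by blast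

lift_definition uminus_bmat :: "'a bmat \<Rightarrow> 'a bmat" is "\<lambda>M s r. - M s r"
  by (auto simp: mat_bound_def)

lift_definition minus_bmat :: "'a bmat \<Rightarrow> 'a bmat \<Rightarrow> 'a bmat" is "\<lambda>M N s r. M s r - N s r"
proof -
  fix M N :: "'a \<Rightarrow> 'a \<Rightarrow> complex"
  assume "\<exists>c. mat_bound M c" "\<exists>c. mat_bound N c"
  then obtain c d where "mat_bound M c" "mat_bound (\<lambda>s r. - N s r) d"
    by (auto simp: mat_bound_def)
  from mat_bound_add[OF this] show "\<exists>c. mat_bound (\<lambda>s r. M s r - N s r) c"
    by auto
qed

lift_definition scaleR_bmat :: "real \<Rightarrow> 'a bmat \<Rightarrow> 'a bmat" is "\<lambda>c M s r. of_real c * M s r"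
  using mat_bound_cmult by blast

lift_definition times_bmat :: "'a bmat \<Rightarrow> 'a bmat \<Rightarrow> 'a bmat" is "\<lambda>M N s r. \<Sum>\<^sub>\<infinity>m. M s m * N m r"
  using mat_bound_prod by blast

lift_definition norm_bmat :: "'a bmat \<Rightarrow> real" is "\<lambda>M. Inf {c. mat_bound M c}" .

definition dist_bmat :: "'a bmat \<Rightarrow> 'a bmat \<Rightarrow> real" where
  "dist_bmat M N = norm (M - N)"

definition sgn_bmat :: "'a bmat \<Rightarrow> 'a bmat" where
  "sgn_bmat M = inverse (norm M) *\<^sub>R M"

definition uniformity_bmat :: "('a bmat \<times> 'a bmat) filter" where
  "uniformity_bmat = (INF e\<in>{0<..}. principal {(x, y). dist (x::'a bmat) y < e})"

definition open_bmat :: "'a bmat set \<Rightarrow> bool" where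
  "open_bmat S \<longleftrightarrow> (\<forall>x\<in>S. \<forall>\<^sub>F (x', y) in uniformity. x' = x \<longrightarrow> y \<in> S)"

text \<open>The infimum that defines the norm is attained: each finite partial sum is a lower bound
  of the set of admissible constants, hence at most its infimum.\<close>

lemma mat_bound_norm: "mat_bound (ent M) (norm M)"
proof -
  obtain c0 where c0: "mat_bound (ent M) c0" using ent_bound by blast
  have "(\<Sum>s\<in>F. norm (ent M s r)) \<le> norm M \<and> (\<Sum>s\<in>F. norm (ent M r s)) \<le> norm M"
    if "finite F" for F r
  proof -
    have "{c. mat_bound (ent M) c} \<noteq> {}" using c0 by blast
    then show ?thesis
      using that unfolding norm_bmat.rep_eq mat_bound_def
      by (intro conjI cInf_greatest) blast+
  qed
  then show ?thesis unfolding mat_bound_def by blast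
qed

lemma norm_bmat_le: "mat_bound (ent M) c \<Longrightarrow> norm M \<le> c"
  unfolding norm_bmat.rep_eq
  by (rule cInf_lower) (auto intro!: bdd_belowI[of _ 0] dest: mat_bound_nonneg)

instance
proof
  fix a b c :: "'a bmat" and x y :: real
  show "a + b + c = a + (b + c)" by transfer (simp add: add.assoc)
  show "a + b = b + a" by transfer (simp add: add.commute)
  show "0 + a = a" by transfer simp
  show "- a + a = 0" by transfer simp
  show "a - b = a + - b" by transfer simp
  show "x *\<^sub>R (a + b) = x *\<^sub>R a + x *\<^sub>R b" by transfer (simp add: algebra_simps)
  show "(x + y) *\<^sub>R a = x *\<^sub>R a + y *\<^sub>R a" by transfer (simp add: algebra_simps)
  show "x *\<^sub>R y *\<^sub>R a = (x * y) *\<^sub>R a" by transfer (simp add: algebra_simps)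
  show "1 *\<^sub>R a = a" by transfer simp
  show "a * b * c = a * (b * c)"
  proof (rule bmat_eqI)
    fix s r
    obtain \<alpha> \<beta> \<gamma> where "mat_bound (ent a) \<alpha>" "mat_bound (ent b) \<beta>" "mat_bound (ent c) \<gamma>"
      using ent_bound by metis
    from mat_prod_assoc[OF this, of s r] show "ent (a * b * c) s r = ent (a * (b * c)) s r"
      by (simp add: times_bmat.rep_eq)
  qed
  show "(a + b) * c = a * c + b * c"
  proof (rule bmat_eqI)
    fix s r
    obtain \<alpha> \<beta> \<gamma> where "mat_bound (ent a) \<alpha>" "mat_bound (ent b) \<beta>" "mat_bound (ent c) \<gamma>"
      using ent_bound by metis
    then show "ent ((a + b) * c) s r = ent (a * c + b * c) s r"
      by (simp add: times_bmat.rep_eq plus_bmat.rep_eq distrib_right infsum_add mat_bound_prod_summable(2))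
  qed
  show "a * (b + c) = a * b + a * c"
  proof (rule bmat_eqI)
    fix s r
    obtain \<alpha> \<beta> \<gamma> where "mat_bound (ent a) \<alpha>" "mat_bound (ent b) \<beta>" "mat_bound (ent c) \<gamma>"
      using ent_bound by metis
    then show "ent (a * (b + c)) s r = ent (a * b + a * c) s r"
      by (simp add: times_bmat.rep_eq plus_bmat.rep_eq distrib_left infsum_add mat_bound_prod_summable(2))
  qed
  show "x *\<^sub>R a * b = x *\<^sub>R (a * b)"
    by (rule bmat_eqI) (simp add: times_bmat.rep_eq scaleR_bmat.rep_eq infsum_cmult_right' mult.assoc)
  show "a * x *\<^sub>R b = x *\<^sub>R (a * b)"
    by (rule bmat_eqI)
       (simp add: times_bmat.rep_eq scaleR_bmat.rep_eq infsum_cmult_right' mult.left_commute[of _ "of_real x"])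
  have single1: "(\<Sum>\<^sub>\<infinity>m. (if s = m then 1 else 0) * f m) = f s"
    "(\<Sum>\<^sub>\<infinity>m. f m * (if m = s then 1 else 0)) = f s" for s :: 'a and f :: "'a \<Rightarrow> complex"
    by (subst infsum_cong_neutral[where T = "{s}" and g = f]; auto)+
  show "1 * a = a" "a * 1 = a"
    by (rule bmat_eqI; simp add: times_bmat.rep_eq one_bmat.rep_eq single1)+
  show "(0::'a bmat) \<noteq> 1"
    by transfer (metis zero_neq_one)
  show "dist a b = norm (a - b)" by (simp add: dist_bmat_def)
  show "sgn a = inverse (norm a) *\<^sub>R a" by (simp add: sgn_bmat_def)
  show "(norm a = 0) = (a = 0)"
  proof
    assume "norm a = 0"
    then have "ent a s r = 0" for s r
      using mat_bound_entry[OF mat_bound_norm[of a], of s r] by simp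
    then show "a = 0" by (intro bmat_eqI) (simp add: zero_bmat.rep_eq)
  next
    assume "a = 0"
    then have "norm a \<le> 0" by (intro norm_bmat_le) (simp add: mat_bound_def zero_bmat.rep_eq)
    moreover have "0 \<le> norm a" using mat_bound_nonneg mat_bound_norm by blast
    ultimately show "norm a = 0" by simp
  qed
  show "norm (a + b) \<le> norm a + norm b"
    by (intro norm_bmat_le) (simp add: plus_bmat.rep_eq mat_bound_add mat_bound_norm)
  have le: "norm (x *\<^sub>R a) \<le> \<bar>x\<bar> * norm a" for x and a :: "'a bmat"
    using mat_bound_cmult[OF mat_bound_norm[of a], of "of_real x"]
    by (intro norm_bmat_le) (simp add: scaleR_bmat.rep_eq)
  show "norm (x *\<^sub>R a) = \<bar>x\<bar> * norm a"
  proof (cases "x = 0")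
    case True
    have "0 *\<^sub>R a = 0" by transfer simp
    with True show ?thesis using \<open>(norm a = 0) = (a = 0)\<close> le[of 0 a] mat_bound_nonneg[OF mat_bound_norm[of "0 *\<^sub>R a"]]
      by simp
  next
    case False
    have "(1 / x) *\<^sub>R x *\<^sub>R a = a"
      by (rule bmat_eqI) (simp add: scaleR_bmat.rep_eq False)
    then have "norm a = norm ((1 / x) *\<^sub>R x *\<^sub>R a)" by simp
    also have "\<dots> \<le> \<bar>1 / x\<bar> * norm (x *\<^sub>R a)" by (rule le)
    finally have "\<bar>x\<bar> * norm a \<le> norm (x *\<^sub>R a)"
      using False by (simp add: field_simps)
    with le[of x a] show ?thesis by simp
  qed
  show "norm (a * b) \<le> norm a * norm b"
    by (intro norm_bmat_le) (simp add: times_bmat.rep_eq mat_bound_prod mat_bound_norm)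
  have "norm (1 :: 'a bmat) \<le> 1"
    by (intro norm_bmat_le) (simp add: one_bmat.rep_eq mat_bound_one)
  moreover have "1 \<le> norm (1 :: 'a bmat)"
    using mat_bound_entry[OF mat_bound_norm[of "1 :: 'a bmat"], of undefined undefined]
    by (simp add: one_bmat.rep_eq)
  ultimately show "norm (1 :: 'a bmat) = 1" by simp
next
  show "(uniformity :: ('a bmat \<times> 'a bmat) filter) = (INF e\<in>{0<..}. principal {(x, y). dist x y < e})"
    by (rule uniformity_bmat_def)
next
  fix S :: "'a bmat set"
  show "open S = (\<forall>x\<in>S. \<forall>\<^sub>F (x', y) in uniformity. x' = x \<longrightarrow> y \<in> S)"
    by (rule open_bmat_def)
qed

end

text \<open>The entries of a Cauchy sequence converge, and a bound on finite partial sums of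
  \<open>X m - X n\<close> survives the limit in \<open>n\<close>. This yields both boundedness of
  the entrywise limit and convergence in norm.\<close>

instance bmat :: (type) banach
proof
  fix X :: "nat \<Rightarrow> 'a bmat" assume X: "Cauchy X"
  have dist: "dist a b = norm (a - b)" for a b :: "'a bmat" by (simp add: dist_bmat_def)
  have entle: "norm (ent (X m) s r - ent (X n) s r) \<le> norm (X m - X n)" for m n s r
    using mat_bound_entry[OF mat_bound_norm[of "X m - X n"]] by (simp add: minus_bmat.rep_eq)
  have "Cauchy (\<lambda>n. ent (X n) s r)" for s r
    unfolding Cauchy_def
  proof (intro allI impI)
    fix e :: real assume "e > 0"
    with X obtain N where "\<And>m n. m \<ge> N \<Longrightarrow> n \<ge> N \<Longrightarrow> norm (X m - X n) < e"
      unfolding Cauchy_def dist by blast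
    then show "\<exists>M. \<forall>m\<ge>M. \<forall>n\<ge>M. dist (ent (X m) s r) (ent (X n) s r) < e"
      using entle by (metis dist_norm le_less_trans)
  qed
  then obtain L where L: "\<And>s r. (\<lambda>n. ent (X n) s r) \<longlonglongrightarrow> L s r"
    unfolding Cauchy_convergent_iff convergent_def by metis
  have bd: "mat_bound (\<lambda>s r. ent (X m) s r - L s r) e"
    if "\<And>n. n \<ge> N \<Longrightarrow> norm (X m - X n) \<le> e" for m N e
    unfolding mat_bound_def
  proof (intro allI impI conjI)
    fix F :: "'a set" and r assume F: "finite F"
    have *: "mat_bound (\<lambda>s r. ent (X m) s r - ent (X n) s r) e" if "n \<ge> N" for n
      using mat_bound_mono[OF mat_bound_norm[of "X m - X n"]] that \<open>\<And>n. n \<ge> N \<Longrightarrow> norm (X m - X n) \<le> e\<close>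
      by (simp add: minus_bmat.rep_eq)
    show "(\<Sum>s\<in>F. norm (ent (X m) s r - L s r)) \<le> e"
    proof (rule tendsto_upperbound)
      show "(\<lambda>n. \<Sum>s\<in>F. norm (ent (X m) s r - ent (X n) s r)) \<longlonglongrightarrow> (\<Sum>s\<in>F. norm (ent (X m) s r - L s r))"
        by (intro tendsto_intros L)
      show "\<forall>\<^sub>F n in sequentially. (\<Sum>s\<in>F. norm (ent (X m) s r - ent (X n) s r)) \<le> e"
        using * F by (auto simp: eventually_sequentially mat_bound_def)
    qed auto
    show "(\<Sum>s\<in>F. norm (ent (X m) r s - L r s)) \<le> e"
    proof (rule tendsto_upperbound)
      show "(\<lambda>n. \<Sum>s\<in>F. norm (ent (X m) r s - ent (X n) r s)) \<longlonglongrightarrow> (\<Sum>s\<in>F. norm (ent (X m) r s - L r s))"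
        by (intro tendsto_intros L)
      show "\<forall>\<^sub>F n in sequentially. (\<Sum>s\<in>F. norm (ent (X m) r s - ent (X n) r s)) \<le> e"
        using * F by (auto simp: eventually_sequentially mat_bound_def)
    qed auto
  qed
  from X obtain N0 where N0: "\<And>m n. m \<ge> N0 \<Longrightarrow> n \<ge> N0 \<Longrightarrow> norm (X m - X n) < 1"
    unfolding Cauchy_def dist by (metis zero_less_one)
  \<comment> \<open>The limit is written as \<open>X N0\<close> minus a difference that is already
    bounded by 1.\<close>
  have "mat_bound (\<lambda>s r. ent (X N0) s r + (-1) * (ent (X N0) s r - L s r)) (norm (X N0) + norm (-1 :: complex) * 1)"
    by (intro mat_bound_add mat_bound_cmult mat_bound_norm bd[of N0 N0 1] less_imp_le[OF N0]) auto
  then have "mat_bound L (norm (X N0) + 1)" by simp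
  then have entL: "ent (Bmat L) = L" by (rule ent_Bmat)
  have "X \<longlonglongrightarrow> Bmat L"
    unfolding lim_sequentially dist
  proof (intro allI impI)
    fix e :: real assume e: "e > 0"
    with X obtain N where N: "\<And>m n. m \<ge> N \<Longrightarrow> n \<ge> N \<Longrightarrow> norm (X m - X n) < e / 2"
      unfolding Cauchy_def dist by (metis half_gt_zero)
    have "norm (X m - Bmat L) \<le> e / 2" if "m \<ge> N" for m
      by (intro norm_bmat_le) (use bd[of N m "e / 2"] N that in \<open>force simp: minus_bmat.rep_eq entL less_imp_le\<close>)
    then show "\<exists>N. \<forall>n\<ge>N. norm (X n - Bmat L) < e"
      using e by (intro exI[of _ N]) (auto intro: le_less_trans[where y = "e / 2"])
  qed
  then show "convergent X" by (auto simp: convergent_def)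
qed

lemmas ent_simps = zero_bmat.rep_eq one_bmat.rep_eq plus_bmat.rep_eq minus_bmat.rep_eq
  uminus_bmat.rep_eq scaleR_bmat.rep_eq

lemma norm_ent_le: "norm (ent M s r) \<le> norm M"
  by (rule mat_bound_entry[OF mat_bound_norm])

lemma bounded_linear_ent: "bounded_linear (\<lambda>M. ent M s r)"
  by (rule bounded_linear_intro[where K = 1]) (simp_all add: ent_simps norm_ent_le scaleR_conv_of_real[where 'a = complex])

lemma ent_summable:
  "(\<lambda>s. norm (ent M s r)) summable_on UNIV" "(\<lambda>s. norm (ent M r s)) summable_on UNIV"
  "(\<Sum>\<^sub>\<infinity>s. norm (ent M s r)) \<le> norm M" "(\<Sum>\<^sub>\<infinity>s. norm (ent M r s)) \<le> norm M"
  by (rule mat_bound_summable[OF mat_bound_norm])+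

lemma ent_prod_summable: "(\<lambda>m. ent M s m * ent N m r) summable_on UNIV"
  by (rule mat_bound_prod_summable(2)[OF mat_bound_norm mat_bound_norm])

section \<open>Neumann series and differentiable families in a Banach algebra\<close>

definition neu :: "'b::{real_normed_algebra_1, banach} \<Rightarrow> 'b" where
  "neu M = (\<Sum>n. (- M) ^ n)"

lemma norm_mult3_le: "norm (x * y * z) \<le> norm x * norm y * norm z"
  for x :: "'b::real_normed_algebra"
  by (rule order_trans[OF norm_mult_ineq mult_right_mono[OF norm_mult_ineq]]) simp

text \<open>The number 3/4 is a ratio below 1 whose square 9/16 is at least 1/2, the gain from two
  further factors. The prefactor leaves room for odd powers, where one factor is bounded by
  \<open>b\<close> only.\<close>

lemma norm_power_le_of_square:
  fixes M :: "'b::real_normed_algebra_1"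
  assumes sq: "norm (M * M) \<le> 1 / 2" and b: "norm M \<le> b"
  shows "norm (M ^ n) \<le> 2 * (1 + b) * (3 / 4) ^ n"
proof (induction n rule: induct_nat_012)
  case 0
  show ?case using order_trans[OF norm_ge_zero b] by simp
next
  case 1
  show ?case using b order_trans[OF norm_ge_zero b] by simp
next
  case (ge2 n)
  have "norm (M ^ Suc (Suc n)) = norm ((M * M) * M ^ n)"
    by (simp add: mult.assoc)
  also have "\<dots> \<le> 1 / 2 * (2 * (1 + b) * (3 / 4) ^ n)"
    by (rule order_trans[OF norm_mult_ineq]) (intro mult_mono sq ge2; simp)
  also have "\<dots> \<le> (9 / 16) * (2 * (1 + b) * (3 / 4) ^ n)"
    using order_trans[OF norm_ge_zero b] by (intro mult_right_mono) auto
  also have "\<dots> = 2 * (1 + b) * (3 / 4) ^ Suc (Suc n)"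
    by simp
  finally show ?case .
qed

lemma norm_minus_power: "norm ((- M) ^ n) = norm (M ^ n)" for M :: "'b::real_normed_algebra_1"
  by (cases "even n") auto

lemma summable_powers_of_square:
  fixes M :: "'b::{real_normed_algebra_1, banach}"
  assumes sq: "norm (M * M) \<le> 1 / 2"
  shows "summable (\<lambda>n. norm ((- M) ^ n))" and "summable (\<lambda>n. (- M) ^ n)"
proof -
  have "summable (\<lambda>n. 2 * (1 + norm M) * (3 / 4 :: real) ^ n)"
    by (intro summable_mult summable_geometric) simp
  then show "summable (\<lambda>n. norm ((- M) ^ n))"
    by (rule summable_comparison_test'[where N = 0])
       (use norm_power_le_of_square[OF sq order_refl] in \<open>simp only: norm_minus_power real_norm_def abs_norm_cancel\<close>)
  then show "summable (\<lambda>n. (- M) ^ n)"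
    by (rule summable_norm_cancel)
qed

lemma neu_norm_le:
  fixes M :: "'b::{real_normed_algebra_1, banach}"
  assumes sq: "norm (M * M) \<le> 1 / 2" and b: "norm M \<le> b"
  shows "norm (neu M) \<le> 8 * (1 + b)"
proof -
  have "norm (neu M) \<le> (\<Sum>n. norm ((- M) ^ n))"
    unfolding neu_def by (rule summable_norm[OF summable_powers_of_square(1)[OF sq]])
  also have "\<dots> \<le> (\<Sum>n. 2 * (1 + b) * (3 / 4) ^ n)"
    by (intro suminf_le summable_powers_of_square(1)[OF sq] summable_mult summable_geometric)
       (use norm_power_le_of_square[OF sq b] in \<open>simp_all only: norm_minus_power, simp\<close>)
  also have "\<dots> = 8 * (1 + b)"
    by (subst suminf_mult) (auto simp: suminf_geometric)
  finally show ?thesis .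
qed

lemma neu_inverse:
  fixes M :: "'b::{real_normed_algebra_1, banach}"
  assumes sq: "norm (M * M) \<le> 1 / 2"
  shows "neu M * (1 + M) = 1" and "(1 + M) * neu M = 1"
proof -
  note s = summable_powers_of_square(2)[OF sq]
  have e: "(\<Sum>n. (- M) ^ Suc n) = neu M - 1"
    unfolding neu_def using suminf_split_head[OF s] by simp
  have "neu M * (- M) = (\<Sum>n. (- M) ^ n * (- M))"
    unfolding neu_def by (rule suminf_mult2[OF s])
  also have "\<dots> = neu M - 1"
    using e by (simp add: power_commutes power_Suc2 del: mult_minus_left mult_minus_right power_Suc)
  finally show "neu M * (1 + M) = 1" by (simp add: algebra_simps)
  have "(- M) * neu M = (\<Sum>n. (- M) * (- M) ^ n)"
    unfolding neu_def by (rule suminf_mult[OF s, symmetric])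
  also have "\<dots> = neu M - 1"
    using e by simp
  finally show "(1 + M) * neu M = 1" by (simp add: algebra_simps)
qed

text \<open>The resolvent identity, for a left inverse \<open>B\<close> of \<open>A\<close> and a
  right inverse \<open>B'\<close> of \<open>A'\<close>. It turns bounds on inverses into Lipschitz
  bounds.\<close>

lemma inverse_diff:
  fixes A :: "'b::ring_1"
  assumes "B * A = 1" "A' * B' = 1"
  shows "B - B' = B * (A' - A) * B'"
  by (metis assms mult.assoc mult_1 mult_1_right left_diff_distrib right_diff_distrib)

lemma neu_diff_le:
  fixes M M' :: "'b::{real_normed_algebra_1, banach}"
  assumes "norm (M * M) \<le> 1 / 2" "norm (M' * M') \<le> 1 / 2" "norm M \<le> b" "norm M' \<le> b"
  shows "norm (neu M - neu M') \<le> (8 * (1 + b))\<^sup>2 * norm (M - M')"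
proof -
  have nn: "0 \<le> 8 * (1 + b)" using order_trans[OF norm_ge_zero assms(3)] by simp
  have "neu M - neu M' = neu M * ((1 + M') - (1 + M)) * neu M'"
    by (rule inverse_diff[OF neu_inverse(1)[OF assms(1)] neu_inverse(2)[OF assms(2)]])
  then have "neu M - neu M' = neu M * (M' - M) * neu M'" by simp
  then have "norm (neu M - neu M') \<le> norm (neu M) * norm (M' - M) * norm (neu M')"
    by (metis norm_mult3_le)
  also have "\<dots> \<le> (8 * (1 + b)) * norm (M' - M) * (8 * (1 + b))"
    using nn by (intro mult_mono neu_norm_le assms order_refl) auto
  finally show ?thesis by (simp add: power2_eq_square norm_minus_commute ac_simps)
qed

section \<open>Continuously differentiable families with a continuous parameter\<close>

text \<open>Differentiability concerns the first argument only; the second, usually a point of a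
  contour, enters continuously. Joint continuity of the derivative in operator norm is the form in
  which differentiation under the integral applies.\<close>

definition C1p :: "'a::real_normed_vector set \<Rightarrow> 'p::topological_space set \<Rightarrow>
    ('a \<Rightarrow> 'p \<Rightarrow> 'b::real_normed_vector) \<Rightarrow> bool" where
  "C1p U T f \<longleftrightarrow> continuous_on (U \<times> T) (\<lambda>x. f (fst x) (snd x)) \<and>
     (\<exists>f'. (\<forall>x\<in>U. \<forall>\<tau>\<in>T. ((\<lambda>x. f x \<tau>) has_derivative blinfun_apply (f' x \<tau>)) (at x)) \<and>
        continuous_on (U \<times> T) (\<lambda>x. f' (fst x) (snd x)))"

lemma C1pE:
  assumes "C1p U T f"
  obtains f' where "continuous_on (U \<times> T) (\<lambda>x. f (fst x) (snd x))"
    "\<And>x \<tau>. x \<in> U \<Longrightarrow> \<tau> \<in> T \<Longrightarrow> ((\<lambda>x. f x \<tau>) has_derivative blinfun_apply (f' x \<tau>)) (at x)"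
    "continuous_on (U \<times> T) (\<lambda>x. f' (fst x) (snd x))"
  using assms unfolding C1p_def by blast

lemma C1p_continuous: "C1p U T f \<Longrightarrow> continuous_on (U \<times> T) (\<lambda>x. f (fst x) (snd x))"
  unfolding C1p_def by blast

lemma C1p_continuous_param:
  assumes "C1p U T f" "x \<in> U"
  shows "continuous_on T (f x)"
proof -
  have "continuous_on T (\<lambda>\<tau>. (x, \<tau>))" by (intro continuous_intros)
  from continuous_on_compose2[OF C1p_continuous[OF assms(1)] this] assms(2) show ?thesis by auto
qed

lemma C1p_differentiable:
  assumes "C1p U T f" "x \<in> U" "\<tau> \<in> T"
  shows "(\<lambda>x. f x \<tau>) differentiable (at x)"
  using assms unfolding C1p_def differentiable_def by blast

lemma C1p_param: "continuous_on T g \<Longrightarrow> C1p U T (\<lambda>x. g)"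
  unfolding C1p_def
  by (intro conjI exI[of _ "\<lambda>_ _. 0"])
     (auto simp: zero_blinfun.rep_eq intro!: continuous_intros continuous_on_compose2[of T g])

text \<open>Through this the derivative given by the product rule is continuous in operator norm,
  not only pointwise.\<close>

lemma bounded_linear_Blinfun_bilinear:
  assumes "bounded_bilinear B"
  shows "bounded_linear (\<lambda>a. Blinfun (B a))"
proof -
  interpret bounded_bilinear B by fact
  have ap: "blinfun_apply (Blinfun (B a)) = B a" for a
    by (rule bounded_linear_Blinfun_apply[OF bounded_linear_right])
  obtain K where K: "\<And>a c. norm (B a c) \<le> norm a * norm c * K" and "0 \<le> K"
    using nonneg_bounded by blast
  show ?thesis
  proof (rule bounded_linear_intro[where K = K])
    show "Blinfun (B (x + y)) = Blinfun (B x) + Blinfun (B y)" for x y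
      by (rule blinfun_eqI) (simp add: ap add_left blinfun.add_left)
    show "Blinfun (B (r *\<^sub>R x)) = r *\<^sub>R Blinfun (B x)" for r x
      by (rule blinfun_eqI) (simp add: ap scaleR_left blinfun.scaleR_left)
    show "norm (Blinfun (B x)) \<le> norm x * K" for x
      using K \<open>0 \<le> K\<close> by (intro norm_blinfun_bound) (auto simp: ap ac_simps)
  qed
qed

lemma C1p_bilinear:
  assumes B: "bounded_bilinear B" and f: "C1p U T f" and g: "C1p U T g"
  shows "C1p U T (\<lambda>x \<tau>. B (f x \<tau>) (g x \<tau>))"
proof -
  interpret bounded_bilinear B by fact
  have B': "bounded_bilinear (\<lambda>x y. B y x)" by (rule flip)
  obtain f' where f': "continuous_on (U \<times> T) (\<lambda>x. f (fst x) (snd x))"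
    "\<And>x \<tau>. x \<in> U \<Longrightarrow> \<tau> \<in> T \<Longrightarrow> ((\<lambda>x. f x \<tau>) has_derivative blinfun_apply (f' x \<tau>)) (at x)"
    "continuous_on (U \<times> T) (\<lambda>x. f' (fst x) (snd x))" by (rule C1pE[OF f]) (rule that)
  obtain g' where g': "continuous_on (U \<times> T) (\<lambda>x. g (fst x) (snd x))"
    "\<And>x \<tau>. x \<in> U \<Longrightarrow> \<tau> \<in> T \<Longrightarrow> ((\<lambda>x. g x \<tau>) has_derivative blinfun_apply (g' x \<tau>)) (at x)"
    "continuous_on (U \<times> T) (\<lambda>x. g' (fst x) (snd x))" by (rule C1pE[OF g]) (rule that)
  let ?d = "\<lambda>x \<tau>. (Blinfun (B (f x \<tau>)) o\<^sub>L g' x \<tau>) + (Blinfun (\<lambda>y. B y (g x \<tau>)) o\<^sub>L f' x \<tau>)"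
  have "((\<lambda>x. B (f x \<tau>) (g x \<tau>)) has_derivative blinfun_apply (?d x \<tau>)) (at x)"
    if "x \<in> U" "\<tau> \<in> T" for x \<tau>
  proof -
    have "blinfun_apply (?d x \<tau>) = (\<lambda>h. B (f x \<tau>) (g' x \<tau> h) + B (f' x \<tau> h) (g x \<tau>))"
      by (auto simp: blinfun.add_left bounded_linear_Blinfun_apply[OF bounded_linear_right]
          bounded_linear_Blinfun_apply[OF bounded_linear_left])
    then show ?thesis
      using FDERIV[OF f'(2)[OF that] g'(2)[OF that]] by simp
  qed
  moreover have "continuous_on (U \<times> T) (\<lambda>x. ?d (fst x) (snd x))"
    by (intro continuous_intros f' g'
        bounded_linear.continuous_on[OF bounded_linear_Blinfun_bilinear[OF B]]
        bounded_linear.continuous_on[OF bounded_linear_Blinfun_bilinear[OF B']])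
  moreover have "continuous_on (U \<times> T) (\<lambda>x. B (f (fst x) (snd x)) (g (fst x) (snd x)))"
    by (rule continuous_on[OF f'(1) g'(1)])
  ultimately show ?thesis unfolding C1p_def by (intro conjI exI[of _ ?d]) auto
qed

lemmas C1p_mult = C1p_bilinear[OF bounded_bilinear_mult]
lemmas C1p_scaleR = C1p_bilinear[OF bounded_bilinear_scaleR]

lemma C1p_linear:
  assumes L: "bounded_linear L" and f: "C1p U T f"
  shows "C1p U T (\<lambda>x \<tau>. L (f x \<tau>))"
proof -
  obtain f' where f': "continuous_on (U \<times> T) (\<lambda>x. f (fst x) (snd x))"
    "\<And>x \<tau>. x \<in> U \<Longrightarrow> \<tau> \<in> T \<Longrightarrow> ((\<lambda>x. f x \<tau>) has_derivative blinfun_apply (f' x \<tau>)) (at x)"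
    "continuous_on (U \<times> T) (\<lambda>x. f' (fst x) (snd x))" by (rule C1pE[OF f]) (rule that)
  let ?d = "\<lambda>x \<tau>. Blinfun L o\<^sub>L f' x \<tau>"
  have "((\<lambda>x. L (f x \<tau>)) has_derivative blinfun_apply (?d x \<tau>)) (at x)"
    if "x \<in> U" "\<tau> \<in> T" for x \<tau>
  proof -
    have "blinfun_apply (?d x \<tau>) = (\<lambda>h. L (f' x \<tau> h))"
      by (auto simp: bounded_linear_Blinfun_apply[OF L])
    then show ?thesis
      using bounded_linear.has_derivative[OF L f'(2)[OF that]] by simp
  qed
  moreover have "continuous_on (U \<times> T) (\<lambda>x. ?d (fst x) (snd x))"
    by (intro continuous_intros f')
  moreover have "continuous_on (U \<times> T) (\<lambda>x. L (f (fst x) (snd x)))"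
    by (rule bounded_linear.continuous_on[OF L f'(1)])
  ultimately show ?thesis unfolding C1p_def by (intro conjI exI[of _ ?d]) auto
qed

lemma C1p_add:
  assumes f: "C1p U T f" and g: "C1p U T g"
  shows "C1p U T (\<lambda>x \<tau>. f x \<tau> + g x \<tau>)"
proof -
  obtain f' where f': "continuous_on (U \<times> T) (\<lambda>x. f (fst x) (snd x))"
    "\<And>x \<tau>. x \<in> U \<Longrightarrow> \<tau> \<in> T \<Longrightarrow> ((\<lambda>x. f x \<tau>) has_derivative blinfun_apply (f' x \<tau>)) (at x)"
    "continuous_on (U \<times> T) (\<lambda>x. f' (fst x) (snd x))" by (rule C1pE[OF f]) (rule that)
  obtain g' where g': "continuous_on (U \<times> T) (\<lambda>x. g (fst x) (snd x))"
    "\<And>x \<tau>. x \<in> U \<Longrightarrow> \<tau> \<in> T \<Longrightarrow> ((\<lambda>x. g x \<tau>) has_derivative blinfun_apply (g' x \<tau>)) (at x)"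
    "continuous_on (U \<times> T) (\<lambda>x. g' (fst x) (snd x))" by (rule C1pE[OF g]) (rule that)
  have "((\<lambda>x. f x \<tau> + g x \<tau>) has_derivative blinfun_apply (f' x \<tau> + g' x \<tau>)) (at x)"
    if "x \<in> U" "\<tau> \<in> T" for x \<tau>
    using has_derivative_add[OF f'(2)[OF that] g'(2)[OF that]]
    by (simp add: plus_blinfun.rep_eq)
  then show ?thesis
    unfolding C1p_def
    by (intro conjI exI[of _ "\<lambda>x \<tau>. f' x \<tau> + g' x \<tau>"]) (auto intro!: continuous_intros f' g')
qed

lemma C1p_uminus: "C1p U T f \<Longrightarrow> C1p U T (\<lambda>x \<tau>. - f x \<tau>)"
  by (rule C1p_linear[OF bounded_linear_minus[OF bounded_linear_ident]])

lemma C1p_diff: "C1p U T f \<Longrightarrow> C1p U T g \<Longrightarrow> C1p U T (\<lambda>x \<tau>. f x \<tau> - g x \<tau>)"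
  using C1p_add[OF _ C1p_uminus, of U T f g] by simp

lemma C1p_sum: "finite I \<Longrightarrow> (\<And>i. i \<in> I \<Longrightarrow> C1p U T (f i)) \<Longrightarrow> C1p U T (\<lambda>x \<tau>. \<Sum>i\<in>I. f i x \<tau>)"
  by (induction I rule: finite_induct) (auto intro!: C1p_add C1p_param continuous_intros)

lemma C1p_power:
  fixes f :: "'a::real_normed_vector \<Rightarrow> 'p::topological_space \<Rightarrow> 'b::real_normed_algebra_1"
  shows "C1p U T f \<Longrightarrow> C1p U T (\<lambda>x \<tau>. f x \<tau> ^ n)"
  by (induction n) (auto intro!: C1p_mult C1p_param continuous_intros)

lemma C1p_linear_arg:
  assumes L: "bounded_linear L"
  shows "C1p U T (\<lambda>x \<tau>. L x)"
  unfolding C1p_def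
  by (intro conjI exI[of _ "\<lambda>_ _. Blinfun L"])
     (auto simp: bounded_linear_Blinfun_apply[OF L] bounded_linear_imp_has_derivative[OF L]
       intro!: continuous_intros bounded_linear.continuous_on[OF L])

lemma C1p_compose_linear:
  assumes f: "C1p U T f" and L: "bounded_linear L" and LU: "\<And>x. x \<in> U' \<Longrightarrow> L x \<in> U"
  shows "C1p U' T (\<lambda>x. f (L x))"
proof -
  obtain f' where f': "continuous_on (U \<times> T) (\<lambda>x. f (fst x) (snd x))"
    "\<And>x \<tau>. x \<in> U \<Longrightarrow> \<tau> \<in> T \<Longrightarrow> ((\<lambda>x. f x \<tau>) has_derivative blinfun_apply (f' x \<tau>)) (at x)"
    "continuous_on (U \<times> T) (\<lambda>x. f' (fst x) (snd x))" by (rule C1pE[OF f]) (rule that)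
  have cL: "continuous_on (U' \<times> T) (\<lambda>x. (L (fst x), snd x))"
    by (intro continuous_intros bounded_linear.continuous_on[OF L])
  have sub: "(\<lambda>x. (L (fst x), snd x)) ` (U' \<times> T) \<subseteq> U \<times> T" using LU by auto
  have "((\<lambda>x. f (L x) \<tau>) has_derivative blinfun_apply (f' (L x) \<tau> o\<^sub>L Blinfun L)) (at x)"
    if "x \<in> U'" "\<tau> \<in> T" for x \<tau>
    using has_derivative_compose[OF bounded_linear_imp_has_derivative[OF L] f'(2)[OF LU[OF that(1)] that(2)]]
    by (simp add: blinfun_compose.rep_eq o_def bounded_linear_Blinfun_apply[OF L])
  moreover have "continuous_on (U' \<times> T) (\<lambda>x. f' (L (fst x)) (snd x) o\<^sub>L Blinfun L)"
    using continuous_on_compose2[OF f'(3) cL sub] by (intro continuous_intros) auto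
  moreover have "continuous_on (U' \<times> T) (\<lambda>x. f (L (fst x)) (snd x))"
    using continuous_on_compose2[OF f'(1) cL sub] by auto
  ultimately show ?thesis
    unfolding C1p_def by (intro conjI exI[of _ "\<lambda>x \<tau>. f' (L x) \<tau> o\<^sub>L Blinfun L"]) auto
qed

lemma C1p_reparam:
  assumes f: "C1p U T f" and p: "continuous_on T' p" and pT: "\<And>\<tau>. \<tau> \<in> T' \<Longrightarrow> p \<tau> \<in> T"
  shows "C1p U T' (\<lambda>x \<tau>. f x (p \<tau>))"
proof -
  obtain f' where f': "continuous_on (U \<times> T) (\<lambda>x. f (fst x) (snd x))"
    "\<And>x \<tau>. x \<in> U \<Longrightarrow> \<tau> \<in> T \<Longrightarrow> ((\<lambda>x. f x \<tau>) has_derivative blinfun_apply (f' x \<tau>)) (at x)"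
    "continuous_on (U \<times> T) (\<lambda>x. f' (fst x) (snd x))" by (rule C1pE[OF f]) (rule that)
  have cL: "continuous_on (U \<times> T') (\<lambda>x. (fst x, p (snd x)))"
    by (intro continuous_intros continuous_on_compose2[OF p]) auto
  have sub: "(\<lambda>x. (fst x, p (snd x))) ` (U \<times> T') \<subseteq> U \<times> T" using pT by auto
  show ?thesis
    unfolding C1p_def
    using continuous_on_compose2[OF f'(3) cL sub] continuous_on_compose2[OF f'(1) cL sub] f'(2) pT
    by (intro conjI exI[of _ "\<lambda>x \<tau>. f' x (p \<tau>)"]) auto
qed

lemma C1p_cong:
  assumes "open U" and "\<And>x \<tau>. x \<in> U \<Longrightarrow> \<tau> \<in> T \<Longrightarrow> f x \<tau> = g x \<tau>" and f: "C1p U T f"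
  shows "C1p U T g"
proof -
  obtain f' where f': "continuous_on (U \<times> T) (\<lambda>x. f (fst x) (snd x))"
    "\<And>x \<tau>. x \<in> U \<Longrightarrow> \<tau> \<in> T \<Longrightarrow> ((\<lambda>x. f x \<tau>) has_derivative blinfun_apply (f' x \<tau>)) (at x)"
    "continuous_on (U \<times> T) (\<lambda>x. f' (fst x) (snd x))" by (rule C1pE[OF f]) (rule that)
  have "((\<lambda>x. g x \<tau>) has_derivative blinfun_apply (f' x \<tau>)) (at x)" if "x \<in> U" "\<tau> \<in> T" for x \<tau>
    by (rule has_derivative_transform_within_open[OF f'(2)[OF that] assms(1) that(1)])
       (use assms(2) that in auto)
  moreover have "continuous_on (U \<times> T) (\<lambda>x. g (fst x) (snd x))"
    by (rule continuous_on_eq[OF f'(1)]) (use assms(2) in auto)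
  ultimately show ?thesis
    unfolding C1p_def using f'(3) by blast
qed

text \<open>A factor that is merely continuous suffices next to one that vanishes at the point: the
  error splits into \<open>G y\<close> times the remainder of \<open>f\<close> and
  \<open>G y - G x\<close> times the linear term, both of lower order. In this way an inverse is
  differentiated without knowing beforehand that it is differentiable.\<close>

lemma has_derivative_vanishing_product:
  fixes G :: "'a::real_normed_vector \<Rightarrow> 'b::real_normed_algebra"
  assumes f: "(f has_derivative f') (at x)" and f0: "f x = 0"
    and G: "(G \<longlongrightarrow> G x) (at x)"
  shows "((\<lambda>y. G y * f y) has_derivative (\<lambda>h. G x * f' h)) (at x)"
proof -
  interpret f': bounded_linear f' using f by (rule has_derivative_bounded_linear)
  obtain K where K: "\<And>h. norm (f' h) \<le> norm h * K" using f'.nonneg_bounded by blast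
  have lim0: "((\<lambda>y. norm (f y - f x - f' (y - x)) / norm (y - x)) \<longlongrightarrow> 0) (at x)"
    using f unfolding has_derivative_at_within by (auto dest: tendsto_norm_zero simp: divide_inverse ac_simps)
  have "((\<lambda>y. norm (G y) * (norm (f y - f x - f' (y - x)) / norm (y - x))
      + norm (G y - G x) * K) \<longlongrightarrow> norm (G x) * 0 + norm (G x - G x) * K) (at x)"
    by (intro tendsto_intros G lim0)
  then have lim: "((\<lambda>y. norm (G y) * (norm (f y - f x - f' (y - x)) / norm (y - x))
      + norm (G y - G x) * K) \<longlongrightarrow> 0) (at x)" by simp
  have "((\<lambda>y. (G y * f y - G x * f x - G x * f' (y - x)) /\<^sub>R norm (y - x)) \<longlongrightarrow> 0) (at x)"
  proof (rule Lim_null_comparison[OF _ lim])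
    show "\<forall>\<^sub>F y in at x. norm ((G y * f y - G x * f x - G x * f' (y - x)) /\<^sub>R norm (y - x))
        \<le> norm (G y) * (norm (f y - f x - f' (y - x)) / norm (y - x)) + norm (G y - G x) * K"
      unfolding eventually_at_filter
    proof (intro always_eventually allI impI)
      fix y assume "y \<noteq> x"
      have "G y * f y - G x * f x - G x * f' (y - x)
          = G y * (f y - f x - f' (y - x)) + (G y - G x) * f' (y - x)"
        by (simp add: f0 algebra_simps)
      then have "norm (G y * f y - G x * f x - G x * f' (y - x))
          \<le> norm (G y) * norm (f y - f x - f' (y - x)) + norm (G y - G x) * (norm (y - x) * K)"
        using K[of "y - x"]
        by (auto intro!: order_trans[OF norm_triangle_ineq] add_mono order_trans[OF norm_mult_ineq] mult_left_mono)
      then have "norm (G y * f y - G x * f x - G x * f' (y - x)) / norm (y - x)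
          \<le> (norm (G y) * norm (f y - f x - f' (y - x)) + norm (G y - G x) * (norm (y - x) * K)) / norm (y - x)"
        by (rule divide_right_mono) simp
      also have "\<dots> = norm (G y) * (norm (f y - f x - f' (y - x)) / norm (y - x)) + norm (G y - G x) * K"
        using \<open>y \<noteq> x\<close> by (simp add: add_divide_distrib)
      finally show "norm ((G y * f y - G x * f x - G x * f' (y - x)) /\<^sub>R norm (y - x))
          \<le> norm (G y) * (norm (f y - f x - f' (y - x)) / norm (y - x)) + norm (G y - G x) * K"
        by (simp only: norm_scaleR divide_inverse abs_inverse abs_norm_cancel mult.commute)
    qed
  qed
  moreover have "bounded_linear (\<lambda>h. G x * f' h)"
    by (rule bounded_linear_const_mult[OF has_derivative_bounded_linear[OF f]])
  ultimately show ?thesis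
    unfolding has_derivative_at_within by simp
qed

text \<open>The resolvent identity and the uniform bound \<open>K\<close> make \<open>g\<close>
  continuous. Then \<open>g y - g x = - g y * (f y - f x) * g x\<close> is a product in which the
  factor \<open>f y - f x\<close> vanishes at \<open>x\<close>.\<close>

lemma C1p_inverse:
  fixes f g :: "'a::real_normed_vector \<Rightarrow> 'p::topological_space \<Rightarrow> 'b::real_normed_algebra_1"
  assumes U: "open U" and f: "C1p U T f"
    and fg: "\<And>x \<tau>. x \<in> U \<Longrightarrow> \<tau> \<in> T \<Longrightarrow> f x \<tau> * g x \<tau> = 1"
    and gf: "\<And>x \<tau>. x \<in> U \<Longrightarrow> \<tau> \<in> T \<Longrightarrow> g x \<tau> * f x \<tau> = 1"
    and K: "\<And>x \<tau>. x \<in> U \<Longrightarrow> \<tau> \<in> T \<Longrightarrow> norm (g x \<tau>) \<le> K"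
  shows "C1p U T g"
proof -
  obtain f' where f': "continuous_on (U \<times> T) (\<lambda>x. f (fst x) (snd x))"
    "\<And>x \<tau>. x \<in> U \<Longrightarrow> \<tau> \<in> T \<Longrightarrow> ((\<lambda>x. f x \<tau>) has_derivative blinfun_apply (f' x \<tau>)) (at x)"
    "continuous_on (U \<times> T) (\<lambda>x. f' (fst x) (snd x))" by (rule C1pE[OF f]) (rule that)
  have lip: "norm (g x \<tau> - g y \<rho>) \<le> K * K * norm (f x \<tau> - f y \<rho>)"
    if "x \<in> U" "\<tau> \<in> T" "y \<in> U" "\<rho> \<in> T" for x y \<tau> \<rho>
  proof -
    have K0: "0 \<le> K" using K[OF that(1,2)] norm_ge_zero order_trans by blast
    have "norm (g x \<tau> - g y \<rho>) = norm (g x \<tau> * (f y \<rho> - f x \<tau>) * g y \<rho>)"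
      using inverse_diff[OF gf[OF that(1,2)] fg[OF that(3,4)]] by simp
    also have "\<dots> \<le> norm (g x \<tau>) * norm (f y \<rho> - f x \<tau>) * norm (g y \<rho>)"
      by (rule norm_mult3_le)
    also have "\<dots> \<le> K * norm (f y \<rho> - f x \<tau>) * K"
      using K0 that by (intro mult_mono K) auto
    finally show ?thesis by (simp add: norm_minus_commute ac_simps)
  qed
  have cont: "continuous_on (U \<times> T) (\<lambda>x. g (fst x) (snd x))"
    unfolding continuous_on
  proof
    fix p assume p: "p \<in> U \<times> T"
    have "((\<lambda>q. K * K * norm (f (fst q) (snd q) - f (fst p) (snd p))) \<longlongrightarrow>
        K * K * norm (f (fst p) (snd p) - f (fst p) (snd p))) (at p within U \<times> T)"
      using f'(1) p unfolding continuous_on by (intro tendsto_intros) auto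
    then have lim: "((\<lambda>q. K * K * norm (f (fst q) (snd q) - f (fst p) (snd p))) \<longlongrightarrow> 0) (at p within U \<times> T)"
      by simp
    have "((\<lambda>q. g (fst q) (snd q) - g (fst p) (snd p)) \<longlongrightarrow> 0) (at p within U \<times> T)"
    proof (rule Lim_null_comparison[OF _ lim])
      show "\<forall>\<^sub>F q in at p within U \<times> T. norm (g (fst q) (snd q) - g (fst p) (snd p))
          \<le> K * K * norm (f (fst q) (snd q) - f (fst p) (snd p))"
        unfolding eventually_at_filter
      proof (intro always_eventually allI impI)
        fix q assume "q \<in> U \<times> T"
        with p show "norm (g (fst q) (snd q) - g (fst p) (snd p))
            \<le> K * K * norm (f (fst q) (snd q) - f (fst p) (snd p))"
          by (intro lip) (simp_all add: mem_Times_iff)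
      qed
    qed
    then show "((\<lambda>q. g (fst q) (snd q)) \<longlongrightarrow> g (fst p) (snd p)) (at p within U \<times> T)"
      by (rule LIM_zero_cancel)
  qed
  let ?d = "\<lambda>x \<tau>. - (blinfun_mult_right (g x \<tau>) o\<^sub>L (blinfun_mult_left (g x \<tau>) o\<^sub>L f' x \<tau>))"
  have der: "((\<lambda>x. g x \<tau>) has_derivative blinfun_apply (?d x \<tau>)) (at x)"
    if x: "x \<in> U" and \<tau>: "\<tau> \<in> T" for x \<tau>
  proof -
    have gc: "((\<lambda>y. g y \<tau>) \<longlongrightarrow> g x \<tau>) (at x)"
    proof -
      have "continuous_on U (\<lambda>y. g y \<tau>)"
      proof -
        have "continuous_on U (\<lambda>y. (y, \<tau>))" by (intro continuous_intros)
        moreover have "(\<lambda>y. (y, \<tau>)) ` U \<subseteq> U \<times> T" using \<tau> by auto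
        ultimately show ?thesis using continuous_on_compose2[OF cont] by fastforce
      qed
      then show ?thesis using x unfolding continuous_on by (metis U at_within_open)
    qed
    have "((\<lambda>y. (f y \<tau> - f x \<tau>) * g x \<tau>) has_derivative (\<lambda>h. (f' x \<tau> h - 0) * g x \<tau>)) (at x)"
      by (intro has_derivative_mult_left has_derivative_diff f'(2)[OF x \<tau>] has_derivative_const)
    then have "((\<lambda>y. (f y \<tau> - f x \<tau>) * g x \<tau>) has_derivative (\<lambda>h. f' x \<tau> h * g x \<tau>)) (at x)"
      by simp
    then have "((\<lambda>y. - g y \<tau> * ((f y \<tau> - f x \<tau>) * g x \<tau>)) has_derivative
        (\<lambda>h. - g x \<tau> * (f' x \<tau> h * g x \<tau>))) (at x)"
      by (rule has_derivative_vanishing_product) (simp, rule tendsto_minus[OF gc])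
    then have "((\<lambda>y. g x \<tau> + - g y \<tau> * ((f y \<tau> - f x \<tau>) * g x \<tau>)) has_derivative
        (\<lambda>h. 0 + - g x \<tau> * (f' x \<tau> h * g x \<tau>))) (at x)"
      by (intro has_derivative_add has_derivative_const)
    then have "((\<lambda>y. g y \<tau>) has_derivative (\<lambda>h. 0 + - g x \<tau> * (f' x \<tau> h * g x \<tau>))) (at x)"
    proof (rule has_derivative_transform_within_open[OF _ U x])
      fix y assume y: "y \<in> U"
      have "g y \<tau> - g x \<tau> = g y \<tau> * (f x \<tau> - f y \<tau>) * g x \<tau>"
        by (rule inverse_diff[OF gf[OF y \<tau>] fg[OF x \<tau>]])
      then show "g x \<tau> + - g y \<tau> * ((f y \<tau> - f x \<tau>) * g x \<tau>) = g y \<tau>"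
        by (simp add: algebra_simps)
    qed
    moreover have "blinfun_apply (?d x \<tau>) = (\<lambda>h. 0 + - g x \<tau> * (f' x \<tau> h * g x \<tau>))"
      by (auto simp: blinfun.minus_left)
    ultimately show ?thesis by simp
  qed
  moreover have "continuous_on (U \<times> T) (\<lambda>x. ?d (fst x) (snd x))"
    by (intro continuous_intros cont f'(3))
  ultimately show ?thesis
    unfolding C1p_def using cont by (intro conjI exI[of _ ?d]) auto
qed

lemma C1p_neu:
  fixes f :: "'a::real_normed_vector \<Rightarrow> 'p::topological_space \<Rightarrow> 'b::{real_normed_algebra_1, banach}"
  assumes "open U" and "C1p U T f"
    and sq: "\<And>x \<tau>. x \<in> U \<Longrightarrow> \<tau> \<in> T \<Longrightarrow> norm (f x \<tau> * f x \<tau>) \<le> 1 / 2"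
    and b: "\<And>x \<tau>. x \<in> U \<Longrightarrow> \<tau> \<in> T \<Longrightarrow> norm (f x \<tau>) \<le> b"
  shows "C1p U T (\<lambda>x \<tau>. neu (f x \<tau>))"
  by (rule C1p_inverse[OF assms(1) C1p_add[OF C1p_param[OF continuous_on_const, of _ _ 1] assms(2)]])
     (use neu_inverse sq neu_norm_le b in blast)+

text \<open>Differentiation under the integral. The derivative is again an integral, of bounded
  linear maps, so its joint continuity follows from the same theorem as that of the integral
  itself.\<close>

lemma C1p_integral:
  fixes f :: "'a::banach \<Rightarrow> 'p::topological_space \<Rightarrow> real \<Rightarrow> 'b::banach"
  assumes U: "open U" "convex U" and f: "C1p U (T \<times> {0..1}) (\<lambda>x p. f x (fst p) (snd p))"
  shows "C1p U T (\<lambda>x \<tau>. integral {0..1} (f x \<tau>))"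
proof -
  obtain f' where f': "continuous_on (U \<times> (T \<times> {0..1})) (\<lambda>x. f (fst x) (fst (snd x)) (snd (snd x)))"
    "\<And>x p. x \<in> U \<Longrightarrow> p \<in> T \<times> {0..1} \<Longrightarrow>
      ((\<lambda>x. f x (fst p) (snd p)) has_derivative blinfun_apply (f' x p)) (at x)"
    "continuous_on (U \<times> (T \<times> {0..1})) (\<lambda>x. f' (fst x) (snd x))" by (rule C1pE[OF f]) (rule that)
  have swap: "continuous_on ((U \<times> T) \<times> {0..1}) (\<lambda>q::('a \<times> 'p) \<times> real. (fst (fst q), snd (fst q), snd q))"
    by (intro continuous_intros)
  have sub: "(\<lambda>q::('a \<times> 'p) \<times> real. (fst (fst q), snd (fst q), snd q)) ` ((U \<times> T) \<times> {0..1})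
      \<subseteq> U \<times> (T \<times> {0..1})" by auto
  have c1: "continuous_on ((U \<times> T) \<times> cbox 0 1) (\<lambda>(q, s). f (fst q) (snd q) s)"
    using continuous_on_compose2[OF f'(1) swap sub] by (simp add: case_prod_unfold)
  have c2: "continuous_on ((U \<times> T) \<times> cbox 0 1) (\<lambda>(q, s). f' (fst q) (snd q, s))"
    using continuous_on_compose2[OF f'(3) swap sub] by (simp add: case_prod_unfold)
  have der: "((\<lambda>x. integral {0..1} (f x \<tau>)) has_derivative
      blinfun_apply (integral {0..1} (\<lambda>s. f' x (\<tau>, s)))) (at x)" if x: "x \<in> U" and \<tau>: "\<tau> \<in> T" for x \<tau>
  proof -
    have "((\<lambda>x. integral (cbox 0 1) (f x \<tau>)) has_derivative
      blinfun_apply (integral (cbox 0 1) (\<lambda>s. f' x (\<tau>, s)))) (at x within U)"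
    proof (rule leibniz_rule[OF _ _ _ x U(2)])
      show "((\<lambda>x. f x \<tau> s) has_derivative blinfun_apply (f' y (\<tau>, s))) (at y within U)"
        if "y \<in> U" "s \<in> cbox 0 1" for y s
        using f'(2)[of y "(\<tau>, s)"] that \<tau> by (auto intro: has_derivative_at_withinI)
      show "f y \<tau> integrable_on cbox 0 1" if "y \<in> U" for y
      proof (rule integrable_continuous)
        have "continuous_on (cbox 0 1 :: real set) (\<lambda>s. ((y, \<tau>), s))" by (intro continuous_intros)
        from continuous_on_compose2[OF c1 this] that \<tau> show "continuous_on (cbox 0 1) (f y \<tau>)" by auto
      qed
      show "continuous_on (U \<times> cbox 0 1) (\<lambda>(x, s). f' x (\<tau>, s))"
      proof -
        have "continuous_on (U \<times> cbox 0 1 :: ('a \<times> real) set) (\<lambda>p. ((fst p, \<tau>), snd p))"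
          by (intro continuous_intros)
        moreover have "(\<lambda>p. ((fst p, \<tau>), snd p)) ` (U \<times> cbox 0 1 :: ('a \<times> real) set) \<subseteq> (U \<times> T) \<times> cbox 0 1"
          using \<tau> by auto
        ultimately show ?thesis
          using continuous_on_compose2[OF c2] by (fastforce simp: case_prod_unfold)
      qed
    qed
    then show ?thesis using U x by (simp add: at_within_open[of x U])
  qed
  show ?thesis
    unfolding C1p_def
  proof (intro conjI exI[of _ "\<lambda>x \<tau>. integral {0..1} (\<lambda>s. f' x (\<tau>, s))"] ballI der)
    show "continuous_on (U \<times> T) (\<lambda>x. integral {0..1} (f (fst x) (snd x)))"
      using integral_continuous_on_param[OF c1] by simp
    show "continuous_on (U \<times> T) (\<lambda>x. integral {0..1} (\<lambda>s. f' (fst x) (snd x, s)))"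
      using integral_continuous_on_param[OF c2] by simp
  qed
qed

section \<open>Lipschitz bounds and differentiability of fixed points\<close>

text \<open>Only increments from the base point \<open>x\<close> are compared. The derivative is
  homogeneous, so \<open>h\<close> may be shrunk until the increment stays in \<open>U\<close> and
  the linear approximation is accurate.\<close>

lemma has_derivative_lipschitz_bound:
  assumes f: "(f has_derivative D) (at x)" and U: "open U" "x \<in> U"
    and L: "\<And>y. y \<in> U \<Longrightarrow> norm (f y - f x) \<le> L * norm (y - x)"
  shows "norm (D h) \<le> L * norm h"
proof -
  interpret D: bounded_linear D using f by (rule has_derivative_bounded_linear)
  show ?thesis
  proof (cases "h = 0")
    case False
    show ?thesis
    proof (rule field_le_epsilon)
      fix e :: real assume e: "e > 0"
      define e' where "e' = e / norm h"
      have e': "e' > 0" using e False by (simp add: e'_def)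
      obtain d where d: "d > 0" "\<And>y. norm (y - x) < d \<Longrightarrow> norm (f y - f x - D (y - x)) \<le> e' * norm (y - x)"
        using f e' unfolding has_derivative_at_alt by blast
      obtain r where r: "r > 0" "ball x r \<subseteq> U" using U open_contains_ball by blast
      define s where "s = min d r / (2 * norm h)"
      have s: "s > 0" "s * norm h < d" "s * norm h < r"
        using d r False by (auto simp: s_def)
      let ?y = "x + s *\<^sub>R h"
      have "norm (D (s *\<^sub>R h)) \<le> norm (f ?y - f x) + norm (f ?y - f x - D (s *\<^sub>R h))"
        using norm_triangle_ineq4[of "f ?y - f x" "f ?y - f x - D (s *\<^sub>R h)"] by simp
      also have "\<dots> \<le> L * norm (s *\<^sub>R h) + e' * norm (s *\<^sub>R h)"
        using L[of ?y] d(2)[of ?y] r(2) s by (intro add_mono) (auto simp: dist_norm subset_iff)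
      also have "\<dots> = s * (L * norm h + e)"
        using s False by (simp add: e'_def algebra_simps)
      finally show "norm (D h) \<le> L * norm h + e"
        using s by (simp add: D.scaleR)
    qed
  qed (simp add: D.zero)
qed

text \<open>Implicit differentiation of \<open>Y s = F (s, Y s)\<close> gives this equation for the
  derivative of \<open>Y\<close>. The half bound makes it a contraction in the second slot, and
  uniqueness of the solution yields linearity of \<open>D\<close>.\<close>

lemma linear_fixed_point:
  fixes F' :: "'a::real_normed_vector \<times> 'b::banach \<Rightarrow> 'b"
  assumes F': "bounded_linear F'" and half: "\<And>g. norm (F' (0, g)) \<le> norm g / 2"
  obtains D where "bounded_linear D" "\<And>h. D h = F' (h, D h)"
proof -
  interpret F': bounded_linear F' by fact
  have split: "F' (h, g) = F' (h, 0) + F' (0, g)" for h g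
    using F'.add[of "(h, 0)" "(0, g)"] by simp
  have diff: "F' (0, g) - F' (0, g') = F' (0, g - g')" for g g'
    using F'.diff[of "(0, g)" "(0, g')"] by simp
  have ex1: "\<exists>!y. F' (h, y) = y" for h
  proof (rule banach_fix_type[where c = "1/2"])
    show "\<forall>x y. dist (F' (h, x)) (F' (h, y)) \<le> 1 / 2 * dist x y"
    proof (intro allI)
      fix x y
      show "dist (F' (h, x)) (F' (h, y)) \<le> 1 / 2 * dist x y"
        using half[of "x - y"] split[of h x] split[of h y] diff[of x y] by (simp only: dist_norm) simp
    qed
  qed auto
  then obtain D where D: "\<And>h. F' (h, D h) = D h" by metis
  have uniq: "y = D h" if "F' (h, y) = y" for h y
    using ex1[of h] that D by blast
  obtain K where K: "\<And>x. norm (F' x) \<le> norm x * K" using F'.bounded by blast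
  have "bounded_linear D"
  proof (rule bounded_linear_intro[where K = "2 * K"])
    show "D (x + y) = D x + D y" for x y
      by (rule uniq[symmetric]) (use F'.add[of "(x, D x)" "(y, D y)"] D in simp)
    show "D (r *\<^sub>R x) = r *\<^sub>R D x" for r x
      by (rule uniq[symmetric]) (use F'.scaleR[of r "(x, D x)"] D in simp)
    show "norm (D h) \<le> norm h * (2 * K)" for h
    proof -
      have "norm (D h) \<le> norm (F' (h, 0)) + norm (F' (0, D h))"
        by (metis D split norm_triangle_ineq)
      also have "\<dots> \<le> norm h * K + norm (D h) / 2"
        using K[of "(h, 0)"] half[of "D h"] by (simp add: norm_prod_def)
      finally show ?thesis by simp
    qed
  qed
  with D that show ?thesis by metis
qed

text \<open>The a priori Lipschitz bound on \<open>Y\<close> makes an error that is small against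
  \<open>(s, Y s) - (t, Y t)\<close> small against \<open>s - t\<close> as well. The remainder
  \<Delta> occurs on both sides of its own equation and is absorbed by the half bound.\<close>

lemma fixed_point_differentiable:
  fixes F :: "'a::real_normed_vector \<times> 'b::banach \<Rightarrow> 'b" and Y :: "'a \<Rightarrow> 'b"
  assumes U: "open U" "t \<in> U" and fp: "\<And>s. s \<in> U \<Longrightarrow> Y s = F (s, Y s)"
    and F: "(F has_derivative F') (at (t, Y t))"
    and half: "\<And>g. norm (F' (0, g)) \<le> norm g / 2"
    and lip: "\<And>s. s \<in> U \<Longrightarrow> norm (Y s - Y t) \<le> K * norm (s - t)"
  shows "Y differentiable (at t)"
proof -
  have F': "bounded_linear F'" using F by (rule has_derivative_bounded_linear)
  interpret F': bounded_linear F' by fact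
  obtain D where D: "bounded_linear D" "\<And>h. D h = F' (h, D h)"
    using linear_fixed_point[OF F' half] by blast
  obtain r where r: "r > 0" "ball t r \<subseteq> U" using U open_contains_ball by blast
  have K0: "0 \<le> \<bar>K\<bar>" by simp
  have "(Y has_derivative D) (at t)"
    unfolding has_derivative_at_alt
  proof (intro conjI D allI impI)
    fix e :: real assume e: "e > 0"
    \<comment> \<open>Chosen so that \<open>2 * e' * (1 + |K|) = e\<close>; the factor 2 comes from
      absorbing half of the remainder.\<close>
    define e' where "e' = e / (2 * (1 + \<bar>K\<bar>))"
    have e': "e' > 0" using e by (simp add: e'_def add_pos_nonneg)
    obtain d where d: "d > 0"
      "\<And>y. norm (y - (t, Y t)) < d \<Longrightarrow> norm (F y - F (t, Y t) - F' (y - (t, Y t))) \<le> e' * norm (y - (t, Y t))"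
      using F e' unfolding has_derivative_at_alt by blast
    define d' where "d' = min r (d / (1 + \<bar>K\<bar>))"
    have "d' > 0" using r d by (simp add: d'_def add_pos_nonneg)
    moreover have "norm (Y s - Y t - D (s - t)) \<le> e * norm (s - t)" if s: "norm (s - t) < d'" for s
    proof -
      have sU: "s \<in> U" using s r(2) by (auto simp: d'_def dist_norm norm_minus_commute)
      have tU: "t \<in> U" by fact
      let ?y = "(s, Y s)"
      have np: "norm (?y - (t, Y t)) \<le> (1 + \<bar>K\<bar>) * norm (s - t)"
      proof -
        have "norm (?y - (t, Y t)) \<le> norm (s - t) + norm (Y s - Y t)"
          by (simp add: norm_prod_def sqrt_sum_squares_le_sum)
        also have "\<dots> \<le> norm (s - t) + \<bar>K\<bar> * norm (s - t)"
          by (intro add_left_mono order_trans[OF lip[OF sU]] mult_right_mono) auto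
        finally show ?thesis by (simp add: algebra_simps)
      qed
      have nd: "norm (?y - (t, Y t)) < d"
      proof -
        have "(1 + \<bar>K\<bar>) * norm (s - t) < d"
          using s by (simp add: d'_def field_simps add_pos_nonneg)
        with np show ?thesis by simp
      qed
      define \<Delta> where "\<Delta> = Y s - Y t - D (s - t)"
      have "\<Delta> = (F ?y - F (t, Y t) - F' (?y - (t, Y t))) + F' (0, \<Delta>)"
      proof -
        have "F' (?y - (t, Y t)) - F' (s - t, D (s - t)) = F' (0, \<Delta>)"
          by (simp add: \<Delta>_def F'.diff[symmetric])
        then show ?thesis
          using fp[OF sU] fp[OF tU] D(2)[of "s - t"] by (simp add: \<Delta>_def algebra_simps)
      qed
      then have "norm \<Delta> \<le> norm (F ?y - F (t, Y t) - F' (?y - (t, Y t))) + norm (F' (0, \<Delta>))"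
        by (metis norm_triangle_ineq)
      also have "\<dots> \<le> e' * norm (?y - (t, Y t)) + norm \<Delta> / 2"
        by (intro add_mono d nd half)
      finally have "norm \<Delta> \<le> 2 * (e' * norm (?y - (t, Y t)))" by simp
      also have "\<dots> \<le> 2 * (e' * ((1 + \<bar>K\<bar>) * norm (s - t)))"
        using e' np by (intro mult_left_mono) auto
      also have "\<dots> = e * norm (s - t)"
      proof -
        have "2 * e' * (1 + \<bar>K\<bar>) = e" using K0 by (simp add: e'_def field_simps)
        then show ?thesis by (metis mult.assoc)
      qed
      finally show ?thesis by (simp add: \<Delta>_def)
    qed
    ultimately show "\<exists>d>0. \<forall>y. norm (y - t) < d \<longrightarrow> norm (Y y - Y t - D (y - t)) \<le> e * norm (y - t)"
      by blast
  qed
  then show ?thesis unfolding differentiable_def by blast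
qed

section \<open>Integrals over the unit interval\<close>

lemma integral_unit_diff_le:
  fixes f g :: "real \<Rightarrow> 'b::banach"
  assumes "continuous_on {0..1} f" "continuous_on {0..1} g"
    and "\<And>\<theta>. \<theta> \<in> {0..1} \<Longrightarrow> norm (f \<theta> - g \<theta>) \<le> B"
  shows "norm (integral {0..1} f - integral {0..1} g) \<le> B"
proof -
  have "integral {0..1} f - integral {0..1} g = integral {0..1} (\<lambda>\<theta>. f \<theta> - g \<theta>)"
    by (intro integral_diff[symmetric] integrable_continuous_real assms)
  also have "norm \<dots> \<le> B * (1 - 0)"
    by (rule integral_bound) (auto intro!: continuous_intros assms)
  finally show ?thesis by simp
qed

lemma integral_unit_le:
  fixes f :: "real \<Rightarrow> 'b::banach"
  assumes "continuous_on {0..1} f" and "\<And>\<theta>. \<theta> \<in> {0..1} \<Longrightarrow> norm (f \<theta>) \<le> B"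
  shows "norm (integral {0..1} f) \<le> B"
  using integral_unit_diff_le[of f "\<lambda>_. 0" B] assms by simp

lemma integral_unit_sums:
  fixes f :: "nat \<Rightarrow> real \<Rightarrow> 'b::banach"
  assumes c: "\<And>n. continuous_on {0..1} (f n)"
    and le: "\<And>n \<theta>. \<theta> \<in> {0..1} \<Longrightarrow> norm (f n \<theta>) \<le> a n" and a: "summable a"
  shows "(\<lambda>n. integral {0..1} (f n)) sums integral {0..1} (\<lambda>\<theta>. \<Sum>n. f n \<theta>)"
proof -
  have u: "uniform_limit {0..1} (\<lambda>N \<theta>. \<Sum>n<N. f n \<theta>) (\<lambda>\<theta>. \<Sum>n. f n \<theta>) sequentially"
    by (rule Weierstrass_m_test[OF le a])
  have cs: "continuous_on {0..1} (\<lambda>\<theta>. \<Sum>n<N. f n \<theta>)" for N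
    by (intro continuous_intros c)
  obtain I J where I: "\<And>N. ((\<lambda>\<theta>. \<Sum>n<N. f n \<theta>) has_integral I N) {0..1}"
    and J: "((\<lambda>\<theta>. \<Sum>n. f n \<theta>) has_integral J) {0..1}" and L: "I \<longlonglongrightarrow> J"
    using uniform_limit_integral[OF u cs] by auto
  have e: "I N = (\<Sum>n<N. integral {0..1} (f n))" for N
    using integral_unique[OF I[of N]]
    by (simp add: integral_sum integrable_continuous_real c)
  have "(\<lambda>N. \<Sum>n<N. integral {0..1} (f n)) \<longlonglongrightarrow> J"
    using L unfolding e[symmetric] .
  then show ?thesis
    unfolding sums_def by (simp add: integral_unique[OF J])
qed

section \<open>The nonlinear eigenvalue problem in a Banach algebra\<close>

text \<open>\<open>R t \<theta>\<close> and \<open>RQ t \<theta>\<close> play the roles of the resolvent of the model operator at the point of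
  the circle with parameter \<open>\<theta>\<close> and of its part outside the block \<open>{j, j - q}\<close>, \<open>Z \<theta>\<close> that of
  \<open>z\<close> minus the centre, \<open>Bil\<close> that of squaring the modulus of the eigenfunction, \<open>c\<close> that of
  \<open>\<sigma>|A|\<^sup>2\<close>, and \<open>tr\<close> that of the trace of the block.\<close>

locale nonlinear_pert =
  fixes U :: "'a::euclidean_space set"
    and R RQ :: "'a \<Rightarrow> real \<Rightarrow> 'b::{real_normed_algebra_1, banach}"
    and Z :: "real \<Rightarrow> 'b" and Bil :: "'b \<Rightarrow> 'b \<Rightarrow> 'b" and tr :: "'b \<Rightarrow> complex"
    and YV :: 'b and c b y d \<beta> \<kappa> :: real
  assumes U: "open U" "convex U"
    and pos: "1 \<le> b" "1 \<le> y" "0 \<le> d" "0 \<le> \<kappa>" "0 < \<beta>"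
    and C1R: "C1p U {0..1} R" "C1p U {0..1} RQ"
    and Z: "continuous_on {0..1} Z" "\<And>\<theta>. \<theta> \<in> {0..1} \<Longrightarrow> norm (Z \<theta>) \<le> d"
    and Rb: "\<And>t \<theta>. t \<in> U \<Longrightarrow> \<theta> \<in> {0..1} \<Longrightarrow> norm (R t \<theta>) \<le> b"
      "\<And>t \<theta>. t \<in> U \<Longrightarrow> \<theta> \<in> {0..1} \<Longrightarrow> norm (RQ t \<theta>) \<le> b"
    and Rlip: "\<And>t t' \<theta>. t \<in> U \<Longrightarrow> t' \<in> U \<Longrightarrow> \<theta> \<in> {0..1} \<Longrightarrow> norm (R t \<theta> - R t' \<theta>) \<le> \<kappa> * norm (t - t')"
      "\<And>t t' \<theta>. t \<in> U \<Longrightarrow> t' \<in> U \<Longrightarrow> \<theta> \<in> {0..1} \<Longrightarrow> norm (RQ t \<theta> - RQ t' \<theta>) \<le> \<kappa> * norm (t - t')"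
    and Yb: "\<And>Y. Y \<in> ball YV \<beta> \<Longrightarrow> norm Y \<le> y"
    and sqR: "\<And>t \<theta> Y. t \<in> U \<Longrightarrow> \<theta> \<in> {0..1} \<Longrightarrow> Y \<in> ball YV \<beta> \<Longrightarrow>
        norm ((R t \<theta> * Y) * (R t \<theta> * Y)) \<le> 1 / 2"
      "\<And>t \<theta> Y. t \<in> U \<Longrightarrow> \<theta> \<in> {0..1} \<Longrightarrow> Y \<in> ball YV \<beta> \<Longrightarrow>
        norm ((RQ t \<theta> * Y) * (RQ t \<theta> * Y)) \<le> 1 / 2"
    and Bil: "bounded_bilinear Bil" "\<And>x x'. norm (Bil x x') \<le> norm x * norm x'"
    and tr: "bounded_linear tr" "\<And>x. norm (tr x) \<le> 2 * norm x"
    and small: "\<bar>c\<bar> * (d * (8 * (1 + b * y)) * b)\<^sup>2 \<le> \<beta> / 2"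
      "\<bar>c\<bar> * (2 * (d * (8 * (1 + b * y)) * b) * (d * ((8 * (1 + b * y))\<^sup>2 * (y + b) * b + 8 * (1 + b * y)))) \<le> 1 / 2"
begin

text \<open>\<open>K\<close> bounds all Neumann series below; \<open>CE\<close> and
  \<open>CL\<close> are the Lipschitz constants of \<open>Emap\<close> and \<open>Lmap\<close> with
  respect to \<open>\<kappa> |t - t'| + |Y - Y'|\<close>.\<close>

definition K where "K = 8 * (1 + b * y)"
definition CE where "CE = d * (K\<^sup>2 * (y + b) * b + K)"
definition CL where
  "CL = 2 * d * (2 * (y + b) * K\<^sup>2 + 2 * b * y * (2 * K * (K\<^sup>2 * (y + b))))"

text \<open>The Riesz projection of the perturbed operator: \<open>neu (R Y) * R\<close> is its
  resolvent, and \<open>dz = 2 pi i Z d\<theta>\<close> on the circle. The minus sign is there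
  because the resolvent inverts the operator minus \<open>z\<close>.\<close>

definition Emap where
  "Emap t Y = - integral {0..1} (\<lambda>\<theta>. Z \<theta> * (neu (R t \<theta> * Y) * R t \<theta>))"

definition Fmap where "Fmap t Y = YV + c *\<^sub>R Bil (Emap t Y) (Emap t Y)"

text \<open>In the eigenvalue series the term of order \<open>r\<close> carries the factor
  \<open>1 / r\<close>. Integrating powers of \<open>s\<close> over the unit interval produces these
  factors, so the series sums to an integral of a product of two Neumann series, which is
  differentiable by the same rules as \<open>Emap\<close>.\<close>

definition Jmap where
  "Jmap t Y \<theta> = integral {0..1} (\<lambda>s. neu (s *\<^sub>R (R t \<theta> * Y)) * neu (s *\<^sub>R (RQ t \<theta> * Y)))"

text \<open>The closed form of the sum of all eigenvalue corrections. The factor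
  \<open>R - RQ\<close>, of finite rank in the application, has been moved cyclically to the front,
  which leaves a trace over the block.\<close>

definition Lmap where
  "Lmap t Y = - integral {0..1} (\<lambda>\<theta>. tr (Z \<theta> * ((R t \<theta> - RQ t \<theta>) * Y * Jmap t Y \<theta>)))"

definition Yit where "Yit t m = (Fmap t ^^ m) YV"

definition Ysol where "Ysol t = lim (Yit t)"

lemma K_pos: "1 \<le> K" and CE_nonneg: "0 \<le> CE" and CL_nonneg: "0 \<le> CL"
proof -
  have "0 \<le> b * y" using pos by simp
  then show K: "1 \<le> K" unfolding K_def by simp
  show "0 \<le> CE" "0 \<le> CL" unfolding CE_def CL_def using pos K by simp_all
qed

section \<open>Bounds along the circle\<close>

context
  fixes t Y and \<theta> :: real assumes t: "t \<in> U" and \<theta>: "\<theta> \<in> {0..1}" and Y: "Y \<in> ball YV \<beta>"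
begin

lemma RY_le: "norm (R t \<theta> * Y) \<le> b * y" "norm (RQ t \<theta> * Y) \<le> b * y"
  by (rule order_trans[OF norm_mult_ineq]; use Rb t \<theta> Yb Y pos in \<open>intro mult_mono; simp\<close>)+

context
  fixes s :: real assumes s: "s \<in> {0..1}"
begin

lemma sRY_le: "norm (s *\<^sub>R (R t \<theta> * Y)) \<le> b * y" "norm (s *\<^sub>R (RQ t \<theta> * Y)) \<le> b * y"
proof -
  have *: "norm (s *\<^sub>R x) \<le> norm x" for x :: 'b
    using s by (simp add: mult_left_le_one_le)
  show "norm (s *\<^sub>R (R t \<theta> * Y)) \<le> b * y" "norm (s *\<^sub>R (RQ t \<theta> * Y)) \<le> b * y"
    using *[of "R t \<theta> * Y"] *[of "RQ t \<theta> * Y"] RY_le by linarith+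
qed

lemma sRY_sq: "norm (s *\<^sub>R (R t \<theta> * Y) * s *\<^sub>R (R t \<theta> * Y)) \<le> 1 / 2"
  "norm (s *\<^sub>R (RQ t \<theta> * Y) * s *\<^sub>R (RQ t \<theta> * Y)) \<le> 1 / 2"
proof -
  have *: "norm (s *\<^sub>R x * s *\<^sub>R x) \<le> 1 / 2" if "norm (x * x) \<le> 1 / 2" for x :: 'b
  proof -
    have "norm (s *\<^sub>R x * s *\<^sub>R x) = s * s * norm (x * x)"
      using s by simp
    also have "\<dots> \<le> 1 * (1 / 2)"
      using s that by (intro mult_mono) (auto intro: mult_le_one)
    finally show ?thesis by simp
  qed
  show "norm (s *\<^sub>R (R t \<theta> * Y) * s *\<^sub>R (R t \<theta> * Y)) \<le> 1 / 2"
    "norm (s *\<^sub>R (RQ t \<theta> * Y) * s *\<^sub>R (RQ t \<theta> * Y)) \<le> 1 / 2"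
    by (rule *, rule sqR[OF t \<theta> Y])+
qed

lemma neu_le: "norm (neu (s *\<^sub>R (R t \<theta> * Y))) \<le> K" "norm (neu (s *\<^sub>R (RQ t \<theta> * Y))) \<le> K"
  unfolding K_def by (rule neu_norm_le[OF sRY_sq(1) sRY_le(1)] neu_norm_le[OF sRY_sq(2) sRY_le(2)])+

end

lemma neu1_le: "norm (neu (R t \<theta> * Y)) \<le> K"
  using neu_le(1)[of 1] by simp

end

section \<open>Smoothness in the quasimomentum and the potential jointly\<close>

lemma C1p_RY: "C1p (U \<times> ball YV \<beta>) {0..1} (\<lambda>x \<theta>. R (fst x) \<theta> * snd x)"
  "C1p (U \<times> ball YV \<beta>) {0..1} (\<lambda>x \<theta>. RQ (fst x) \<theta> * snd x)"
  by (intro C1p_mult C1p_compose_linear[OF C1R(1)] C1p_compose_linear[OF C1R(2)] bounded_linear_fst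
      C1p_linear_arg bounded_linear_snd; auto)+

lemma UB: "open (U \<times> ball YV \<beta>)" "convex (U \<times> ball YV \<beta>)"
  using U by (auto intro: open_Times convex_Times)

lemma C1p_neuRY:
  "C1p (U \<times> ball YV \<beta>) ({0..1} \<times> {0..1}) (\<lambda>x p. neu (snd p *\<^sub>R (R (fst x) (fst p) * snd x)))"
  "C1p (U \<times> ball YV \<beta>) ({0..1} \<times> {0..1}) (\<lambda>x p. neu (snd p *\<^sub>R (RQ (fst x) (fst p) * snd x)))"
  using sRY_sq sRY_le
  by (intro C1p_neu[where b = "b * y"] UB C1p_scaleR C1p_param continuous_intros
      C1p_reparam[OF C1p_RY(1)] C1p_reparam[OF C1p_RY(2)]; force)+

lemma C1p_neuRY1: "C1p (U \<times> ball YV \<beta>) {0..1} (\<lambda>x \<theta>. neu (R (fst x) \<theta> * snd x))"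
proof -
  have "continuous_on {0..1} (\<lambda>\<theta>::real. (\<theta>, 1::real))" by (intro continuous_intros)
  from C1p_reparam[OF C1p_neuRY(1) this] show ?thesis by simp
qed

lemma C1p_Eint: "C1p (U \<times> ball YV \<beta>) {0..1} (\<lambda>x \<theta>. Z \<theta> * (neu (R (fst x) \<theta> * snd x) * R (fst x) \<theta>))"
  by (intro C1p_mult C1p_param Z C1p_neuRY1 C1p_compose_linear[OF C1R(1)] bounded_linear_fst) auto

text \<open>The one-point parameter set is a dummy: after integration no contour parameter is left,
  but \<open>C1p\<close> asks for one.\<close>

lemma C1p_Emap: "C1p (U \<times> ball YV \<beta>) {0::real} (\<lambda>x _. Emap (fst x) (snd x))"
  unfolding Emap_def
  by (intro C1p_uminus C1p_integral UB C1p_reparam[OF C1p_Eint, where p = snd])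
     (auto intro!: continuous_intros)

lemma C1p_Fmap: "C1p (U \<times> ball YV \<beta>) {0::real} (\<lambda>x _. Fmap (fst x) (snd x))"
  unfolding Fmap_def
  by (intro C1p_add C1p_param continuous_intros C1p_Emap C1p_bilinear[OF Bil(1)]
      C1p_bilinear[OF bounded_bilinear_scaleR])

lemma C1p_Jmap: "C1p (U \<times> ball YV \<beta>) {0..1} (\<lambda>x. Jmap (fst x) (snd x))"
  unfolding Jmap_def
  by (rule C1p_integral[OF UB]) (intro C1p_mult C1p_neuRY)

lemma C1p_Lint: "C1p (U \<times> ball YV \<beta>) {0..1}
    (\<lambda>x \<theta>. tr (Z \<theta> * ((R (fst x) \<theta> - RQ (fst x) \<theta>) * snd x * Jmap (fst x) (snd x) \<theta>)))"
  by (intro C1p_linear[OF tr(1)] C1p_mult C1p_param Z C1p_Jmap C1p_diff C1p_linear_arg bounded_linear_snd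
      C1p_compose_linear[OF C1R(1)] C1p_compose_linear[OF C1R(2)] bounded_linear_fst) auto

lemma C1p_Lmap: "C1p (U \<times> ball YV \<beta>) {0::real} (\<lambda>x _. Lmap (fst x) (snd x))"
  unfolding Lmap_def
  by (intro C1p_uminus C1p_integral UB C1p_reparam[OF C1p_Lint, where p = snd])
     (auto intro!: continuous_intros)

section \<open>Lipschitz estimates for the projection and the eigenvalue correction\<close>

lemma norm_prod_diff_le:
  fixes x x' z z' :: "'c::real_normed_algebra"
  assumes "norm (x - x') \<le> p" "norm z \<le> q" "norm x' \<le> r" "norm (z - z') \<le> w"
  shows "norm (x * z - x' * z') \<le> p * q + r * w"
proof -
  have nn: "0 \<le> p" "0 \<le> r" using assms norm_ge_zero order_trans by blast+
  have "x * z - x' * z' = (x - x') * z + x' * (z - z')" by (simp add: algebra_simps)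
  also have "norm \<dots> \<le> norm ((x - x') * z) + norm (x' * (z - z'))" by (rule norm_triangle_ineq)
  also have "\<dots> \<le> norm (x - x') * norm z + norm x' * norm (z - z')"
    by (intro add_mono norm_mult_ineq)
  also have "\<dots> \<le> p * q + r * w"
    using assms nn by (intro add_mono mult_mono) auto
  finally show ?thesis .
qed

context
  fixes t t' Y Y' assumes t: "t \<in> U" "t' \<in> U" and Y: "Y \<in> ball YV \<beta>" "Y' \<in> ball YV \<beta>"
begin

text \<open>One modulus for both variables, so that the estimates compose. The factor \<kappa> stays
  visible in it because the final gradient bound has to be proportional to it.\<close>

abbreviation "\<rho> \<equiv> \<kappa> * norm (t - t') + norm (Y - Y')"

lemma rho_ge: "\<kappa> * norm (t - t') \<le> \<rho>" "norm (Y - Y') \<le> \<rho>" "0 \<le> \<rho>"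
  using pos by (auto intro: add_nonneg_nonneg)

lemma R_rho: "\<theta> \<in> {0..1} \<Longrightarrow> norm (R t \<theta> - R t' \<theta>) \<le> \<rho>" "\<theta> \<in> {0..1} \<Longrightarrow> norm (RQ t \<theta> - RQ t' \<theta>) \<le> \<rho>"
  using Rlip t rho_ge(1) order_trans by blast+

lemma RY_rho:
  assumes \<theta>: "\<theta> \<in> {0..1}"
  shows "norm (R t \<theta> * Y - R t' \<theta> * Y') \<le> (y + b) * \<rho>" "norm (RQ t \<theta> * Y - RQ t' \<theta> * Y') \<le> (y + b) * \<rho>"
  using norm_prod_diff_le[OF R_rho(1)[OF \<theta>] Yb[OF Y(1)] Rb(1)[OF t(2) \<theta>] rho_ge(2)]
    norm_prod_diff_le[OF R_rho(2)[OF \<theta>] Yb[OF Y(1)] Rb(2)[OF t(2) \<theta>] rho_ge(2)]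
  by (simp_all add: algebra_simps)

lemma neu_rho:
  assumes \<theta>: "\<theta> \<in> {0..1}" and s: "s \<in> {0..1}"
  shows "norm (neu (s *\<^sub>R (R t \<theta> * Y)) - neu (s *\<^sub>R (R t' \<theta> * Y'))) \<le> K\<^sup>2 * ((y + b) * \<rho>)"
    "norm (neu (s *\<^sub>R (RQ t \<theta> * Y)) - neu (s *\<^sub>R (RQ t' \<theta> * Y'))) \<le> K\<^sup>2 * ((y + b) * \<rho>)"
proof -
  have s1: "norm (s *\<^sub>R x) \<le> norm x" for x :: 'b
    using s by (simp add: mult_left_le_one_le)
  have "norm (s *\<^sub>R (R t \<theta> * Y) - s *\<^sub>R (R t' \<theta> * Y')) \<le> (y + b) * \<rho>"
    using s1[of "R t \<theta> * Y - R t' \<theta> * Y'"] RY_rho(1)[OF \<theta>] by (simp add: scaleR_diff_right)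
  then show "norm (neu (s *\<^sub>R (R t \<theta> * Y)) - neu (s *\<^sub>R (R t' \<theta> * Y'))) \<le> K\<^sup>2 * ((y + b) * \<rho>)"
    unfolding K_def
    by (rule order_trans[OF neu_diff_le[OF sRY_sq(1)[OF t(1) \<theta> Y(1) s] sRY_sq(1)[OF t(2) \<theta> Y(2) s]
        sRY_le(1)[OF t(1) \<theta> Y(1) s] sRY_le(1)[OF t(2) \<theta> Y(2) s]] mult_left_mono]) simp
  have "norm (s *\<^sub>R (RQ t \<theta> * Y) - s *\<^sub>R (RQ t' \<theta> * Y')) \<le> (y + b) * \<rho>"
    using s1[of "RQ t \<theta> * Y - RQ t' \<theta> * Y'"] RY_rho(2)[OF \<theta>] by (simp add: scaleR_diff_right)
  then show "norm (neu (s *\<^sub>R (RQ t \<theta> * Y)) - neu (s *\<^sub>R (RQ t' \<theta> * Y'))) \<le> K\<^sup>2 * ((y + b) * \<rho>)"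
    unfolding K_def
    by (rule order_trans[OF neu_diff_le[OF sRY_sq(2)[OF t(1) \<theta> Y(1) s] sRY_sq(2)[OF t(2) \<theta> Y(2) s]
        sRY_le(2)[OF t(1) \<theta> Y(1) s] sRY_le(2)[OF t(2) \<theta> Y(2) s]] mult_left_mono]) simp
qed

end

lemma Eint_continuous: "t \<in> U \<Longrightarrow> Y \<in> ball YV \<beta> \<Longrightarrow>
    continuous_on {0..1} (\<lambda>\<theta>. Z \<theta> * (neu (R t \<theta> * Y) * R t \<theta>))"
  using C1p_continuous_param[OF C1p_Eint, of "(t, Y)"] by simp

lemma Lint_continuous: "t \<in> U \<Longrightarrow> Y \<in> ball YV \<beta> \<Longrightarrow>
    continuous_on {0..1} (\<lambda>\<theta>. tr (Z \<theta> * ((R t \<theta> - RQ t \<theta>) * Y * Jmap t Y \<theta>)))"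
  using C1p_continuous_param[OF C1p_Lint, of "(t, Y)"] by simp

lemma Jint_continuous:
  assumes "t \<in> U" "Y \<in> ball YV \<beta>" "\<theta> \<in> {0..1}"
  shows "continuous_on {0..1} (\<lambda>s. neu (s *\<^sub>R (R t \<theta> * Y)) * neu (s *\<^sub>R (RQ t \<theta> * Y)))"
proof -
  have "continuous_on {0..1} (\<lambda>s::real. (\<theta>, s))" by (intro continuous_intros)
  from C1p_continuous_param[OF C1p_reparam[OF C1p_mult[OF C1p_neuRY] this], of "(t, Y)"] assms
  show ?thesis by simp
qed

lemma Emap_le:
  assumes "t \<in> U" "Y \<in> ball YV \<beta>"
  shows "norm (Emap t Y) \<le> d * (K * b)"
  unfolding Emap_def norm_minus_cancel
proof (rule integral_unit_le[OF Eint_continuous[OF assms]])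
  fix \<theta> :: real assume \<theta>: "\<theta> \<in> {0..1}"
  show "norm (Z \<theta> * (neu (R t \<theta> * Y) * R t \<theta>)) \<le> d * (K * b)"
    using Z(2)[OF \<theta>] neu1_le[OF assms(1) \<theta> assms(2)] Rb(1)[OF assms(1) \<theta>] K_pos pos
    by (intro order_trans[OF norm_mult_ineq] mult_mono) auto
qed

lemma Emap_lipschitz:
  assumes t: "t \<in> U" "t' \<in> U" and Y: "Y \<in> ball YV \<beta>" "Y' \<in> ball YV \<beta>"
  shows "norm (Emap t Y - Emap t' Y') \<le> CE * (\<kappa> * norm (t - t') + norm (Y - Y'))"
proof -
  let ?r = "\<kappa> * norm (t - t') + norm (Y - Y')"
  have "norm (Emap t Y - Emap t' Y') = norm (integral {0..1} (\<lambda>\<theta>. Z \<theta> * (neu (R t \<theta> * Y) * R t \<theta>))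
      - integral {0..1} (\<lambda>\<theta>. Z \<theta> * (neu (R t' \<theta> * Y') * R t' \<theta>)))"
    by (simp add: Emap_def norm_minus_commute)
  also have "\<dots> \<le> CE * ?r"
  proof (rule integral_unit_diff_le[OF Eint_continuous Eint_continuous])
    fix \<theta> :: real assume \<theta>: "\<theta> \<in> {0..1}"
    have "norm (neu (R t \<theta> * Y) * R t \<theta> - neu (R t' \<theta> * Y') * R t' \<theta>)
        \<le> K\<^sup>2 * ((y + b) * ?r) * b + K * ?r"
      by (rule norm_prod_diff_le[OF _ Rb(1)[OF t(1) \<theta>] neu1_le[OF t(2) \<theta> Y(2)] R_rho(1)[OF t Y \<theta>]])
         (use neu_rho(1)[OF t Y \<theta>, of 1] in simp)
    then have "norm (Z \<theta> * (neu (R t \<theta> * Y) * R t \<theta> - neu (R t' \<theta> * Y') * R t' \<theta>))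
        \<le> d * (K\<^sup>2 * ((y + b) * ?r) * b + K * ?r)"
      using Z(2)[OF \<theta>] pos by (intro order_trans[OF norm_mult_ineq] mult_mono) auto
    then show "norm (Z \<theta> * (neu (R t \<theta> * Y) * R t \<theta>) - Z \<theta> * (neu (R t' \<theta> * Y') * R t' \<theta>)) \<le> CE * ?r"
      unfolding CE_def by (simp add: algebra_simps)
  qed (use t Y in auto)
  finally show ?thesis .
qed

lemma Jmap_le:
  assumes "t \<in> U" "Y \<in> ball YV \<beta>" "\<theta> \<in> {0..1}"
  shows "norm (Jmap t Y \<theta>) \<le> K\<^sup>2"
  unfolding Jmap_def
proof (rule integral_unit_le[OF Jint_continuous[OF assms]])
  fix s :: real assume s: "s \<in> {0..1}"
  show "norm (neu (s *\<^sub>R (R t \<theta> * Y)) * neu (s *\<^sub>R (RQ t \<theta> * Y))) \<le> K\<^sup>2"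
    unfolding power2_eq_square
    using neu_le[OF assms(1,3,2) s] K_pos by (intro order_trans[OF norm_mult_ineq] mult_mono) auto
qed

lemma Lmap_lipschitz:
  assumes t: "t \<in> U" "t' \<in> U" and Y: "Y \<in> ball YV \<beta>" "Y' \<in> ball YV \<beta>"
  shows "norm (Lmap t Y - Lmap t' Y') \<le> CL * (\<kappa> * norm (t - t') + norm (Y - Y'))"
proof -
  let ?r = "\<kappa> * norm (t - t') + norm (Y - Y')"
  let ?f = "\<lambda>t Y \<theta>. Z \<theta> * ((R t \<theta> - RQ t \<theta>) * Y * Jmap t Y \<theta>)"
  have "norm (Lmap t Y - Lmap t' Y') =
      norm (integral {0..1} (\<lambda>\<theta>. tr (?f t Y \<theta>)) - integral {0..1} (\<lambda>\<theta>. tr (?f t' Y' \<theta>)))"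
    by (simp add: Lmap_def norm_minus_commute)
  also have "\<dots> \<le> CL * ?r"
  proof (rule integral_unit_diff_le[OF Lint_continuous Lint_continuous])
    fix \<theta> :: real assume \<theta>: "\<theta> \<in> {0..1}"
    have J: "norm (Jmap t Y \<theta> - Jmap t' Y' \<theta>) \<le> 2 * K * (K\<^sup>2 * (y + b)) * ?r"
      unfolding Jmap_def
    proof (rule integral_unit_diff_le[OF Jint_continuous Jint_continuous])
      fix s :: real assume s: "s \<in> {0..1}"
      show "norm (neu (s *\<^sub>R (R t \<theta> * Y)) * neu (s *\<^sub>R (RQ t \<theta> * Y))
          - neu (s *\<^sub>R (R t' \<theta> * Y')) * neu (s *\<^sub>R (RQ t' \<theta> * Y'))) \<le> 2 * K * (K\<^sup>2 * (y + b)) * ?r"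
        using norm_prod_diff_le[OF neu_rho(1)[OF t Y \<theta> s] neu_le(2)[OF t(1) \<theta> Y(1) s]
            neu_le(1)[OF t(2) \<theta> Y(2) s] neu_rho(2)[OF t Y \<theta> s]]
        by (simp add: algebra_simps)
    qed (use t Y \<theta> in auto)
    have "norm ((R t \<theta> - RQ t \<theta>) - (R t' \<theta> - RQ t' \<theta>)) \<le> norm (R t \<theta> - R t' \<theta>) + norm (RQ t \<theta> - RQ t' \<theta>)"
      using norm_triangle_ineq4[of "R t \<theta> - R t' \<theta>" "RQ t \<theta> - RQ t' \<theta>"] by (simp add: algebra_simps)
    from order_trans[OF this add_mono[OF R_rho(1)[OF t Y \<theta>] R_rho(2)[OF t Y \<theta>]]]
    have R2: "norm ((R t \<theta> - RQ t \<theta>) - (R t' \<theta> - RQ t' \<theta>)) \<le> 2 * ?r"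
      by (simp only: mult_2)
    have Rb2: "norm (R t \<theta> - RQ t \<theta>) \<le> 2 * b" if "t \<in> U" for t
      using norm_triangle_ineq4[of "R t \<theta>" "RQ t \<theta>"] Rb[OF that \<theta>] by linarith
    have D: "norm ((R t \<theta> - RQ t \<theta>) * Y - (R t' \<theta> - RQ t' \<theta>) * Y') \<le> 2 * (y + b) * ?r"
      using norm_prod_diff_le[OF R2 Yb[OF Y(1)] Rb2[OF t(2)] rho_ge(2)[OF t Y]]
      by (simp add: algebra_simps)
    have D': "norm ((R t' \<theta> - RQ t' \<theta>) * Y') \<le> 2 * b * y"
      using Rb2[OF t(2)] Yb[OF Y(2)] pos by (intro order_trans[OF norm_mult_ineq] mult_mono) auto
    have "norm ((R t \<theta> - RQ t \<theta>) * Y * Jmap t Y \<theta> - (R t' \<theta> - RQ t' \<theta>) * Y' * Jmap t' Y' \<theta>)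
        \<le> 2 * (y + b) * ?r * K\<^sup>2 + 2 * b * y * (2 * K * (K\<^sup>2 * (y + b)) * ?r)"
      by (rule norm_prod_diff_le[OF D Jmap_le[OF t(1) Y(1) \<theta>] D' J])
    then have "norm (Z \<theta> * ((R t \<theta> - RQ t \<theta>) * Y * Jmap t Y \<theta> - (R t' \<theta> - RQ t' \<theta>) * Y' * Jmap t' Y' \<theta>))
        \<le> d * (2 * (y + b) * ?r * K\<^sup>2 + 2 * b * y * (2 * K * (K\<^sup>2 * (y + b)) * ?r))"
      using Z(2)[OF \<theta>] pos by (intro order_trans[OF norm_mult_ineq] mult_mono) auto
    \<comment> \<open>Half of \<open>CL\<close>, since \<open>tr\<close> may double the
      norm.\<close>
    then have "norm (?f t Y \<theta> - ?f t' Y' \<theta>) \<le> CL / 2 * ?r"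
      unfolding CL_def by (simp add: algebra_simps)
    then have "norm (tr (?f t Y \<theta> - ?f t' Y' \<theta>)) \<le> CL * ?r"
      using tr(2)[of "?f t Y \<theta> - ?f t' Y' \<theta>"] by simp
    then show "norm (tr (?f t Y \<theta>) - tr (?f t' Y' \<theta>)) \<le> CL * ?r"
      by (simp add: bounded_linear.linear[OF tr(1)] linear_diff)
  qed (use t Y in auto)
  finally show ?thesis .
qed

section \<open>The contraction and its fixed point\<close>

text \<open>The image lies within half the radius, so the iterates and the fixed point stay inside
  the open ball on which differentiability is available.\<close>

lemma Fmap_in_cball:
  assumes "t \<in> U" "Y \<in> ball YV \<beta>"
  shows "Fmap t Y \<in> cball YV (\<beta> / 2)"
proof -
  have "norm (c *\<^sub>R Bil (Emap t Y) (Emap t Y)) \<le> \<bar>c\<bar> * (norm (Emap t Y) * norm (Emap t Y))"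
    using Bil(2)[of "Emap t Y" "Emap t Y"] by (simp add: mult_left_mono)
  also have "\<dots> \<le> \<bar>c\<bar> * (d * (K * b))\<^sup>2"
    using power_mono[OF Emap_le[OF assms], of 2] by (intro mult_left_mono) (auto simp: power2_eq_square)
  also have "\<dots> \<le> \<beta> / 2"
    using small(1) by (simp add: K_def mult.assoc)
  finally show ?thesis by (simp add: Fmap_def dist_norm)
qed

lemma Fmap_lipschitz:
  assumes t: "t \<in> U" "t' \<in> U" and Y: "Y \<in> ball YV \<beta>" "Y' \<in> ball YV \<beta>"
  shows "norm (Fmap t Y - Fmap t' Y') \<le> 1 / 2 * (\<kappa> * norm (t - t') + norm (Y - Y'))"
proof -
  interpret Bil: bounded_bilinear Bil by (rule Bil)
  let ?r = "\<kappa> * norm (t - t') + norm (Y - Y')" and ?E = "Emap t Y" and ?E' = "Emap t' Y'"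
  have r0: "0 \<le> ?r" using pos by simp
  have "Bil ?E ?E - Bil ?E' ?E' = Bil (?E - ?E') ?E + Bil ?E' (?E - ?E')"
    by (simp add: Bil.diff_left Bil.diff_right)
  then have "norm (Bil ?E ?E - Bil ?E' ?E') \<le> norm (Bil (?E - ?E') ?E) + norm (Bil ?E' (?E - ?E'))"
    by (metis norm_triangle_ineq)
  also have "\<dots> \<le> norm (?E - ?E') * norm ?E + norm ?E' * norm (?E - ?E')"
    by (intro add_mono Bil(2))
  also have "\<dots> \<le> (CE * ?r) * (d * (K * b)) + (d * (K * b)) * (CE * ?r)"
    using Emap_le[OF t(1) Y(1)] Emap_le[OF t(2) Y(2)] Emap_lipschitz[OF t Y] CE_nonneg r0 pos K_pos
    by (intro add_mono mult_mono) auto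
  finally have B: "norm (Bil ?E ?E - Bil ?E' ?E') \<le> 2 * (d * K * b) * CE * ?r"
    by (simp add: algebra_simps)
  have "norm (Fmap t Y - Fmap t' Y') = \<bar>c\<bar> * norm (Bil ?E ?E - Bil ?E' ?E')"
    by (simp add: Fmap_def scaleR_diff_right[symmetric])
  also have "\<dots> \<le> (\<bar>c\<bar> * (2 * (d * K * b) * CE)) * ?r"
    using mult_left_mono[OF B, of "\<bar>c\<bar>"] by (simp add: mult.assoc)
  also have "\<dots> \<le> 1 / 2 * ?r"
    by (rule mult_right_mono[OF small(2)[folded K_def, folded CE_def] r0])
  finally show ?thesis .
qed

lemma half_ball: "cball YV (\<beta> / 2) \<subseteq> ball YV \<beta>"
  using pos by auto

lemma Yit_in: "t \<in> U \<Longrightarrow> Yit t m \<in> cball YV (\<beta> / 2)"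
proof (induction m)
  case 0
  then show ?case using pos by (simp add: Yit_def)
next
  case (Suc m)
  then have "Yit t m \<in> ball YV \<beta>" using half_ball by blast
  with Suc.prems show ?case using Fmap_in_cball by (simp add: Yit_def del: mem_cball)
qed

text \<open>The fixed point is identified with the limit of the concrete iterates started at
  \<open>YV\<close>, since these are the matrices that correspond to the potentials of the
  iteration. Banach's theorem is applied on the closed ball of half radius, which is
  complete.\<close>

lemma Ysol_props:
  assumes t: "t \<in> U"
  shows "Yit t \<longlonglongrightarrow> Ysol t" "Ysol t \<in> cball YV (\<beta> / 2)" "Ysol t = Fmap t (Ysol t)"
proof -
  let ?S = "cball YV (\<beta> / 2)"
  have con: "norm (Fmap t Y - Fmap t Y') \<le> 1 / 2 * norm (Y - Y')" if "Y \<in> ?S" "Y' \<in> ?S" for Y Y'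
    using Fmap_lipschitz[OF t t subsetD[OF half_ball that(1)] subsetD[OF half_ball that(2)]] by simp
  have "\<exists>!Y. Y \<in> ?S \<and> Fmap t Y = Y"
    using Fmap_in_cball[OF t] half_ball pos con
    by (intro Banach_fix[where c = "1/2"]) (auto simp: complete_eq_closed dist_norm)
  then obtain Y where Y: "Y \<in> ?S" "Fmap t Y = Y" by blast
  have "norm (Yit t m - Y) \<le> (1 / 2) ^ m * norm (YV - Y)" for m
  proof (induction m)
    case (Suc m)
    have "norm (Yit t (Suc m) - Y) \<le> 1 / 2 * norm (Yit t m - Y)"
      using con[OF Yit_in[OF t] Y(1), of m] Y(2) by (simp add: Yit_def)
    then show ?case using Suc by simp
  qed (simp add: Yit_def)
  moreover have "(\<lambda>m. (1 / 2 :: real) ^ m * norm (YV - Y)) \<longlonglongrightarrow> 0"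
    by (intro tendsto_mult_left_zero LIMSEQ_power_zero) simp
  ultimately have "(\<lambda>m. Yit t m - Y) \<longlonglongrightarrow> 0"
    by (intro Lim_null_comparison[of "\<lambda>m. Yit t m - Y"]) auto
  then have l: "Yit t \<longlonglongrightarrow> Y" by (rule LIM_zero_cancel)
  then have "Ysol t = Y" unfolding Ysol_def by (rule limI)
  with l Y show "Yit t \<longlonglongrightarrow> Ysol t" "Ysol t \<in> ?S" "Ysol t = Fmap t (Ysol t)" by auto
qed

lemma Ysol_ball: "t \<in> U \<Longrightarrow> Ysol t \<in> ball YV \<beta>" and Yit_ball: "t \<in> U \<Longrightarrow> Yit t m \<in> ball YV \<beta>"
  using Ysol_props(2) Yit_in half_ball by blast+

text \<open>With contraction factor 1/2 the difference of the fixed points is absorbed on the left,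
  and exactly \<kappa> remains.\<close>

lemma Ysol_lipschitz:
  assumes t: "t \<in> U" "t' \<in> U"
  shows "norm (Ysol t - Ysol t') \<le> \<kappa> * norm (t - t')"
proof -
  have "norm (Ysol t - Ysol t') \<le> 1 / 2 * (\<kappa> * norm (t - t') + norm (Ysol t - Ysol t'))"
    using Fmap_lipschitz[OF t Ysol_ball[OF t(1)] Ysol_ball[OF t(2)]] Ysol_props(3)[OF t(1)] Ysol_props(3)[OF t(2)]
    by simp
  then show ?thesis by simp
qed

lemma Ysol_differentiable:
  assumes t: "t \<in> U"
  shows "Ysol differentiable (at t)"
proof -
  have tY: "(t, Ysol t) \<in> U \<times> ball YV \<beta>" using t Ysol_ball by simp
  from C1p_differentiable[OF C1p_Fmap this] obtain F'
    where F': "((\<lambda>x. Fmap (fst x) (snd x)) has_derivative F') (at (t, Ysol t))"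
    unfolding differentiable_def by auto
  interpret F': bounded_linear F' using F' by (rule has_derivative_bounded_linear)
  have "((\<lambda>Y. Fmap t Y) has_derivative (\<lambda>g. F' (0, g))) (at (Ysol t))"
    using has_derivative_compose[OF has_derivative_Pair[OF has_derivative_const has_derivative_ident] F']
    by simp
  \<comment> \<open>The contraction estimate with \<open>t\<close> held fixed bounds the partial
    derivative in the second slot.\<close>
  from has_derivative_lipschitz_bound[OF this open_ball Ysol_ball[OF t], of "1/2"]
  have half: "norm (F' (0, g)) \<le> norm g / 2" for g
    using Fmap_lipschitz[OF t t] Ysol_ball[OF t] by auto
  show ?thesis
    by (rule fixed_point_differentiable[where F = "\<lambda>x. Fmap (fst x) (snd x)" and Y = Ysol and K = \<kappa>, OF U(1) t _ F' half])
       (use Ysol_props(3) Ysol_lipschitz t in auto)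
qed

text \<open>The chain rule supplies only the existence of the derivative; its size comes from the
  Lipschitz bounds. The constant \<kappa> occurs twice, once directly and once through the fixed
  point.\<close>

theorem Lmap_Ysol_derivative:
  assumes t: "t \<in> U"
  obtains D where "((\<lambda>t. Lmap t (Ysol t)) has_derivative D) (at t)"
    and "\<And>h. norm (D h) \<le> 2 * CL * \<kappa> * norm h"
proof -
  have tY: "(t, Ysol t) \<in> U \<times> ball YV \<beta>" using t Ysol_ball by simp
  obtain Y' where Y': "(Ysol has_derivative Y') (at t)"
    using Ysol_differentiable[OF t] unfolding differentiable_def by blast
  have "(\<lambda>t. (t, Ysol t)) differentiable (at t)"
    unfolding differentiable_def by (rule exI, rule has_derivative_Pair[OF has_derivative_ident Y'])
  then have "((\<lambda>x. Lmap (fst x) (snd x)) \<circ> (\<lambda>t. (t, Ysol t))) differentiable (at t)"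
    using C1p_differentiable[OF C1p_Lmap tY, of 0] by (intro differentiable_chain_at) auto
  then obtain D where D: "((\<lambda>t. Lmap t (Ysol t)) has_derivative D) (at t)"
    unfolding differentiable_def by (auto simp: o_def)
  moreover have "norm (D h) \<le> 2 * CL * \<kappa> * norm h" for h
  proof (rule has_derivative_lipschitz_bound[OF D U(1) t])
    fix t' assume t': "t' \<in> U"
    have "norm (Lmap t' (Ysol t') - Lmap t (Ysol t)) \<le> CL * (\<kappa> * norm (t' - t) + norm (Ysol t' - Ysol t))"
      by (intro Lmap_lipschitz t t' Ysol_ball)
    also have "\<dots> \<le> CL * (\<kappa> * norm (t' - t) + \<kappa> * norm (t' - t))"
      using CL_nonneg by (intro mult_left_mono add_left_mono Ysol_lipschitz t t')
    finally show "norm (Lmap t' (Ysol t') - Lmap t (Ysol t)) \<le> 2 * CL * \<kappa> * norm (t' - t)"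
      by (simp add: algebra_simps)
  qed
  ultimately show ?thesis by (rule that)
qed

section \<open>Expansion of the integrals into perturbation series\<close>

lemma Emap_sums:
  assumes t: "t \<in> U" and Y: "Y \<in> ball YV \<beta>"
  shows "(\<lambda>r. integral {0..1} (\<lambda>\<theta>. Z \<theta> * ((- (R t \<theta> * Y)) ^ r * R t \<theta>))) sums (- Emap t Y)"
proof -
  let ?f = "\<lambda>r \<theta>. Z \<theta> * ((- (R t \<theta> * Y)) ^ r * R t \<theta>)"
  have cRY: "continuous_on {0..1} (\<lambda>\<theta>. R t \<theta> * Y)"
    using C1p_continuous_param[OF C1p_RY(1), of "(t, Y)"] t Y by simp
  have cR: "continuous_on {0..1} (R t)" by (rule C1p_continuous_param[OF C1R(1) t])
  have "(\<lambda>r. integral {0..1} (?f r)) sums integral {0..1} (\<lambda>\<theta>. \<Sum>r. ?f r \<theta>)"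
  proof (rule integral_unit_sums)
    show "continuous_on {0..1} (?f r)" for r
      by (intro continuous_intros Z cRY cR)
    show "norm (?f r \<theta>) \<le> d * (2 * (1 + b * y) * (3 / 4) ^ r * b)" if \<theta>: "\<theta> \<in> {0..1}" for r \<theta>
    proof -
      have "norm ((- (R t \<theta> * Y)) ^ r) \<le> 2 * (1 + b * y) * (3 / 4) ^ r"
        unfolding norm_minus_power by (intro norm_power_le_of_square sqR RY_le t \<theta> Y)
      then show ?thesis
        using Z(2)[OF \<theta>] Rb(1)[OF t \<theta>] pos by (intro order_trans[OF norm_mult_ineq] mult_mono) auto
    qed
    show "summable (\<lambda>r. d * (2 * (1 + b * y) * (3 / 4) ^ r * b))"
      by (intro summable_mult summable_mult2 summable_geometric) simp
  qed
  moreover have "integral {0..1} (\<lambda>\<theta>. \<Sum>r. ?f r \<theta>) = - Emap t Y"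
    unfolding Emap_def minus_minus
  proof (rule integral_cong)
    fix \<theta> :: real assume \<theta>: "\<theta> \<in> {0..1}"
    note s = summable_powers_of_square(2)[OF sqR(1)[OF t \<theta> Y]]
    show "(\<Sum>r. ?f r \<theta>) = Z \<theta> * (neu (R t \<theta> * Y) * R t \<theta>)"
      unfolding neu_def by (simp add: suminf_mult2[OF s] suminf_mult[OF summable_mult2[OF s]])
  qed
  ultimately show ?thesis by simp
qed

text \<open>The Cauchy product of the Neumann series at \<open>s R Y\<close> and
  \<open>s RQ Y\<close> has \<open>s ^ r * h r\<close> as its term of index \<open>r\<close>;
  integration in \<open>s\<close> gives the factor \<open>1 / (r + 1)\<close>.\<close>

lemma Jmap_sums:
  assumes t: "t \<in> U" and Y: "Y \<in> ball YV \<beta>" and \<theta>: "\<theta> \<in> {0..1}"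
  defines "h \<equiv> \<lambda>r. \<Sum>i\<le>r. (- (R t \<theta> * Y)) ^ i * (- (RQ t \<theta> * Y)) ^ (r - i)"
  shows "(\<lambda>r. (1 / real (Suc r)) *\<^sub>R h r) sums Jmap t Y \<theta>"
    and "norm (h r) \<le> real (Suc r) * ((2 * (1 + b * y))\<^sup>2 * (3 / 4) ^ r)"
proof -
  let ?M = "R t \<theta> * Y" and ?Q = "RQ t \<theta> * Y" and ?k = "2 * (1 + b * y)"
  have k0: "0 \<le> ?k" using pos by simp
  show hle: "norm (h r) \<le> real (Suc r) * (?k\<^sup>2 * (3 / 4) ^ r)" for r
  proof -
    have "norm (h r) \<le> (\<Sum>i\<le>r. ?k\<^sup>2 * (3 / 4) ^ r)"
      unfolding h_def
    proof (rule sum_norm_le)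
      fix i assume "i \<in> {..r}"
      then have e: "(?k * (3 / 4) ^ i) * (?k * (3 / 4) ^ (r - i)) = ?k\<^sup>2 * (3 / 4) ^ r"
        by (simp add: power2_eq_square power_add[symmetric] mult.assoc mult.left_commute[of _ ?k])
      have "norm ((- ?M) ^ i * (- ?Q) ^ (r - i)) \<le> (?k * (3 / 4) ^ i) * (?k * (3 / 4) ^ (r - i))"
        using k0 norm_power_le_of_square[OF sqR(1)[OF t \<theta> Y] RY_le(1)[OF t \<theta> Y], of i]
          norm_power_le_of_square[OF sqR(2)[OF t \<theta> Y] RY_le(2)[OF t \<theta> Y], of "r - i"]
        by (intro order_trans[OF norm_mult_ineq] mult_mono) (simp_all add: norm_minus_power)
      with e show "norm ((- ?M) ^ i * (- ?Q) ^ (r - i)) \<le> ?k\<^sup>2 * (3 / 4) ^ r" by simp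
    qed
    then show ?thesis by simp
  qed
  have "(\<lambda>r. integral {0..1} (\<lambda>s::real. s ^ r *\<^sub>R h r)) sums integral {0..1} (\<lambda>s. \<Sum>r. s ^ r *\<^sub>R h r)"
  proof (rule integral_unit_sums)
    show "continuous_on {0..1} (\<lambda>s::real. s ^ r *\<^sub>R h r)" for r by (intro continuous_intros)
    show "norm (s ^ r *\<^sub>R h r) \<le> real (Suc r) * (?k\<^sup>2 * (3 / 4) ^ r)" if "s \<in> {0..1}" for r s
    proof -
      have "norm (s ^ r *\<^sub>R h r) \<le> norm (h r)"
        using that by (auto intro!: mult_left_le_one_le power_le_one)
      with hle[of r] show ?thesis by simp
    qed
    have "summable (\<lambda>r. real (Suc r) * (3 / 4) ^ r)"
      using geometric_deriv_sums[of "3/4 :: real"] by (auto simp: sums_iff)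
    from summable_mult[OF this, of "?k\<^sup>2"] show "summable (\<lambda>r. real (Suc r) * (?k\<^sup>2 * (3 / 4) ^ r))"
      by (simp add: algebra_simps)
  qed
  moreover have "integral {0..1} (\<lambda>s::real. s ^ r *\<^sub>R h r) = (1 / real (Suc r)) *\<^sub>R h r" for r
  proof -
    have "((\<lambda>s::real. s ^ r *\<^sub>R h r) has_integral
        ((1 ^ Suc r / real (Suc r)) *\<^sub>R h r - (0 ^ Suc r / real (Suc r)) *\<^sub>R h r)) {0..1}"
    proof (rule fundamental_theorem_of_calculus)
      fix s :: real
      have "((\<lambda>s. s ^ Suc r / real (Suc r)) has_real_derivative s ^ r) (at s within {0..1})"
        by (auto intro!: derivative_eq_intros simp del: power_Suc of_nat_Suc)
      then show "((\<lambda>s. (s ^ Suc r / real (Suc r)) *\<^sub>R h r) has_vector_derivative s ^ r *\<^sub>R h r) (at s within {0..1})"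
        by (auto intro!: derivative_eq_intros simp del: power_Suc of_nat_Suc
            simp: has_real_derivative_iff_has_vector_derivative[symmetric])
    qed simp
    then show ?thesis by (auto dest: integral_unique)
  qed
  moreover have "integral {0..1} (\<lambda>s. \<Sum>r. s ^ r *\<^sub>R h r) = Jmap t Y \<theta>"
    unfolding Jmap_def
  proof (rule integral_cong)
    fix s :: real assume s: "s \<in> {0..1}"
    have "(\<lambda>r. \<Sum>i\<le>r. (- (s *\<^sub>R ?M)) ^ i * (- (s *\<^sub>R ?Q)) ^ (r - i)) sums (neu (s *\<^sub>R ?M) * neu (s *\<^sub>R ?Q))"
      unfolding neu_def
      by (intro Cauchy_product_sums summable_powers_of_square(1) sRY_sq t \<theta> Y s)
    moreover have "(\<Sum>i\<le>r. (- (s *\<^sub>R ?M)) ^ i * (- (s *\<^sub>R ?Q)) ^ (r - i)) = s ^ r *\<^sub>R h r" for r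
    proof -
      have "(- (s *\<^sub>R ?M)) ^ i * (- (s *\<^sub>R ?Q)) ^ (r - i) = s ^ r *\<^sub>R ((- ?M) ^ i * (- ?Q) ^ (r - i))"
        if "i \<le> r" for i
        using that by (simp add: scaleR_minus_right[symmetric] scaleR_power power_add[symmetric] del: scaleR_minus_right)
      then show ?thesis unfolding h_def scaleR_sum_right by (intro sum.cong) auto
    qed
    ultimately show "(\<Sum>r. s ^ r *\<^sub>R h r) = neu (s *\<^sub>R ?M) * neu (s *\<^sub>R ?Q)" by (simp add: sums_iff)
  qed
  ultimately show "(\<lambda>r. (1 / real (Suc r)) *\<^sub>R h r) sums Jmap t Y \<theta>" by simp
qed

text \<open>Indices are shifted by one: in the application term \<open>r\<close> is the eigenvalue
  correction of order \<open>r + 1\<close>, whence the divisor \<open>Suc r\<close>.\<close>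

lemma Lmap_sums:
  assumes t: "t \<in> U" and Y: "Y \<in> ball YV \<beta>"
  defines "h \<equiv> \<lambda>r \<theta>. \<Sum>i\<le>r. (- (R t \<theta> * Y)) ^ i * (- (RQ t \<theta> * Y)) ^ (r - i)"
  shows "(\<lambda>r. - integral {0..1} (\<lambda>\<theta>. tr (Z \<theta> * ((R t \<theta> - RQ t \<theta>) * Y * h r \<theta>)) / of_nat (Suc r)))
    sums Lmap t Y"
proof -
  let ?g = "\<lambda>\<theta> x. tr (Z \<theta> * ((R t \<theta> - RQ t \<theta>) * Y * x))"
  have g: "bounded_linear (?g \<theta>)" for \<theta>
    by (intro bounded_linear_compose[OF tr(1)] bounded_linear_const_mult bounded_linear_ident)
  have gle: "norm (?g \<theta> x) \<le> 2 * (d * (2 * b * y * norm x))" if \<theta>: "\<theta> \<in> {0..1}" for \<theta> x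
  proof -
    have "norm (R t \<theta> - RQ t \<theta>) \<le> 2 * b"
      using norm_triangle_ineq4[of "R t \<theta>" "RQ t \<theta>"] Rb[OF t \<theta>] by linarith
    then have "norm (Z \<theta> * ((R t \<theta> - RQ t \<theta>) * Y * x)) \<le> d * (2 * b * y * norm x)"
      using Z(2)[OF \<theta>] Yb[OF Y] pos
      by (intro order_trans[OF norm_mult_ineq] mult_mono order_trans[OF norm_mult3_le]) auto
    with tr(2) show ?thesis by (rule order_trans[OF _ mult_left_mono]) simp
  qed
  have cRY: "continuous_on {0..1} (\<lambda>\<theta>. R t \<theta> * Y)" "continuous_on {0..1} (\<lambda>\<theta>. RQ t \<theta> * Y)"
    using C1p_continuous_param[OF C1p_RY(1), of "(t, Y)"] C1p_continuous_param[OF C1p_RY(2), of "(t, Y)"] t Y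
    by simp_all
  have cR: "continuous_on {0..1} (R t)" "continuous_on {0..1} (RQ t)"
    by (rule C1p_continuous_param[OF C1R(1) t] C1p_continuous_param[OF C1R(2) t])+
  let ?f = "\<lambda>r \<theta>. ?g \<theta> ((1 / real (Suc r)) *\<^sub>R h r \<theta>)"
  have "(\<lambda>r. integral {0..1} (?f r)) sums integral {0..1} (\<lambda>\<theta>. \<Sum>r. ?f r \<theta>)"
  proof (rule integral_unit_sums)
    show "continuous_on {0..1} (?f r)" for r
      unfolding h_def by (intro bounded_linear.continuous_on[OF tr(1)] continuous_intros Z cRY cR)
    show "norm (?f r \<theta>) \<le> 2 * (d * (2 * b * y * ((2 * (1 + b * y))\<^sup>2 * (3 / 4) ^ r)))"
      if \<theta>: "\<theta> \<in> {0..1}" for r \<theta>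
    proof -
      have "norm ((1 / real (Suc r)) *\<^sub>R h r \<theta>) \<le> (2 * (1 + b * y))\<^sup>2 * (3 / 4) ^ r"
        using Jmap_sums(2)[OF t Y \<theta>, of r] unfolding h_def
        by (simp add: divide_le_eq mult.commute[of _ "1 + real r"])
      then show ?thesis
        using pos by (intro order_trans[OF gle[OF \<theta>]] mult_left_mono) auto
    qed
    show "summable (\<lambda>r. 2 * (d * (2 * b * y * ((2 * (1 + b * y))\<^sup>2 * (3 / 4) ^ r))))"
      by (intro summable_mult summable_geometric) simp
  qed
  moreover have "integral {0..1} (\<lambda>\<theta>. \<Sum>r. ?f r \<theta>) = - Lmap t Y"
    unfolding Lmap_def minus_minus
  proof (rule integral_cong)
    fix \<theta> :: real assume \<theta>: "\<theta> \<in> {0..1}"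
    show "(\<Sum>r. ?f r \<theta>) = ?g \<theta> (Jmap t Y \<theta>)"
      using bounded_linear.sums[OF g Jmap_sums(1)[OF t Y \<theta>]] unfolding h_def by (simp add: sums_iff)
  qed
  ultimately have "(\<lambda>r. integral {0..1} (?f r)) sums (- Lmap t Y)" by simp
  from sums_minus[OF this] have "(\<lambda>r. - integral {0..1} (?f r)) sums Lmap t Y" by simp
  moreover have "?f r \<theta> = ?g \<theta> (h r \<theta>) / of_nat (Suc r)" for r \<theta>
    unfolding linear_scale[OF bounded_linear.linear[OF g]] by (simp add: scaleR_conv_of_real del: of_nat_Suc)
  ultimately show ?thesis by simp
qed

end

section \<open>Scalars, adjoints, blocks and traces\<close>

lemma ent_mult: "ent (M * N) = (\<lambda>s r. \<Sum>\<^sub>\<infinity>m. ent M s m * ent N m r)"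
  by (rule times_bmat.rep_eq)

lemma infsum_finite_support:
  fixes f :: "'a \<Rightarrow> 'b::{topological_comm_monoid_add, t2_space}"
  assumes "finite P" "\<And>x. x \<notin> P \<Longrightarrow> f x = 0"
  shows "infsum f UNIV = sum f P"
  using assms by (subst infsum_cong_neutral[where T = P and g = f]) auto

section \<open>Complex scalars and adjoints\<close>

text \<open>The type classes make the algebra an algebra over the reals; complex scalars act through
  these central elements.\<close>

lift_definition sc :: "complex \<Rightarrow> 'i bmat" is "\<lambda>c s r. if s = r then c else 0"
proof -
  fix c :: complex
  have "(\<lambda>s r. c * (if s = r then 1 else 0)) = (\<lambda>s r :: 'i. if s = r then c else 0)"
    by (auto intro!: ext)
  then show "\<exists>b. mat_bound (\<lambda>s r :: 'i. if s = r then c else 0) b"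
    using mat_bound_cmult[OF mat_bound_one, of c] by (metis (no_types))
qed

lemma ent_sc_mult: "ent (sc c * M) s r = c * ent M s r" "ent (M * sc c) s r = c * ent M s r"
  unfolding ent_mult sc.rep_eq
  by (subst infsum_finite_support[of "{s}"]; simp) (subst infsum_finite_support[of "{r}"]; simp)

lemma sc_commute: "sc c * M = M * sc c"
  by (rule bmat_eqI) (simp add: ent_sc_mult)

lemma norm_sc_le: "norm (sc c :: 'i bmat) \<le> norm c"
proof (rule norm_bmat_le)
  have "(\<lambda>s r. c * (if s = r then 1 else 0)) = ent (sc c :: 'i bmat)"
    by (auto intro!: ext simp: sc.rep_eq)
  with mat_bound_cmult[OF mat_bound_one[where 'a = 'i], of c] show "mat_bound (ent (sc c :: 'i bmat)) (norm c)"
    by simp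
qed

lemma bounded_linear_sc: "bounded_linear sc"
  by (rule bounded_linear_intro[where K = 1])
     (auto intro!: bmat_eqI simp: ent_simps sc.rep_eq norm_sc_le scaleR_conv_of_real[where 'a = complex])

lift_definition star :: "'i bmat \<Rightarrow> 'i bmat" is "\<lambda>M s r. cnj (M r s)"
proof -
  fix M :: "'i \<Rightarrow> 'i \<Rightarrow> complex"
  assume "\<exists>c. mat_bound M c"
  then obtain c where "mat_bound M c" ..
  then have "mat_bound (\<lambda>s r. cnj (M r s)) c" by (simp add: mat_bound_def)
  then show "\<exists>c. mat_bound (\<lambda>s r. cnj (M r s)) c" ..
qed

lemma norm_star: "norm (star M) = norm M"
proof -
  have le: "norm (star M) \<le> norm M" for M :: "'i bmat"
    using mat_bound_norm[of M] by (intro norm_bmat_le) (simp add: star.rep_eq mat_bound_def)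
  have "star (star M) = M" by (rule bmat_eqI) (simp add: star.rep_eq)
  with le[of "star M"] le[of M] show ?thesis by simp
qed

lemma star_star [simp]: "star (star M) = M"
  by (rule bmat_eqI) (simp add: star.rep_eq)

lemma bounded_linear_star: "bounded_linear star"
  by (rule bounded_linear_intro[where K = 1])
     (auto intro!: bmat_eqI simp: ent_simps star.rep_eq norm_star)

lemma star_mult: "star (M * N) = star N * star M"
  by (rule bmat_eqI) (simp add: ent_mult star.rep_eq mult.commute flip: infsum_cnj)

lemma star_one: "star 1 = 1"
  by (rule bmat_eqI) (simp add: star.rep_eq ent_simps)

lemma star_power: "star (M ^ n) = star M ^ n"
  by (induction n) (simp_all add: star_one star_mult power_commutes)

lemma star_neu:
  assumes "norm (M * M) \<le> 1 / 2"
  shows "star (neu M) = neu (star M)"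
proof -
  have "star (neu M) = (\<Sum>n. star ((- M) ^ n))"
    unfolding neu_def
    by (rule bounded_linear.suminf[OF bounded_linear_star summable_powers_of_square(2)[OF assms]])
  then show ?thesis
    by (simp add: neu_def star_power linear_neg[OF bounded_linear.linear[OF bounded_linear_star]])
qed

section \<open>Block matrices and traces\<close>

text \<open>Every row or column meets either the finite block or a single diagonal entry. The model
  resolvents and their differences all have this shape.\<close>

lemma mat_bound_block:
  fixes M :: "'i \<Rightarrow> 'i \<Rightarrow> complex"
  assumes P: "finite P" and off: "\<And>s r. s \<noteq> r \<Longrightarrow> \<not> (s \<in> P \<and> r \<in> P) \<Longrightarrow> M s r = 0"
    and diag: "\<And>s. s \<notin> P \<Longrightarrow> norm (M s s) \<le> \<epsilon>"
    and blk: "\<And>s r. s \<in> P \<Longrightarrow> r \<in> P \<Longrightarrow> norm (M s r) \<le> B"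
    and nn: "0 \<le> \<epsilon>" "0 \<le> B"
  shows "mat_bound M (real (card P) * B + \<epsilon>)"
proof -
  have *: "(\<Sum>s\<in>F. norm (f s)) \<le> real (card P) * B + \<epsilon>"
    if F: "finite F" and a: "\<And>s. s \<noteq> r \<Longrightarrow> \<not> (s \<in> P \<and> r \<in> P) \<Longrightarrow> f s = 0"
      and b: "r \<notin> P \<Longrightarrow> norm (f r) \<le> \<epsilon>" and c: "\<And>s. s \<in> P \<Longrightarrow> r \<in> P \<Longrightarrow> norm (f s) \<le> B"
    for F r and f :: "'i \<Rightarrow> complex"
  proof (cases "r \<in> P")
    case True
    have "(\<Sum>s\<in>F. norm (f s)) = (\<Sum>s\<in>F \<inter> P. norm (f s))"
      using F a True by (intro sum.mono_neutral_right) (auto, metis)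
    also have "\<dots> \<le> (\<Sum>s\<in>F \<inter> P. B)"
      using c True by (intro sum_mono) auto
    also have "\<dots> \<le> real (card P) * B"
      using nn P by (simp add: mult_right_mono card_mono)
    finally show ?thesis using nn by simp
  next
    case False
    have "(\<Sum>s\<in>F. norm (f s)) = (\<Sum>s\<in>F \<inter> {r}. norm (f s))"
      using F a False by (intro sum.mono_neutral_right) auto
    also have "\<dots> \<le> \<epsilon>"
      using b False nn by (cases "r \<in> F") auto
    finally show ?thesis using nn by (simp add: add_increasing)
  qed
  show ?thesis
    unfolding mat_bound_def
  proof (intro allI impI conjI)
    fix F :: "'i set" and r assume F: "finite F"
    show "(\<Sum>s\<in>F. norm (M s r)) \<le> real (card P) * B + \<epsilon>"
      by (rule *[OF F, of r]) (simp_all add: off diag blk)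
    show "(\<Sum>s\<in>F. norm (M r s)) \<le> real (card P) * B + \<epsilon>"
    proof (rule *[OF F, of r])
      fix s assume "s \<noteq> r" "\<not> (s \<in> P \<and> r \<in> P)"
      then show "M r s = 0" by (intro off) auto
    qed (simp_all add: diag blk)
  qed
qed

lemma infsum_block_row:
  assumes "finite P" and off: "\<And>m. s \<noteq> m \<Longrightarrow> \<not> (s \<in> P \<and> m \<in> P) \<Longrightarrow> M s m = (0 :: complex)"
  shows "(\<Sum>\<^sub>\<infinity>m. M s m * N m) = (if s \<in> P then \<Sum>p\<in>P. M s p * N p else M s s * N s)"
proof (cases "s \<in> P")
  case True
  then have "M s m = 0" if "m \<notin> P" for m using off[of m] that by auto
  with True show ?thesis using assms(1) by (subst infsum_finite_support[of P]) auto
next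
  case False
  then show ?thesis using off by (subst infsum_finite_support[of "{s}"]) auto
qed

definition Pr :: "'i set \<Rightarrow> 'i bmat" where
  "Pr P = Bmat (\<lambda>s r. if s = r \<and> s \<in> P then 1 else 0)"

lemma mat_bound_Pr: "mat_bound (\<lambda>s r. if s = r \<and> s \<in> P then 1 else 0) 1"
  unfolding mat_bound_def
proof (intro allI impI conjI)
  fix F :: "'a set" and r assume F: "finite F"
  have "(\<Sum>s\<in>F. norm (if s = r \<and> s \<in> P then 1 else 0 :: complex)) \<le> (\<Sum>s\<in>F. norm (if s = r then 1 else 0 :: complex))"
    by (intro sum_mono) simp
  also have "\<dots> \<le> 1" by (rule conjunct1[OF mat_bound_one[unfolded mat_bound_def, rule_format, OF F]])
  finally show "(\<Sum>s\<in>F. norm (if s = r \<and> s \<in> P then 1 else 0 :: complex)) \<le> 1" .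
  have "(\<Sum>s\<in>F. norm (if r = s \<and> r \<in> P then 1 else 0 :: complex)) \<le> (\<Sum>s\<in>F. norm (if r = s then 1 else 0 :: complex))"
    by (intro sum_mono) simp
  also have "\<dots> \<le> 1" by (rule conjunct2[OF mat_bound_one[unfolded mat_bound_def, rule_format, OF F]])
  finally show "(\<Sum>s\<in>F. norm (if r = s \<and> r \<in> P then 1 else 0 :: complex)) \<le> 1" .
qed

lemma ent_Pr: "ent (Pr P) s r = (if s = r \<and> s \<in> P then 1 else 0)"
  unfolding Pr_def ent_Bmat[OF mat_bound_Pr] ..

lemma norm_Pr_le: "norm (Pr P) \<le> 1"
  using mat_bound_Pr[of P] by (intro norm_bmat_le) (simp add: Pr_def ent_Bmat[OF mat_bound_Pr])

lemma ent_Pr_mult: "ent (Pr P * M) s r = (if s \<in> P then ent M s r else 0)"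
  "ent (M * Pr P) s r = (if r \<in> P then ent M s r else 0)"
  unfolding ent_mult ent_Pr
  by (subst infsum_finite_support[of "{s}"]; simp) (subst infsum_finite_support[of "{r}"]; simp)

text \<open>Bounded matrices have no trace in general, but the trace over a finite block is a
  continuous functional, and it is all that remains once a product contains the factor
  \<open>Pr P\<close>.\<close>

definition trP :: "'i set \<Rightarrow> 'i bmat \<Rightarrow> complex" where
  "trP P M = (\<Sum>p\<in>P. ent M p p)"

lemma norm_trP_le: "norm (trP P M) \<le> real (card P) * norm M"
  unfolding trP_def by (intro sum_norm_bound norm_ent_le)

lemma bounded_linear_trP: "bounded_linear (trP P)"
  unfolding trP_def by (intro bounded_linear_sum bounded_linear_ent)

lemma trP_star: "trP P (star M) = cnj (trP P M)"
  by (simp add: trP_def star.rep_eq)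

lemma has_sum_ent_mult: "((\<lambda>m. ent M s m * ent N m r) has_sum ent (M * N) s r) UNIV"
  unfolding ent_mult by (rule has_sum_infsum[OF ent_prod_summable])

lemma has_sum_finite_sum:
  fixes f :: "'a \<Rightarrow> 'b \<Rightarrow> 'c::{topological_comm_monoid_add, t2_space}"
  assumes "finite F" and "\<And>s. s \<in> F \<Longrightarrow> (f s has_sum g s) A"
  shows "((\<lambda>m. \<Sum>s\<in>F. f s m) has_sum (\<Sum>s\<in>F. g s)) A"
  using assms by (induction F rule: finite_induct) (auto intro: has_sum_add)

lemma ent_mult_Pr_mult:
  assumes "finite P"
  shows "ent (M * Pr P * N) s r = (\<Sum>p\<in>P. ent M s p * ent N p r)"
  unfolding ent_mult[of "M * Pr P"] ent_Pr_mult
  using assms by (subst infsum_finite_support[of P]) auto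

text \<open>Cyclicity of the trace, available because \<open>Pr P\<close> has finite rank.
  Convergence of the sum over the whole diagonal is part of the conclusion.\<close>

lemma has_sum_trace:
  assumes "finite P"
  shows "((\<lambda>s. ent (M * Pr P * N) s s) has_sum trP P (N * M)) UNIV"
  unfolding ent_mult_Pr_mult[OF assms] trP_def
  using has_sum_ent_mult[of N _ M] by (intro has_sum_finite_sum[OF assms]) (simp add: mult.commute)

lift_definition diagcol :: "'i \<Rightarrow> 'i bmat \<Rightarrow> 'i bmat \<Rightarrow> 'i bmat"
  is "\<lambda>p A B s r. if r = p then A s p * B p s else 0"
proof -
  fix p and A B :: "'i \<Rightarrow> 'i \<Rightarrow> complex"
  assume "\<exists>c. mat_bound A c" "\<exists>c. mat_bound B c"
  then obtain a b where A: "mat_bound A a" and B: "mat_bound B b" by blast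
  note nn = mat_bound_nonneg[OF A] mat_bound_nonneg[OF B]
  have "mat_bound (\<lambda>s r. if r = p then A s p * B p s else 0) (a * b)"
    unfolding mat_bound_def
  proof (intro allI impI conjI)
    fix F :: "'i set" and r assume F: "finite F"
    have "(\<Sum>s\<in>F. norm (A s p * B p s)) \<le> (\<Sum>s\<in>F. norm (A s p) * b)"
      by (intro sum_mono) (simp add: norm_mult mult_left_mono mat_bound_entry[OF B])
    also have "\<dots> \<le> a * b"
      using A F nn unfolding mat_bound_def sum_distrib_right[symmetric] by (intro mult_right_mono) auto
    finally show "(\<Sum>s\<in>F. norm (if r = p then A s p * B p s else 0)) \<le> a * b"
      using nn by (cases "r = p") simp_all
    have "norm (A r p * B p r) \<le> a * b"
      using mat_bound_entry[OF A] mat_bound_entry[OF B] nn by (simp add: norm_mult mult_mono)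
    then show "(\<Sum>s\<in>F. norm (if s = p then A r p * B p r else 0)) \<le> a * b"
      using F nn by (simp add: if_distrib[of norm] cong: if_cong)
  qed
  then show "\<exists>c. mat_bound (\<lambda>s r. if r = p then A s p * B p s else 0) c" by blast
qed

lemma norm_diagcol_le: "norm (diagcol p A B) \<le> norm A * norm B"
proof (rule norm_bmat_le)
  have A: "mat_bound (ent A) (norm A)" and B: "mat_bound (ent B) (norm B)" by (rule mat_bound_norm)+
  show "mat_bound (ent (diagcol p A B)) (norm A * norm B)"
    unfolding mat_bound_def diagcol.rep_eq
  proof (intro allI impI conjI)
    fix F :: "'a set" and r assume F: "finite F"
    have "(\<Sum>s\<in>F. norm (ent A s p * ent B p s)) \<le> (\<Sum>s\<in>F. norm (ent A s p) * norm B)"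
      by (intro sum_mono) (simp add: norm_mult mult_left_mono norm_ent_le)
    also have "\<dots> \<le> norm A * norm B"
      using A F unfolding mat_bound_def sum_distrib_right[symmetric] by (intro mult_right_mono) auto
    finally show "(\<Sum>s\<in>F. norm (if r = p then ent A s p * ent B p s else 0)) \<le> norm A * norm B"
      by (cases "r = p") simp_all
    have "norm (ent A r p * ent B p r) \<le> norm A * norm B"
      by (simp add: norm_mult mult_mono norm_ent_le)
    then show "(\<Sum>s\<in>F. norm (if s = p then ent A r p * ent B p r else 0)) \<le> norm A * norm B"
      using F by (simp add: if_distrib[of norm] cong: if_cong)
  qed
qed

lemma bounded_bilinear_diagcol: "bounded_bilinear (diagcol p)"
proof
  show "\<exists>K. \<forall>a b. norm (diagcol p a b) \<le> norm a * norm b * K"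
    by (rule exI[of _ 1]) (simp add: norm_diagcol_le)
qed (auto intro!: bmat_eqI simp: diagcol.rep_eq ent_simps algebra_simps scaleR_conv_of_real[where 'a = complex])

definition colsum :: "'i \<Rightarrow> 'i bmat \<Rightarrow> complex" where
  "colsum p M = (\<Sum>\<^sub>\<infinity>s. ent M s p)"

lemma has_sum_colsum: "((\<lambda>s. ent M s p) has_sum colsum p M) UNIV"
  unfolding colsum_def by (intro has_sum_infsum abs_summable_summable[OF ent_summable(1)])

lemma bounded_linear_colsum: "bounded_linear (colsum p)"
proof (rule bounded_linear_intro[where K = 1])
  show "colsum p (x + y) = colsum p x + colsum p y" for x y
    using has_sum_add[OF has_sum_colsum[of x p] has_sum_colsum[of y p]]
    by (simp add: colsum_def[of _ "x + y"] ent_simps infsumI)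
  show "colsum p (r *\<^sub>R x) = r *\<^sub>R colsum p x" for r x
    using has_sum_cmult_right[OF has_sum_colsum[of x p], of "of_real r"]
    by (simp add: colsum_def[of _ "r *\<^sub>R x"] ent_simps infsumI scaleR_conv_of_real[where 'a = complex])
  show "norm (colsum p x) \<le> norm x * 1" for x
    unfolding colsum_def using norm_infsum_bound[OF ent_summable(1)[of x p]] ent_summable(3)[of x p] by simp
qed

text \<open>Trace sums and contour integrals may be interchanged because a whole diagonal, as a column of
  \<open>diagcol\<close>, is integrated at once in the Banach space of matrices.\<close>

lemma has_sum_integral_diag:
  fixes A B :: "real \<Rightarrow> 'i bmat"
  assumes A: "continuous_on {0..1} A" and B: "continuous_on {0..1} B"
  shows "((\<lambda>s. integral {0..1} (\<lambda>\<theta>. ent (A \<theta>) s p * ent (B \<theta>) p s)) has_sum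
      integral {0..1} (\<lambda>\<theta>. ent (B \<theta> * A \<theta>) p p)) UNIV"
proof -
  have c: "continuous_on {0..1} (\<lambda>\<theta>. diagcol p (A \<theta>) (B \<theta>))"
    by (rule bounded_bilinear.continuous_on[OF bounded_bilinear_diagcol A B])
  note i = integrable_continuous_real[OF c]
  let ?D = "integral {0..1} (\<lambda>\<theta>. diagcol p (A \<theta>) (B \<theta>))"
  have "ent ?D s p = integral {0..1} (\<lambda>\<theta>. ent (A \<theta>) s p * ent (B \<theta>) p s)" for s
    using integral_linear[OF i bounded_linear_ent[of s p]] by (simp add: o_def diagcol.rep_eq)
  moreover have "colsum p ?D = integral {0..1} (\<lambda>\<theta>. ent (B \<theta> * A \<theta>) p p)"
  proof -
    have "colsum p (diagcol p (A \<theta>) (B \<theta>)) = ent (B \<theta> * A \<theta>) p p" for \<theta>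
      unfolding colsum_def ent_mult diagcol.rep_eq by (simp add: mult.commute)
    then show ?thesis
      using integral_linear[OF i bounded_linear_colsum[of p]] by (simp add: o_def)
  qed
  ultimately show ?thesis using has_sum_colsum[of ?D p] by simp
qed

lemma has_sum_integral_trace:
  fixes A B :: "real \<Rightarrow> 'i bmat"
  assumes P: "finite P" and A: "continuous_on {0..1} A" and B: "continuous_on {0..1} B"
  shows "((\<lambda>s. integral {0..1} (\<lambda>\<theta>. ent (A \<theta> * Pr P * B \<theta>) s s)) has_sum
      integral {0..1} (\<lambda>\<theta>. trP P (B \<theta> * A \<theta>))) UNIV"
proof -
  have e: "continuous_on {0..1} (\<lambda>\<theta>. ent (M \<theta>) s r)" if "continuous_on {0..1} M" for M :: "real \<Rightarrow> 'i bmat" and s r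
    by (rule bounded_linear.continuous_on[OF bounded_linear_ent that])
  have "integral {0..1} (\<lambda>\<theta>. ent (A \<theta> * Pr P * B \<theta>) s s)
      = (\<Sum>p\<in>P. integral {0..1} (\<lambda>\<theta>. ent (A \<theta>) s p * ent (B \<theta>) p s))" for s
    unfolding ent_mult_Pr_mult[OF P]
    by (intro integral_sum P integrable_continuous_real continuous_intros e A B)
  moreover have "integral {0..1} (\<lambda>\<theta>. trP P (B \<theta> * A \<theta>)) = (\<Sum>p\<in>P. integral {0..1} (\<lambda>\<theta>. ent (B \<theta> * A \<theta>) p p))"
    unfolding trP_def by (intro integral_sum P integrable_continuous_real continuous_intros e A B)
  ultimately show ?thesis
    using has_sum_finite_sum[OF P has_sum_integral_diag[OF A B]] by simp
qed

section \<open>Toeplitz matrices and autocorrelation\<close>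

lemma mat_bound_toeplitz:
  fixes c :: "'i::ab_group_add \<Rightarrow> complex"
  assumes "\<And>F. finite F \<Longrightarrow> (\<Sum>s\<in>F. norm (c s)) \<le> b"
  shows "mat_bound (\<lambda>s r. c (s - r)) b"
  unfolding mat_bound_def
proof (intro allI impI conjI)
  fix F :: "'i set" and r assume F: "finite F"
  have "(\<Sum>s\<in>F. norm (c (s - r))) = (\<Sum>s\<in>(\<lambda>s. s - r) ` F. norm (c s))"
    by (subst sum.reindex) (auto simp: inj_on_def)
  then show "(\<Sum>s\<in>F. norm (c (s - r))) \<le> b" using assms F by simp
  have "(\<Sum>s\<in>F. norm (c (r - s))) = (\<Sum>s\<in>(\<lambda>s. r - s) ` F. norm (c s))"
    by (subst sum.reindex) (auto simp: inj_on_def)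
  then show "(\<Sum>s\<in>F. norm (c (r - s))) \<le> b" using assms F by simp
qed

text \<open>Column \<open>p\<close> is read as a family of Fourier coefficients and turned into the
  matrix of multiplication by that function. Autocorrelation then is a matrix product and inherits
  its norm estimate.\<close>

lift_definition tcol :: "'i::ab_group_add \<Rightarrow> 'i bmat \<Rightarrow> 'i bmat" is "\<lambda>p M s r. M (s - r) p"
proof -
  fix p and M :: "'i \<Rightarrow> 'i \<Rightarrow> complex"
  assume "\<exists>c. mat_bound M c"
  then obtain c where "mat_bound M c" ..
  then have "mat_bound (\<lambda>s r. M (s - r) p) c"
    by (intro mat_bound_toeplitz[of "\<lambda>s. M s p"]) (simp add: mat_bound_def)
  then show "\<exists>c. mat_bound (\<lambda>s r. M (s - r) p) c" ..
qed

lemma norm_tcol_le: "norm (tcol p M) \<le> norm M"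
proof (rule norm_bmat_le)
  show "mat_bound (ent (tcol p M)) (norm M)"
    unfolding tcol.rep_eq using mat_bound_norm[of M]
    by (intro mat_bound_toeplitz[of "\<lambda>s. ent M s p"]) (simp add: mat_bound_def)
qed

lemma bounded_linear_tcol: "bounded_linear (tcol p)"
  by (rule bounded_linear_intro[where K = 1])
     (auto intro!: bmat_eqI simp: ent_simps tcol.rep_eq norm_tcol_le)

text \<open>The matrix of multiplication by \<open>u * cnj v\<close>, where \<open>u\<close> and
  \<open>v\<close> have the columns \<open>p\<close> of \<open>M\<close> and \<open>N\<close> as
  coefficients.\<close>

definition autocor :: "'i::ab_group_add \<Rightarrow> 'i bmat \<Rightarrow> 'i bmat \<Rightarrow> 'i bmat" where
  "autocor p M N = tcol p M * star (tcol p N)"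

lemma norm_autocor_le: "norm (autocor p M N) \<le> norm M * norm N"
  unfolding autocor_def
  by (rule order_trans[OF norm_mult_ineq]) (intro mult_mono; simp add: norm_star norm_tcol_le)

lemma bounded_bilinear_autocor: "bounded_bilinear (autocor p)"
proof -
  have "bounded_bilinear (\<lambda>M N. tcol p M * star (tcol p N))"
    by (rule bounded_bilinear.comp[OF bounded_bilinear_mult bounded_linear_tcol
          bounded_linear_compose[OF bounded_linear_star bounded_linear_tcol]])
  then show ?thesis by (simp add: autocor_def[abs_def])
qed

lemma ent_autocor: "ent (autocor p M N) a b = (\<Sum>\<^sub>\<infinity>m. ent M (a - m) p * cnj (ent N (b - m) p))"
  by (simp add: autocor_def ent_mult tcol.rep_eq star.rep_eq)

lemma star_autocor: "star (autocor p M M) = autocor p M M"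
  by (simp add: autocor_def star_mult)

section \<open>Plain matrices versus bounded ones, and diagonal matrices\<close>

lemma mmul_ent: "mmul (ent M) (ent N) = ent (M * N)"
  by (intro ext) (simp add: mmul_def ent_mult)

lemma ent_one: "ent 1 = mone"
  by (intro ext) (simp add: mone_def ent_simps)

lemma mpow_ent: "mpow (ent M) r = ent (M ^ r)"
  by (induction r) (simp_all add: ent_one mmul_ent)

lemma C1p_real_fun:
  fixes f :: "'a::real_normed_vector \<Rightarrow> 'p::topological_space \<Rightarrow> real"
  assumes f: "C1p U T f" and \<phi>: "\<And>x \<tau>. x \<in> U \<Longrightarrow> \<tau> \<in> T \<Longrightarrow> f x \<tau> \<in> I"
    and der: "\<And>y. y \<in> I \<Longrightarrow> (\<phi> has_real_derivative \<phi>' y) (at y)" and cont: "continuous_on I \<phi>'"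
  shows "C1p U T (\<lambda>x \<tau>. \<phi> (f x \<tau>))"
proof -
  obtain f' where f': "continuous_on (U \<times> T) (\<lambda>x. f (fst x) (snd x))"
    "\<And>x \<tau>. x \<in> U \<Longrightarrow> \<tau> \<in> T \<Longrightarrow> ((\<lambda>x. f x \<tau>) has_derivative blinfun_apply (f' x \<tau>)) (at x)"
    "continuous_on (U \<times> T) (\<lambda>x. f' (fst x) (snd x))" by (rule C1pE[OF f]) (rule that)
  have sub: "(\<lambda>x. f (fst x) (snd x)) ` (U \<times> T) \<subseteq> I" using \<phi> by auto
  have "continuous_on I \<phi>"
    using der by (intro DERIV_continuous_on) (blast intro: has_field_derivative_at_within)
  then have c: "continuous_on (U \<times> T) (\<lambda>x. \<phi> (f (fst x) (snd x)))"
    by (rule continuous_on_compose2[OF _ f'(1) sub])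
  have c': "continuous_on (U \<times> T) (\<lambda>x. \<phi>' (f (fst x) (snd x)))"
    by (rule continuous_on_compose2[OF cont f'(1) sub])
  have "((\<lambda>x. \<phi> (f x \<tau>)) has_derivative blinfun_apply (\<phi>' (f x \<tau>) *\<^sub>R f' x \<tau>)) (at x)"
    if "x \<in> U" "\<tau> \<in> T" for x \<tau>
  proof -
    have "(\<phi> has_derivative (*) (\<phi>' (f x \<tau>))) (at (f x \<tau>))"
      using der[OF \<phi>[OF that]] by (simp add: has_field_derivative_def)
    from has_derivative_compose[OF f'(2)[OF that] this] show ?thesis
      by (simp add: scaleR_blinfun.rep_eq)
  qed
  then show ?thesis
    unfolding C1p_def using c
    by (intro conjI exI[of _ "\<lambda>x \<tau>. \<phi>' (f x \<tau>) *\<^sub>R f' x \<tau>"]) (auto intro!: continuous_intros c' f'(3))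
qed

text \<open>For an unbounded \<open>f\<close> the value is unspecified, so every use comes with a
  bound.\<close>

definition dg :: "('i \<Rightarrow> complex) \<Rightarrow> 'i bmat" where
  "dg f = Bmat (\<lambda>s r. if s = r then f s else 0)"

lemma mat_bound_dg:
  assumes "\<And>s. norm (f s) \<le> c"
  shows "mat_bound (\<lambda>s r. if s = r then f s else 0) c"
proof -
  have "0 \<le> c" using assms norm_ge_zero order_trans by blast
  then show ?thesis
    using mat_bound_block[of "{}" "\<lambda>s r. if s = r then f s else 0" c 0] assms by simp
qed

lemma ent_dg: "(\<And>s. norm (f s) \<le> c) \<Longrightarrow> ent (dg f) s r = (if s = r then f s else 0)"
  unfolding dg_def by (subst ent_Bmat[OF mat_bound_dg]) auto

lemma ent_dg_mult:
  assumes "\<And>s. norm (f s) \<le> c"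
  shows "ent (dg f * M) s r = f s * ent M s r" "ent (M * dg f) s r = ent M s r * f r"
  unfolding ent_mult ent_dg[of f, OF assms]
  by (subst infsum_finite_support[of "{s}"]; simp) (subst infsum_finite_support[of "{r}"]; simp)

section \<open>The resolvent of the model operator\<close>

text \<open>\<open>v_minus\<close> reflects that the potential is real, and \<open>v0\<close> that
  its mean vanishes, so that the diagonal of the block consists of the unperturbed
  eigenvalues.\<close>

locale model =
  fixes l :: nat and V :: "real ^ 'n \<Rightarrow> complex" and q j :: "int ^ 'n" and e :: real
  assumes l: "1 \<le> l" and q: "q \<noteq> 0" and v: "fcoeff V q \<noteq> 0"
    and v_minus: "fcoeff V (- q) = cnj (fcoeff V q)" and v0: "fcoeff V 0 = 0"
    and e: "e = 1 \<or> e = -1"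
begin

abbreviation "vq \<equiv> fcoeff V q"
definition d where "d = norm vq / 10"
definition P where "P = {j, j - q}"
definition a :: "int ^ 'n \<Rightarrow> real ^ 'n \<Rightarrow> real" where "a m t = pn m t ^ (2 * l)"
definition D :: "real ^ 'n \<Rightarrow> real" where "D t = a j t - a (j - q) t"
definition S :: "real ^ 'n \<Rightarrow> real" where "S t = sqrt (4 * (norm vq)\<^sup>2 + (D t)\<^sup>2)"
abbreviation "lh \<equiv> lam_hat l V q j e"

lemma d_pos: "0 < d"
  using v by (simp add: d_def)

lemma j_ne: "j \<noteq> j - q" "j - q \<noteq> j"
  using q by auto

lemma P: "finite P" "card P = 2" "j \<in> P" "j - q \<in> P"
  using j_ne by (auto simp: P_def)

lemma sum_P: "(\<Sum>p\<in>P. f p) = f j + f (j - q)"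
  using j_ne by (simp add: P_def)

lemma lh_eq: "lh t = (a j t + a (j - q) t) / 2 + e * (S t / 2)"
  by (simp add: lam_hat_def a_def S_def D_def)

lemma ee: "e * e = 1" "\<bar>e\<bar> = 1" "(of_real e * of_real e :: complex) = 1"
  using e by auto

text \<open>\<open>S\<close> is the distance between the two eigenvalues of the block, so the second
  one stays at distance at least \<open>19 d\<close> from the circle around the first.\<close>

lemma S_ge: "20 * d \<le> S t" "\<bar>D t\<bar> \<le> S t" "(S t)\<^sup>2 = 4 * (norm vq)\<^sup>2 + (D t)\<^sup>2" "0 < S t"
proof -
  have "2 * norm vq \<le> S t"
    unfolding S_def by (rule real_le_rsqrt) (simp add: power_mult_distrib)
  then show *: "20 * d \<le> S t" by (simp add: d_def)
  have "sqrt ((D t)\<^sup>2) \<le> S t" unfolding S_def by (intro real_sqrt_le_mono) simp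
  then show "\<bar>D t\<bar> \<le> S t" by simp
  show "(S t)\<^sup>2 = 4 * (norm vq)\<^sup>2 + (D t)\<^sup>2" unfolding S_def by simp
  show "0 < S t" using * d_pos by linarith
qed

text \<open>\<open>S\<close> is the modulus of the complex number with parts \<open>2 |v_q|\<close>
  and \<open>D\<close>, so the reverse triangle inequality applies.\<close>

lemma S_diff_le: "\<bar>S t - S t'\<bar> \<le> \<bar>D t - D t'\<bar>"
proof -
  have "S t = norm (Complex (2 * norm vq) (D t))" for t
    by (simp add: S_def cmod_def power_mult_distrib)
  then have "\<bar>S t - S t'\<bar> \<le> norm (Complex (2 * norm vq) (D t) - Complex (2 * norm vq) (D t'))"
    by (simp only: norm_triangle_ineq3)
  also have "\<dots> = \<bar>D t - D t'\<bar>" by (simp add: cmod_def)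
  finally show ?thesis .
qed

text \<open>The explicit inverse of \<open>Ha\<close>: the \<open>2 \<times> 2\<close> block on \<open>{j, j - q}\<close> has determinant \<open>\<zeta> * (e * S t + \<zeta>)\<close>.\<close>

definition Ra :: "real ^ 'n \<Rightarrow> complex \<Rightarrow> 'n mat" where
  "Ra t \<zeta> s r =
    (if s = j \<and> r = j then - (of_real (D t / 2 + e * S t / 2) + \<zeta>) / (\<zeta> * (of_real (e * S t) + \<zeta>))
     else if s = j \<and> r = j - q then - vq / (\<zeta> * (of_real (e * S t) + \<zeta>))
     else if s = j - q \<and> r = j then - cnj vq / (\<zeta> * (of_real (e * S t) + \<zeta>))
     else if s = j - q \<and> r = j - q then
       - (of_real (- D t / 2 + e * S t / 2) + \<zeta>) / (\<zeta> * (of_real (e * S t) + \<zeta>))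
     else if s = r then 1 / (of_real (a s t - lh t) - \<zeta>) else 0)"

definition Ha :: "real ^ 'n \<Rightarrow> complex \<Rightarrow> 'n mat" where
  "Ha t \<zeta> s r = Hq l V q j t s r - (of_real (lh t) + \<zeta>) * mone s r"

lemma PVP_ent: "PVP V q j s r = (if s \<in> P \<and> r \<in> P then fcoeff V (s - r) else 0)"
proof -
  have Pq: "Pq q j s r = (if s = r \<and> s \<in> P then 1 else 0)" for s r
    by (simp add: Pq_def P_def)
  have "mmul (multop V) (Pq q j) s r = (if r \<in> P then fcoeff V (s - r) else 0)" for s r
    unfolding mmul_def Pq multop_def by (subst infsum_finite_support[of "{r}"]) auto
  then show ?thesis
    unfolding PVP_def mmul_def[of "Pq q j"] Pq by (subst infsum_finite_support[of "{s}"]) auto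
qed

lemma Ha_ent: "Ha t \<zeta> s r =
    (if s = j \<and> r = j then of_real (D t / 2 - e * S t / 2) - \<zeta>
     else if s = j \<and> r = j - q then vq
     else if s = j - q \<and> r = j then cnj vq
     else if s = j - q \<and> r = j - q then of_real (- D t / 2 - e * S t / 2) - \<zeta>
     else if s = r then of_real (a s t - lh t) - \<zeta> else 0)"
proof -
  have 1: "a j t - lh t = D t / 2 - e * S t / 2" "a (j - q) t - lh t = - D t / 2 - e * S t / 2"
    by (simp_all add: lh_eq D_def field_simps)
  have lhd: "(of_real (a j t) :: complex) - of_real (lh t) = of_real (D t / 2 - e * S t / 2)"
    "(of_real (a (j - q) t) :: complex) - of_real (lh t) = of_real (- D t / 2 - e * S t / 2)"
    by (simp_all only: 1[symmetric] of_real_diff)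
  have H: "Ha t \<zeta> s r = (if s = r then of_real (a s t) - of_real (lh t) - \<zeta> else 0)
      + (if s \<in> P \<and> r \<in> P then fcoeff V (s - r) else 0)"
    unfolding Ha_def Hq_def PVP_ent H0_def mone_def a_def[symmetric] by simp
  consider "s = j" "r = j" | "s = j" "r = j - q" | "s = j - q" "r = j" | "s = j - q" "r = j - q"
    | "\<not> (s \<in> P \<and> r \<in> P)" by (auto simp: P_def)
  then show ?thesis
  proof cases
    case 1
    then show ?thesis unfolding H lhd(1)[symmetric] using v0 P by simp
  next
    case 2
    then show ?thesis unfolding H using j_ne P by simp
  next
    case 3
    then show ?thesis unfolding H using j_ne P v_minus by simp
  next
    case 4
    then show ?thesis unfolding H lhd(2)[symmetric] using v0 P j_ne by simp
  next
    case 5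
    then show ?thesis unfolding H by (auto simp: P_def of_real_diff)
  qed
qed

lemma Ra_off: "s \<noteq> r \<Longrightarrow> \<not> (s \<in> P \<and> r \<in> P) \<Longrightarrow> Ra t \<zeta> s r = 0"
  and Ha_off: "s \<noteq> r \<Longrightarrow> \<not> (s \<in> P \<and> r \<in> P) \<Longrightarrow> Ha t \<zeta> s r = 0"
  by (auto simp: Ra_def Ha_ent P_def)

lemma Ha_row: "mmul (Ha t \<zeta>) N s r = (if s \<in> P then Ha t \<zeta> s j * N j r + Ha t \<zeta> s (j - q) * N (j - q) r
      else Ha t \<zeta> s s * N s r)"
  and Ra_row: "mmul (Ra t \<zeta>) N s r = (if s \<in> P then Ra t \<zeta> s j * N j r + Ra t \<zeta> s (j - q) * N (j - q) r
      else Ra t \<zeta> s s * N s r)"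
  unfolding mmul_def
  using infsum_block_row[of P s "Ha t \<zeta>" "\<lambda>m. N m r", OF P(1) Ha_off]
    infsum_block_row[of P s "Ra t \<zeta>" "\<lambda>m. N m r", OF P(1) Ra_off]
  by (simp_all add: sum_P)

lemma block_prod:
  assumes z: "\<zeta> \<noteq> 0" "of_real (e * S t) + \<zeta> \<noteq> 0" and s: "s \<in> P" "r \<in> P"
  shows "Ha t \<zeta> s j * Ra t \<zeta> j r + Ha t \<zeta> s (j - q) * Ra t \<zeta> (j - q) r = mone s r"
    and "Ra t \<zeta> s j * Ha t \<zeta> j r + Ra t \<zeta> s (j - q) * Ha t \<zeta> (j - q) r = mone s r"
proof -
  define w :: complex where "w = \<zeta> * (of_real (e * S t) + \<zeta>)"
  have w: "w \<noteq> 0" using z by (simp add: w_def)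
  have SS: "(of_real (S t))\<^sup>2 = 4 * (vq * cnj vq) + (of_real (D t))\<^sup>2"
    using arg_cong[OF S_ge(3)[of t], of complex_of_real]
    by (simp add: complex_norm_square[symmetric])
  have ee': "(of_real e)\<^sup>2 = (1::complex)" using ee by (simp add: power2_eq_square)
  \<comment> \<open>The determinant of the block. Multiplication by 4 clears the halves, after which
    \<open>S^2 = 4 |v_q|^2 + D^2\<close> and \<open>e^2 = 1\<close> cancel everything except the
    terms with \<zeta>.\<close>
  have det: "- (of_real (D t / 2 - e * S t / 2) - \<zeta>) * (of_real (D t / 2 + e * S t / 2) + \<zeta>) - vq * cnj vq = w"
  proof -
    have "4 * (- (of_real (D t / 2 - e * S t / 2) - \<zeta>) * (of_real (D t / 2 + e * S t / 2) + \<zeta>) - vq * cnj vq)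
      = (of_real e)\<^sup>2 * (of_real (S t))\<^sup>2 - (of_real (D t))\<^sup>2 - 4 * (vq * cnj vq) + 4 * w"
      unfolding w_def by (simp add: field_simps power2_eq_square)
    also have "\<dots> = 4 * w" using SS ee' by simp
    finally show ?thesis by (simp only: mult_cancel_left) simp
  qed
  have det': "- (of_real (- D t / 2 - e * S t / 2) - \<zeta>) * (of_real (- D t / 2 + e * S t / 2) + \<zeta>) - vq * cnj vq = w"
    using det by (simp add: field_simps)
  have R: "Ra t \<zeta> j j = - (of_real (D t / 2 + e * S t / 2) + \<zeta>) / w" "Ra t \<zeta> j (j - q) = - vq / w"
    "Ra t \<zeta> (j - q) j = - cnj vq / w" "Ra t \<zeta> (j - q) (j - q) = - (of_real (- D t / 2 + e * S t / 2) + \<zeta>) / w"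
    using j_ne by (simp_all add: Ra_def w_def)
  have H: "Ha t \<zeta> j j = of_real (D t / 2 - e * S t / 2) - \<zeta>" "Ha t \<zeta> j (j - q) = vq"
    "Ha t \<zeta> (j - q) j = cnj vq" "Ha t \<zeta> (j - q) (j - q) = of_real (- D t / 2 - e * S t / 2) - \<zeta>"
    using j_ne by (simp_all add: Ha_ent)
  have opp: "(of_real (- D t / 2 - e * S t / 2) :: complex) = - of_real (D t / 2 + e * S t / 2)"
    "(of_real (- D t / 2 + e * S t / 2) :: complex) = - of_real (D t / 2 - e * S t / 2)"
    by simp_all
  define x y :: complex where "x = of_real (D t / 2 - e * S t / 2) - \<zeta>" and "y = of_real (D t / 2 + e * S t / 2) + \<zeta>"
  have xy: "- x * y - vq * cnj vq = w" using det by (simp add: x_def y_def)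
  have R': "Ra t \<zeta> j j = - y / w" "Ra t \<zeta> j (j - q) = - vq / w"
    "Ra t \<zeta> (j - q) j = - cnj vq / w" "Ra t \<zeta> (j - q) (j - q) = x / w"
    unfolding R opp x_def y_def by simp_all
  have H': "Ha t \<zeta> j j = x" "Ha t \<zeta> j (j - q) = vq" "Ha t \<zeta> (j - q) j = cnj vq" "Ha t \<zeta> (j - q) (j - q) = - y"
    unfolding H opp x_def y_def by simp_all
  have 1: "x * (- y / w) + vq * (- cnj vq / w) = 1" "cnj vq * (- vq / w) + (- y) * (x / w) = 1"
    "(- y / w) * x + (- vq / w) * cnj vq = 1" "(- cnj vq / w) * vq + (x / w) * (- y) = 1"
    using w xy by (simp_all add: field_simps)
  have s': "s = j \<or> s = j - q" "r = j \<or> r = j - q" using s by (auto simp: P_def)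
  show "Ha t \<zeta> s j * Ra t \<zeta> j r + Ha t \<zeta> s (j - q) * Ra t \<zeta> (j - q) r = mone s r"
    "Ra t \<zeta> s j * Ha t \<zeta> j r + Ra t \<zeta> s (j - q) * Ha t \<zeta> (j - q) r = mone s r"
    using s' 1 j_ne by (elim disjE; simp add: H' R' mone_def)+
qed

context
  fixes t and \<zeta> :: complex
  assumes z: "\<zeta> \<noteq> 0" "of_real (e * S t) + \<zeta> \<noteq> 0" and m: "\<And>m. m \<notin> P \<Longrightarrow> of_real (a m t - lh t) - \<zeta> \<noteq> 0"
begin

lemma Ha_Ra: "mmul (Ha t \<zeta>) (Ra t \<zeta>) = mone" and Ra_Ha: "mmul (Ra t \<zeta>) (Ha t \<zeta>) = mone"
proof -
  have diag: "Ha t \<zeta> s s * Ra t \<zeta> s s = 1" if "s \<notin> P" for s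
    using that m[OF that] by (auto simp: Ha_ent Ra_def P_def)
  show "mmul (Ha t \<zeta>) (Ra t \<zeta>) = mone"
  proof (intro ext)
    fix s r
    consider "s \<in> P" "r \<in> P" | "s \<in> P" "r \<notin> P" | "s \<notin> P" "r = s" | "s \<notin> P" "r \<noteq> s" by blast
    then show "mmul (Ha t \<zeta>) (Ra t \<zeta>) s r = mone s r"
    proof cases
      case 1
      then show ?thesis using block_prod(1)[OF z] by (simp add: Ha_row)
    next
      case 2
      then have "Ra t \<zeta> j r = 0" "Ra t \<zeta> (j - q) r = 0" "s \<noteq> r" using P by (auto intro: Ra_off)
      with 2 show ?thesis by (simp add: Ha_row mone_def)
    next
      case 3
      then show ?thesis using diag[of s] by (simp add: Ha_row mone_def mult.commute)
    next
      case 4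
      then show ?thesis by (simp add: Ha_row Ra_off mone_def)
    qed
  qed
  show "mmul (Ra t \<zeta>) (Ha t \<zeta>) = mone"
  proof (intro ext)
    fix s r
    consider "s \<in> P" "r \<in> P" | "s \<in> P" "r \<notin> P" | "s \<notin> P" "r = s" | "s \<notin> P" "r \<noteq> s" by blast
    then show "mmul (Ra t \<zeta>) (Ha t \<zeta>) s r = mone s r"
    proof cases
      case 1
      then show ?thesis using block_prod(2)[OF z] by (simp add: Ra_row)
    next
      case 2
      then have "Ha t \<zeta> j r = 0" "Ha t \<zeta> (j - q) r = 0" "s \<noteq> r" using P by (auto intro: Ha_off)
      with 2 show ?thesis by (simp add: Ra_row mone_def)
    next
      case 3
      then show ?thesis using diag[of s] by (simp add: Ra_row mone_def mult.commute)
    next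
      case 4
      then show ?thesis by (simp add: Ra_row Ha_off mone_def)
    qed
  qed
qed

text \<open>\<open>minv\<close> is a definite description over all matrices, and nothing is known
  about the size of a competitor \<open>N\<close>. Uniqueness holds nevertheless: every row of
  \<open>Ha\<close> has finite support, so the equations for \<open>N\<close> are finite linear
  systems.\<close>

lemma resolv_eq: "resolv l V q j t (of_real (lh t) + \<zeta>) = Ra t \<zeta>"
proof -
  have uniq: "N = Ra t \<zeta>" if N: "mmul (Ha t \<zeta>) N = mone" for N
  proof (intro ext)
    fix s r
    show "N s r = Ra t \<zeta> s r"
    proof (cases "s \<in> P")
      case False
      have "Ha t \<zeta> s s \<noteq> 0" using False m[OF False] by (auto simp: Ha_ent P_def)
      moreover have "Ha t \<zeta> s s * N s r = Ha t \<zeta> s s * Ra t \<zeta> s r"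
        using Ha_row[of t \<zeta> N s r] Ha_row[of t \<zeta> "Ra t \<zeta>" s r] False N Ha_Ra by simp
      ultimately show ?thesis by simp
    next
      case True
      define x y where "x = N j r - Ra t \<zeta> j r" and "y = N (j - q) r - Ra t \<zeta> (j - q) r"
      have eq: "Ha t \<zeta> p j * x + Ha t \<zeta> p (j - q) * y = 0" if "p \<in> P" for p
        using Ha_row[of t \<zeta> N p r] Ha_row[of t \<zeta> "Ra t \<zeta>" p r] that N Ha_Ra by (simp add: x_def y_def algebra_simps)
      \<comment> \<open>Row \<open>s\<close> of the inverse block is applied to the homogeneous
        system that the differences \<open>x\<close> and \<open>y\<close> satisfy.\<close>
      have "(Ra t \<zeta> s j * Ha t \<zeta> j j + Ra t \<zeta> s (j - q) * Ha t \<zeta> (j - q) j) * x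
          + (Ra t \<zeta> s j * Ha t \<zeta> j (j - q) + Ra t \<zeta> s (j - q) * Ha t \<zeta> (j - q) (j - q)) * y
        = Ra t \<zeta> s j * (Ha t \<zeta> j j * x + Ha t \<zeta> j (j - q) * y)
          + Ra t \<zeta> s (j - q) * (Ha t \<zeta> (j - q) j * x + Ha t \<zeta> (j - q) (j - q) * y)"
        by (simp add: algebra_simps)
      then have xy: "mone s j * x + mone s (j - q) * y = 0"
        using eq[OF P(3)] eq[OF P(4)] block_prod(2)[OF z True P(3)] block_prod(2)[OF z True P(4)] by simp
      from True consider "s = j" | "s = j - q" by (auto simp: P_def)
      then show ?thesis
      proof cases
        case 1
        with xy j_ne have "x = 0" by (simp add: mone_def)
        with 1 show ?thesis by (simp add: x_def)
      next
        case 2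
        with xy j_ne have "y = 0" by (simp add: mone_def)
        with 2 show ?thesis by (simp add: y_def)
      qed
    qed
  qed
  have "(THE N. mmul (Ha t \<zeta>) N = mone \<and> mmul N (Ha t \<zeta>) = mone) = Ra t \<zeta>"
    by (rule the_equality) (blast intro: Ha_Ra Ra_Ha uniq)+
  then show ?thesis
    unfolding resolv_def minv_def Ha_def[abs_def] .
qed

end

end

text \<open>Since \<open>n' / w'\<close> is at most 2 in modulus and \<open>w\<close> is at least
  \<open>19 d\<close>, the changes of numerator and denominator together contribute at most
  \<open>3 x / (19 d)\<close>.\<close>

lemma frac_diff_le:
  fixes n n' w w' :: complex
  assumes "norm (n - n') \<le> x" "norm (w - w') \<le> x" "norm n' \<le> 2 * norm w'" "19 * d \<le> norm w" "w' \<noteq> 0" "0 < d"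
  shows "norm (n / w - n' / w') \<le> x / d"
proof -
  have w: "w \<noteq> 0" using assms by auto
  have x: "0 \<le> x" using assms(1) norm_ge_zero order_trans by blast
  have "n / w - n' / w' = (n - n') / w + n' / w' * ((w' - w) / w)"
    using w assms(5) by (simp add: field_simps)
  also have "norm \<dots> \<le> norm (n - n') / norm w + norm n' / norm w' * (norm (w' - w) / norm w)"
    by (rule order_trans[OF norm_triangle_ineq]) (simp add: norm_mult norm_divide)
  also have "\<dots> \<le> x / norm w + 2 * (x / norm w)"
    using assms w by (intro add_mono mult_mono divide_right_mono) (auto simp: divide_le_eq norm_minus_commute)
  also have "\<dots> = 3 * x / norm w" by simp
  also have "\<dots> \<le> 3 * x / (19 * d)"
    using assms x w by (intro divide_left_mono) auto
  also have "\<dots> \<le> x / d" using assms x by (simp add: field_simps)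
  finally show ?thesis .
qed

lemma ent_power_diagonal:
  assumes "\<And>s r. ent M s r = (if s = r then f s else 0)"
  shows "ent (M ^ n) s r = (if s = r then f s ^ n else 0)"
proof (induction n arbitrary: s r)
  case 0
  show ?case by (simp add: ent_simps)
next
  case (Suc n)
  have "ent (M ^ Suc n) s r = (\<Sum>\<^sub>\<infinity>m. ent M s m * ent (M ^ n) m r)" by (simp add: ent_mult)
  also have "\<dots> = ent M s s * ent (M ^ n) s r"
    by (subst infsum_finite_support[of "{s}"]) (auto simp: assms)
  finally show ?case by (simp add: assms Suc)
qed

lemma one_plus_power_le: "(1 + x) ^ n \<le> 2 ^ n * (1 + x ^ n)" if "0 \<le> x" for x :: real
proof -
  have "(1 + x) ^ n \<le> (2 * max 1 x) ^ n" using that by (intro power_mono) auto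
  also have "\<dots> \<le> 2 ^ n * (1 + x ^ n)"
    using that by (auto simp: power_mult_distrib max_def)
  finally show ?thesis .
qed

lemma pn_power: "pn m t ^ (2 * l) = ((lvec m + t) \<bullet> (lvec m + t)) ^ l"
  by (simp add: pn_def Pv_def power_mult dot_square_norm)

context model
begin

section \<open>Smoothness of the model eigenvalue\<close>

lemma C1p_a: "C1p U T (\<lambda>t _. a m t)"
  unfolding a_def pn_power
  by (intro C1p_power C1p_bilinear[OF bounded_bilinear_inner] C1p_add C1p_param C1p_linear_arg
      bounded_linear_ident continuous_intros)

lemma C1p_D: "C1p U T (\<lambda>t _. D t)"
  unfolding D_def by (intro C1p_diff C1p_a)

lemma C1p_S: "C1p U T (\<lambda>t _. S t)"
  unfolding S_def
proof (rule C1p_real_fun[where \<phi> = sqrt and f = "\<lambda>t _. 4 * (norm vq)\<^sup>2 + (D t)\<^sup>2" and I = "{0<..}" and \<phi>' = "\<lambda>y. inverse (sqrt y) / 2"])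
  show "C1p U T (\<lambda>t _. 4 * (norm vq)\<^sup>2 + (D t)\<^sup>2)"
    by (intro C1p_add C1p_param C1p_power C1p_D continuous_intros)
  show "4 * (norm vq)\<^sup>2 + (D t)\<^sup>2 \<in> {0<..}" for t
    using v by (simp add: add_pos_nonneg)
  show "(sqrt has_real_derivative inverse (sqrt y) / 2) (at y)" if "y \<in> {0<..}" for y
    using DERIV_real_sqrt[of y] that by simp
  show "continuous_on {0<..} (\<lambda>y::real. inverse (sqrt y) / 2)"
    by (intro continuous_intros) auto
qed

lemma C1p_lh: "C1p U T (\<lambda>t _. lh t)"
proof -
  have "C1p U T (\<lambda>t _. (1 / 2) * (a j t + a (j - q) t) + (e / 2) * S t)"
    by (intro C1p_add C1p_mult C1p_param C1p_a C1p_S continuous_intros)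
  moreover have "lh = (\<lambda>t. (1 / 2) * (a j t + a (j - q) t) + (e / 2) * S t)"
    by (rule ext) (simp add: lh_eq)
  ultimately show ?thesis by simp
qed

section \<open>The circle and the entries of the block\<close>

text \<open>The circle is centred at 0 and parametrised over the unit interval, so that the domain
  of integration does not move with \<open>t\<close>; the moving centre \<open>lh t\<close> is added
  where a spectral parameter is wanted.\<close>

definition zeta :: "real \<Rightarrow> complex" where
  "zeta \<theta> = of_real d * exp (2 * of_real pi * \<i> * of_real \<theta>)"

lemma norm_zeta [simp]: "norm (zeta \<theta>) = d"
  using d_pos by (simp add: zeta_def norm_mult)

lemma zeta_nz: "zeta \<theta> \<noteq> 0"
  using norm_zeta[of \<theta>] d_pos by (metis less_irrefl norm_zero)

lemma continuous_zeta: "continuous_on A zeta"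
  unfolding zeta_def[abs_def] by (intro continuous_intros)

lemma eS_ge: "cmod \<zeta> \<le> d \<Longrightarrow> S t - d \<le> norm (of_real (e * S t) + \<zeta>)"
proof -
  assume "cmod \<zeta> \<le> d"
  moreover have "norm (of_real (e * S t) :: complex) = S t"
    unfolding norm_of_real using ee S_ge(4)[of t] by (simp add: abs_mult)
  ultimately show ?thesis
    using norm_diff_ineq[of "of_real (e * S t) :: complex" \<zeta>] by linarith
qed

lemma eS_ge2: "cmod \<zeta> \<le> d \<Longrightarrow> 19 * d \<le> norm (of_real (e * S t) + \<zeta>)" and
  eS_nz: "cmod \<zeta> \<le> d \<Longrightarrow> of_real (e * S t) + \<zeta> \<noteq> 0"
  using eS_ge[of \<zeta> t] S_ge(1)[of t] d_pos by auto

text \<open>Numerators of the block of \<open>Ra\<close>, up to sign; at \<open>\<zeta> = 0\<close>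
  they are those of the spectral projection.\<close>

definition num :: "real ^ 'n \<Rightarrow> complex \<Rightarrow> int ^ 'n \<Rightarrow> int ^ 'n \<Rightarrow> complex" where
  "num t \<zeta> s r = (if s = j \<and> r = j then of_real (D t / 2 + e * S t / 2) + \<zeta>
     else if s = j \<and> r = j - q then vq
     else if s = j - q \<and> r = j then cnj vq
     else of_real (- D t / 2 + e * S t / 2) + \<zeta>)"

lemma Ra_block:
  assumes "s \<in> P" "r \<in> P"
  shows "Ra t \<zeta> s r = - (num t \<zeta> s r / (of_real (e * S t) + \<zeta>)) / \<zeta>"
proof -
  have eq: "- (x / w) / \<zeta> = - x / (\<zeta> * w)" for x w :: complex by (simp add: mult.commute)
  have "s = j \<or> s = j - q" "r = j \<or> r = j - q" using assms by (auto simp: P_def)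
  then show ?thesis
    unfolding eq Ra_def num_def by (elim disjE) (simp_all only: j_ne simp_thms if_True if_False)
qed

lemma num_le: "cmod \<zeta> \<le> d \<Longrightarrow> norm (num t \<zeta> s r) \<le> 2 * norm (of_real (e * S t) + \<zeta>)"
proof -
  assume \<zeta>: "cmod \<zeta> \<le> d"
  have r: "norm (of_real x + \<zeta>) \<le> S t + d" if "\<bar>x\<bar> \<le> S t" for x
    using norm_triangle_ineq[of "of_real x" \<zeta>] \<zeta> that by (simp add: norm_of_real)
  have eS: "\<bar>e * S t / 2\<bar> = S t / 2" using ee S_ge(4)[of t] by (simp add: abs_mult)
  have "\<bar>D t / 2 + e * S t / 2\<bar> \<le> S t" "\<bar>- D t / 2 + e * S t / 2\<bar> \<le> S t"
    using abs_triangle_ineq[of "D t / 2" "e * S t / 2"] abs_triangle_ineq[of "- D t / 2" "e * S t / 2"] eS S_ge(2)[of t]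
    by simp_all
  note 1 = r[OF this(1)] r[OF this(2)]
  \<comment> \<open>Both follow from \<open>S \<ge> 20 d\<close>; the quantity \<open>10 d\<close>
    is the modulus of \<open>v_q\<close>.\<close>
  have "S t + d \<le> 2 * norm (of_real (e * S t) + \<zeta>)" "10 * d \<le> 2 * norm (of_real (e * S t) + \<zeta>)"
    using eS_ge[OF \<zeta>, of t] S_ge(1)[of t] d_pos by linarith+
  moreover have "norm (num t \<zeta> s r) \<le> max (S t + d) (10 * d)"
    unfolding num_def using 1 by (simp add: d_def le_max_iff_disj)
  ultimately show ?thesis by linarith
qed

lemma num_diff_le: "norm (num t \<zeta> s r - num t' \<zeta> s r) \<le> \<bar>D t - D t'\<bar>"
proof -
  have eq: "of_real x + \<zeta> - (of_real y + \<zeta>) = of_real (x - y)" for x y by simp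
  have eS: "\<bar>e * S t / 2 - e * S t' / 2\<bar> \<le> \<bar>D t - D t'\<bar> / 2"
    using ee S_diff_le[of t t'] by (simp add: right_diff_distrib[symmetric] abs_mult flip: diff_divide_distrib)
  have 1: "\<bar>(D t / 2 + e * S t / 2) - (D t' / 2 + e * S t' / 2)\<bar> \<le> \<bar>D t - D t'\<bar>"
    using eS by argo
  have 2: "\<bar>(- D t / 2 + e * S t / 2) - (- D t' / 2 + e * S t' / 2)\<bar> \<le> \<bar>D t - D t'\<bar>"
    using eS by argo
  show ?thesis
    unfolding num_def using 1 2
    by (cases "s = j \<and> r = j"; cases "s = j \<and> r = j - q"; cases "s = j - q \<and> r = j")
       (simp_all only: if_True if_False eq norm_of_real simp_thms, simp_all)
qed

lemma eS_diff_le: "norm ((of_real (e * S t) + \<zeta>) - (of_real (e * S t') + \<zeta>)) \<le> \<bar>D t - D t'\<bar>"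
  for \<zeta> :: complex
proof -
  have "(of_real (e * S t) + \<zeta>) - (of_real (e * S t') + \<zeta>) = of_real (e * (S t - S t'))"
    by (simp add: algebra_simps)
  then show ?thesis
    using ee S_diff_le[of t t'] by (simp only: norm_of_real) (simp add: abs_mult)
qed

lemma Ra_block_le:
  assumes "cmod \<zeta> = d" "s \<in> P" "r \<in> P"
  shows "norm (Ra t \<zeta> s r) \<le> 2 / d"
proof -
  have "norm (num t \<zeta> s r / (of_real (e * S t) + \<zeta>)) \<le> 2"
    using num_le[of \<zeta> t s r] eS_nz[of \<zeta> t] assms by (simp add: norm_divide divide_le_eq)
  then have "norm (num t \<zeta> s r / (of_real (e * S t) + \<zeta>)) / d \<le> 2 / d"
    using d_pos by (intro divide_right_mono) auto
  then show ?thesis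
    unfolding Ra_block[OF assms(2,3)] norm_divide[of _ \<zeta>] norm_minus_cancel assms(1) .
qed

lemma Ra_block_diff_le:
  assumes "cmod \<zeta> = d" "s \<in> P" "r \<in> P"
  shows "norm (Ra t \<zeta> s r - Ra t' \<zeta> s r) \<le> \<bar>D t - D t'\<bar> / d\<^sup>2"
proof -
  have \<zeta>: "cmod \<zeta> \<le> d" using assms by simp
  have "norm (num t \<zeta> s r / (of_real (e * S t) + \<zeta>) - num t' \<zeta> s r / (of_real (e * S t') + \<zeta>)) \<le> \<bar>D t - D t'\<bar> / d"
    by (intro frac_diff_le num_diff_le eS_diff_le num_le eS_ge2 eS_nz \<zeta> d_pos)
  moreover have "Ra t \<zeta> s r - Ra t' \<zeta> s r =
    - (num t \<zeta> s r / (of_real (e * S t) + \<zeta>) - num t' \<zeta> s r / (of_real (e * S t') + \<zeta>)) / \<zeta>"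
    unfolding Ra_block[OF assms(2,3)] by (simp only: minus_diff_eq diff_divide_distrib minus_divide_left) simp
  ultimately have "norm (Ra t \<zeta> s r - Ra t' \<zeta> s r) \<le> \<bar>D t - D t'\<bar> / d / d"
    using d_pos assms(1) by (simp only: norm_divide[of _ \<zeta>] norm_minus_cancel divide_right_mono)
  then show ?thesis by (simp add: power2_eq_square)
qed

lemma Ra_diag: "s \<notin> P \<Longrightarrow> Ra t \<zeta> s s = 1 / (of_real (a s t - lh t) - \<zeta>)"
  by (auto simp: Ra_def P_def)

text \<open>\<open>Ha t \<zeta>\<close> is unbounded. Multiplied by the weight \<open>S1\<close> it becomes a bounded family \<open>G\<close> that is
  polynomial in \<open>t\<close>, so the resolvent \<open>S1 * inverse (G t \<theta>)\<close> is continuously differentiable in norm.\<close>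

definition wt :: "int ^ 'n \<Rightarrow> real" where "wt m = 1 + (norm (lvec m))\<^sup>2"

lemma wt_ge: "1 \<le> wt m" "0 < wt m" "wt m \<noteq> 0"
  by (auto simp: wt_def add_pos_nonneg) (smt (verit) zero_le_power2)

definition S1 :: "(int ^ 'n) bmat" where "S1 = dg (\<lambda>s. of_real (1 / wt s ^ l))"

lemma ent_S1_mult: "ent (S1 * M) s r = of_real (1 / wt s ^ l) * ent M s r"
  "ent (M * S1) s r = ent M s r * of_real (1 / wt r ^ l)"
proof -
  have "norm (of_real (1 / wt s ^ l) :: complex) \<le> 1" for s
    using wt_ge[of s] by (simp add: norm_divide norm_power one_le_power)
  from ent_dg_mult[OF this] show "ent (S1 * M) s r = of_real (1 / wt s ^ l) * ent M s r"
    "ent (M * S1) s r = ent M s r * of_real (1 / wt r ^ l)"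
    unfolding S1_def .
qed

text \<open>The diagonal matrix of \<open>p_s^2 / wt s\<close>, expanded as a quadratic polynomial
  in \<open>t\<close> whose coefficients are bounded matrices. Smoothness in norm is then
  immediate.\<close>

definition Pit :: "real ^ 'n \<Rightarrow> (int ^ 'n) bmat" where
  "Pit t = dg (\<lambda>s. of_real ((norm (lvec s))\<^sup>2 / wt s))
     + (\<Sum>i\<in>Basis. (t \<bullet> i) *\<^sub>R dg (\<lambda>s. of_real (2 * (lvec s \<bullet> i) / wt s)))
     + (t \<bullet> t) *\<^sub>R dg (\<lambda>s. of_real (1 / wt s))"

lemma ent_Pit: "ent (Pit t) s r = (if s = r then of_real ((pn s t)\<^sup>2 / wt s) else 0)"
proof -
  have b: "norm (of_real ((norm (lvec s))\<^sup>2 / wt s) :: complex) \<le> 1"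
    "norm (of_real (1 / wt s) :: complex) \<le> 1" for s
    using wt_ge[of s] unfolding norm_of_real by (simp_all add: wt_def)
  have bi: "norm (of_real (2 * (lvec s \<bullet> i) / wt s) :: complex) \<le> 1" if i: "i \<in> Basis" for s :: "int ^ 'n" and i
  proof -
    have "\<bar>lvec s \<bullet> i\<bar> \<le> norm (lvec s)" using Basis_le_norm[OF i] .
    moreover have "2 * norm (lvec s) \<le> wt s"
      using zero_le_power2[of "norm (lvec s) - 1"] by (simp add: wt_def power2_eq_square algebra_simps)
    ultimately show ?thesis
      using wt_ge[of s] unfolding norm_of_real by (simp add: abs_mult)
  qed
  have "ent (Pit t) s r = ent (dg (\<lambda>s. of_real ((norm (lvec s))\<^sup>2 / wt s))) s r
     + (\<Sum>i\<in>Basis. of_real (t \<bullet> i) * ent (dg (\<lambda>s. of_real (2 * (lvec s \<bullet> i) / wt s))) s r)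
     + of_real (t \<bullet> t) * ent (dg (\<lambda>s. of_real (1 / wt s))) s r"
    unfolding Pit_def
    by (simp add: ent_simps linear_sum[OF bounded_linear.linear[OF bounded_linear_ent]])
  also have "\<dots> = (if s = r then of_real ((norm (lvec s))\<^sup>2 / wt s) else 0)
     + (\<Sum>i\<in>Basis. of_real (t \<bullet> i) * (if s = r then of_real (2 * (lvec s \<bullet> i) / wt s) else 0))
     + of_real (t \<bullet> t) * (if s = r then of_real (1 / wt s) else 0)"
    unfolding ent_dg[of "\<lambda>s. of_real ((norm (lvec s))\<^sup>2 / wt s)", OF b(1)] ent_dg[of "\<lambda>s. of_real (1 / wt s)", OF b(2)]
    by (intro arg_cong2[where f = "(+)"] sum.cong refl arg_cong2[where f = "(*)"] ent_dg[OF bi])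
  also have "\<dots> = (if s = r then of_real ((pn s t)\<^sup>2 / wt s) else 0)"
  proof (cases "s = r")
    case True
    have "(\<Sum>i\<in>Basis. (t \<bullet> i) * (2 * (lvec s \<bullet> i))) = 2 * (lvec s \<bullet> t)"
      unfolding euclidean_inner[of "lvec s" t] sum_distrib_left by (intro sum.cong) auto
    then have "(pn s t)\<^sup>2 = (norm (lvec s))\<^sup>2 + (\<Sum>i\<in>Basis. (t \<bullet> i) * (2 * (lvec s \<bullet> i))) + t \<bullet> t"
      unfolding pn_def Pv_def dot_square_norm[symmetric]
      by (simp add: inner_add_left inner_add_right inner_commute[of t "lvec s"])
    then have "(pn s t)\<^sup>2 / wt s = (norm (lvec s))\<^sup>2 / wt s + (\<Sum>i\<in>Basis. (t \<bullet> i) * (2 * (lvec s \<bullet> i) / wt s)) + (t \<bullet> t) * (1 / wt s)"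
      by (simp add: add_divide_distrib sum_divide_distrib)
    then show ?thesis
      using True by simp
  next
    case False
    then show ?thesis by simp
  qed
  finally show ?thesis .
qed

lemma ent_Pit_power: "ent (Pit t ^ l) s r = (if s = r then of_real (a s t / wt s ^ l) else 0)"
  unfolding ent_power_diagonal[OF ent_Pit] by (simp add: a_def power_divide power_mult)

definition Pvp :: "(int ^ 'n) bmat" where "Pvp = Bmat (PVP V q j)"

lemma ent_Pvp: "ent Pvp = PVP V q j"
proof -
  have le: "norm (PVP V q j s r) \<le> norm vq" for s r
    using v0 v_minus by (auto simp: PVP_ent P_def)
  have "mat_bound (PVP V q j) (real (card P) * norm vq + 0)"
    by (rule mat_bound_block[OF P(1) _ _ le]) (auto simp: PVP_ent)
  then show ?thesis unfolding Pvp_def by (rule ent_Bmat)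
qed

definition G :: "real ^ 'n \<Rightarrow> real \<Rightarrow> (int ^ 'n) bmat" where
  "G t \<theta> = Pit t ^ l + (Pvp - sc (of_real (lh t) + zeta \<theta>)) * S1"

lemma ent_G: "ent (G t \<theta>) s r = Ha t (zeta \<theta>) s r / of_real (wt r ^ l)"
  unfolding G_def Ha_def Hq_def H0_def mone_def a_def[symmetric]
  by (simp add: ent_simps ent_Pit_power ent_S1_mult ent_Pvp sc.rep_eq add_divide_distrib diff_divide_distrib)

lemma C1p_G: "C1p U {0..1} G"
  unfolding G_def Pit_def
  by (intro C1p_add C1p_power C1p_mult C1p_diff C1p_linear[OF bounded_linear_sc] C1p_linear[OF bounded_linear_of_real]
      C1p_sum finite_Basis C1p_scaleR C1p_bilinear[OF bounded_bilinear_inner] C1p_linear_arg bounded_linear_ident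
      C1p_param continuous_intros C1p_lh continuous_zeta bounded_linear_inner_left)

end

section \<open>The resolvent as a differentiable family of bounded matrices\<close>

text \<open>The gap is required on the disc of radius \<open>2 d\<close>, twice that of the circle,
  to leave room for Cauchy's theorem. \<kappa>1 and \<kappa>2 measure the variation of the block and
  of the diagonal outside it; \<open>T\<close> and \<open>L\<close> serve the growth estimate behind
  differentiability in norm.\<close>

locale model_gap = model l V q j e
  for l :: nat and V :: "real ^ 'n \<Rightarrow> complex" and q j :: "int ^ 'n" and e :: real +
  fixes U :: "(real ^ 'n) set" and g \<kappa>1 \<kappa>2 T L :: real
  assumes U: "open U" "convex U" and g: "1 \<le> g"
    and gap: "\<And>t \<zeta> m. t \<in> U \<Longrightarrow> cmod \<zeta> \<le> 2 * d \<Longrightarrow> m \<notin> P \<Longrightarrow> g \<le> norm (of_real (a m t - lh t) - \<zeta>)"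
    and DL: "\<And>t t'. t \<in> U \<Longrightarrow> t' \<in> U \<Longrightarrow> \<bar>D t - D t'\<bar> \<le> \<kappa>1 * norm (t - t')"
    and QL: "\<And>t t' m \<zeta>. t \<in> U \<Longrightarrow> t' \<in> U \<Longrightarrow> cmod \<zeta> = d \<Longrightarrow> m \<notin> P \<Longrightarrow>
      norm (1 / (of_real (a m t - lh t) - \<zeta>) - 1 / (of_real (a m t' - lh t') - \<zeta>)) \<le> \<kappa>2 * norm (t - t')"
    and T: "\<And>t. t \<in> U \<Longrightarrow> norm t \<le> T" and L: "\<And>t. t \<in> U \<Longrightarrow> \<bar>lh t\<bar> \<le> L"
    and \<kappa>: "0 \<le> \<kappa>1" "0 \<le> \<kappa>2"
begin

lemma gap_nz: "t \<in> U \<Longrightarrow> cmod \<zeta> \<le> 2 * d \<Longrightarrow> m \<notin> P \<Longrightarrow> of_real (a m t - lh t) - \<zeta> \<noteq> 0"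
  using gap[of t \<zeta> m] g by auto

lemma gap_inv: "t \<in> U \<Longrightarrow> cmod \<zeta> \<le> 2 * d \<Longrightarrow> m \<notin> P \<Longrightarrow> norm (1 / (of_real (a m t - lh t) - \<zeta>)) \<le> 1 / g"
  using gap[of t \<zeta> m] g by (simp add: norm_divide divide_simps)

definition R :: "real ^ 'n \<Rightarrow> real \<Rightarrow> (int ^ 'n) bmat" where "R t \<theta> = Bmat (Ra t (zeta \<theta>))"

text \<open>Defined for every \<zeta> and not only on the circle, because Cauchy's theorem acts on
  its dependence on \<zeta> inside the disc.\<close>

definition RQz :: "real ^ 'n \<Rightarrow> complex \<Rightarrow> (int ^ 'n) bmat" where
  "RQz t \<zeta> = dg (\<lambda>s. if s \<in> P then 0 else 1 / (of_real (a s t - lh t) - \<zeta>))"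

definition RQ :: "real ^ 'n \<Rightarrow> real \<Rightarrow> (int ^ 'n) bmat" where "RQ t \<theta> = RQz t (zeta \<theta>)"

lemma mat_bound_Ra: "t \<in> U \<Longrightarrow> mat_bound (Ra t (zeta \<theta>)) (real (card P) * (2 / d) + 1 / g)"
  using Ra_block_le[of "zeta \<theta>"] gap_inv[of t "zeta \<theta>"] d_pos g
  by (intro mat_bound_block P Ra_off) (auto simp: Ra_diag)

lemma ent_R: "t \<in> U \<Longrightarrow> ent (R t \<theta>) = Ra t (zeta \<theta>)"
  unfolding R_def by (rule ent_Bmat[OF mat_bound_Ra])

lemma norm_R_le: "t \<in> U \<Longrightarrow> norm (R t \<theta>) \<le> 4 / d + 1 / g"
  using mat_bound_Ra[of t \<theta>] P by (intro norm_bmat_le) (simp add: ent_R)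

lemma ent_RQz:
  assumes "t \<in> U" "cmod \<zeta> \<le> 2 * d"
  shows "ent (RQz t \<zeta>) s r = (if s = r \<and> s \<notin> P then 1 / (of_real (a s t - lh t) - \<zeta>) else 0)"
    and "ent (RQz t \<zeta> * M) s r = (if s \<notin> P then 1 / (of_real (a s t - lh t) - \<zeta>) * ent M s r else 0)"
    and "norm (RQz t \<zeta>) \<le> 1 / g"
proof -
  have b: "norm (if s \<in> P then 0 else 1 / (of_real (a s t - lh t) - \<zeta>)) \<le> 1 / g" for s
    using gap_inv[OF assms] g by auto
  show e: "ent (RQz t \<zeta>) s r = (if s = r \<and> s \<notin> P then 1 / (of_real (a s t - lh t) - \<zeta>) else 0)" for s r
    unfolding RQz_def ent_dg[OF b] by auto
  show "ent (RQz t \<zeta> * M) s r = (if s \<notin> P then 1 / (of_real (a s t - lh t) - \<zeta>) * ent M s r else 0)"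
    unfolding RQz_def ent_dg_mult[OF b] by auto
  show "norm (RQz t \<zeta>) \<le> 1 / g"
    using mat_bound_dg[OF b] ent_dg[OF b] by (intro norm_bmat_le) (simp add: RQz_def ent_dg[OF b, abs_def])
qed

lemma zeta_le: "norm (zeta \<theta>) \<le> 2 * d"
  using d_pos by simp

lemma RQ_eq: "t \<in> U \<Longrightarrow> RQ t \<theta> = (1 - Pr P) * R t \<theta>"
  by (rule bmat_eqI)
     (auto simp: RQ_def ent_RQz zeta_le less_imp_le[OF d_pos] left_diff_distrib ent_simps ent_Pr_mult ent_R Ra_diag
       intro!: Ra_off)

lemma R_minus_RQ: "t \<in> U \<Longrightarrow> R t \<theta> - RQ t \<theta> = Pr P * R t \<theta>"
  by (simp add: RQ_eq algebra_simps)

lemma R_minus_RQ_right: "t \<in> U \<Longrightarrow> R t \<theta> - RQ t \<theta> = R t \<theta> * Pr P"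
  unfolding R_minus_RQ
  by (rule bmat_eqI) (auto simp: ent_Pr_mult ent_R intro: Ra_off Ra_off[symmetric])

text \<open>For bounded \<open>t\<close> the weight is controlled by \<open>1 + a m t\<close>, and a
  gap of at least 1 absorbs the bounded terms \<open>lh t\<close> and \<zeta>. This keeps the
  weighted resolvent bounded although the weights are not.\<close>

lemma growth:
  assumes t: "t \<in> U" and \<zeta>: "cmod \<zeta> \<le> 2 * d" and m: "m \<notin> P"
  shows "wt m ^ l \<le> (2 + 2 * T\<^sup>2) ^ l * (2 ^ l * (2 + L + 2 * d)) * norm (of_real (a m t - lh t) - \<zeta>)"
proof -
  let ?b = "norm (of_real (a m t - lh t) - \<zeta>)" and ?p = "pn m t"
  have L0: "0 \<le> L" using L[OF t] by linarith
  have "norm (lvec m) \<le> ?p + norm t"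
    using norm_triangle_ineq4[of "lvec m + t" t] by (simp add: pn_def Pv_def)
  then have lm: "norm (lvec m) \<le> ?p + T" using T[OF t] by linarith
  have "(norm (lvec m))\<^sup>2 \<le> (?p + T)\<^sup>2" using lm by (intro power_mono) auto
  also have "\<dots> \<le> 2 * ?p\<^sup>2 + 2 * T\<^sup>2"
    using zero_le_power2[of "?p - T"] by (simp add: power2_eq_square algebra_simps)
  finally have lv: "(norm (lvec m))\<^sup>2 \<le> 2 * ?p\<^sup>2 + 2 * T\<^sup>2" .
  have "wt m \<le> (2 + 2 * T\<^sup>2) * (1 + ?p\<^sup>2)"
  proof -
    have "0 \<le> T\<^sup>2 * ?p\<^sup>2" by simp
    moreover have "(2 + 2 * T\<^sup>2) * (1 + ?p\<^sup>2) = 2 + 2 * T\<^sup>2 + 2 * ?p\<^sup>2 + 2 * (T\<^sup>2 * ?p\<^sup>2)"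
      by (simp add: algebra_simps)
    ultimately show ?thesis using lv unfolding wt_def by linarith
  qed
  then have "wt m ^ l \<le> ((2 + 2 * T\<^sup>2) * (1 + ?p\<^sup>2)) ^ l"
    using wt_ge(2)[of m] by (intro power_mono) auto
  also have "\<dots> = (2 + 2 * T\<^sup>2) ^ l * (1 + ?p\<^sup>2) ^ l" by (rule power_mult_distrib)
  also have "\<dots> \<le> (2 + 2 * T\<^sup>2) ^ l * (2 ^ l * (1 + a m t))"
    using one_plus_power_le[of "?p\<^sup>2" l]
    by (intro mult_left_mono) (auto simp: a_def power_mult[symmetric])
  also have "\<dots> \<le> (2 + 2 * T\<^sup>2) ^ l * (2 ^ l * ((2 + L + 2 * d) * ?b))"
  proof (intro mult_left_mono)
    have "of_real (a m t) = (of_real (a m t - lh t) - \<zeta>) + of_real (lh t) + \<zeta>" by simp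
    then have "norm (of_real (a m t) :: complex) \<le> ?b + norm (of_real (lh t) :: complex) + cmod \<zeta>"
      by (metis norm_triangle_ineq norm_triangle_mono order_refl)
    then have "a m t \<le> ?b + L + 2 * d"
      using L[OF t] \<zeta> unfolding norm_of_real by linarith
    moreover have "1 * (1 + L + 2 * d) \<le> ?b * (1 + L + 2 * d)"
      using gap[OF t \<zeta> m] g L0 d_pos by (intro mult_right_mono) auto
    ultimately show "1 + a m t \<le> (2 + L + 2 * d) * ?b" by (simp add: algebra_simps)
  qed auto
  finally show ?thesis by (simp add: mult.assoc)
qed

lemma nz: "t \<in> U \<Longrightarrow> m \<notin> P \<Longrightarrow> of_real (a m t - lh t) - zeta \<theta> \<noteq> 0"
  by (rule gap_nz) (use d_pos in auto)

lemma C1p_R: "C1p U {0..1} R"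
proof -
  define w where "w = max (wt j ^ l) (wt (j - q) ^ l)"
  define Kd where "Kd = (2 + 2 * T\<^sup>2) ^ l * (2 ^ l * (2 + L + 2 * d))"
  \<comment> \<open>The resolvent with weighted rows, which is the inverse of \<open>G\<close>;
    multiplication by \<open>S1\<close> at the end removes the weights.\<close>
  define Gi where "Gi t \<theta> = Bmat (\<lambda>s r. of_real (wt s ^ l) * Ra t (zeta \<theta>) s r)" for t \<theta>
  have Kd: "0 \<le> Kd" if "t \<in> U" for t
    using L[OF that] d_pos unfolding Kd_def by (intro mult_nonneg_nonneg) auto
  have w: "wt s ^ l \<le> w" "0 \<le> w" if "s \<in> P" for s
    using that wt_ge(2) by (auto simp: w_def P_def le_max_iff_disj less_imp_le)
  have bd: "mat_bound (\<lambda>s r. of_real (wt s ^ l) * Ra t (zeta \<theta>) s r) (real (card P) * (w * (2 / d)) + Kd)"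
    if t: "t \<in> U" for t \<theta>
  proof (intro mat_bound_block P)
    show "of_real (wt s ^ l) * Ra t (zeta \<theta>) s r = 0" if "s \<noteq> r" "\<not> (s \<in> P \<and> r \<in> P)" for s r
      using Ra_off[OF that] by simp
    show "norm (of_real (wt s ^ l) * Ra t (zeta \<theta>) s s) \<le> Kd" if s: "s \<notin> P" for s
      using growth[OF t zeta_le s, of \<theta>] nz[OF t s, of \<theta>] wt_ge(2)[of s]
      by (simp add: Ra_diag s norm_mult norm_divide norm_power Kd_def divide_le_eq)
    show "norm (of_real (wt s ^ l) * Ra t (zeta \<theta>) s r) \<le> w * (2 / d)" if "s \<in> P" "r \<in> P" for s r
      using Ra_block_le[OF norm_zeta that] w[OF that(1)] wt_ge(2)[of s]
      unfolding norm_mult norm_of_real by (intro mult_mono) auto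
    show "0 \<le> Kd" "0 \<le> w * (2 / d)" using Kd[OF t] w[OF P(3)] d_pos by auto
  qed
  have ent_Gi: "ent (Gi t \<theta>) s r = of_real (wt s ^ l) * Ra t (zeta \<theta>) s r" if "t \<in> U" for t \<theta> s r
    unfolding Gi_def ent_Bmat[OF bd[OF that]] ..
  have "C1p U {0..1} Gi"
  proof (rule C1p_inverse[OF U(1) C1p_G])
    fix t \<theta> assume t: "t \<in> U"
    note zz = zeta_nz eS_nz[OF eq_refl[OF norm_zeta]] nz[OF t]
    show "G t \<theta> * Gi t \<theta> = 1"
    proof (rule bmat_eqI)
      fix s r
      have "ent (G t \<theta> * Gi t \<theta>) s r = mmul (Ha t (zeta \<theta>)) (Ra t (zeta \<theta>)) s r"
        using wt_ge(3) by (simp add: ent_mult ent_G ent_Gi[OF t] mmul_def)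
      then show "ent (G t \<theta> * Gi t \<theta>) s r = ent 1 s r"
        using Ha_Ra[OF zz] by (simp add: ent_one)
    qed
    show "Gi t \<theta> * G t \<theta> = 1"
    proof (rule bmat_eqI)
      fix s r
      have "ent (Gi t \<theta> * G t \<theta>) s r
          = (\<Sum>\<^sub>\<infinity>m. (of_real (wt s ^ l) / of_real (wt r ^ l)) * (Ra t (zeta \<theta>) s m * Ha t (zeta \<theta>) m r))"
        by (simp add: ent_mult ent_G ent_Gi[OF t] mult.assoc)
      also have "\<dots> = (of_real (wt s ^ l) / of_real (wt r ^ l)) * mmul (Ra t (zeta \<theta>)) (Ha t (zeta \<theta>)) s r"
        unfolding mmul_def by (rule infsum_cmult_right')
      also have "mmul (Ra t (zeta \<theta>)) (Ha t (zeta \<theta>)) = mone"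
        by (rule Ra_Ha[OF zz])
      also have "(of_real (wt s ^ l) / of_real (wt r ^ l)) * mone s r = mone s r"
        using wt_ge(3)[of r] by (simp add: mone_def)
      finally show "ent (Gi t \<theta> * G t \<theta>) s r = ent 1 s r" by (simp add: ent_one)
    qed
    show "norm (Gi t \<theta>) \<le> real (card P) * (w * (2 / d)) + Kd"
      using bd[OF t, of \<theta>] by (intro norm_bmat_le) (simp add: ent_Gi[OF t, abs_def])
  qed
  then have "C1p U {0..1} (\<lambda>t \<theta>. S1 * Gi t \<theta>)"
    by (intro C1p_mult C1p_param continuous_intros)
  then show ?thesis
  proof (rule C1p_cong[OF U(1), rotated])
    fix t \<theta> assume t: "t \<in> U"
    show "S1 * Gi t \<theta> = R t \<theta>"
      using wt_ge(3) by (intro bmat_eqI) (simp add: ent_S1_mult ent_Gi[OF t] ent_R[OF t])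
  qed
qed

lemma C1p_RQ: "C1p U {0..1} RQ"
proof -
  have "C1p U {0..1} (\<lambda>t \<theta>. (1 - Pr P) * R t \<theta>)"
    by (intro C1p_mult C1p_param continuous_intros C1p_R)
  then show ?thesis by (rule C1p_cong[OF U(1), rotated]) (simp add: RQ_eq)
qed

text \<open>The factor 2 counts the entries in a row of the block.\<close>

definition \<kappa> where "\<kappa> = 2 * (\<kappa>1 / d\<^sup>2) + \<kappa>2"

lemma kappa_nonneg: "0 \<le> \<kappa>"
  using \<kappa> unfolding \<kappa>_def by simp

lemma R_lipschitz:
  assumes t: "t \<in> U" "t' \<in> U"
  shows "norm (R t \<theta> - R t' \<theta>) \<le> \<kappa> * norm (t - t')"
proof (rule norm_bmat_le)
  have "mat_bound (\<lambda>s r. Ra t (zeta \<theta>) s r - Ra t' (zeta \<theta>) s r)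
      (real (card P) * (\<kappa>1 * norm (t - t') / d\<^sup>2) + \<kappa>2 * norm (t - t'))"
  proof (intro mat_bound_block P)
    show "Ra t (zeta \<theta>) s r - Ra t' (zeta \<theta>) s r = 0" if "s \<noteq> r" "\<not> (s \<in> P \<and> r \<in> P)" for s r
      using Ra_off[OF that] by simp
    show "norm (Ra t (zeta \<theta>) s s - Ra t' (zeta \<theta>) s s) \<le> \<kappa>2 * norm (t - t')" if "s \<notin> P" for s
      using QL[OF t norm_zeta that] that by (simp add: Ra_diag)
    show "norm (Ra t (zeta \<theta>) s r - Ra t' (zeta \<theta>) s r) \<le> \<kappa>1 * norm (t - t') / d\<^sup>2" if "s \<in> P" "r \<in> P" for s r
      by (rule order_trans[OF Ra_block_diff_le[OF norm_zeta that] divide_right_mono[OF DL[OF t]]]) simp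
  qed (use \<kappa> in auto)
  then show "mat_bound (ent (R t \<theta> - R t' \<theta>)) (\<kappa> * norm (t - t'))"
    using P by (simp add: minus_bmat.rep_eq ent_R t \<kappa>_def algebra_simps)
qed

lemma RQ_lipschitz:
  assumes t: "t \<in> U" "t' \<in> U"
  shows "norm (RQ t \<theta> - RQ t' \<theta>) \<le> \<kappa> * norm (t - t')"
proof (rule norm_bmat_le)
  have "mat_bound (\<lambda>s r. ent (RQ t \<theta>) s r - ent (RQ t' \<theta>) s r) (real (card ({} :: (int ^ 'n) set)) * 0 + \<kappa>2 * norm (t - t'))"
  proof (intro mat_bound_block)
    show "norm (ent (RQ t \<theta>) s s - ent (RQ t' \<theta>) s s) \<le> \<kappa>2 * norm (t - t')" for s
      using QL[OF t norm_zeta, of s] \<kappa> by (simp add: RQ_def ent_RQz t zeta_le less_imp_le[OF d_pos])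
  qed (use \<kappa> in \<open>auto simp: RQ_def ent_RQz t zeta_le less_imp_le[OF d_pos]\<close>)
  moreover have "\<kappa>2 * norm (t - t') \<le> \<kappa> * norm (t - t')"
    using \<kappa> by (intro mult_right_mono) (auto simp: \<kappa>_def)
  ultimately show "mat_bound (ent (RQ t \<theta> - RQ t' \<theta>)) (\<kappa> * norm (t - t'))"
    by (auto simp: minus_bmat.rep_eq intro: mat_bound_mono)
qed

end

section \<open>Contour integrals and the spectral projection of the model\<close>

text \<open>The difference \<open>A - B\<close> stands between powers of \<open>B\<close> and powers
  of \<open>A\<close>; when it has finite rank, so does every term.\<close>

lemma power_telescope:
  fixes A B :: "'a::ring_1"
  shows "A ^ n - B ^ n = (\<Sum>i<n. B ^ (n - 1 - i) * (A - B) * A ^ i)"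
proof (induction n)
  case (Suc n)
  have "A ^ Suc n - B ^ Suc n = B * (A ^ n - B ^ n) + (A - B) * A ^ n"
    by (simp add: algebra_simps)
  also have "B * (A ^ n - B ^ n) = (\<Sum>i<n. B ^ (Suc n - 1 - i) * (A - B) * A ^ i)"
    unfolding Suc sum_distrib_left
  proof (intro sum.cong refl)
    fix i assume "i \<in> {..<n}"
    then have "Suc n - 1 - i = Suc (n - 1 - i)" by auto
    then show "B * (B ^ (n - 1 - i) * (A - B) * A ^ i) = B ^ (Suc n - 1 - i) * (A - B) * A ^ i"
      by (simp add: mult.assoc)
  qed
  finally show ?case by simp
qed simp

lemma holomorphic_if:
  "(b \<Longrightarrow> f holomorphic_on A) \<Longrightarrow> (\<not> b \<Longrightarrow> g holomorphic_on A) \<Longrightarrow> (\<lambda>z. if b then f z else g z) holomorphic_on A"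
  by (cases b) auto

context model
begin

lemma path_image_C1: "z \<in> path_image (C1 l V q j e t) \<longleftrightarrow> (\<exists>\<theta>\<in>{0..1}. z = of_real (lh t) + zeta \<theta>)"
  by (auto simp: C1_def path_image_def circlepath zeta_def d_def scaleR_conv_of_real mult_ac)

lemma contour_circle_zeta:
  "contour_integral (circlepath x d) f = 2 * of_real pi * \<i> * integral {0..1} (\<lambda>\<theta>. zeta \<theta> * f (x + zeta \<theta>))"
proof -
  have c: "circlepath x d \<theta> = x + zeta \<theta>" for \<theta>
    by (simp add: circlepath zeta_def mult_ac)
  have "contour_integral (circlepath x d) f =
      integral {0..1} (\<lambda>\<theta>. 2 * of_real pi * \<i> * (zeta \<theta> * f (x + zeta \<theta>)))"
    unfolding contour_integral_integral vector_derivative_circlepath c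
    by (rule integral_cong) (simp add: zeta_def mult_ac)
  then show ?thesis by simp
qed

lemma contour_C1:
  "contour_integral (C1 l V q j e t) f =
     2 * of_real pi * \<i> * integral {0..1} (\<lambda>\<theta>. zeta \<theta> * f (of_real (lh t) + zeta \<theta>))"
  using contour_circle_zeta[of "of_real (lh t)" f] by (simp add: C1_def d_def)

lemma integral_zeta_holomorphic:
  assumes "f holomorphic_on ball 0 (2 * d)"
  shows "integral {0..1} (\<lambda>\<theta>. zeta \<theta> * f (zeta \<theta>)) = 0"
proof -
  have "(f has_contour_integral 0) (circlepath 0 d)"
    by (rule Cauchy_theorem_disc_simple[OF assms]) (use d_pos in auto)
  then have "contour_integral (circlepath 0 d) f = 0" by (rule contour_integral_unique)
  then show ?thesis using contour_circle_zeta[of 0 f] by simp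
qed

text \<open>A block entry is \<open>h(\<zeta>) / \<zeta>\<close> with \<open>h\<close> holomorphic
  on the closed disc, as the second eigenvalue lies outside. Cauchy's formula returns the residue
  \<open>h 0\<close>.\<close>

lemma integral_zeta_block:
  assumes "s \<in> P" "r \<in> P"
  shows "integral {0..1} (\<lambda>\<theta>. zeta \<theta> * Ra t (zeta \<theta>) s r) = - num t 0 s r / of_real (e * S t)"
proof -
  define h where "h \<zeta> = - (num t \<zeta> s r / (of_real (e * S t) + \<zeta>))" for \<zeta>
  have "(\<lambda>\<zeta>. num t \<zeta> s r) holomorphic_on cball 0 d"
    unfolding num_def by (intro holomorphic_if holomorphic_intros)
  then have h: "h holomorphic_on cball 0 d"
    unfolding h_def[abs_def] using eS_nz by (intro holomorphic_intros) auto
  have "((\<lambda>u. h u / (u - 0)) has_contour_integral 2 * of_real pi * \<i> * h 0) (circlepath 0 d)"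
    by (rule Cauchy_integral_circlepath_simple[OF h]) (use d_pos in auto)
  then have "contour_integral (circlepath 0 d) (\<lambda>u. h u / u) = 2 * of_real pi * \<i> * h 0"
    by (simp add: contour_integral_unique)
  then have "2 * of_real pi * \<i> * integral {0..1} (\<lambda>\<theta>. zeta \<theta> * (h (zeta \<theta>) / zeta \<theta>)) = 2 * of_real pi * \<i> * h 0"
    unfolding contour_circle_zeta[of 0] add_0 .
  then have "integral {0..1} (\<lambda>\<theta>. zeta \<theta> * (h (zeta \<theta>) / zeta \<theta>)) = h 0"
    by (subst (asm) mult_left_cancel) auto
  then show ?thesis
    unfolding Ra_block[OF assms] h_def by simp
qed

text \<open>Minus the residue of \<open>Ra\<close> at \<open>\<zeta> = 0\<close>, an explicit form
  of the spectral projection.\<close>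

definition Eh :: "real ^ 'n \<Rightarrow> 'n mat" where
  "Eh t s r = (if s \<in> P \<and> r \<in> P then num t 0 s r / of_real (e * S t) else 0)"

lemma Hq_eigen:
  assumes w: "\<And>s. s \<notin> P \<Longrightarrow> w s = 0"
  shows "(\<forall>s. (\<Sum>\<^sub>\<infinity>r. Hq l V q j t s r * w r) = of_real (lh t) * w s) \<longleftrightarrow>
    vq * w (j - q) = of_real ((e * S t - D t) / 2) * w j \<and>
    cnj vq * w j = of_real ((e * S t + D t) / 2) * w (j - q)"
proof -
  have H: "Hq l V q j t s r = Ha t 0 s r + of_real (lh t) * mone s r" for s r
    by (simp add: Ha_def)
  have off: "Hq l V q j t s m = 0" if "s \<noteq> m" "\<not> (s \<in> P \<and> m \<in> P)" for s m
    using that Ha_off[of s m] by (simp add: H mone_def)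
  have row: "(\<Sum>\<^sub>\<infinity>r. Hq l V q j t s r * w r) =
     (if s \<in> P then Hq l V q j t s j * w j + Hq l V q j t s (j - q) * w (j - q) else 0)" for s
    using infsum_block_row[of P s "Hq l V q j t" w, OF P(1) off] w by (simp add: sum_P)
  have "(\<forall>s. (\<Sum>\<^sub>\<infinity>r. Hq l V q j t s r * w r) = of_real (lh t) * w s) \<longleftrightarrow>
    (\<forall>s\<in>P. Hq l V q j t s j * w j + Hq l V q j t s (j - q) * w (j - q) = of_real (lh t) * w s)"
    unfolding row using w by auto
  also have "\<dots> \<longleftrightarrow> Ha t 0 j j * w j + Ha t 0 j (j - q) * w (j - q) = 0 \<and>
      Ha t 0 (j - q) j * w j + Ha t 0 (j - q) (j - q) * w (j - q) = 0"
    using j_ne by (simp add: P_def H mone_def algebra_simps)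
  also have "\<dots> \<longleftrightarrow> vq * w (j - q) = of_real ((e * S t - D t) / 2) * w j \<and>
    cnj vq * w j = of_real ((e * S t + D t) / 2) * w (j - q)"
  proof -
    have "Ha t 0 j j = - of_real ((e * S t - D t) / 2)" "Ha t 0 j (j - q) = vq"
      "Ha t 0 (j - q) j = cnj vq" "Ha t 0 (j - q) (j - q) = - of_real ((e * S t + D t) / 2)"
      using j_ne by (simp_all add: Ha_ent field_simps)
    then show ?thesis by (auto simp: algebra_simps)
  qed
  finally show ?thesis .
qed

text \<open>A unit eigenvector is determined only up to a phase, which cancels in
  \<open>w s * cnj (w r)\<close>. With \<open>\<mu> + \<nu> = e S\<close> and
  \<open>\<mu> \<nu> = |v_q|^2\<close>, the eigenvalue equations and the normalisation fix both
  squared moduli and the mixed product.\<close>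

lemma E_hat_eq: "E_hat l V q j e t = Eh t"
proof -
  define \<mu> \<nu> where "\<mu> = (e * S t - D t) / 2" and "\<nu> = (e * S t + D t) / 2"
  have munu: "\<mu> * \<nu> = (norm vq)\<^sup>2"
  proof -
    have "\<mu> * \<nu> = ((e * e) * (S t)\<^sup>2 - (D t)\<^sup>2) / 4"
      by (simp add: \<mu>_def \<nu>_def field_simps power2_eq_square)
    then show ?thesis using S_ge(3)[of t] ee by simp
  qed
  have nz: "\<mu> \<noteq> 0" "\<nu> \<noteq> 0" using munu v by auto
  have sum: "\<mu> + \<nu> = e * S t" by (simp add: \<mu>_def \<nu>_def field_simps)
  have eS: "e * S t \<noteq> 0" using S_ge(4)[of t] ee by auto
  \<comment> \<open>\<nu> itself is negative for \<open>e = -1\<close>; its quotient by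
    \<open>e S\<close> is not, because \<open>|D| \<le> S\<close>. The quotient is the squared
    modulus of the component at \<open>j\<close>.\<close>
  have pos: "0 \<le> \<nu> / (e * S t)"
    using e S_ge(2,4)[of t] by (auto simp: \<nu>_def divide_simps)
  have Eh: "Eh t j j = of_real (\<nu> / (e * S t))" "Eh t j (j - q) = vq / of_real (e * S t)"
    "Eh t (j - q) j = cnj vq / of_real (e * S t)" "Eh t (j - q) (j - q) = of_real (\<mu> / (e * S t))"
    using j_ne P by (simp_all add: Eh_def num_def \<mu>_def \<nu>_def field_simps)
  let ?Q = "\<lambda>w. (\<forall>s. s \<notin> {j, j - q} \<longrightarrow> w s = 0) \<and> (\<Sum>s\<in>{j, j - q}. (norm (w s))\<^sup>2) = 1 \<and>
      (\<forall>s. (\<Sum>\<^sub>\<infinity>r. Hq l V q j t s r * w r) = of_real (lh t) * w s)"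
  have Q: "?Q w \<longleftrightarrow> (\<forall>s. s \<notin> P \<longrightarrow> w s = 0) \<and> (norm (w j))\<^sup>2 + (norm (w (j - q)))\<^sup>2 = 1 \<and>
      vq * w (j - q) = of_real \<mu> * w j \<and> cnj vq * w j = of_real \<nu> * w (j - q)" for w :: "int ^ 'n \<Rightarrow> complex"
    using Hq_eigen[of w t] j_ne unfolding P_def[symmetric] \<mu>_def \<nu>_def by (auto simp: sum_P)
  have uniq: "(\<lambda>s r. w s * cnj (w r)) = Eh t" if "?Q w" for w
  proof -
    define x y where "x = w j" and "y = w (j - q)"
    have w: "\<And>s. s \<notin> P \<Longrightarrow> w s = 0" "(norm x)\<^sup>2 + (norm y)\<^sup>2 = 1" "vq * y = of_real \<mu> * x" "cnj vq * x = of_real \<nu> * y"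
      using that unfolding Q x_def y_def by auto
    have "(norm vq)\<^sup>2 * (norm y)\<^sup>2 = \<mu>\<^sup>2 * (norm x)\<^sup>2"
      using arg_cong[OF w(3), of "\<lambda>z. (norm z)\<^sup>2"] by (simp add: norm_mult power_mult_distrib)
    then have "\<mu> * (\<nu> * (norm y)\<^sup>2) = \<mu> * (\<mu> * (norm x)\<^sup>2)"
      unfolding munu[symmetric] by (simp only: power2_eq_square[of \<mu>] mult.assoc)
    then have ny: "\<nu> * (norm y)\<^sup>2 = \<mu> * (norm x)\<^sup>2" using nz by simp
    have "(\<mu> + \<nu>) * (norm x)\<^sup>2 = \<nu> * ((norm x)\<^sup>2 + (norm y)\<^sup>2)"
      using ny by (simp add: algebra_simps)
    then have x2: "(norm x)\<^sup>2 = \<nu> / (e * S t)" using w(2) sum eS by (simp add: field_simps)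
    have "(\<mu> + \<nu>) * (norm y)\<^sup>2 = \<mu> * ((norm x)\<^sup>2 + (norm y)\<^sup>2)"
      using ny by (simp add: algebra_simps)
    then have y2: "(norm y)\<^sup>2 = \<mu> / (e * S t)" using w(2) sum eS by (simp add: field_simps)
    have xx: "x * cnj x = of_real (\<nu> / (e * S t))" "y * cnj y = of_real (\<mu> / (e * S t))"
      using x2 y2 by (simp_all only: complex_norm_square[symmetric])
    have "of_real \<mu> * (x * cnj y) = vq * (y * cnj y)" using w(3) by (metis mult.assoc)
    also have "\<dots> = of_real \<mu> * (vq / of_real (e * S t))" unfolding xx by simp
    finally have xy: "x * cnj y = vq / of_real (e * S t)"
      using nz by (simp only: mult_left_cancel of_real_eq_0_iff not_False_eq_True)
    have yx: "y * cnj x = cnj vq / of_real (e * S t)"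
      using arg_cong[OF xy, of cnj] by (simp add: mult.commute)
    show ?thesis
    proof (intro ext)
      fix s r
      show "w s * cnj (w r) = Eh t s r"
      proof (cases "s \<in> P \<and> r \<in> P")
        case True
        then have "s = j \<or> s = j - q" "r = j \<or> r = j - q" by (auto simp: P_def)
        then show ?thesis using xx xy yx Eh unfolding x_def y_def by (elim disjE) simp_all
      next
        case False
        then show ?thesis using w(1) by (auto simp: Eh_def)
      qed
    qed
  qed
  define x where "x = sqrt (\<nu> / (e * S t))"
  define w :: "int ^ 'n \<Rightarrow> complex" where
    "w s = (if s = j then of_real x else if s = j - q then cnj vq * of_real x / of_real \<nu> else 0)" for s
  have "?Q w"
    unfolding Q
  proof (intro conjI)
    have x2: "x\<^sup>2 = \<nu> / (e * S t)" using pos by (simp add: x_def)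
    have "(norm (w j))\<^sup>2 + (norm (w (j - q)))\<^sup>2 = x\<^sup>2 + (norm vq)\<^sup>2 * x\<^sup>2 / \<nu>\<^sup>2"
      using j_ne by (simp add: w_def norm_mult norm_divide power_mult_distrib power_divide)
    also have "\<dots> = x\<^sup>2 * ((\<mu> + \<nu>) / \<nu>)"
      unfolding munu[symmetric] using nz by (simp add: field_simps power2_eq_square)
    also have "\<dots> = 1" unfolding x2 sum using nz eS by simp
    finally show "(norm (w j))\<^sup>2 + (norm (w (j - q)))\<^sup>2 = 1" .
    have "vq * cnj vq = of_real (\<mu> * \<nu>)"
      by (simp only: munu complex_norm_square)
    then show "vq * w (j - q) = of_real \<mu> * w j"
      using nz j_ne by (simp add: w_def field_simps)
    show "cnj vq * w j = of_real \<nu> * w (j - q)"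
      using nz j_ne by (simp add: w_def)
  qed (auto simp: w_def P_def)
  show ?thesis
    unfolding E_hat_def
  proof (rule the_equality)
    show "\<exists>w. (\<forall>s. s \<notin> {j, j - q} \<longrightarrow> w s = 0) \<and> (\<Sum>s\<in>{j, j - q}. (norm (w s))\<^sup>2) = 1 \<and>
      (\<forall>s. (\<Sum>\<^sub>\<infinity>r. Hq l V q j t s r * w r) = of_real (lh t) * w s) \<and> Eh t = (\<lambda>s r. w s * cnj (w r))"
      using \<open>?Q w\<close> uniq[OF \<open>?Q w\<close>] by (intro exI[of _ w]) simp
    show "E = Eh t" if "\<exists>w. (\<forall>s. s \<notin> {j, j - q} \<longrightarrow> w s = 0) \<and> (\<Sum>s\<in>{j, j - q}. (norm (w s))\<^sup>2) = 1 \<and>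
      (\<forall>s. (\<Sum>\<^sub>\<infinity>r. Hq l V q j t s r * w r) = of_real (lh t) * w s) \<and> E = (\<lambda>s r. w s * cnj (w r))" for E
      using that uniq by blast
  qed
qed

end

context model_gap
begin

lemma resolv_zeta: "t \<in> U \<Longrightarrow> resolv l V q j t (of_real (lh t) + zeta \<theta>) = ent (R t \<theta>)"
  using resolv_eq[OF zeta_nz eS_nz[OF eq_refl[OF norm_zeta]] nz] by (simp add: ent_R)

text \<open>Outside the block the resolvent has no pole in the disc. An entry of a power is an
  infinite sum of holomorphic functions with a summable majorant; the theorem on uniform limits asks
  for continuity on the closed disc, so both properties are carried through the induction, for all
  entries at once.\<close>

lemma holomorphic_RQY_power:
  assumes t: "t \<in> U"
  shows "continuous_on (cball 0 (2 * d)) (\<lambda>\<zeta>. ent ((RQz t \<zeta> * Y) ^ n) s r) \<and>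
    (\<lambda>\<zeta>. ent ((RQz t \<zeta> * Y) ^ n) s r) holomorphic_on ball 0 (2 * d)"
proof (induction n arbitrary: s r)
  case 0
  show ?case by simp
next
  case (Suc n)
  let ?C = "cball 0 (2 * d) :: complex set" and ?B = "ball 0 (2 * d) :: complex set"
  let ?k = "(norm Y / g) ^ n"
  let ?f = "\<lambda>\<zeta>. \<Sum>\<^sub>\<infinity>m. ent Y s m * ent ((RQz t \<zeta> * Y) ^ n) m r"
  have k: "norm (ent ((RQz t \<zeta> * Y) ^ n) m r) \<le> ?k" if "\<zeta> \<in> ?C" for \<zeta> m
  proof -
    have "norm (RQz t \<zeta>) \<le> 1 / g" using ent_RQz(3)[OF t, of \<zeta>] that by simp
    then have "norm (RQz t \<zeta> * Y) \<le> 1 / g * norm Y"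
      by (rule order_trans[OF norm_mult_ineq mult_right_mono]) simp
    then have "norm (RQz t \<zeta> * Y) \<le> norm Y / g" by simp
    then have "norm (RQz t \<zeta> * Y) ^ n \<le> ?k" by (rule power_mono) simp
    with norm_power_ineq have "norm ((RQz t \<zeta> * Y) ^ n) \<le> ?k" by (rule order_trans)
    with norm_ent_le show ?thesis by (rule order_trans)
  qed
  have "uniform_limit ?C (\<lambda>F \<zeta>. \<Sum>m\<in>F. ent Y s m * ent ((RQz t \<zeta> * Y) ^ n) m r) ?f (finite_subsets_at_top UNIV)"
  proof (rule Weierstrass_m_test_general)
    show "norm (ent Y s m * ent ((RQz t \<zeta> * Y) ^ n) m r) \<le> norm (ent Y s m) * ?k" if "\<zeta> \<in> ?C" for m \<zeta>
      using k[OF that] by (simp add: norm_mult mult_left_mono)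
    show "(\<lambda>m. norm (ent Y s m) * ?k) summable_on UNIV"
      by (intro summable_on_cmult_left ent_summable)
  qed
  then obtain "continuous_on ?C ?f" "?f holomorphic_on ?B"
  proof (rule holomorphic_uniform_limit[rotated])
    show "\<forall>\<^sub>F F in finite_subsets_at_top UNIV. continuous_on ?C (\<lambda>\<zeta>. \<Sum>m\<in>F. ent Y s m * ent ((RQz t \<zeta> * Y) ^ n) m r) \<and>
        (\<lambda>\<zeta>. \<Sum>m\<in>F. ent Y s m * ent ((RQz t \<zeta> * Y) ^ n) m r) holomorphic_on ?B"
      using Suc by (intro always_eventually allI conjI continuous_intros holomorphic_intros) auto
  qed auto
  note f = this
  let ?h = "\<lambda>\<zeta>. 1 / (of_real (a s t - lh t) - \<zeta>)"
  have eq: "ent ((RQz t \<zeta> * Y) ^ Suc n) s r = (if s \<notin> P then ?h \<zeta> * ?f \<zeta> else 0)"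
    if "\<zeta> \<in> ?C" for \<zeta>
  proof -
    have "(RQz t \<zeta> * Y) ^ Suc n = RQz t \<zeta> * (Y * (RQz t \<zeta> * Y) ^ n)" by (simp add: mult.assoc)
    moreover have "ent (RQz t \<zeta> * (Y * (RQz t \<zeta> * Y) ^ n)) s r =
        (if s \<notin> P then ?h \<zeta> * ent (Y * (RQz t \<zeta> * Y) ^ n) s r else 0)"
      by (rule ent_RQz(2)[OF t]) (use that in simp)
    ultimately show ?thesis by (simp only: ent_mult[of Y])
  qed
  have ch: "continuous_on ?C (\<lambda>\<zeta>. if s \<notin> P then ?h \<zeta> * ?f \<zeta> else 0) \<and>
      (\<lambda>\<zeta>. if s \<notin> P then ?h \<zeta> * ?f \<zeta> else 0) holomorphic_on ?B"
  proof (cases "s \<in> P")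
    case False
    have nz: "of_real (a s t - lh t) - \<zeta> \<noteq> 0" if "\<zeta> \<in> ?C" for \<zeta>
      using gap_nz[OF t _ False] that by simp
    have "continuous_on ?C (\<lambda>\<zeta>. ?h \<zeta> * ?f \<zeta>)"
      by (intro continuous_on_mult f continuous_on_divide continuous_on_const continuous_on_diff continuous_on_id ballI nz)
    moreover have "(\<lambda>\<zeta>. ?h \<zeta> * ?f \<zeta>) holomorphic_on ?B"
      by (intro holomorphic_on_mult f holomorphic_on_divide holomorphic_on_const holomorphic_on_diff holomorphic_on_ident)
         (rule nz, simp)
    ultimately show ?thesis using False by (simp only: if_True not_False_eq_True simp_thms)
  qed simp
  show ?case
  proof
    show "continuous_on ?C (\<lambda>\<zeta>. ent ((RQz t \<zeta> * Y) ^ Suc n) s r)"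
      by (rule continuous_on_eq[OF conjunct1[OF ch]]) (rule eq[symmetric])
    show "(\<lambda>\<zeta>. ent ((RQz t \<zeta> * Y) ^ Suc n) s r) holomorphic_on ?B"
      by (rule holomorphic_transform[OF conjunct2[OF ch]]) (rule eq[symmetric], simp)
  qed
qed

text \<open>Hence powers of \<open>RQ Y\<close> may be subtracted from powers of \<open>R Y\<close>
  under the contour integral at no cost.\<close>

lemma integral_zeta_RQY:
  assumes "t \<in> U"
  shows "integral {0..1} (\<lambda>\<theta>. zeta \<theta> * ent ((RQ t \<theta> * Y) ^ n) s r) = 0"
  using integral_zeta_holomorphic[OF conjunct2[OF holomorphic_RQY_power[OF assms]]] unfolding RQ_def .

lemma integral_R: 
  assumes t: "t \<in> U"
  shows "integral {0..1} (\<lambda>\<theta>. zeta \<theta> * ent (R t \<theta>) s r) = - Eh t s r"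
proof (cases "s \<in> P \<and> r \<in> P")
  case True
  then show ?thesis by (simp add: ent_R[OF t] integral_zeta_block Eh_def)
next
  case False
  have "(\<lambda>\<zeta>. if s = r then 1 / (of_real (a s t - lh t) - \<zeta>) else 0) holomorphic_on ball 0 (2 * d)"
    if "s = r"
  proof -
    have "s \<notin> P" using that False by simp
    then show ?thesis
      using gap_nz[OF t _ \<open>s \<notin> P\<close>] that by (auto intro!: holomorphic_intros simp del: of_real_diff)
  qed
  from integral_zeta_holomorphic[OF this]
  have "integral {0..1} (\<lambda>\<theta>. zeta \<theta> * (if s = r then 1 / (of_real (a s t - lh t) - zeta \<theta>) else 0)) = 0"
    by (cases "s = r") auto
  moreover have "Ra t \<zeta> s r = (if s = r then 1 / (of_real (a s t - lh t) - \<zeta>) else 0)" for \<zeta>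
    using False Ra_off[of s r] by (auto simp: Ra_diag)
  moreover have "Eh t s r = 0" using False by (auto simp: Eh_def)
  ultimately show ?thesis by (simp add: ent_R[OF t])
qed

end

section \<open>The perturbation series\<close>

lemma two_pi_i_nz: "2 * of_real pi * \<i> \<noteq> (0 :: complex)"
  by simp

lemma divide_mult_cancel_self: "k \<noteq> 0 \<Longrightarrow> x / k * (k * y) = x * y" for x k y :: "'a::field"
  by simp

lemma uminus_power_scaleR: "(- x) ^ n = (-1) ^ n *\<^sub>R x ^ n" for x :: "'a::real_algebra_1"
  by (cases "even n") auto

text \<open>\<open>sm1\<close> and \<open>sm2\<close> make the squares of \<open>R Y\<close> and
  \<open>RQ Y\<close> at most 1/2 on the ball of radius \<beta>; \<open>sm3\<close> and
  \<open>sm4\<close> make the nonlinear map preserve this ball and contract. The resolvents are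
  bounded by \<open>4 / d + 1\<close> and the perturbations by \<open>v1 + 1\<close>.\<close>

locale model_pert = model_gap l V q j e U g \<kappa>1 \<kappa>2 T L
  for l :: nat and V :: "real ^ 'n \<Rightarrow> complex" and q j :: "int ^ 'n" and e :: real
    and U :: "(real ^ 'n) set" and g \<kappa>1 \<kappa>2 T L :: real +
  fixes v1 \<beta> c :: real
  assumes V1: "\<And>F. finite F \<Longrightarrow> (\<Sum>m\<in>F. cmod (fcoeff V m)) \<le> v1"
    and beta: "0 < \<beta>" "\<beta> \<le> 1"
    and sm1: "2 * (4 / d + 1) * (v1 + 1)\<^sup>2 / g + (4 / d + 1)\<^sup>2 * (v1 + 1) * \<beta> \<le> 1 / 2"
    and sm2: "((v1 + 1) / g)\<^sup>2 \<le> 1 / 2"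
    and sm3: "\<bar>c\<bar> * (d * (8 * (1 + (4 / d + 1) * (v1 + 1))) * (4 / d + 1))\<^sup>2 \<le> \<beta> / 2"
    and sm4: "\<bar>c\<bar> * (2 * (d * (8 * (1 + (4 / d + 1) * (v1 + 1))) * (4 / d + 1)) *
      (d * ((8 * (1 + (4 / d + 1) * (v1 + 1)))\<^sup>2 * (v1 + 1 + (4 / d + 1)) * (4 / d + 1)
        + 8 * (1 + (4 / d + 1) * (v1 + 1))))) \<le> 1 / 2"
begin

section \<open>Smallness of the square of \<open>R Y\<close>\<close>

abbreviation "bb \<equiv> 4 / d + 1"
abbreviation "yy \<equiv> v1 + 1"

definition Vop :: "(int ^ 'n) bmat" where "Vop = Bmat (\<lambda>s r. fcoeff V (s - r))"
definition YV :: "(int ^ 'n) bmat" where "YV = Vop - Pvp"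

lemma v1_nonneg: "0 \<le> v1"
  using V1[of "{}"] by simp

lemma mat_bound_V: "mat_bound (\<lambda>s r. fcoeff V (s - r)) v1"
  by (rule mat_bound_toeplitz[OF V1])

lemma ent_YV: "ent YV s r = (if s \<in> P \<and> r \<in> P then 0 else fcoeff V (s - r))"
  by (simp add: YV_def minus_bmat.rep_eq Vop_def ent_Bmat[OF mat_bound_V] ent_Pvp PVP_ent)

lemma norm_YV_le: "norm YV \<le> v1"
proof (rule norm_bmat_le)
  have "(\<Sum>s\<in>F. norm (ent YV s r)) \<le> v1 \<and> (\<Sum>s\<in>F. norm (ent YV r s)) \<le> v1" if F: "finite F" for F r
  proof
    have "(\<Sum>s\<in>F. norm (ent YV s r)) \<le> (\<Sum>s\<in>F. norm (fcoeff V (s - r)))"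
      by (intro sum_mono) (simp add: ent_YV)
    also have "\<dots> \<le> v1" using mat_bound_V F unfolding mat_bound_def by blast
    finally show "(\<Sum>s\<in>F. norm (ent YV s r)) \<le> v1" .
    have "(\<Sum>s\<in>F. norm (ent YV r s)) \<le> (\<Sum>s\<in>F. norm (fcoeff V (r - s)))"
      by (intro sum_mono) (simp add: ent_YV)
    also have "\<dots> \<le> v1" using mat_bound_V F unfolding mat_bound_def by blast
    finally show "(\<Sum>s\<in>F. norm (ent YV r s)) \<le> v1" .
  qed
  then show "mat_bound (ent YV) v1" unfolding mat_bound_def by blast
qed

lemma norm_R_bb: "t \<in> U \<Longrightarrow> norm (R t \<theta>) \<le> bb"
proof -
  have "1 / g \<le> 1" using g by simp
  then show "t \<in> U \<Longrightarrow> norm (R t \<theta>) \<le> bb" using norm_R_le[of t \<theta>] by linarith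
qed

lemma norm_RQ_le: "t \<in> U \<Longrightarrow> norm (RQ t \<theta>) \<le> 1 / g"
  unfolding RQ_def by (rule ent_RQz(3)[OF _ zeta_le])

lemma bb_ge: "1 \<le> bb" and yy_ge: "1 \<le> yy"
  using d_pos v1_nonneg by auto

lemma norm_Y_le: "Y \<in> ball YV \<beta> \<Longrightarrow> norm Y \<le> yy"
  using norm_triangle_ineq4[of YV "YV - Y"] norm_YV_le beta by (simp add: dist_norm)

text \<open>\<open>YV\<close> vanishes on the block, so the compression sees only
  \<open>Y - YV\<close>.\<close>

lemma norm_PYP_le:
  assumes "Y \<in> ball YV \<beta>"
  shows "norm (Pr P * Y * Pr P) \<le> \<beta>"
proof -
  have "Pr P * YV * Pr P = 0"
    by (rule bmat_eqI) (simp add: ent_Pr_mult ent_YV ent_simps)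
  then have "Pr P * Y * Pr P = Pr P * (Y - YV) * Pr P"
    by (simp add: algebra_simps)
  also have "norm \<dots> \<le> norm (Pr P) * norm (Y - YV) * norm (Pr P)" by (rule norm_mult3_le)
  also have "\<dots> \<le> 1 * \<beta> * 1"
    using assms beta by (intro mult_mono norm_Pr_le) (auto simp: dist_norm norm_minus_commute)
  finally show ?thesis by simp
qed

text \<open>\<open>R\<close> is split into its block part \<open>E\<close> and \<open>RQ\<close>.
  Every term of the square contains \<open>RQ\<close>, of size \<open>1 / g\<close>, except
  \<open>E Y E Y\<close>, in which the inner \<open>Y\<close> is compressed to the block and
  therefore of size \<beta>.\<close>

lemma norm_square_RY_le:
  assumes t: "t \<in> U" and Y: "Y \<in> ball YV \<beta>"
  shows "norm ((R t \<theta> * Y) * (R t \<theta> * Y)) \<le> 1 / 2"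
proof -
  let ?R = "R t \<theta>" and ?Q = "RQ t \<theta>" and ?p = "Pr P :: (int ^ 'n) bmat"
  define E where "E = ?R - ?Q"
  have pp: "?p * ?p = ?p" by (rule bmat_eqI) (simp add: ent_Pr_mult ent_Pr)
  have E: "E = ?p * ?R" "E = ?R * ?p" unfolding E_def by (rule R_minus_RQ[OF t] R_minus_RQ_right[OF t])+
  have E': "E * ?p = E" "?p * E = E" using E pp by (metis mult.assoc)+
  note nR = norm_R_bb[OF t, of \<theta>] and nQ = norm_RQ_le[OF t, of \<theta>] and nY = norm_Y_le[OF Y]
  have nE: "norm E \<le> bb"
  proof -
    have "norm E \<le> norm ?p * norm ?R" unfolding E(1) by (rule norm_mult_ineq)
    also have "\<dots> \<le> 1 * bb" using nR norm_Pr_le[of P] by (intro mult_mono) auto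
    finally show ?thesis by simp
  qed
  have g0: "0 \<le> 1 / g" using g by simp
  have eq: "(?R * Y) * (?R * Y) = ?R * Y * ?Q * Y + E * (?p * Y * ?p) * (E * Y) + ?Q * Y * (E * Y)"
  proof -
    have "E * (?p * Y * ?p) * (E * Y) = (E * ?p) * Y * ((?p * E) * Y)" by (simp only: mult.assoc)
    then have "E * (?p * Y * ?p) * (E * Y) = E * Y * (E * Y)" by (simp only: E')
    moreover have "(?R * Y) * (?R * Y) = ?R * Y * ?Q * Y + (E + ?Q) * Y * (E * Y)"
      by (simp add: E_def algebra_simps)
    ultimately show ?thesis by (simp add: algebra_simps)
  qed
  have n4: "norm (x * y * z * w) \<le> norm x * norm y * norm z * norm w" for x y z w :: "(int ^ 'n) bmat"
    by (rule order_trans[OF norm_mult_ineq mult_right_mono[OF norm_mult3_le]]) simp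
  have 1: "norm (?R * Y * ?Q * Y) \<le> bb * yy * (1 / g) * yy"
    using nR nQ nY bb_ge yy_ge g0 by (intro order_trans[OF n4] mult_mono) auto
  have nEY: "norm (E * Y) \<le> bb * yy"
    using nE nY bb_ge by (intro order_trans[OF norm_mult_ineq] mult_mono) auto
  have 2: "norm (E * (?p * Y * ?p) * (E * Y)) \<le> bb * \<beta> * (bb * yy)"
    using nE norm_PYP_le[OF Y] nEY bb_ge yy_ge beta
    by (intro order_trans[OF norm_mult3_le[of E "?p * Y * ?p" "E * Y"]] mult_mono) auto
  have 3: "norm (?Q * Y * (E * Y)) \<le> (1 / g) * yy * (bb * yy)"
    using nQ nY nEY bb_ge yy_ge g0 by (intro order_trans[OF norm_mult3_le] mult_mono) auto
  have "norm ((?R * Y) * (?R * Y)) \<le> bb * yy * (1 / g) * yy + bb * \<beta> * (bb * yy) + (1 / g) * yy * (bb * yy)"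
    unfolding eq by (intro order_trans[OF norm_triangle_ineq] add_mono 1 2 3)
  also have "\<dots> = 2 * bb * yy\<^sup>2 / g + bb\<^sup>2 * yy * \<beta>"
  proof -
    have "b * y * h * y + b * \<beta> * (b * y) + h * y * (b * y) = 2 * b * y\<^sup>2 * h + b\<^sup>2 * y * \<beta>" for b y h :: real
      by (simp add: power2_eq_square algebra_simps)
    from this[of bb yy "1 / g"] show ?thesis by simp
  qed
  finally show ?thesis using sm1 by simp
qed

lemma norm_square_RQY_le:
  assumes t: "t \<in> U" and Y: "Y \<in> ball YV \<beta>"
  shows "norm ((RQ t \<theta> * Y) * (RQ t \<theta> * Y)) \<le> 1 / 2"
proof -
  have "norm (RQ t \<theta> * Y) \<le> 1 / g * yy"
    using norm_RQ_le[OF t, of \<theta>] norm_Y_le[OF Y] g by (intro order_trans[OF norm_mult_ineq] mult_mono) auto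
  then have n: "norm (RQ t \<theta> * Y) \<le> yy / g" by simp
  have "norm ((RQ t \<theta> * Y) * (RQ t \<theta> * Y)) \<le> norm (RQ t \<theta> * Y) * norm (RQ t \<theta> * Y)"
    by (rule norm_mult_ineq)
  also have "\<dots> \<le> yy / g * (yy / g)" using n order_trans[OF norm_ge_zero n] by (intro mult_mono) auto
  also have "\<dots> = (yy / g)\<^sup>2" by (simp only: power2_eq_square)
  finally show ?thesis using sm2 by linarith
qed

sublocale np: nonlinear_pert U R RQ "\<lambda>\<theta>. sc (zeta \<theta>)" "autocor j" "trP P" YV c bb yy d \<beta> \<kappa>
proof (rule nonlinear_pert.intro)
  show "continuous_on {0..1} (\<lambda>\<theta>. sc (zeta \<theta>))"
    by (rule bounded_linear.continuous_on[OF bounded_linear_sc continuous_zeta])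
  show "norm (sc (zeta \<theta>)) \<le> d" for \<theta>
    using norm_sc_le[of "zeta \<theta>"] by simp
  show "norm (RQ t \<theta>) \<le> bb" if "t \<in> U" for t \<theta>
  proof -
    have "1 / g \<le> 1" using g by simp
    then show ?thesis using norm_RQ_le[OF that, of \<theta>] bb_ge by linarith
  qed
  show "norm (trP P x) \<le> 2 * norm x" for x :: "(int ^ 'n) bmat"
    using norm_trP_le[of P x] P by simp
qed (rule U bb_ge yy_ge less_imp_le[OF d_pos] kappa_nonneg beta C1p_R C1p_RQ norm_R_bb R_lipschitz RQ_lipschitz
    norm_Y_le norm_square_RY_le norm_square_RQY_le bounded_bilinear_autocor norm_autocor_le bounded_linear_trP
    sm3 sm4 | assumption)+

section \<open>Identification of the perturbation series with the abstract integrals\<close>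

context
  fixes t :: "real ^ 'n" and W :: "real ^ 'n \<Rightarrow> complex" and Y :: "(int ^ 'n) bmat"
  assumes t: "t \<in> U" and Y: "Y \<in> ball YV \<beta>"
    and WY: "\<And>s r. multop W s r - PVP V q j s r = ent Y s r"
begin

lemma RY_zeta: "RY l V q j t W (of_real (lh t) + zeta \<theta>) = ent (R t \<theta> * Y)"
  unfolding RY_def WY resolv_zeta[OF t] by (rule mmul_ent)

lemma continuous_R: "continuous_on {0..1} (R t)" "continuous_on {0..1} (RQ t)"
  by (rule C1p_continuous_param[OF C1p_R t] C1p_continuous_param[OF C1p_RQ t])+

lemma ent_integral:
  fixes f :: "real \<Rightarrow> (int ^ 'n) bmat"
  assumes "continuous_on {0..1} f"
  shows "ent (integral {0..1} f) s r = integral {0..1} (\<lambda>\<theta>. ent (f \<theta>) s r)"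
  using integral_linear[OF integrable_continuous_real[OF assms] bounded_linear_ent] by (simp add: o_def)

lemma continuous_Z: "continuous_on {0..1} (\<lambda>\<theta>. sc (zeta \<theta>))"
  by (rule bounded_linear.continuous_on[OF bounded_linear_sc continuous_zeta])

lemma G_hat_eq:
  "G_hat l V q j e t W n s s' =
    - ent (integral {0..1} (\<lambda>\<theta>. sc (zeta \<theta>) * ((- (R t \<theta> * Y)) ^ n * R t \<theta>))) s s'"
proof -
  have "mmul (mpow (RY l V q j t W (of_real (lh t) + zeta \<theta>)) n) (resolv l V q j t (of_real (lh t) + zeta \<theta>)) s s'
      = ent ((R t \<theta> * Y) ^ n * R t \<theta>) s s'" for \<theta>
    by (simp add: RY_zeta resolv_zeta[OF t] mpow_ent mmul_ent)
  then have "G_hat l V q j e t W n s s' =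
      (-1) ^ (n + 1) * integral {0..1} (\<lambda>\<theta>. zeta \<theta> * ent ((R t \<theta> * Y) ^ n * R t \<theta>) s s')"
    unfolding G_hat_def contour_C1 by (simp only: divide_mult_cancel_self[OF two_pi_i_nz])
  also have "\<dots> = - integral {0..1} (\<lambda>\<theta>. (-1) ^ n * (zeta \<theta> * ent ((R t \<theta> * Y) ^ n * R t \<theta>) s s'))"
    by simp
  also have "(\<lambda>\<theta>. (-1) ^ n * (zeta \<theta> * ent ((R t \<theta> * Y) ^ n * R t \<theta>) s s'))
      = (\<lambda>\<theta>. ent (sc (zeta \<theta>) * ((- (R t \<theta> * Y)) ^ n * R t \<theta>)) s s')"
    by (rule ext, cases "even n") (simp_all add: ent_sc_mult uminus_bmat.rep_eq)
  also have "integral {0..1} \<dots> = ent (integral {0..1} (\<lambda>\<theta>. sc (zeta \<theta>) * ((- (R t \<theta> * Y)) ^ n * R t \<theta>))) s s'"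
    by (rule ent_integral[symmetric]) (intro continuous_intros continuous_Z continuous_R)
  finally show ?thesis .
qed

lemma E_pert_eq:
  "summable (\<lambda>i. G_hat l V q j e t W (Suc i) s s')" "E_pert l V q j e t W s s' = ent (np.Emap t Y) s s'"
proof -
  let ?f = "\<lambda>n. ent (integral {0..1} (\<lambda>\<theta>. sc (zeta \<theta>) * ((- (R t \<theta> * Y)) ^ n * R t \<theta>))) s s'"
  have "?f sums ent (- np.Emap t Y) s s'"
    by (rule bounded_linear.sums[OF bounded_linear_ent np.Emap_sums[OF t Y]])
  then have "?f sums (- ent (np.Emap t Y) s s')" by (simp add: uminus_bmat.rep_eq)
  define f where "f n = - ?f n" for n
  have "f sums ent (np.Emap t Y) s s'"
    using sums_minus[OF \<open>?f sums (- ent (np.Emap t Y) s s')\<close>] by (simp add: f_def[abs_def])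
  \<comment> \<open>The term of index 0 is the unperturbed projection, which \<open>E_pert\<close>
    adds separately.\<close>
  then have "(\<lambda>n. f (Suc n)) sums (ent (np.Emap t Y) s s' - f 0)"
    by (simp add: sums_Suc_iff)
  moreover have "?f 0 = - Eh t s s'"
  proof -
    have "?f 0 = integral {0..1} (\<lambda>\<theta>. ent (sc (zeta \<theta>) * R t \<theta>) s s')"
      by (subst ent_integral) (auto intro!: continuous_intros continuous_Z continuous_R)
    then show ?thesis by (simp add: ent_sc_mult integral_R[OF t])
  qed
  ultimately have S: "(\<lambda>n. G_hat l V q j e t W (Suc n) s s') sums (ent (np.Emap t Y) s s' - Eh t s s')"
    by (simp only: G_hat_eq f_def) simp
  then show "summable (\<lambda>i. G_hat l V q j e t W (Suc i) s s')" by (rule sums_summable)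
  show "E_pert l V q j e t W s s' = ent (np.Emap t Y) s s'"
    unfolding E_pert_def E_hat_eq using S by (simp add: sums_iff)
qed

text \<open>The algebra provides no trace for \<open>A ^ n\<close> itself. Subtracting
  \<open>B ^ n\<close>, whose contour integral vanishes entrywise, leaves telescoped terms with a
  factor \<open>Pr P\<close>; for these the sum over the diagonal converges and may be exchanged
  with the integral.\<close>

lemma trace_sum:
  defines "A \<equiv> \<lambda>\<theta>. R t \<theta> * Y" and "B \<equiv> \<lambda>\<theta>. RQ t \<theta> * Y"
  shows "((\<lambda>s. integral {0..1} (\<lambda>\<theta>. zeta \<theta> * ent (A \<theta> ^ n) s s)) has_sum
    integral {0..1} (\<lambda>\<theta>. trP P (sc (zeta \<theta>) * ((R t \<theta> - RQ t \<theta>) * Y * (\<Sum>i<n. A \<theta> ^ i * B \<theta> ^ (n - 1 - i)))))) UNIV"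
proof -
  have cA: "continuous_on {0..1} A" "continuous_on {0..1} B"
    unfolding A_def B_def by (intro continuous_intros continuous_R)+
  have e: "continuous_on {0..1} (\<lambda>\<theta>. ent (M \<theta>) s r)" if "continuous_on {0..1} M" for M :: "real \<Rightarrow> (int ^ 'n) bmat" and s r
    by (rule bounded_linear.continuous_on[OF bounded_linear_ent that])
  let ?X = "\<lambda>i \<theta>. sc (zeta \<theta>) * B \<theta> ^ (n - 1 - i)" and ?Z = "\<lambda>i \<theta>. R t \<theta> * Y * A \<theta> ^ i"
  have cX: "continuous_on {0..1} (?X i)" "continuous_on {0..1} (?Z i)" for i
    by (intro continuous_intros continuous_Z cA continuous_R)+
  have "integral {0..1} (\<lambda>\<theta>. zeta \<theta> * ent (A \<theta> ^ n) s s)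
      = (\<Sum>i<n. integral {0..1} (\<lambda>\<theta>. ent (?X i \<theta> * Pr P * ?Z i \<theta>) s s))" for s
  proof -
    have "zeta \<theta> * ent (A \<theta> ^ n) s s = zeta \<theta> * ent (B \<theta> ^ n) s s + (\<Sum>i<n. ent (?X i \<theta> * Pr P * ?Z i \<theta>) s s)" for \<theta>
    proof -
      have AB: "A \<theta> - B \<theta> = Pr P * (R t \<theta> * Y)"
        unfolding A_def B_def left_diff_distrib[symmetric] R_minus_RQ[OF t] mult.assoc ..
      have "A \<theta> ^ n = B \<theta> ^ n + (\<Sum>i<n. B \<theta> ^ (n - 1 - i) * (Pr P * (R t \<theta> * Y)) * A \<theta> ^ i)"
        using power_telescope[of "A \<theta>" n "B \<theta>"] unfolding AB by (simp add: algebra_simps)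
      then have "sc (zeta \<theta>) * A \<theta> ^ n = sc (zeta \<theta>) * B \<theta> ^ n + (\<Sum>i<n. ?X i \<theta> * Pr P * ?Z i \<theta>)"
        by (simp add: distrib_left sum_distrib_left mult.assoc)
      then show ?thesis
        unfolding ent_sc_mult(1)[symmetric]
        by (simp add: plus_bmat.rep_eq linear_sum[OF bounded_linear.linear[OF bounded_linear_ent]])
    qed
    then have "integral {0..1} (\<lambda>\<theta>. zeta \<theta> * ent (A \<theta> ^ n) s s)
        = integral {0..1} (\<lambda>\<theta>. zeta \<theta> * ent (B \<theta> ^ n) s s) + integral {0..1} (\<lambda>\<theta>. \<Sum>i<n. ent (?X i \<theta> * Pr P * ?Z i \<theta>) s s)"
      by (simp only:) (intro integral_add integrable_continuous_real continuous_intros continuous_zeta e cA cX)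
    also have "integral {0..1} (\<lambda>\<theta>. zeta \<theta> * ent (B \<theta> ^ n) s s) = 0"
      unfolding B_def by (rule integral_zeta_RQY[OF t])
    also have "integral {0..1} (\<lambda>\<theta>. \<Sum>i<n. ent (?X i \<theta> * Pr P * ?Z i \<theta>) s s)
        = (\<Sum>i<n. integral {0..1} (\<lambda>\<theta>. ent (?X i \<theta> * Pr P * ?Z i \<theta>) s s))"
      by (intro integral_sum integrable_continuous_real continuous_intros e cX) auto
    finally show ?thesis by simp
  qed
  moreover have "((\<lambda>s. \<Sum>i<n. integral {0..1} (\<lambda>\<theta>. ent (?X i \<theta> * Pr P * ?Z i \<theta>) s s)) has_sum
      (\<Sum>i<n. integral {0..1} (\<lambda>\<theta>. trP P (?Z i \<theta> * ?X i \<theta>)))) UNIV"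
    by (intro has_sum_finite_sum has_sum_integral_trace P cX) auto
  moreover have "(\<Sum>i<n. integral {0..1} (\<lambda>\<theta>. trP P (?Z i \<theta> * ?X i \<theta>))) =
    integral {0..1} (\<lambda>\<theta>. trP P (sc (zeta \<theta>) * ((R t \<theta> - RQ t \<theta>) * Y * (\<Sum>i<n. A \<theta> ^ i * B \<theta> ^ (n - 1 - i)))))"
  proof -
    have pr: "trP P (Pr P * M) = trP P M" for M by (simp add: trP_def ent_Pr_mult)
    have "trP P (sc (zeta \<theta>) * ((R t \<theta> - RQ t \<theta>) * Y * (\<Sum>i<n. A \<theta> ^ i * B \<theta> ^ (n - 1 - i))))
        = (\<Sum>i<n. trP P (?Z i \<theta> * ?X i \<theta>))" for \<theta>
    proof -
      have "sc (zeta \<theta>) * ((R t \<theta> - RQ t \<theta>) * Y * (\<Sum>i<n. A \<theta> ^ i * B \<theta> ^ (n - 1 - i)))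
          = Pr P * (\<Sum>i<n. ?Z i \<theta> * ?X i \<theta>)"
        unfolding R_minus_RQ[OF t] sum_distrib_left
        by (intro sum.cong refl) (simp only: mult.assoc sc_commute)
      then show ?thesis
        by (simp add: pr linear_sum[OF bounded_linear.linear[OF bounded_linear_trP]])
    qed
    then show ?thesis
      by (simp only:) (intro integral_sum[symmetric] integrable_continuous_real
          bounded_linear.continuous_on[OF bounded_linear_trP] continuous_on_mult cX finite_lessThan)
  qed
  ultimately show ?thesis by simp
qed

lemma contour_trace: "contour_integral (C1 l V q j e t) (\<lambda>z. mpow (RY l V q j t W z) n s s)
    = 2 * of_real pi * \<i> * integral {0..1} (\<lambda>\<theta>. zeta \<theta> * ent ((R t \<theta> * Y) ^ n) s s)"
  unfolding contour_C1 RY_zeta mpow_ent ..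

lemma contour_trace_summable:
  "(\<lambda>s. contour_integral (C1 l V q j e t) (\<lambda>z. mpow (RY l V q j t W z) n s s)) summable_on UNIV"
  unfolding contour_trace using trace_sum by (intro summable_on_cmult_right) (auto simp: summable_on_def)

lemma g_hat_eq:
  "g_hat l V q j e t W (Suc n) = - integral {0..1} (\<lambda>\<theta>. trP P (sc (zeta \<theta>) * ((R t \<theta> - RQ t \<theta>) * Y *
      (\<Sum>i\<le>n. (- (R t \<theta> * Y)) ^ i * (- (RQ t \<theta> * Y)) ^ (n - i)))) / of_nat (Suc n))"
proof -
  let ?X = "\<lambda>\<theta>. trP P (sc (zeta \<theta>) * ((R t \<theta> - RQ t \<theta>) * Y * (\<Sum>i\<le>n. (R t \<theta> * Y) ^ i * (RQ t \<theta> * Y) ^ (n - i))))"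
  have "(\<Sum>\<^sub>\<infinity>s. contour_integral (C1 l V q j e t) (\<lambda>z. mpow (RY l V q j t W z) (Suc n) s s))
      = 2 * of_real pi * \<i> * integral {0..1} ?X"
    unfolding contour_trace infsum_cmult_right'
    using infsumI[OF trace_sum[of "Suc n"]] by (simp add: lessThan_Suc_atMost)
  then have g: "g_hat l V q j e t W (Suc n) = (-1) ^ Suc n / of_nat (Suc n) * integral {0..1} ?X"
    unfolding g_hat_def by (simp add: field_simps del: of_nat_Suc)
  have "(\<Sum>i\<le>n. (- (R t \<theta> * Y)) ^ i * (- (RQ t \<theta> * Y)) ^ (n - i))
      = (-1) ^ n *\<^sub>R (\<Sum>i\<le>n. (R t \<theta> * Y) ^ i * (RQ t \<theta> * Y) ^ (n - i))" for \<theta>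
    unfolding scaleR_sum_right
  proof (intro sum.cong refl)
    fix i assume "i \<in> {..n}"
    then have "(-1 :: real) ^ n = (-1) ^ (n - i) * (-1) ^ i" by (simp add: power_add[symmetric])
    then show "(- (R t \<theta> * Y)) ^ i * (- (RQ t \<theta> * Y)) ^ (n - i) = (-1) ^ n *\<^sub>R ((R t \<theta> * Y) ^ i * (RQ t \<theta> * Y) ^ (n - i))"
      unfolding uminus_power_scaleR[of "R t \<theta> * Y"] uminus_power_scaleR[of "RQ t \<theta> * Y"]
      by (simp only: mult_scaleR_left mult_scaleR_right scaleR_scaleR)
  qed
  then have "trP P (sc (zeta \<theta>) * ((R t \<theta> - RQ t \<theta>) * Y * (\<Sum>i\<le>n. (- (R t \<theta> * Y)) ^ i * (- (RQ t \<theta> * Y)) ^ (n - i))))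
      = (-1) ^ n * ?X \<theta>" for \<theta>
    by (simp add: linear_scale[OF bounded_linear.linear[OF bounded_linear_trP]] scaleR_conv_of_real[where 'a = complex])
  then show ?thesis unfolding g by simp
qed

lemma lam_pert_eq:
  "summable (\<lambda>i. g_hat l V q j e t W (Suc i))" "lam_pert l V q j e t W = of_real (lh t) + np.Lmap t Y"
proof -
  have S: "(\<lambda>i. g_hat l V q j e t W (Suc i)) sums np.Lmap t Y"
    unfolding g_hat_eq by (rule np.Lmap_sums[OF t Y])
  then show "summable (\<lambda>i. g_hat l V q j e t W (Suc i))" by (rule sums_summable)
  show "lam_pert l V q j e t W = of_real (lh t) + np.Lmap t Y"
    unfolding lam_pert_def using S by (simp add: sums_iff)
qed

end

end

section \<open>Absolutely convergent Fourier series\<close>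

lemma lvec_add: "lvec (m + p) = lvec m + lvec p" and lvec_diff: "lvec (m - p) = lvec m - lvec p"
  by (simp_all add: lvec_def vec_eq_iff)

lemma lvec_eq_0_iff: "lvec m = 0 \<longleftrightarrow> m = 0"
  by (simp add: lvec_def vec_eq_iff)

lemma mode_add: "mode (y + z) x = mode y x * mode z x"
  by (simp add: mode_def inner_add_left distrib_left exp_add)

lemma cnj_mode: "cnj (mode y x) = mode (- y) x"
  by (simp add: mode_def exp_cnj)

lemma norm_mode [simp]: "norm (mode y x) = 1"
  by (simp add: mode_def)

lemma continuous_on_mode [continuous_intros]: "continuous_on A (mode y)"
  unfolding mode_def[abs_def] by (intro continuous_intros)

lemma mode_periodic: "mode (lvec m) (x + (2 * pi) *\<^sub>R lvec p) = mode (lvec m) x"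
proof -
  have "lvec m \<bullet> lvec p = of_int (\<Sum>i\<in>UNIV. m $ i * p $ i)"
    by (simp add: inner_vec_def lvec_def)
  then have "mode (lvec m) (x + (2 * pi) *\<^sub>R lvec p)
      = mode (lvec m) x * exp (\<i> * of_real (2 * pi * of_int (\<Sum>i\<in>UNIV. m $ i * p $ i)))"
    by (simp add: mode_def inner_add_right distrib_left exp_add)
  also have "exp (\<i> * of_real (2 * pi * of_int (\<Sum>i\<in>UNIV. m $ i * p $ i))) = 1"
    by (subst exp_eq_1) (auto intro!: exI[of _ "\<Sum>i\<in>UNIV. m $ i * p $ i"])
  finally show ?thesis by simp
qed

lemma cellQ_cbox: "cellQ = cbox 0 (\<chi> i. 2 * pi)"
  by (auto simp: cellQ_def mem_box_cart)

lemma continuous_set_integrable_cellQ: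
  fixes f :: "real ^ 'n \<Rightarrow> complex"
  assumes "continuous_on UNIV f"
  shows "set_integrable lborel cellQ f"
  unfolding set_integrable_def cellQ_cbox
  by (intro borel_integrable_compact compact_cbox continuous_on_subset[OF assms]) simp

lemma integral_exp_1d:
  fixes k :: int
  shows "(\<integral>y. indicator {0..2 * pi} y *\<^sub>R exp (\<i> * of_real (of_int k * y)) \<partial>lborel) = (if k = 0 then of_real (2 * pi) else 0)"
proof (cases "k = 0")
  case True
  have "(\<integral>y. indicator {0..2 * pi} y *\<^sub>R (1::complex) \<partial>lborel) = of_real (2 * pi) - of_real 0"
    by (rule integral_FTC_atLeastAtMost) (auto intro!: derivative_eq_intros)
  with True show ?thesis by simp
next
  case False
  let ?F = "\<lambda>y. exp (\<i> * of_real (of_int k * y)) / (\<i> * of_int k)"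
  have "(\<integral>y. indicator {0..2 * pi} y *\<^sub>R exp (\<i> * of_real (of_int k * y)) \<partial>lborel) = ?F (2 * pi) - ?F 0"
  proof (rule integral_FTC_atLeastAtMost)
    fix y :: real
    have "((\<lambda>z. exp (\<i> * (of_int k * z)) / (\<i> * of_int k)) has_field_derivative exp (\<i> * (of_int k * of_real y))) (at (of_real y))"
      using False by (auto intro!: derivative_eq_intros simp: mult.commute[of _ \<i>])
    from has_vector_derivative_real_field[OF this]
    show "(?F has_vector_derivative exp (\<i> * of_real (of_int k * y))) (at y within {0..2 * pi})"
      by simp
  qed (auto intro!: continuous_intros)
  also have "exp (\<i> * of_real (of_int k * (2 * pi))) = 1"
    by (subst exp_eq_1) (auto intro!: exI[of _ k])
  finally show ?thesis using False by simp
qed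

lemma integral_mode_cellQ:
  fixes p :: "int ^ 'n"
  shows "(LINT x:cellQ|lborel. mode (lvec p) x) = (if p = 0 then of_real ((2 * pi) ^ CARD('n)) else 0)"
proof -
  \<comment> \<open>Recovers the coordinate from a basis vector: the product measure is indexed by
    \<open>Basis\<close>, but \<open>p\<close> by coordinates.\<close>
  let ?k = "\<lambda>b :: real ^ 'n. THE i. b = axis i 1"
  have k: "?k (axis i 1) = i" for i :: 'n
    by (rule the_equality) (auto simp: axis_eq_axis)
  let ?f = "\<lambda>b y. indicator {0..2 * pi} y *\<^sub>R exp (\<i> * of_real (of_int (p $ ?k b) * y)) :: complex"
  interpret product_sigma_finite "\<lambda>_ :: real ^ 'n. lborel :: real measure" ..
  have prod: "(\<Prod>b\<in>(Basis :: (real ^ 'n) set). g b) = (\<Prod>i\<in>UNIV. g (axis i 1))" for g :: "real ^ 'n \<Rightarrow> complex"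
  proof -
    have B: "(Basis :: (real ^ 'n) set) = (\<lambda>i. axis i 1) ` UNIV" by (auto simp: Basis_vec_def)
    show ?thesis unfolding B by (subst prod.reindex) (auto simp: inj_on_def axis_eq_axis)
  qed
  have f: "indicator cellQ x *\<^sub>R mode (lvec p) x = (\<Prod>b\<in>Basis. ?f b (x \<bullet> b))" for x :: "real ^ 'n"
  proof -
    have "(\<Prod>b\<in>Basis. ?f b (x \<bullet> b)) = (\<Prod>i\<in>UNIV. indicator {0..2 * pi} (x $ i) *\<^sub>R exp (\<i> * of_real (of_int (p $ i) * x $ i)))"
      unfolding prod by (simp only: k cart_eq_inner_axis[symmetric])
    also have "\<dots> = (\<Prod>i\<in>UNIV. of_real (indicator {0..2 * pi} (x $ i))) * (\<Prod>i\<in>UNIV. exp (\<i> * of_real (of_int (p $ i) * x $ i)))"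
      by (simp add: prod.distrib scaleR_conv_of_real)
    also have "(\<Prod>i\<in>UNIV. exp (\<i> * of_real (of_int (p $ i) * x $ i))) = mode (lvec p) x"
      by (simp add: mode_def inner_vec_def lvec_def exp_sum sum_distrib_left)
    also have "(\<Prod>i\<in>UNIV. of_real (indicator {0..2 * pi} (x $ i))) = (of_real (indicator cellQ x) :: complex)"
    proof (cases "x \<in> cellQ")
      case True
      then show ?thesis by (simp add: cellQ_def)
    next
      case False
      then obtain i where "\<not> (0 \<le> x $ i \<and> x $ i \<le> 2 * pi)" unfolding cellQ_def by auto
      then have "of_real (indicator {0..2 * pi} (x $ i)) = (0 :: complex)" by (simp add: indicator_def)
      then have "(\<Prod>i\<in>UNIV. of_real (indicator {0..2 * pi} (x $ i))) = (0 :: complex)"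
        by (intro prod_zero bexI[of _ i]) simp_all
      then show ?thesis using False by simp
    qed
    finally show ?thesis by (simp add: scaleR_conv_of_real)
  qed
  have int: "integrable lborel (?f b)" for b
    by (intro borel_integrable_compact compact_Icc continuous_intros)
  have "(LINT x:cellQ|lborel. mode (lvec p) x) = (\<integral>x. (\<Prod>b\<in>Basis. ?f b (x \<bullet> b)) \<partial>lborel)"
    unfolding set_lebesgue_integral_def f ..
  also have "\<dots> = (\<integral>x. (\<Prod>b\<in>Basis. ?f b ((\<Sum>c\<in>Basis. x c *\<^sub>R c) \<bullet> b)) \<partial>(\<Pi>\<^sub>M b\<in>Basis. lborel))"
    by (subst lborel_eq, subst integral_distr) simp_all
  also have "\<dots> = (\<integral>x. (\<Prod>b\<in>Basis. ?f b (x b)) \<partial>(\<Pi>\<^sub>M b\<in>Basis. lborel))"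
  proof -
    have "(\<Sum>c\<in>Basis. x c *\<^sub>R c) \<bullet> b = x b" if "b \<in> Basis" for x and b :: "real ^ 'n"
      using that by (simp add: inner_sum_left inner_Basis if_distrib sum.delta' cong: if_cong)
    then show ?thesis by (intro Bochner_Integration.integral_cong refl prod.cong) auto
  qed
  also have "\<dots> = (\<Prod>b\<in>Basis. \<integral>y. ?f b y \<partial>lborel)"
    by (rule product_integral_prod[OF finite_Basis int])
  also have "\<dots> = (\<Prod>i\<in>UNIV. if p $ i = 0 then of_real (2 * pi) else 0)"
    unfolding prod k integral_exp_1d ..
  also have "\<dots> = (if p = 0 then of_real ((2 * pi) ^ CARD('n)) else 0)"
  proof (cases "p = 0")
    case False
    then obtain i where "p $ i \<noteq> 0" by (auto simp: vec_eq_iff)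
    then show ?thesis using False by (subst prod_zero[of UNIV]) (auto intro!: bexI[of _ i])
  qed simp
  finally show ?thesis .
qed

lemma fcoeff_mode:
  fixes p m :: "int ^ 'n"
  shows "fcoeff (mode (lvec p)) m = (if p = m then 1 else 0)"
proof -
  have "mode (lvec p) x * mode (- lvec m) x = mode (lvec (p - m)) x" for x :: "real ^ 'n"
    by (simp add: mode_add[symmetric] lvec_diff)
  then have "fcoeff (mode (lvec p)) m = (LINT x:cellQ|lborel. mode (lvec (p - m)) x) / of_real ((2 * pi) ^ CARD('n))"
    unfolding fcoeff_def by simp
  then show ?thesis unfolding integral_mode_cellQ by simp
qed

lemma set_integrable_mode_mult:
  fixes f :: "real ^ 'n \<Rightarrow> complex"
  assumes "set_integrable lborel cellQ f"
  shows "set_integrable lborel cellQ (\<lambda>x. f x * mode y x)"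
proof (rule set_integrable_bound[OF assms])
  have "(\<lambda>x. indicator cellQ x *\<^sub>R f x) \<in> borel_measurable lborel"
    using assms unfolding set_integrable_def by auto
  moreover have "mode y \<in> borel_measurable lborel"
    using borel_measurable_continuous_onI[OF continuous_on_mode] by simp
  ultimately have "(\<lambda>x. (indicator cellQ x *\<^sub>R f x) * mode y x) \<in> borel_measurable lborel"
    by (rule borel_measurable_times)
  then show "set_borel_measurable lborel cellQ (\<lambda>x. f x * mode y x)"
    unfolding set_borel_measurable_def by simp
qed (simp add: norm_mult)

lemma fcoeff_diff:
  assumes "set_integrable lborel cellQ f" "set_integrable lborel cellQ h"
  shows "fcoeff (\<lambda>x. f x - h x) m = fcoeff f m - fcoeff h m"
  unfolding fcoeff_def
  using set_integral_diff(2)[OF assms[THEN set_integrable_mode_mult, of "- lvec m"]]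
  by (simp add: left_diff_distrib diff_divide_distrib)

lemma fcoeff_sum:
  assumes "finite F" "\<And>p. p \<in> F \<Longrightarrow> set_integrable lborel cellQ (f p)"
  shows "fcoeff (\<lambda>x. \<Sum>p\<in>F. f p x) m = (\<Sum>p\<in>F. fcoeff (f p) m)"
proof -
  have "(LINT x:cellQ|lborel. \<Sum>p\<in>F. f p x * mode (- lvec m) x) = (\<Sum>p\<in>F. LINT x:cellQ|lborel. f p x * mode (- lvec m) x)"
    using assms(2)[THEN set_integrable_mode_mult, of _ "- lvec m"]
    unfolding set_lebesgue_integral_def set_integrable_def scaleR_sum_right
    by (intro Bochner_Integration.integral_sum) auto
  then show ?thesis
    unfolding fcoeff_def by (simp add: sum_distrib_right sum_divide_distrib)
qed

lemma fcoeff_cmult: "fcoeff (\<lambda>x. c * f x) m = c * fcoeff f m"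
  unfolding fcoeff_def by (simp add: mult.assoc)

lemma norm_fcoeff_le:
  fixes f :: "real ^ 'n \<Rightarrow> complex"
  assumes f: "continuous_on UNIV f" and B: "\<And>x. norm (f x) \<le> B"
  shows "norm (fcoeff f m) \<le> B"
proof -
  have B0: "0 \<le> B" using B[of 0] norm_ge_zero order_trans by blast
  let ?C = "cbox 0 (\<chi> i. 2 * pi) :: (real ^ 'n) set"
  have c: "continuous_on UNIV (\<lambda>x. f x * mode (- lvec m) x)"
    by (intro continuous_intros f)
  have "(LINT x:cellQ|lborel. f x * mode (- lvec m) x) = integral ?C (\<lambda>x. f x * mode (- lvec m) x)"
    using set_borel_integral_eq_integral(2)[OF continuous_set_integrable_cellQ[OF c]] by (simp add: cellQ_cbox)
  also have "norm \<dots> \<le> B * measure lborel ?C"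
    using B0 B continuous_on_subset[OF c subset_UNIV]
    by (intro integrable_bound integrable_continuous) (auto simp: norm_mult)
  also have "measure lborel ?C = (2 * pi) ^ CARD('n)"
    by (subst content_cbox_cart) (auto simp: interval_ne_empty_cart)
  finally show ?thesis
    unfolding fcoeff_def by (simp add: norm_divide norm_power norm_mult divide_le_eq)
qed

section \<open>Functions built from summable coefficients\<close>

definition fser :: "(int ^ 'n \<Rightarrow> complex) \<Rightarrow> real ^ 'n \<Rightarrow> complex" where
  "fser c x = (\<Sum>\<^sub>\<infinity>m. c m * mode (lvec m) x)"

context
  fixes c :: "int ^ 'n \<Rightarrow> complex"
  assumes c: "(\<lambda>m. norm (c m)) summable_on UNIV"
begin

lemma fser_uniform:
  "uniform_limit UNIV (\<lambda>F x. \<Sum>m\<in>F. c m * mode (lvec m) x) (fser c) (finite_subsets_at_top UNIV)"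
  unfolding fser_def[abs_def] by (rule Weierstrass_m_test_general[OF _ c]) (simp add: norm_mult)

lemma continuous_fser: "continuous_on UNIV (fser c)"
  by (rule uniform_limit_theorem[OF always_eventually fser_uniform]) (auto intro!: continuous_intros)

text \<open>A partial sum over a finite set containing \<open>m\<close> already has the coefficient
  \<open>c m\<close>. Uniform convergence carries this to the limit because coefficients are bounded
  by the supremum norm.\<close>

lemma fcoeff_fser: "fcoeff (fser c) m = c m"
proof -
  have "norm (fcoeff (fser c) m - c m) \<le> \<epsilon>" if "\<epsilon> > 0" for \<epsilon>
  proof -
    have "\<forall>\<^sub>F F in finite_subsets_at_top UNIV. \<forall>x\<in>UNIV. dist (\<Sum>m\<in>F. c m * mode (lvec m) x) (fser c x) < \<epsilon>"
      using fser_uniform that unfolding uniform_limit_iff by blast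
    moreover have "\<forall>\<^sub>F F in finite_subsets_at_top UNIV. finite F \<and> {m} \<subseteq> F"
      unfolding eventually_finite_subsets_at_top by (auto intro!: exI[of _ "{m}"])
    ultimately have "\<forall>\<^sub>F F in finite_subsets_at_top (UNIV :: (int ^ 'n) set). norm (fcoeff (fser c) m - c m) \<le> \<epsilon>"
    proof eventually_elim
      case (elim F)
      let ?S = "\<lambda>x. \<Sum>m\<in>F. c m * mode (lvec m) x"
      have cS: "continuous_on UNIV ?S" by (intro continuous_intros)
      have "fcoeff ?S m = (\<Sum>p\<in>F. c p * (if p = m then 1 else 0))"
        using elim by (subst fcoeff_sum)
          (auto intro!: continuous_set_integrable_cellQ continuous_intros simp: fcoeff_cmult fcoeff_mode)
      also have "\<dots> = (\<Sum>p\<in>F. if p = m then c p else 0)" by (intro sum.cong) auto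
      also have "\<dots> = c m" using elim by simp
      finally have "fcoeff (fser c) m - c m = fcoeff (\<lambda>x. fser c x - ?S x) m"
        by (subst fcoeff_diff) (auto intro!: continuous_set_integrable_cellQ continuous_fser cS)
      also have "norm \<dots> \<le> \<epsilon>"
        using elim by (intro norm_fcoeff_le continuous_intros continuous_fser)
          (auto simp: dist_norm norm_minus_commute less_imp_le)
      finally show ?case .
    qed
    then show ?thesis by simp
  qed
  then have "norm (fcoeff (fser c) m - c m) \<le> 0" by (rule field_le_epsilon[of _ 0, simplified])
  then show ?thesis by simp
qed

lemma star_fun_fser: "star_fun (fser c)"
  unfolding star_fun_def
  using c continuous_set_integrable_cellQ[OF continuous_fser]
  by (simp add: fcoeff_fser fser_def mode_periodic)

end

text \<open>Convergence in star norm forces convergence of every coefficient. This determines the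
  coefficients of whichever limit potential \<open>SOME\<close> selects.\<close>

lemma norm_fcoeff_diff_le:
  assumes X: "star_fun X" and W: "star_fun W"
  shows "norm (fcoeff X m - fcoeff W m) \<le> star_norm (\<lambda>x. X x - W x)"
proof -
  have d: "fcoeff (\<lambda>x. X x - W x) m = fcoeff X m - fcoeff W m" for m
    using X W unfolding star_fun_def by (intro fcoeff_diff) auto
  have "(\<lambda>m. norm (fcoeff X m) + norm (fcoeff W m)) summable_on UNIV"
    using X W unfolding star_fun_def by (intro summable_on_add) auto
  then have s: "(\<lambda>m. norm (fcoeff (\<lambda>x. X x - W x) m)) summable_on UNIV"
    by (rule Infinite_Sum.abs_summable_on_comparison_test') (simp add: d norm_triangle_ineq4)
  have "norm (fcoeff (\<lambda>x. X x - W x) m) = (\<Sum>\<^sub>\<infinity>k\<in>{m}. norm (fcoeff (\<lambda>x. X x - W x) k))" by simp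
  also have "\<dots> \<le> star_norm (\<lambda>x. X x - W x)"
    unfolding star_norm_def by (rule infsum_mono_neutral) (auto intro: s)
  finally show ?thesis unfolding d .
qed

text \<open>The quasimomentum cancels, which is why the squared modulus of a Bloch function is
  periodic.\<close>

lemma Pv_diff: "mode (lvec a) x = mode (Pv (a + r) t) x * cnj (mode (Pv r t) x)"
  unfolding cnj_mode mode_add[symmetric] by (simp add: Pv_def lvec_add)

text \<open>The Fourier coefficients of the squared modulus of a Bloch function are the autocorrelation of
  its coefficients.\<close>

lemma fser_autocor:
  fixes E :: "(int ^ 'n) bmat"
  shows "fser (\<lambda>a. ent (autocor j E E) a 0) x = of_real ((norm (\<Sum>\<^sub>\<infinity>s. ent E s j * mode (Pv s t) x))\<^sup>2)"
proof -
  define f where "f s = ent E s j * mode (Pv s t) x" for s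
  have nf: "norm (f s) = norm (ent E s j)" for s by (simp add: f_def norm_mult)
  have bf: "(\<Sum>s\<in>F. norm (f s)) \<le> norm E" if "finite F" for F
    unfolding nf using mat_bound_norm[of E] that unfolding mat_bound_def by blast
  have sf: "f summable_on UNIV"
    by (rule abs_summable_summable) (use nonneg_bounded_sums(1)[OF bf] in auto)
  have "(\<lambda>(a, r). norm (f (a + r) * cnj (f r))) summable_on UNIV"
  proof (rule nonneg_bounded_sums(1)[where c = "norm E * norm E"])
    fix F :: "((int ^ 'n) \<times> (int ^ 'n)) set" assume F: "finite F"
    let ?A = "fst ` F" and ?B = "snd ` F"
    have "(\<Sum>(a, r)\<in>F. norm (f (a + r) * cnj (f r))) \<le> (\<Sum>(a, r)\<in>?A \<times> ?B. norm (f (a + r) * cnj (f r)))"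
      using F by (intro sum_mono2) (auto simp: rev_image_eqI)
    also have "\<dots> = (\<Sum>r\<in>?B. (\<Sum>a\<in>?A. norm (f (a + r))) * norm (f r))"
      unfolding sum.cartesian_product[symmetric]
      by (subst sum.swap) (simp add: norm_mult sum_distrib_right)
    also have "\<dots> \<le> (\<Sum>r\<in>?B. norm E * norm (f r))"
    proof (intro sum_mono mult_right_mono)
      fix r
      have "(\<Sum>a\<in>?A. norm (f (a + r))) = (\<Sum>s\<in>(\<lambda>a. a + r) ` ?A. norm (f s))"
        by (subst sum.reindex) (auto simp: inj_on_def)
      also have "\<dots> \<le> norm E" using F by (intro bf) auto
      finally show "(\<Sum>a\<in>?A. norm (f (a + r))) \<le> norm E" .
    qed auto
    also have "\<dots> \<le> norm E * norm E"
      unfolding sum_distrib_left[symmetric] using F by (intro mult_left_mono bf) auto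
    finally show "(\<Sum>(a, r)\<in>F. norm (f (a + r) * cnj (f r))) \<le> norm E * norm E" .
  qed auto
  also have "(\<lambda>(a, r). norm (f (a + r) * cnj (f r))) = (\<lambda>x. norm (case x of (a, r) \<Rightarrow> f (a + r) * cnj (f r)))"
    by auto
  finally have sm: "(\<lambda>(a, r). f (a + r) * cnj (f r)) summable_on UNIV \<times> UNIV"
    unfolding UNIV_Times_UNIV by (rule abs_summable_summable)
  have "ent (autocor j E E) a 0 * mode (lvec a) x = (\<Sum>\<^sub>\<infinity>r. f (a + r) * cnj (f r))" for a
  proof -
    have "ent (autocor j E E) a 0 = (\<Sum>\<^sub>\<infinity>r. ent E (a - r) j * cnj (ent E (0 - r) j))"
      by (rule ent_autocor)
    also have "\<dots> = (\<Sum>\<^sub>\<infinity>r. ent E (a + r) j * cnj (ent E r j))"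
      by (rule infsum_reindex_bij_witness[of _ uminus uminus]) auto
    finally have "ent (autocor j E E) a 0 * mode (lvec a) x = (\<Sum>\<^sub>\<infinity>r. ent E (a + r) j * cnj (ent E r j) * mode (lvec a) x)"
      by (simp only: infsum_cmult_left')
    also have "\<dots> = (\<Sum>\<^sub>\<infinity>r. f (a + r) * cnj (f r))"
    proof (rule infsum_cong)
      fix r
      show "ent E (a + r) j * cnj (ent E r j) * mode (lvec a) x = f (a + r) * cnj (f r)"
        unfolding Pv_diff[of a x r t] by (simp add: f_def mult_ac)
    qed
    finally show ?thesis .
  qed
  then have "fser (\<lambda>a. ent (autocor j E E) a 0) x = (\<Sum>\<^sub>\<infinity>a. \<Sum>\<^sub>\<infinity>r. f (a + r) * cnj (f r))"
    unfolding fser_def by simp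
  also have "\<dots> = (\<Sum>\<^sub>\<infinity>r. \<Sum>\<^sub>\<infinity>a. f (a + r) * cnj (f r))"
    by (rule infsum_swap_banach[OF sm])
  also have "\<dots> = (\<Sum>\<^sub>\<infinity>r. infsum f UNIV * cnj (f r))"
  proof (rule infsum_cong)
    fix r
    have "(\<Sum>\<^sub>\<infinity>a. f (a + r)) = infsum f UNIV"
      by (rule infsum_reindex_bij_witness[of _ "\<lambda>s. s - r" "\<lambda>a. a + r"]) auto
    then show "(\<Sum>\<^sub>\<infinity>a. f (a + r) * cnj (f r)) = infsum f UNIV * cnj (f r)"
      by (simp only: infsum_cmult_left')
  qed
  also have "\<dots> = infsum f UNIV * cnj (infsum f UNIV)"
    unfolding infsum_cmult_right' infsum_cnj ..
  finally show ?thesis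
    unfolding f_def[symmetric] by (simp only: complex_norm_square)
qed

section \<open>The iteration and its limit\<close>

locale nonlinear_model = model_pert l V q j e U g \<kappa>1 \<kappa>2 T L v1 \<beta> c
  for l :: nat and V :: "real ^ 'n \<Rightarrow> complex" and q j :: "int ^ 'n" and e :: real
    and U :: "(real ^ 'n) set" and g \<kappa>1 \<kappa>2 T L v1 \<beta> c :: real +
  fixes \<sigma> :: real and A :: complex
  assumes Vser: "\<And>x. V x = fser (fcoeff V) x"
    and Vherm: "\<And>m. fcoeff V (- m) = cnj (fcoeff V m)"
    and c: "c = \<sigma> * (norm A)\<^sup>2"
begin

section \<open>Matrix form of the iteration\<close>

lemma V_summable: "(\<lambda>m. norm (fcoeff V m)) summable_on UNIV"
  by (rule nonneg_bounded_sums(1)[OF V1]) auto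

lemma star_fun_V: "star_fun V"
  using star_fun_fser[OF V_summable] Vser by (metis ext)

text \<open>Column 0 therefore carries all Fourier coefficients of the product.\<close>

lemma ent_autocor_toeplitz: "ent (autocor j M M) s r = ent (autocor j M M) (s - r) 0"
  unfolding ent_autocor
  by (rule infsum_reindex_bij_witness[of _ "\<lambda>m. m + r" "\<lambda>m. m - r"]) (auto simp: algebra_simps)

abbreviation "Wm \<equiv> W_iter l V q j e \<sigma> A"

text \<open>Links the iteration of functions with that of matrices: the squared modulus of
  \<open>u\<close> becomes the autocorrelation of column \<open>j\<close> of the projection, and
  \<sigma> and \<open>|A|^2\<close> are collected in \<open>c\<close>.\<close>

lemma M_map_step:
  assumes t: "t \<in> U" and Y: "Y \<in> ball YV \<beta>"
    and WY: "\<And>s r. multop W s r - PVP V q j s r = ent Y s r"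
  shows "star_fun (M_map l V q j e \<sigma> A t W)"
    and "multop (M_map l V q j e \<sigma> A t W) s r - PVP V q j s r = ent (np.Fmap t Y) s r"
proof -
  let ?E = "np.Emap t Y"
  define w where "w m = fcoeff V m + of_real c * ent (autocor j ?E ?E) m 0" for m
  have sw: "(\<lambda>m. norm (w m)) summable_on UNIV"
  proof (rule Infinite_Sum.abs_summable_on_comparison_test')
    show "(\<lambda>m. norm (fcoeff V m) + \<bar>c\<bar> * norm (ent (autocor j ?E ?E) m 0)) summable_on UNIV"
      by (intro summable_on_add V_summable summable_on_cmult_right ent_summable)
    show "norm (w m) \<le> norm (fcoeff V m) + \<bar>c\<bar> * norm (ent (autocor j ?E ?E) m 0)" for m
      unfolding w_def by (rule order_trans[OF norm_triangle_ineq]) (simp add: norm_mult)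
  qed
  have M: "M_map l V q j e \<sigma> A t W = fser w"
  proof
    fix x
    let ?S = "\<Sum>\<^sub>\<infinity>s. ent ?E s j * mode (Pv s t) x"
    have "u_fun l V q j e A t W x = A * ?S"
      unfolding u_fun_def E_pert_eq(2)[OF t Y WY] ..
    then have "M_map l V q j e \<sigma> A t W x = fser (fcoeff V) x + of_real c * of_real ((norm ?S)\<^sup>2)"
      unfolding M_map_def Vser[of x, symmetric] c by (simp add: norm_mult power_mult_distrib mult.assoc)
    also have "of_real c * of_real ((norm ?S)\<^sup>2) = of_real c * fser (\<lambda>a. ent (autocor j ?E ?E) a 0) x"
      unfolding fser_autocor[of j ?E x t] ..
    also have "\<dots> = (\<Sum>\<^sub>\<infinity>m. of_real c * ent (autocor j ?E ?E) m 0 * mode (lvec m) x)"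
      unfolding fser_def mult.assoc by (rule infsum_cmult_right'[symmetric])
    also have "fser (fcoeff V) x + \<dots> = fser w x"
      unfolding fser_def w_def distrib_right
    proof (rule infsum_add[symmetric])
      show "(\<lambda>m. fcoeff V m * mode (lvec m) x) summable_on UNIV"
        by (rule abs_summable_summable) (simp add: norm_mult V_summable)
      show "(\<lambda>m. of_real c * ent (autocor j ?E ?E) m 0 * mode (lvec m) x) summable_on UNIV"
        by (rule abs_summable_summable) (simp add: norm_mult summable_on_cmult_right ent_summable)
    qed
    finally show "M_map l V q j e \<sigma> A t W x = fser w x" .
  qed
  show "star_fun (M_map l V q j e \<sigma> A t W)"
    unfolding M by (rule star_fun_fser[OF sw])
  have "fcoeff (fser w) (s - r) = fcoeff V (s - r) + of_real c * ent (autocor j ?E ?E) s r"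
    unfolding fcoeff_fser[OF sw] w_def ent_autocor_toeplitz[of _ s r] ..
  then show "multop (M_map l V q j e \<sigma> A t W) s r - PVP V q j s r = ent (np.Fmap t Y) s r"
    unfolding M multop_def np.Fmap_def by (simp add: ent_simps ent_YV PVP_ent)
qed

lemma W_iter_props:
  assumes t: "t \<in> U"
  shows "star_fun (Wm t m) \<and> (\<forall>s r. multop (Wm t m) s r - PVP V q j s r = ent (np.Yit t m) s r)"
proof (induction m)
  case 0
  show ?case
    by (simp add: W_iter_def star_fun_V np.Yit_def ent_YV multop_def PVP_ent)
next
  case (Suc m)
  have "Wm t (Suc m) = M_map l V q j e \<sigma> A t (Wm t m)" "np.Yit t (Suc m) = np.Fmap t (np.Yit t m)"
    by (simp_all add: W_iter_def np.Yit_def)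
  then show ?case
    using M_map_step[OF t np.Yit_ball[OF t]] Suc by metis
qed

lemma W_iter_coeff:
  assumes "t \<in> U"
  shows "fcoeff (Wm t m) (s - r) = ent (np.Yit t m) s r + PVP V q j s r"
  using W_iter_props[OF assms, of m] by (metis diff_add_cancel multop_def)

text \<open>The candidate is the Fourier series read off column 0 of the fixed point, with the
  removed block entries restored. The star norm of the error is an absolute column sum, hence below
  the matrix norm.\<close>

lemma W_lim_exists:
  assumes t: "t \<in> U"
  shows "\<exists>W. star_lim (Wm t) W"
proof -
  let ?Y = "np.Ysol t"
  have conv: "np.Yit t \<longlonglongrightarrow> ?Y" by (rule np.Ysol_props(1)[OF t])
  define w where "w m = ent ?Y m 0 + PVP V q j m 0" for m
  have sw: "(\<lambda>m. norm (w m)) summable_on UNIV"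
  proof (rule Infinite_Sum.abs_summable_on_comparison_test')
    show "(\<lambda>m. norm (ent ?Y m 0) + norm (ent Pvp m 0)) summable_on UNIV"
      by (intro summable_on_add ent_summable)
    show "norm (w m) \<le> norm (ent ?Y m 0) + norm (ent Pvp m 0)" for m
      unfolding w_def ent_Pvp by (rule norm_triangle_ineq)
  qed
  have "fcoeff (\<lambda>x. Wm t n x - fser w x) m = ent (np.Yit t n - ?Y) m 0" for n m
  proof -
    have "fcoeff (\<lambda>x. Wm t n x - fser w x) m = fcoeff (Wm t n) m - fcoeff (fser w) m"
      using W_iter_props[OF t, of n] star_fun_fser[OF sw] unfolding star_fun_def by (intro fcoeff_diff) auto
    then show ?thesis
      using W_iter_coeff[OF t, of n m 0] by (simp add: fcoeff_fser[OF sw] w_def minus_bmat.rep_eq)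
  qed
  then have "star_norm (\<lambda>x. Wm t n x - fser w x) = (\<Sum>\<^sub>\<infinity>m. norm (ent (np.Yit t n - ?Y) m 0))" for n
    unfolding star_norm_def by simp
  then have bnd: "norm (star_norm (\<lambda>x. Wm t n x - fser w x)) \<le> norm (np.Yit t n - ?Y)" for n
    using ent_summable(3)[of "np.Yit t n - ?Y" 0] by (simp add: infsum_nonneg)
  have "(\<lambda>n. norm (np.Yit t n - ?Y)) \<longlonglongrightarrow> 0"
    using conv by (intro tendsto_norm_zero LIM_zero)
  then have "(\<lambda>n. star_norm (\<lambda>x. Wm t n x - fser w x)) \<longlonglongrightarrow> 0"
    by (rule Lim_null_comparison[OF always_eventually[OF allI[OF bnd]]])
  then have "star_lim (Wm t) (fser w)"
    unfolding star_lim_def using W_iter_props[OF t] star_fun_fser[OF sw] by auto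
  then show ?thesis by blast
qed

lemma W_lim_coeff:
  assumes t: "t \<in> U"
  shows "multop (W_lim l V q j e \<sigma> A t) s r - PVP V q j s r = ent (np.Ysol t) s r"
proof -
  let ?W = "W_lim l V q j e \<sigma> A t"
  have W: "star_lim (Wm t) ?W"
    unfolding W_lim_def using W_lim_exists[OF t] by (rule someI_ex)
  have "(\<lambda>n. fcoeff (Wm t n) (s - r)) \<longlonglongrightarrow> fcoeff ?W (s - r)"
  proof (rule LIM_zero_cancel, rule Lim_null_comparison)
    show "(\<lambda>n. star_norm (\<lambda>x. Wm t n x - ?W x)) \<longlonglongrightarrow> 0"
      using W unfolding star_lim_def by auto
    show "\<forall>\<^sub>F n in sequentially. norm (fcoeff (Wm t n) (s - r) - fcoeff ?W (s - r)) \<le> star_norm (\<lambda>x. Wm t n x - ?W x)"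
      using W unfolding star_lim_def by (intro always_eventually allI norm_fcoeff_diff_le) auto
  qed
  moreover have "(\<lambda>n. fcoeff (Wm t n) (s - r)) \<longlonglongrightarrow> ent (np.Ysol t) s r + PVP V q j s r"
    unfolding W_iter_coeff[OF t]
    by (intro tendsto_add tendsto_const bounded_linear.tendsto[OF bounded_linear_ent np.Ysol_props(1)[OF t]])
  ultimately show ?thesis
    unfolding multop_def using LIMSEQ_unique by fastforce
qed

theorem lam_eq:
  assumes t: "t \<in> U"
  shows "lam l V q j e \<sigma> A t = of_real (lh t) + np.Lmap t (np.Ysol t)"
  unfolding lam_def by (rule lam_pert_eq(2)[OF t np.Ysol_ball[OF t] W_lim_coeff[OF t]])

theorem lam_well_defined:
  assumes t: "t \<in> U"
  shows "lam_well_defined l V q j e \<sigma> A t"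
  unfolding lam_well_defined_def
proof (intro conjI allI impI)
  have Y: "\<And>s r. multop (Wm t m) s r - PVP V q j s r = ent (np.Yit t m) s r" for m
    using W_iter_props[OF t] by blast
  show "summable (\<lambda>i. G_hat l V q j e t (Wm t m) (Suc i) s s')" for m s s'
    by (rule E_pert_eq(1)[OF t np.Yit_ball[OF t] Y])
  show "(\<lambda>s. norm (E_pert l V q j e t (Wm t m) s j)) summable_on UNIV" for m
    unfolding E_pert_eq(2)[OF t np.Yit_ball[OF t] Y] by (rule ent_summable)
  show "\<exists>W. star_lim (Wm t) W" by (rule W_lim_exists[OF t])
  show "(\<lambda>s. contour_integral (C1 l V q j e t)
      (\<lambda>z. mpow (RY l V q j t (W_lim l V q j e \<sigma> A t) z) r s s)) summable_on UNIV" for r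
    by (rule contour_trace_summable[OF t np.Ysol_ball[OF t] W_lim_coeff[OF t]])
  show "summable (\<lambda>i. g_hat l V q j e t (W_lim l V q j e \<sigma> A t) (Suc i))"
    by (rule lam_pert_eq(1)[OF t np.Ysol_ball[OF t] W_lim_coeff[OF t]])
qed

subsection \<open>Reality of the perturbed eigenvalue\<close>

text \<open>The circle is reflected in the real axis. Since \<open>lh t\<close> is real and the
  model operator hermitian, taking adjoints of its resolvents amounts to this change of
  parameter.\<close>

lemma zeta_reflect: "zeta (1 - \<theta>) = cnj (zeta \<theta>)"
proof -
  have "exp (2 * of_real pi * \<i> * of_real (1 - \<theta>)) = exp (2 * of_real pi * \<i>) * exp (- (2 * of_real pi * \<i> * of_real \<theta>))"
    unfolding exp_add[symmetric] by (simp add: algebra_simps)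
  then show ?thesis by (simp add: zeta_def exp_cnj)
qed

lemma cnj_Ra: "cnj (Ra t \<zeta> r s) = Ra t (cnj \<zeta>) s r"
proof (cases "s \<in> P \<and> r \<in> P")
  case True
  then have "s = j \<or> s = j - q" "r = j \<or> r = j - q" by (auto simp: P_def)
  then have "cnj (num t \<zeta> r s) = num t (cnj \<zeta>) s r"
    using j_ne by (elim disjE) (simp_all add: num_def)
  with True show ?thesis by (simp add: Ra_block)
next
  case False
  then show ?thesis
    using Ra_off[of r s] Ra_off[of s r] by (cases "s = r") (auto simp: Ra_diag)
qed

lemma star_R: "t \<in> U \<Longrightarrow> star (R t \<theta>) = R t (1 - \<theta>)"
  by (rule bmat_eqI) (simp add: star.rep_eq ent_R zeta_reflect cnj_Ra)

lemma star_Pr: "star (Pr P) = Pr P"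
  by (rule bmat_eqI) (auto simp: star.rep_eq ent_Pr)

lemma star_RQ: "t \<in> U \<Longrightarrow> star (RQ t \<theta>) = RQ t (1 - \<theta>)"
proof -
  assume t: "t \<in> U"
  have "RQ t \<theta> = R t \<theta> - R t \<theta> * Pr P" "RQ t (1 - \<theta>) = R t (1 - \<theta>) - Pr P * R t (1 - \<theta>)"
    using R_minus_RQ[OF t, of "1 - \<theta>"] R_minus_RQ_right[OF t, of \<theta>] by (simp_all add: algebra_simps)
  then show ?thesis
    by (simp add: linear_diff[OF bounded_linear.linear[OF bounded_linear_star]] star_mult star_Pr star_R[OF t])
qed

lemma star_YV: "star YV = YV"
proof (rule bmat_eqI)
  fix s r
  have "cnj (fcoeff V (r - s)) = fcoeff V (s - r)"
    using Vherm[of "r - s"] by (simp only: minus_diff_eq)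
  then show "ent (star YV) s r = ent YV s r"
    unfolding star.rep_eq ent_YV by (auto simp only: complex_cnj_zero split: if_splits)
qed

lemma star_Yit: "star (np.Yit t m) = np.Yit t m"
proof (induction m)
  case 0
  show ?case by (simp add: np.Yit_def star_YV)
next
  case (Suc m)
  note lin = bounded_linear.linear[OF bounded_linear_star]
  have "star (np.Fmap t Y) = np.Fmap t Y" for Y
    unfolding np.Fmap_def linear_add[OF lin] linear_scale[OF lin] star_autocor star_YV ..
  then show ?case by (simp add: np.Yit_def)
qed

lemma star_Ysol: "t \<in> U \<Longrightarrow> star (np.Ysol t) = np.Ysol t"
proof -
  assume t: "t \<in> U"
  have "(\<lambda>m. star (np.Yit t m)) \<longlonglongrightarrow> star (np.Ysol t)"
    by (rule bounded_linear.tendsto[OF bounded_linear_star np.Ysol_props(1)[OF t]])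
  then show ?thesis
    unfolding star_Yit using np.Ysol_props(1)[OF t] LIMSEQ_unique by blast
qed

text \<open>Cyclicity of the trace is available only next to the finite rank factor \<open>M - N\<close>; both sides are
  the trace of \<open>(neu (s N) - neu (s M)) / s\<close>.\<close>

lemma trP_neu_commute:
  assumes sq: "norm (s *\<^sub>R M * s *\<^sub>R M) \<le> 1 / 2" "norm (s *\<^sub>R N * s *\<^sub>R N) \<le> 1 / 2"
    and MN: "M - N = Pr P * X"
  shows "trP P ((M - N) * (neu (s *\<^sub>R M) * neu (s *\<^sub>R N))) = trP P ((M - N) * (neu (s *\<^sub>R N) * neu (s *\<^sub>R M)))"
proof (cases "s = 0")
  case False
  define a b where "a = neu (s *\<^sub>R M)" and "b = neu (s *\<^sub>R N)"
  note inv = neu_inverse[OF sq(1), folded a_def] neu_inverse[OF sq(2), folded b_def]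
  have "b - a = b * ((1 + s *\<^sub>R M) - (1 + s *\<^sub>R N)) * a"
    by (rule inverse_diff[OF inv(3) inv(2)])
  also have "(1 + s *\<^sub>R M) - (1 + s *\<^sub>R N) = s *\<^sub>R (M - N)"
    by (simp add: scaleR_diff_right)
  finally have 1: "b - a = s *\<^sub>R (b * (M - N) * a)" by simp
  have "a - b = a * ((1 + s *\<^sub>R N) - (1 + s *\<^sub>R M)) * b"
    by (rule inverse_diff[OF inv(1) inv(4)])
  also have "(1 + s *\<^sub>R N) - (1 + s *\<^sub>R M) = - (s *\<^sub>R (M - N))"
    by (simp add: scaleR_diff_right)
  finally have "a - b = - (s *\<^sub>R (a * (M - N) * b))" by simp
  then have "b - a = s *\<^sub>R (a * (M - N) * b)" by (metis minus_diff_eq minus_minus)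
  with 1 have "s *\<^sub>R (b * (M - N) * a) = s *\<^sub>R (a * (M - N) * b)" by (rule trans[OF sym])
  then have eq: "b * (M - N) * a = a * (M - N) * b" using False by simp
  have pp: "Pr P * (M - N) = M - N"
    unfolding MN mult.assoc[symmetric] by (intro arg_cong2[where f = "(*)"] bmat_eqI) (auto simp: ent_Pr_mult ent_Pr)
  have tr: "((\<lambda>s. ent (x * (M - N) * y) s s) has_sum trP P ((M - N) * (y * x))) UNIV" for x y
  proof -
    have "x * Pr P * ((M - N) * y) = x * (Pr P * (M - N)) * y" by (simp only: mult.assoc)
    also have "\<dots> = x * (M - N) * y" unfolding pp ..
    finally show ?thesis using has_sum_trace[OF P(1), of x "(M - N) * y"] by (simp only: mult.assoc)
  qed
  show ?thesis
    unfolding a_def[symmetric] b_def[symmetric]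
    using has_sum_unique[OF tr[of b a]] tr[of a b] eq by simp
qed (simp add: neu_def)

text \<open>\<open>F\<close> is supported in the block on both sides, so the sums that define the
  two products are finite and can be swapped.\<close>

lemma trP_commute:
  assumes "F = Pr P * F" "F = F * Pr P"
  shows "trP P (X * F) = trP P (F * X)"
proof -
  have D: "ent F s r = 0" if "s \<notin> P \<or> r \<notin> P" for s r
    using that arg_cong[OF assms(1), of "\<lambda>M. ent M s r"] arg_cong[OF assms(2), of "\<lambda>M. ent M s r"]
    by (auto simp: ent_Pr_mult split: if_splits)
  have "ent (X * F) p p = (\<Sum>m\<in>P. ent X p m * ent F m p)" "ent (F * X) p p = (\<Sum>m\<in>P. ent F p m * ent X m p)" for p
    unfolding ent_mult using D by (auto intro!: infsum_finite_support P)
  then show ?thesis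
    unfolding trP_def by (simp only:) (subst sum.swap, simp add: mult.commute)
qed

text \<open>Taking adjoints reflects the circle and reverses the order of all factors. The order is
  restored by moving the adjoint Neumann series past \<open>Y\<close> and by the two restricted
  forms of cyclicity; the substitution \<open>\<theta> \<mapsto> 1 - \<theta>\<close> then
  identifies the integral with its conjugate.\<close>

lemma Lmap_real:
  assumes t: "t \<in> U"
  shows "cnj (np.Lmap t (np.Ysol t)) = np.Lmap t (np.Ysol t)"
proof -
  let ?Y = "np.Ysol t"
  have Y: "?Y \<in> ball YV \<beta>" by (rule np.Ysol_ball[OF t])
  note sY = star_Ysol[OF t]
  define f where "f \<theta> = trP P (sc (zeta \<theta>) * ((R t \<theta> - RQ t \<theta>) * ?Y * np.Jmap t ?Y \<theta>))" for \<theta>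
  have L: "np.Lmap t ?Y = - integral {0..1} f"
    unfolding np.Lmap_def f_def ..
  have cf: "continuous_on {0..1} f"
    unfolding f_def[abs_def] by (rule np.Lint_continuous[OF t Y])
  have sc_tr: "trP P (sc z * M) = z * trP P M" for z M
    by (simp add: trP_def ent_sc_mult sum_distrib_left)
  have refl: "cnj (f \<theta>) = f (1 - \<theta>)" if \<theta>: "\<theta> \<in> {0..1}" for \<theta>
  proof -
    define \<phi> where "\<phi> = 1 - \<theta>"
    have \<phi>: "\<phi> \<in> {0..1}" using \<theta> by (simp add: \<phi>_def)
    let ?M = "R t \<phi> * ?Y" and ?N = "RQ t \<phi> * ?Y"
    let ?D = "R t \<phi> - RQ t \<phi>"
    let ?J' = "integral {0..1} (\<lambda>s. neu (s *\<^sub>R ?N) * neu (s *\<^sub>R ?M))"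
    have cM: "continuous_on {0..1} (\<lambda>s. neu (s *\<^sub>R ?M))" "continuous_on {0..1} (\<lambda>s. neu (s *\<^sub>R ?N))"
    proof -
      have c: "continuous_on {0..1} (\<lambda>s::real. (\<phi>, s))" by (intro continuous_intros)
      show "continuous_on {0..1} (\<lambda>s. neu (s *\<^sub>R ?M))" "continuous_on {0..1} (\<lambda>s. neu (s *\<^sub>R ?N))"
        using C1p_continuous_param[OF C1p_reparam[OF np.C1p_neuRY(1) c], of "(t, ?Y)"]
          C1p_continuous_param[OF C1p_reparam[OF np.C1p_neuRY(2) c], of "(t, ?Y)"] t Y \<phi> by simp_all
    qed
    \<comment> \<open>An intertwining relation \<open>star X * Y = Y * X'\<close> passes to the
      inverses of \<open>1 + star X\<close> and \<open>1 + X'\<close>.\<close>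
    have push: "neu (star X) * ?Y = ?Y * neu X'"
      if "norm (star X * star X) \<le> 1 / 2" "norm (X' * X') \<le> 1 / 2" "star X * ?Y = ?Y * X'" for X X'
    proof -
      have "(1 + star X) * ?Y = ?Y * (1 + X')" using that(3) by (simp add: algebra_simps)
      then have "neu (star X) * ((1 + star X) * ?Y) * neu X' = neu (star X) * (?Y * (1 + X')) * neu X'" by simp
      then have "(neu (star X) * (1 + star X)) * ?Y * neu X' = neu (star X) * ?Y * ((1 + X') * neu X')"
        by (simp only: mult.assoc)
      then show ?thesis using neu_inverse[OF that(1)] neu_inverse[OF that(2)] by simp
    qed
    have nsq: "norm (star X * star X) = norm (X * X)" for X :: "(int ^ 'n) bmat"
      unfolding star_mult[symmetric] norm_star ..
    have scal: "star (s *\<^sub>R X) = s *\<^sub>R star X" for s and X :: "(int ^ 'n) bmat"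
      by (rule linear_scale[OF bounded_linear.linear[OF bounded_linear_star]])
    have J: "star (np.Jmap t ?Y \<theta>) * ?Y = ?Y * ?J'"
    proof -
      have cJ: "continuous_on {0..1} (\<lambda>s. neu (s *\<^sub>R (R t \<theta> * ?Y)) * neu (s *\<^sub>R (RQ t \<theta> * ?Y)))"
        by (rule np.Jint_continuous[OF t Y \<theta>])
      have lin: "bounded_linear (\<lambda>X. star X * ?Y)" "bounded_linear (\<lambda>X. ?Y * X)"
        by (intro bounded_linear_mult_const bounded_linear_star bounded_linear_const_mult bounded_linear_ident)+
      have "star (np.Jmap t ?Y \<theta>) * ?Y =
          integral {0..1} (\<lambda>s. star (neu (s *\<^sub>R (R t \<theta> * ?Y)) * neu (s *\<^sub>R (RQ t \<theta> * ?Y))) * ?Y)"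
        unfolding np.Jmap_def using integral_linear[OF integrable_continuous_real[OF cJ] lin(1)] by (simp add: o_def)
      also have "\<dots> = integral {0..1} (\<lambda>s. ?Y * (neu (s *\<^sub>R ?N) * neu (s *\<^sub>R ?M)))"
      proof (rule integral_cong)
        fix s :: real assume s: "s \<in> {0..1}"
        let ?A = "s *\<^sub>R (R t \<theta> * ?Y)" and ?B = "s *\<^sub>R (RQ t \<theta> * ?Y)"
        have sA: "star ?A * ?Y = ?Y * (s *\<^sub>R ?M)" "star ?B * ?Y = ?Y * (s *\<^sub>R ?N)"
          by (simp_all add: scal star_mult sY star_R[OF t] star_RQ[OF t] \<phi>_def mult.assoc)
        have pA: "neu (star ?A) * ?Y = ?Y * neu (s *\<^sub>R ?M)" "neu (star ?B) * ?Y = ?Y * neu (s *\<^sub>R ?N)"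
          by (rule push; (unfold nsq)?; intro sA np.sRY_sq[OF t _ Y s] \<theta> \<phi>)+
        have "star (neu ?A * neu ?B) * ?Y = neu (star ?B) * (neu (star ?A) * ?Y)"
          by (simp only: star_mult star_neu[OF np.sRY_sq(1)[OF t \<theta> Y s]] star_neu[OF np.sRY_sq(2)[OF t \<theta> Y s]] mult.assoc)
        also have "\<dots> = ?Y * (neu (s *\<^sub>R ?N) * neu (s *\<^sub>R ?M))"
          unfolding pA mult.assoc[symmetric] unfolding pA ..
        finally show "star (neu ?A * neu ?B) * ?Y = ?Y * (neu (s *\<^sub>R ?N) * neu (s *\<^sub>R ?M))" .
      qed
      also have "\<dots> = ?Y * ?J'"
        using integral_linear[OF integrable_continuous_real[OF continuous_on_mult[OF cM(2) cM(1)]] lin(2)] by (simp add: o_def)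
      finally show ?thesis .
    qed
    have D: "?D = Pr P * ?D" "?D = ?D * Pr P"
    proof -
      have pp: "Pr P * Pr P = (Pr P :: (int ^ 'n) bmat)" by (rule bmat_eqI) (simp add: ent_Pr_mult ent_Pr)
      show "?D = Pr P * ?D" unfolding R_minus_RQ[OF t] mult.assoc[symmetric] pp ..
      show "?D = ?D * Pr P" unfolding R_minus_RQ_right[OF t] mult.assoc pp ..
    qed
    have "cnj (f \<theta>) = zeta \<phi> * cnj (trP P ((R t \<theta> - RQ t \<theta>) * ?Y * np.Jmap t ?Y \<theta>))"
      by (simp add: f_def sc_tr zeta_reflect \<phi>_def)
    also have "cnj (trP P ((R t \<theta> - RQ t \<theta>) * ?Y * np.Jmap t ?Y \<theta>)) = trP P (star (np.Jmap t ?Y \<theta>) * ?Y * ?D)"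
      unfolding trP_star[symmetric] star_mult sY
      by (simp add: linear_diff[OF bounded_linear.linear[OF bounded_linear_star]] star_R[OF t] star_RQ[OF t] \<phi>_def mult.assoc)
    also have "\<dots> = trP P (?D * (?Y * ?J'))"
      unfolding J by (rule trP_commute[OF D])
    also have "?D * (?Y * ?J') = (?M - ?N) * ?J'"
      by (simp add: algebra_simps)
    also have "trP P ((?M - ?N) * ?J') = trP P ((?M - ?N) * np.Jmap t ?Y \<phi>)"
    proof -
      have lin: "bounded_linear (\<lambda>X. trP P ((?M - ?N) * X))"
        by (intro bounded_linear_compose[OF bounded_linear_trP] bounded_linear_const_mult bounded_linear_ident)
      have "trP P ((?M - ?N) * ?J') = integral {0..1} (\<lambda>s. trP P ((?M - ?N) * (neu (s *\<^sub>R ?N) * neu (s *\<^sub>R ?M))))"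
        using integral_linear[OF integrable_continuous_real[OF continuous_on_mult[OF cM(2) cM(1)]] lin] by (simp add: o_def)
      also have "\<dots> = integral {0..1} (\<lambda>s. trP P ((?M - ?N) * (neu (s *\<^sub>R ?M) * neu (s *\<^sub>R ?N))))"
      proof (rule integral_cong)
        fix s :: real assume s: "s \<in> {0..1}"
        show "trP P ((?M - ?N) * (neu (s *\<^sub>R ?N) * neu (s *\<^sub>R ?M))) = trP P ((?M - ?N) * (neu (s *\<^sub>R ?M) * neu (s *\<^sub>R ?N)))"
          by (rule trP_neu_commute[OF np.sRY_sq[OF t \<phi> Y s], of "R t \<phi> * ?Y", symmetric])
             (simp add: R_minus_RQ[OF t] mult.assoc flip: left_diff_distrib)
      qed
      also have "\<dots> = trP P ((?M - ?N) * np.Jmap t ?Y \<phi>)"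
        unfolding np.Jmap_def
        using integral_linear[OF integrable_continuous_real[OF continuous_on_mult[OF cM(1) cM(2)]] lin] by (simp add: o_def)
      finally show ?thesis .
    qed
    also have "zeta \<phi> * \<dots> = f \<phi>"
      by (simp add: f_def sc_tr left_diff_distrib)
    finally show ?thesis by (simp add: \<phi>_def)
  qed
  \<comment> \<open>The affine substitution with factor -1 and shift 1, which maps the unit interval
    onto itself.\<close>
  have "((\<lambda>\<theta>. f ((-1) * \<theta> + 1)) has_integral (1 / \<bar>-1\<bar> ^ DIM(real)) *\<^sub>R integral {0..1} f) ((\<lambda>x. (1 / (-1)) *\<^sub>R x + - ((1 / (-1)) *\<^sub>R 1)) ` cbox 0 1)"
    using has_integral_affinity[of f "integral {0..1} f" 0 1 "-1" 1] integrable_integral[OF integrable_continuous_real[OF cf]]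
    by simp
  moreover have "(\<lambda>x::real. (1 / (-1)) *\<^sub>R x + - ((1 / (-1)) *\<^sub>R 1)) ` cbox 0 1 = {0..1}"
  proof -
    have "(\<lambda>x::real. (1 / (-1)) *\<^sub>R x + - ((1 / (-1)) *\<^sub>R 1)) = (\<lambda>x. 1 - x)" by auto
    then show ?thesis by (auto simp: image_iff intro!: bexI[of _ "1 - _"])
  qed
  ultimately have i: "integral {0..1} (\<lambda>\<theta>. f (1 - \<theta>)) = integral {0..1} f"
    by (simp add: integral_unique)
  have "cnj (integral {0..1} f) = integral {0..1} (\<lambda>\<theta>. cnj (f \<theta>))" by (rule integral_cnj)
  also have "\<dots> = integral {0..1} (\<lambda>\<theta>. f (1 - \<theta>))" by (rule integral_cong) (rule refl)
  finally show ?thesis unfolding L i by simp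
qed

end

section \<open>Gradient estimates\<close>

text \<open>Multiplication by \<open>M\<close> avoids the exponent \<open>n - 1\<close> and its
  special case \<open>n = 0\<close>.\<close>

lemma abs_power_diff_le:
  fixes x y M :: real
  assumes "\<bar>x\<bar> \<le> M" "\<bar>y\<bar> \<le> M"
  shows "\<bar>x ^ n - y ^ n\<bar> * M \<le> real n * M ^ n * \<bar>x - y\<bar>"
proof (induction n)
  case (Suc n)
  have M: "0 \<le> M" using assms by linarith
  have "x ^ Suc n - y ^ Suc n = x * (x ^ n - y ^ n) + (x - y) * y ^ n" by (simp add: algebra_simps)
  then have "\<bar>x ^ Suc n - y ^ Suc n\<bar> \<le> \<bar>x\<bar> * \<bar>x ^ n - y ^ n\<bar> + \<bar>x - y\<bar> * \<bar>y\<bar> ^ n"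
    by (metis abs_mult abs_triangle_ineq power_abs)
  also have "\<dots> \<le> M * \<bar>x ^ n - y ^ n\<bar> + \<bar>x - y\<bar> * M ^ n"
    using assms by (intro add_mono mult_right_mono mult_left_mono power_mono) auto
  finally have "\<bar>x ^ Suc n - y ^ Suc n\<bar> * M \<le> (M * \<bar>x ^ n - y ^ n\<bar> + \<bar>x - y\<bar> * M ^ n) * M"
    using M by (rule mult_right_mono)
  also have "\<dots> = M * (\<bar>x ^ n - y ^ n\<bar> * M) + \<bar>x - y\<bar> * M ^ Suc n" by (simp add: algebra_simps)
  also have "\<dots> \<le> M * (real n * M ^ n * \<bar>x - y\<bar>) + \<bar>x - y\<bar> * M ^ Suc n"
    using Suc M by (intro add_mono mult_left_mono) auto
  also have "\<dots> = real (Suc n) * M ^ Suc n * \<bar>x - y\<bar>" by (simp add: algebra_simps)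
  finally show ?case .
qed simp

text \<open>Meant for an eigenvalue \<open>(x + y) / 2 + s\<close> of a hermitian block with
  diagonal \<open>x\<close>, \<open>y\<close> and off-diagonal modulus \<open>v\<close>.\<close>

lemma abs_max_le:
  fixes s v x y M :: real
  assumes "\<bar>s\<bar> \<le> v + \<bar>x - y\<bar> / 2" "0 \<le> x" "x \<le> M" "0 \<le> y" "y \<le> M"
  shows "\<bar>(x + y) / 2 + s\<bar> \<le> M + v"
proof -
  have s: "s \<le> v + \<bar>x - y\<bar> / 2" "- s \<le> v + \<bar>x - y\<bar> / 2" using assms(1) by (blast dest: abs_le_D1 abs_le_D2)+
  have "(x + y) / 2 + \<bar>x - y\<bar> / 2 \<le> M" "\<bar>x - y\<bar> / 2 \<le> (x + y) / 2" using assms(2-5) by (auto simp: abs_if field_simps)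
  then have "(x + y) / 2 + s \<le> M + v" "- ((x + y) / 2 + s) \<le> M + v" using s assms by linarith+
  then show ?thesis by (rule abs_leI)
qed

text \<open>The representing vector collects the values on a basis, which are real by hypothesis;
  testing with this vector itself bounds its length.\<close>

lemma real_linear_functional:
  fixes D :: "'a::euclidean_space \<Rightarrow> complex"
  assumes D: "bounded_linear D" and real: "\<And>h. cnj (D h) = D h" and le: "\<And>h. norm (D h) \<le> B * norm h"
  obtains w where "\<And>h. D h = of_real (w \<bullet> h)" "norm w \<le> B"
proof -
  interpret D: bounded_linear D by fact
  define w where "w = (\<Sum>b\<in>Basis. Re (D b) *\<^sub>R b)"
  have "D h = of_real (w \<bullet> h)" for h
  proof -
    have "D h = D (\<Sum>b\<in>Basis. (h \<bullet> b) *\<^sub>R b)" by (simp add: euclidean_representation)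
    also have "\<dots> = (\<Sum>b\<in>Basis. of_real (h \<bullet> b) * D b)"
      by (simp add: D.sum D.scaleR scaleR_conv_of_real)
    also have "\<dots> = (\<Sum>b\<in>Basis. of_real (h \<bullet> b * Re (D b)))"
    proof (rule sum.cong[OF refl])
      fix b
      have "D b = of_real (Re (D b))" using real[of b] by (simp add: complex_eq_iff)
      then show "of_real (h \<bullet> b) * D b = of_real (h \<bullet> b * Re (D b))" by (metis of_real_mult)
    qed
    also have "\<dots> = of_real (w \<bullet> h)"
      unfolding w_def inner_sum_left inner_scaleR_left of_real_sum by (simp add: inner_commute mult.commute)
    finally show ?thesis .
  qed
  moreover have "norm w \<le> B"
  proof (cases "w = 0")
    case True
    \<comment> \<open>For \<open>w = 0\<close> the sign of \<open>B\<close> has to be extracted from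
      the hypothesis, by testing with some basis vector.\<close>
    have "0 \<le> B * norm (SOME b. b \<in> (Basis :: 'a set))"
      using le[of "SOME b. b \<in> Basis"] norm_ge_zero order_trans by blast
    then show ?thesis using True some_in_eq[of "Basis :: 'a set"] by (simp add: norm_Basis)
  next
    case False
    have "norm w * norm w = w \<bullet> w" by (simp add: dot_square_norm power2_eq_square)
    also have "\<dots> \<le> norm (D w)" using calculation by (simp add: \<open>\<And>h. D h = of_real (w \<bullet> h)\<close>)
    also have "\<dots> \<le> B * norm w" by (rule le)
    finally show ?thesis using False by simp
  qed
  ultimately show ?thesis by (rule that)
qed

context model
begin

section \<open>Gradients of the model quantities\<close>

definition ga :: "int ^ 'n \<Rightarrow> real ^ 'n \<Rightarrow> real ^ 'n" where
  "ga m t = (2 * real l * pn m t ^ (2 * l - 2)) *\<^sub>R Pv m t"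

definition GD where "GD t = ga j t - ga (j - q) t"

text \<open>The gradient of \<open>a j - D / 2 + e S / 2\<close>. It is arranged around
  \<open>ga j\<close> because the two other terms are of order \<open>k ^ (2 l - 2)\<close>.\<close>

definition Glh where "Glh t = ga j t - (1 / 2) *\<^sub>R GD t + (e * D t / (2 * S t)) *\<^sub>R GD t"

lemma a_derivative: "(a m has_derivative (\<lambda>h. ga m t \<bullet> h)) (at t within A)"
proof -
  have n: "2 * (l - Suc 0) = 2 * l - 2" by simp
  have "((\<lambda>t. (lvec m + t) \<bullet> (lvec m + t)) has_derivative (\<lambda>h. (lvec m + t) \<bullet> h + h \<bullet> (lvec m + t))) (at t within A)"
    by (auto intro!: derivative_eq_intros)
  from has_derivative_power[OF this, of l]
  have "((\<lambda>t. ((lvec m + t) \<bullet> (lvec m + t)) ^ l) has_derivative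
      (\<lambda>h. of_nat l * ((lvec m + t) \<bullet> h + h \<bullet> (lvec m + t)) * ((lvec m + t) \<bullet> (lvec m + t)) ^ (l - 1))) (at t within A)" .
  moreover have "of_nat l * ((lvec m + t) \<bullet> h + h \<bullet> (lvec m + t)) * ((lvec m + t) \<bullet> (lvec m + t)) ^ (l - 1) = ga m t \<bullet> h" for h
    by (simp add: ga_def Pv_def pn_def dot_square_norm power_mult[symmetric] n inner_commute[of h])
  ultimately show ?thesis unfolding a_def[abs_def] pn_power by simp
qed

lemma D_derivative: "(D has_derivative (\<lambda>h. GD t \<bullet> h)) (at t within A)"
  unfolding D_def[abs_def] GD_def inner_diff_left by (intro has_derivative_diff a_derivative)

lemma S_derivative: "(S has_derivative (\<lambda>h. D t / S t * (GD t \<bullet> h))) (at t within A)"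
proof -
  have pos: "0 < 4 * (norm vq)\<^sup>2 + (D t)\<^sup>2" using v by (simp add: add_pos_nonneg)
  have d: "((\<lambda>t. 4 * (norm vq)\<^sup>2 + (D t)\<^sup>2) has_derivative (\<lambda>h. 2 * D t * (GD t \<bullet> h))) (at t within A)"
    by (rule has_derivative_eq_rhs[OF has_derivative_add[OF has_derivative_const has_derivative_power[OF D_derivative]]])
       (simp add: fun_eq_iff)
  have "((\<lambda>t. sqrt (4 * (norm vq)\<^sup>2 + (D t)\<^sup>2)) has_derivative
      (\<lambda>h. inverse (sqrt (4 * (norm vq)\<^sup>2 + (D t)\<^sup>2)) / 2 * (2 * D t * (GD t \<bullet> h)))) (at t within A)"
    by (rule has_derivative_compose[OF d DERIV_real_sqrt[OF pos, unfolded has_field_derivative_def]])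
  moreover have "inverse (sqrt (4 * (norm vq)\<^sup>2 + (D t)\<^sup>2)) / 2 * (2 * D t * (GD t \<bullet> h)) = D t / S t * (GD t \<bullet> h)" for h
  proof -
    have "inverse s / 2 * (2 * x * y) = x / s * y" for s x y :: real
      by (cases "s = 0") (simp_all add: field_simps)
    then show ?thesis unfolding S_def by blast
  qed
  ultimately show ?thesis unfolding S_def[abs_def] by simp
qed

lemma lh_derivative: "(lh has_derivative (\<lambda>h. Glh t \<bullet> h)) (at t within A)"
proof -
  have "((\<lambda>t. a j t - (1 / 2) * D t + (e / 2) * S t) has_derivative
      (\<lambda>h. ga j t \<bullet> h - (1 / 2) * (GD t \<bullet> h) + (e / 2) * (D t / S t * (GD t \<bullet> h)))) (at t within A)"
    by (intro has_derivative_add has_derivative_diff has_derivative_mult_right a_derivative D_derivative S_derivative)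
  moreover have "lh = (\<lambda>t. a j t - (1 / 2) * D t + (e / 2) * S t)"
    by (rule ext) (simp add: lh_eq D_def field_simps)
  moreover have "ga j t \<bullet> h - (1 / 2) * (GD t \<bullet> h) + (e / 2) * (D t / S t * (GD t \<bullet> h)) = Glh t \<bullet> h" for h
    by (simp add: Glh_def inner_add_left inner_diff_left)
  ultimately show ?thesis by simp
qed

lemma norm_ga: "norm (ga m t) = 2 * real l * pn m t ^ (2 * l - 1)"
proof -
  have n: "2 * l - 1 = Suc (2 * l - 2)" using l by simp
  show ?thesis unfolding n power_Suc by (simp add: ga_def pn_def)
qed

lemma Glh_diff_le: "norm (Glh t - ga j t) \<le> norm (GD t)"
proof -
  have "norm (Glh t - ga j t) \<le> norm ((1 / 2) *\<^sub>R GD t) + norm ((e * D t / (2 * S t)) *\<^sub>R GD t)"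
    using norm_triangle_ineq4[of "(e * D t / (2 * S t)) *\<^sub>R GD t" "(1 / 2) *\<^sub>R GD t"]
    by (simp add: Glh_def)
  moreover have "\<bar>e * D t / (2 * S t)\<bar> \<le> 1 / 2"
    using S_ge(2,4)[of t] ee by (simp add: abs_mult divide_le_eq)
  then have "norm ((e * D t / (2 * S t)) *\<^sub>R GD t) \<le> 1 / 2 * norm (GD t)"
    unfolding norm_scaleR by (rule mult_right_mono) simp
  ultimately show ?thesis by simp
qed

text \<open>In \<open>GD\<close> the leading parts of two gradients cancel and leave something
  proportional to the length of \<open>q\<close>, of order \<open>k ^ (2 l - 2)\<close>. The powers
  of 2 come from bounding \<open>p_j\<close> and \<open>p_{j-q}\<close> by
  \<open>2 k\<close>.\<close>

definition CD where "CD = 2 * real l * (real (2 * l - 1) * 2 ^ (2 * l - 2) * norm (lvec q))"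
definition CG where "CG = 2 * real l * 2 ^ (2 * l - 1) + CD"

lemma CD_nonneg: "0 \<le> CD" and CG_nonneg: "0 \<le> CG"
  by (simp_all add: CD_def CG_def)

context
  fixes k r :: real and t0 t :: "real ^ 'n"
  assumes k: "1 \<le> k" "2 * (1 + norm (lvec q)) \<le> k" and t0: "pn j t0 = k" and t: "t \<in> ball t0 r" and r: "r \<le> 1"
begin

lemma pn_bounds: "\<bar>pn j t - k\<bar> \<le> 1" "pn j t \<le> 2 * k" "pn (j - q) t \<le> 2 * k"
proof -
  have "\<bar>norm (lvec j + t) - norm (lvec j + t0)\<bar> \<le> norm ((lvec j + t) - (lvec j + t0))"
    by (rule norm_triangle_ineq3)
  then show 1: "\<bar>pn j t - k\<bar> \<le> 1"
    using t r t0 by (simp add: pn_def Pv_def dist_norm norm_minus_commute)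
  then show "pn j t \<le> 2 * k" using k by linarith
  have "norm (lvec j - lvec q + t) \<le> norm (lvec j + t) + norm (lvec q)"
    using norm_triangle_ineq4[of "lvec j + t" "lvec q"] by (simp add: algebra_simps)
  then have "pn (j - q) t \<le> pn j t + norm (lvec q)" by (simp add: pn_def Pv_def lvec_diff)
  moreover have "2 + 2 * norm (lvec q) \<le> k" "0 \<le> norm (lvec q)" using k by auto
  ultimately show "pn (j - q) t \<le> 2 * k" using 1 by linarith
qed

lemma norm_GD_le: "norm (GD t) \<le> CD * k ^ (2 * l - 2)"
proof -
  let ?n = "2 * l - 2" and ?x = "pn j t" and ?y = "pn (j - q) t"
  have x: "\<bar>?x\<bar> \<le> 2 * k" "\<bar>?y\<bar> \<le> 2 * k" using pn_bounds by (simp_all add: pn_def)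
  have xy: "\<bar>?x - ?y\<bar> \<le> norm (lvec q)"
    using norm_triangle_ineq3[of "Pv j t" "Pv (j - q) t"] by (simp add: pn_def Pv_def lvec_diff)
  \<comment> \<open>Splitting off the common vector \<open>Pv j t\<close> leaves a difference of
    powers and a multiple of \<open>q\<close>.\<close>
  have "GD t = (2 * real l) *\<^sub>R ((?x ^ ?n - ?y ^ ?n) *\<^sub>R Pv j t + ?y ^ ?n *\<^sub>R lvec q)"
    by (simp add: GD_def ga_def Pv_def lvec_diff algebra_simps)
  then have "norm (GD t) = 2 * real l * norm ((?x ^ ?n - ?y ^ ?n) *\<^sub>R Pv j t + ?y ^ ?n *\<^sub>R lvec q)" by simp
  also have "\<dots> \<le> 2 * real l * (\<bar>?x ^ ?n - ?y ^ ?n\<bar> * (2 * k) + (2 * k) ^ ?n * norm (lvec q))"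
  proof (rule mult_left_mono)
    have "norm ((?x ^ ?n - ?y ^ ?n) *\<^sub>R Pv j t + ?y ^ ?n *\<^sub>R lvec q) \<le> \<bar>?x ^ ?n - ?y ^ ?n\<bar> * ?x + ?y ^ ?n * norm (lvec q)"
      by (rule order_trans[OF norm_triangle_ineq]) (simp add: pn_def)
    also have "\<dots> \<le> \<bar>?x ^ ?n - ?y ^ ?n\<bar> * (2 * k) + (2 * k) ^ ?n * norm (lvec q)"
      using pn_bounds by (intro add_mono mult_left_mono mult_right_mono power_mono) (auto simp: pn_def)
    finally show "norm ((?x ^ ?n - ?y ^ ?n) *\<^sub>R Pv j t + ?y ^ ?n *\<^sub>R lvec q)
        \<le> \<bar>?x ^ ?n - ?y ^ ?n\<bar> * (2 * k) + (2 * k) ^ ?n * norm (lvec q)" .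
  qed simp
  also have "\<dots> \<le> 2 * real l * (real ?n * (2 * k) ^ ?n * norm (lvec q) + (2 * k) ^ ?n * norm (lvec q))"
  proof (intro mult_left_mono add_right_mono)
    show "\<bar>?x ^ ?n - ?y ^ ?n\<bar> * (2 * k) \<le> real ?n * (2 * k) ^ ?n * norm (lvec q)"
      using k by (intro order_trans[OF abs_power_diff_le[OF x]] mult_left_mono xy) auto
  qed simp
  also have "\<dots> = 2 * real l * ((real ?n + 1) * 2 ^ ?n * norm (lvec q)) * k ^ ?n"
    by (simp add: power_mult_distrib algebra_simps)
  also have "real ?n + 1 = real (2 * l - 1)" using l by simp
  finally show ?thesis by (simp add: CD_def)
qed

lemma norm_Glh_le: "norm (Glh t) \<le> CG * k ^ (2 * l - 1)"
proof -
  have "norm (Glh t) \<le> norm (ga j t) + norm (GD t)"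
    using norm_triangle_ineq[of "ga j t" "Glh t - ga j t"] Glh_diff_le[of t] by simp
  also have "\<dots> \<le> 2 * real l * (2 * k) ^ (2 * l - 1) + CD * k ^ (2 * l - 2)"
    unfolding norm_ga using pn_bounds norm_GD_le
    by (intro add_mono mult_left_mono power_mono) (auto simp: pn_def)
  also have "k ^ (2 * l - 2) \<le> k ^ (2 * l - 1)" using k by (intro power_increasing) auto
  then have "CD * k ^ (2 * l - 2) \<le> CD * k ^ (2 * l - 1)" by (rule mult_left_mono[OF _ CD_nonneg])
  finally show ?thesis by (simp add: CG_def power_mult_distrib algebra_simps)
qed

lemma abs_lh_le: "\<bar>lh t\<bar> \<le> (2 * k) ^ (2 * l) + norm vq"
proof -
  have aj: "0 \<le> a j t" "a j t \<le> (2 * k) ^ (2 * l)" "0 \<le> a (j - q) t" "a (j - q) t \<le> (2 * k) ^ (2 * l)"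
    unfolding a_def by (intro zero_le_power power_mono pn_bounds; simp add: pn_def)+
  have "S t \<le> 2 * norm vq + \<bar>D t\<bar>"
    unfolding S_def using sqrt_sum_squares_le_sum_abs[of "2 * norm vq" "D t"] by (simp add: power_mult_distrib)
  then have "\<bar>e * (S t / 2)\<bar> \<le> norm vq + \<bar>a j t - a (j - q) t\<bar> / 2"
    using ee S_ge(4)[of t] by (simp add: abs_mult D_def)
  then have "\<bar>(a j t + a (j - q) t) / 2 + e * (S t / 2)\<bar> \<le> (2 * k) ^ (2 * l) + norm vq"
    using aj by (rule abs_max_le)
  then show ?thesis by (simp add: lh_eq add_divide_distrib)
qed

text \<open>On the ball \<open>p_j\<close> differs from \<open>k\<close> by at most 1, so its power
  \<open>2 l - 1\<close> changes by \<open>O(k ^ (2 l - 2))\<close>; the remaining error is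
  \<open>Glh - ga j\<close>.\<close>

lemma norm_Glh_bounds: "\<bar>norm (Glh t) - 2 * real l * k ^ (2 * l - 1)\<bar> \<le>
    (CD + 2 * real l * (real (2 * l - 1) * 2 ^ (2 * l - 1))) * k ^ (2 * l - 2)"
proof -
  let ?n = "2 * l - 1" and ?x = "pn j t"
  have n: "?n = Suc (2 * l - 2)" using l by simp
  have "\<bar>?x ^ ?n - k ^ ?n\<bar> * (2 * k) \<le> real ?n * (2 * k) ^ ?n * \<bar>?x - k\<bar>"
    using pn_bounds k by (intro abs_power_diff_le) (auto simp: pn_def)
  also have "\<dots> \<le> real ?n * (2 * k) ^ ?n * 1"
    using pn_bounds k by (intro mult_left_mono) auto
  also have "\<dots> = (real ?n * 2 ^ ?n * k ^ (2 * l - 2)) * k" 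
    unfolding power_mult_distrib by (subst (2) n, unfold power_Suc) (simp only: mult_ac mult_1_right)
  also have "\<dots> \<le> (real ?n * 2 ^ ?n * k ^ (2 * l - 2)) * (2 * k)"
    using k by (intro mult_left_mono) auto
  finally have "\<bar>?x ^ ?n - k ^ ?n\<bar> \<le> real ?n * 2 ^ ?n * k ^ (2 * l - 2)"
    using k by simp
  then have "2 * real l * \<bar>?x ^ ?n - k ^ ?n\<bar> \<le> 2 * real l * (real ?n * 2 ^ ?n * k ^ (2 * l - 2))"
    by (rule mult_left_mono) simp
  moreover have "\<bar>norm (ga j t) - 2 * real l * k ^ ?n\<bar> = 2 * real l * \<bar>?x ^ ?n - k ^ ?n\<bar>"
    unfolding norm_ga right_diff_distrib[symmetric] abs_mult by simp
  moreover have "\<bar>norm (Glh t) - norm (ga j t)\<bar> \<le> CD * k ^ (2 * l - 2)"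
    using norm_triangle_ineq3[of "Glh t" "ga j t"] Glh_diff_le[of t] norm_GD_le by linarith
  ultimately show ?thesis unfolding distrib_right mult.assoc by linarith
qed

end

lemma lipschitz_of_gradient:
  fixes f :: "real ^ 'n \<Rightarrow> 'b::real_normed_vector"
  assumes "convex U" and f: "\<And>x. x \<in> U \<Longrightarrow> (f has_derivative f' x) (at x within U)"
    and B: "\<And>x h. x \<in> U \<Longrightarrow> norm (f' x h) \<le> B * norm h" and "0 \<le> B" "x \<in> U" "y \<in> U"
  shows "norm (f x - f y) \<le> B * norm (x - y)"
  by (rule differentiable_bound[OF assms(1) f onorm_le[OF B]]) (use assms in auto)

end

section \<open>The gradient of the eigenvalue\<close>

text \<open>A sum over an infinite index set is 0 by convention, so a trigonometric polynomial that
  does not vanish identically has a finite set of frequencies.\<close>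

lemma fcoeff_trig_poly:
  fixes v :: "int ^ 'n \<Rightarrow> complex"
  assumes nz: "\<exists>x. trig_poly R0 v x \<noteq> 0"
  shows "finite {m :: int ^ 'n. 0 < norm (lvec m) \<and> norm (lvec m) \<le> R0}" (is "finite ?F")
    and "fcoeff (trig_poly R0 v) m = (if 0 < norm (lvec m) \<and> norm (lvec m) \<le> R0 then v m else 0)"
    and "fser (fcoeff (trig_poly R0 v)) x = trig_poly R0 v x"
proof -
  define cf where "cf m = (if m \<in> ?F then v m else 0)" for m
  show fin: "finite ?F"
  proof (rule ccontr)
    assume "infinite ?F"
    then show False using nz by (simp add: trig_poly_def)
  qed
  have sm: "(\<lambda>m. norm (cf m)) summable_on UNIV"
    by (rule finite_nonzero_values_imp_summable_on, rule finite_subset[OF _ fin]) (auto simp: cf_def)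
  have ser: "fser cf = trig_poly R0 v"
  proof
    fix x
    have "fser cf x = (\<Sum>m\<in>?F. cf m * mode (lvec m) x)"
      unfolding fser_def by (rule infsum_finite_support[OF fin]) (auto simp: cf_def)
    then show "fser cf x = trig_poly R0 v x"
      unfolding trig_poly_def by (auto simp: cf_def intro!: sum.cong)
  qed
  have cf: "fcoeff (trig_poly R0 v) = cf"
    using fcoeff_fser[OF sm] ser by auto
  show "fcoeff (trig_poly R0 v) m = (if 0 < norm (lvec m) \<and> norm (lvec m) \<le> R0 then v m else 0)"
    by (simp add: cf cf_def)
  show "fser (fcoeff (trig_poly R0 v)) x = trig_poly R0 v x"
    by (simp add: cf ser)
qed

lemma fcoeff_uminus_real:
  assumes "\<And>x. V x \<in> \<real>"
  shows "fcoeff V (- m) = cnj (fcoeff V m)"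
proof -
  have "lvec (- m) = - lvec m" by (simp add: lvec_def vec_eq_iff)
  moreover have "cnj (V x) = V x" for x using assms[of x] by (simp add: Reals_cnj_iff)
  ultimately show ?thesis
    unfolding fcoeff_def set_lebesgue_integral_def
    by (simp add: cnj_mode Bochner_Integration.integral_cnj[symmetric] del: Bochner_Integration.integral_cnj)
qed

context model
begin

section \<open>Lipschitz constants of the resolvent and the perturbed gradient\<close>

text \<open>The bound has to be uniform in \<open>m\<close> although the gradient of
  \<open>a m\<close> is not; differentiating the reciprocal divides that gradient by the squared
  gap.\<close>

lemma inverse_gap_lipschitz:
  assumes k: "1 \<le> k" "2 * (1 + norm (lvec q)) \<le> k" "norm vq + d \<le> k" and t0: "pn j t0 = k" and r: "r \<le> 1"
    and g: "1 \<le> g" and b: "\<And>t. t \<in> ball t0 r \<Longrightarrow> g \<le> norm (of_real (a m t - lh t) - \<zeta>)"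
    and \<zeta>: "cmod \<zeta> = d" and t: "t \<in> ball t0 r" "t' \<in> ball t0 r"
  shows "norm (1 / (of_real (a m t - lh t) - \<zeta>) - 1 / (of_real (a m t' - lh t') - \<zeta>))
    \<le> (4 * real l + (2 * real l * 4 ^ (2 * l - 1) + CG) * k ^ (2 * l - 1) / g\<^sup>2) * norm (t - t')"
proof (rule lipschitz_of_gradient[OF convex_ball[of t0 r] _ _ _ t])
  let ?b = "\<lambda>x. of_real (a m x - lh x) - \<zeta> :: complex"
  let ?f' = "\<lambda>x h. - (inverse (?b x) * of_real ((ga m x - Glh x) \<bullet> h) * inverse (?b x))"
  let ?B = "4 * real l + (2 * real l * 4 ^ (2 * l - 1) + CG) * k ^ (2 * l - 1) / g\<^sup>2"
  fix x assume x: "x \<in> ball t0 r"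
  have gb: "g \<le> norm (?b x)" by (rule b[OF x])
  then have nz: "?b x \<noteq> 0" using g by auto
  have "(?b has_derivative (\<lambda>h. of_real (ga m x \<bullet> h - Glh x \<bullet> h) - 0)) (at x within ball t0 r)"
    by (intro has_derivative_diff has_derivative_const has_derivative_of_real a_derivative lh_derivative)
  from Deriv.has_derivative_inverse[OF nz this]
  show "((\<lambda>x. 1 / ?b x) has_derivative ?f' x) (at x within ball t0 r)"
    by (simp add: inner_diff_left inverse_eq_divide)
  have b2: "1 \<le> norm (?b x)" "g\<^sup>2 \<le> (norm (?b x))\<^sup>2" using gb g by (auto intro!: power_mono)
  have G: "norm (Glh x) \<le> CG * k ^ (2 * l - 1)" by (rule norm_Glh_le[OF k(1,2) t0 x r])
  have lhx: "\<bar>lh x\<bar> \<le> (2 * k) ^ (2 * l) + norm vq" by (rule abs_lh_le[OF k(1,2) t0 x r])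
  have "norm (ga m x) / (norm (?b x))\<^sup>2 \<le> 4 * real l + 2 * real l * (4 * k) ^ (2 * l - 1) / g\<^sup>2"
  \<comment> \<open>If \<open>pn m x\<close> is large, then \<open>a m x\<close> dominates \<open>lh x\<close>, and the gap is comparable to it.\<close>
  proof (cases "pn m x \<le> 4 * k")
    case True
    have "norm (ga m x) / (norm (?b x))\<^sup>2 \<le> 2 * real l * (4 * k) ^ (2 * l - 1) / g\<^sup>2"
      unfolding norm_ga using True b2 g k
      by (intro frac_le mult_left_mono power_mono) (auto simp: pn_def)
    then show ?thesis by simp
  next
    case False
    have p: "(4 * k) ^ (2 * l) \<le> pn m x ^ (2 * l)" using False k by (intro power_mono) auto
    have "(4 * k) ^ (2 * l) = (2 ^ (2 * l)) * (2 * k) ^ (2 * l)" unfolding power_mult_distrib[symmetric] by simp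
    moreover have "(2 :: real) ^ 2 \<le> 2 ^ (2 * l)" using l by (intro power_increasing) auto
    then have "4 * (2 * k) ^ (2 * l) \<le> 2 ^ (2 * l) * (2 * k) ^ (2 * l)"
      using k by (intro mult_right_mono) auto
    ultimately have 4: "4 * (2 * k) ^ (2 * l) \<le> (4 * k) ^ (2 * l)" by (simp only:)
    have "(2 * k) ^ 1 \<le> (2 * k) ^ (2 * l)" using l k by (intro power_increasing) auto
    then have "\<bar>lh x\<bar> + d \<le> 2 * (2 * k) ^ (2 * l)" using lhx k by simp
    then have half: "\<bar>lh x\<bar> + d \<le> a m x / 2" using 4 p by (simp add: a_def)
    have "\<bar>a m x - lh x\<bar> - d \<le> norm (?b x)"
      using norm_triangle_ineq2[of "of_real (a m x - lh x)" \<zeta>] \<zeta> by (simp only: norm_of_real)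
    then have ab: "a m x \<le> 2 * norm (?b x)" using half by linarith
    have "1 \<le> pn m x" using False k by simp
    then have "pn m x ^ (2 * l - 1) \<le> a m x" unfolding a_def by (intro power_increasing) auto
    then have "norm (ga m x) \<le> 2 * real l * (2 * norm (?b x))"
      unfolding norm_ga using ab by (intro mult_left_mono) auto
    also have "\<dots> = 4 * real l * (norm (?b x) * 1)" by simp
    also have "\<dots> \<le> 4 * real l * (norm (?b x) * norm (?b x))"
      using b2 by (intro mult_left_mono) auto
    finally have "norm (ga m x) / (norm (?b x))\<^sup>2 \<le> 4 * real l"
      using b2 by (subst divide_le_eq) (auto simp: power2_eq_square mult.assoc)
    moreover have "0 \<le> 2 * real l * (4 * k) ^ (2 * l - 1) / g\<^sup>2" using k by simp
    ultimately show ?thesis by linarith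
  qed
  moreover have "norm (Glh x) / (norm (?b x))\<^sup>2 \<le> CG * k ^ (2 * l - 1) / g\<^sup>2"
    using G b2 g k CG_nonneg by (intro frac_le) auto
  ultimately have B: "(norm (ga m x) + norm (Glh x)) / (norm (?b x))\<^sup>2 \<le> ?B"
    by (simp add: add_divide_distrib power_mult_distrib distrib_right)
  show "norm (?f' x h) \<le> ?B * norm h" for h
  proof -
    have "norm (?f' x h) = \<bar>(ga m x - Glh x) \<bullet> h\<bar> / (norm (?b x))\<^sup>2"
      by (simp add: norm_mult norm_inverse power2_eq_square divide_inverse del: of_real_diff)
    also have "\<dots> \<le> ((norm (ga m x) + norm (Glh x)) * norm h) / (norm (?b x))\<^sup>2"
    proof (rule divide_right_mono)
      have "\<bar>(ga m x - Glh x) \<bullet> h\<bar> \<le> norm (ga m x - Glh x) * norm h" by (rule Cauchy_Schwarz_ineq2)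
      also have "\<dots> \<le> (norm (ga m x) + norm (Glh x)) * norm h"
        by (intro mult_right_mono norm_triangle_ineq4) simp
      finally show "\<bar>(ga m x - Glh x) \<bullet> h\<bar> \<le> (norm (ga m x) + norm (Glh x)) * norm h" .
    qed simp
    also have "\<dots> \<le> ?B * norm h" using mult_right_mono[OF B, of "norm h"] by simp
    finally show ?thesis .
  qed
next
  show "0 \<le> 4 * real l + (2 * real l * 4 ^ (2 * l - 1) + CG) * k ^ (2 * l - 1) / g\<^sup>2"
    using k CG_nonneg by simp
qed

text \<open>The Lipschitz constant \<open>CL\<close> with its parameters filled in. It involves only
  \<open>d\<close> and \<open>v1\<close>, so it can be fixed before \<open>k\<close>,
  \<open>t\<close> and \<open>j\<close> are known.\<close>

definition Cpert :: "real \<Rightarrow> real" where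
  "Cpert v1 = (let b = 4 / d + 1; y = v1 + 1; K = 8 * (1 + b * y)
     in 2 * d * (2 * (y + b) * K\<^sup>2 + 2 * b * y * (2 * K * (K\<^sup>2 * (y + b)))))"

text \<open>The gradient estimates supply the Lipschitz constants of the model on the ball around
  the resonant point, and the error bound is \<open>2 CL \<kappa>\<close> written out.\<close>

lemma lam_gradient:
  assumes k: "1 \<le> k" "2 * (1 + norm (lvec q)) \<le> k" "norm vq + d \<le> k" and t0: "pn j t0 = k" and r: "r \<le> 1"
    and V: "\<And>x. V x = fser (fcoeff V) x" "\<And>m. fcoeff V (- m) = cnj (fcoeff V m)"
      "\<And>F. finite F \<Longrightarrow> (\<Sum>m\<in>F. cmod (fcoeff V m)) \<le> v1"
    and g: "1 \<le> g" "\<And>t \<zeta> m. t \<in> ball t0 r \<Longrightarrow> cmod \<zeta> \<le> 2 * d \<Longrightarrow> m \<notin> P \<Longrightarrow> g \<le> norm (of_real (a m t - lh t) - \<zeta>)"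
    and c: "c = \<sigma> * (norm A)\<^sup>2" and beta: "0 < \<beta>" "\<beta> \<le> 1"
    and sm: "2 * (4 / d + 1) * (v1 + 1)\<^sup>2 / g + (4 / d + 1)\<^sup>2 * (v1 + 1) * \<beta> \<le> 1 / 2"
      "((v1 + 1) / g)\<^sup>2 \<le> 1 / 2"
      "\<bar>c\<bar> * (d * (8 * (1 + (4 / d + 1) * (v1 + 1))) * (4 / d + 1))\<^sup>2 \<le> \<beta> / 2"
      "\<bar>c\<bar> * (2 * (d * (8 * (1 + (4 / d + 1) * (v1 + 1))) * (4 / d + 1)) *
      (d * ((8 * (1 + (4 / d + 1) * (v1 + 1)))\<^sup>2 * (v1 + 1 + (4 / d + 1)) * (4 / d + 1)
        + 8 * (1 + (4 / d + 1) * (v1 + 1))))) \<le> 1 / 2"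
    and t: "t \<in> ball t0 r"
  obtains G where "(lam l V q j e \<sigma> A has_derivative (\<lambda>h. of_real (G \<bullet> h))) (at t)"
    and "norm (G - Glh t) \<le> 2 * Cpert v1 * (2 * (CD * k ^ (2 * l - 2) / d\<^sup>2)
      + (4 * real l + (2 * real l * 4 ^ (2 * l - 1) + CG) * k ^ (2 * l - 1) / g\<^sup>2))"
    and "\<forall>\<^sub>F t' in nhds t. lam_well_defined l V q j e \<sigma> A t'"
proof -
  let ?U = "ball t0 r"
  define \<kappa>1 where "\<kappa>1 = CD * k ^ (2 * l - 2)"
  define \<kappa>2 where "\<kappa>2 = 4 * real l + (2 * real l * 4 ^ (2 * l - 1) + CG) * k ^ (2 * l - 1) / g\<^sup>2"
  have gap': "g \<le> norm (of_real (a m t - lh t) - \<zeta>)" if "t \<in> ?U" "cmod \<zeta> = d" "m \<notin> P" for t \<zeta> m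
    using g(2)[OF that(1) _ that(3), of \<zeta>] that(2) d_pos by simp
  have \<kappa>: "0 \<le> \<kappa>1" "0 \<le> \<kappa>2" using k CG_nonneg CD_nonneg by (simp_all add: \<kappa>1_def \<kappa>2_def)
  have DL: "\<bar>D x - D x'\<bar> \<le> \<kappa>1 * norm (x - x')" if "x \<in> ?U" "x' \<in> ?U" for x x'
  proof -
    have "norm (D x - D x') \<le> \<kappa>1 * norm (x - x')"
    proof (rule lipschitz_of_gradient[OF convex_ball[of t0 r] D_derivative _ \<kappa>(1) that])
      fix x h assume "x \<in> ?U"
      then have "norm (GD x) \<le> \<kappa>1" unfolding \<kappa>1_def by (rule norm_GD_le[OF k(1,2) t0 _ r])
      then show "norm (GD x \<bullet> h) \<le> \<kappa>1 * norm h"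
        unfolding real_norm_def by (intro order_trans[OF Cauchy_Schwarz_ineq2] mult_right_mono) auto
    qed
    then show ?thesis by simp
  qed
  have T: "norm x \<le> norm t0 + 1" if "x \<in> ?U" for x
    using that r norm_triangle_ineq2[of x t0] by (simp add: dist_norm norm_minus_commute)
  interpret nm: nonlinear_model l V q j e ?U g \<kappa>1 \<kappa>2 "norm t0 + 1" "(2 * k) ^ (2 * l) + norm vq" v1 \<beta> c \<sigma> A
  proof (unfold_locales)
    show "norm (1 / (of_real (a m x - lh x) - \<zeta>) - 1 / (of_real (a m x' - lh x') - \<zeta>)) \<le> \<kappa>2 * norm (x - x')"
      if "x \<in> ?U" "x' \<in> ?U" "cmod \<zeta> = d" "m \<notin> P" for x x' \<zeta> m
      unfolding \<kappa>2_def
      by (rule inverse_gap_lipschitz[OF k t0 r g(1) gap'[OF _ that(3,4)] that(3,1,2)])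
    show "\<bar>lh x\<bar> \<le> (2 * k) ^ (2 * l) + norm vq" if "x \<in> ?U" for x
      by (rule abs_lh_le[OF k(1,2) t0 that r])
  qed (fact open_ball convex_ball g V c beta sm \<kappa> DL T)+
  obtain D' where D': "((\<lambda>t. nm.np.Lmap t (nm.np.Ysol t)) has_derivative D') (at t)"
    and leD: "\<And>h. norm (D' h) \<le> 2 * nm.np.CL * nm.\<kappa> * norm h"
    by (rule nm.np.Lmap_Ysol_derivative[OF t]) (rule that)
  \<comment> \<open>The correction is real on the whole ball, so uniqueness of derivatives makes its
    derivative real as well.\<close>
  have "((\<lambda>t. cnj (nm.np.Lmap t (nm.np.Ysol t))) has_derivative (\<lambda>h. cnj (D' h))) (at t)"
    by (rule bounded_linear.has_derivative[OF bounded_linear_cnj D'])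
  then have "((\<lambda>t. nm.np.Lmap t (nm.np.Ysol t)) has_derivative (\<lambda>h. cnj (D' h))) (at t)"
    by (rule has_derivative_transform_within_open[OF _ open_ball t]) (rule nm.Lmap_real)
  then have real: "cnj (D' h) = D' h" for h
    by (rule fun_cong[OF has_derivative_unique[OF _ D']])
  obtain w where w: "\<And>h. D' h = of_real (w \<bullet> h)" "norm w \<le> 2 * nm.np.CL * nm.\<kappa>"
    by (rule real_linear_functional[OF has_derivative_bounded_linear[OF D'] real leD]) (rule that)
  have "((\<lambda>t. of_real (lh t) + nm.np.Lmap t (nm.np.Ysol t)) has_derivative
      (\<lambda>h. of_real (Glh t \<bullet> h) + D' h)) (at t)"
    by (intro has_derivative_add has_derivative_of_real lh_derivative D')
  then have "(lam l V q j e \<sigma> A has_derivative (\<lambda>h. of_real (Glh t \<bullet> h) + D' h)) (at t)"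
    by (rule has_derivative_transform_within_open[OF _ open_ball t]) (rule nm.lam_eq[symmetric])
  then have der: "(lam l V q j e \<sigma> A has_derivative (\<lambda>h. of_real ((Glh t + w) \<bullet> h))) (at t)"
    by (simp add: w(1) inner_add_left)
  have wd: "\<forall>\<^sub>F t' in nhds t. lam_well_defined l V q j e \<sigma> A t'"
    using eventually_nhds_in_open[OF open_ball t] by eventually_elim (rule nm.lam_well_defined)
  have "nm.np.CL = Cpert v1"
    unfolding nm.np.CL_def nm.np.K_def Cpert_def Let_def ..
  then have "norm (Glh t + w - Glh t) \<le> 2 * Cpert v1 * (2 * (CD * k ^ (2 * l - 2) / d\<^sup>2)
      + (4 * real l + (2 * real l * 4 ^ (2 * l - 1) + CG) * k ^ (2 * l - 1) / g\<^sup>2))"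
    using w(2) unfolding nm.\<kappa>_def by (simp add: \<kappa>1_def \<kappa>2_def)
  with der wd show ?thesis by (intro that)
qed

end

section \<open>Uniform constants and the final estimate\<close>

text \<open>Clipping the total relative error to the interval allowed for the first summand leaves a
  remainder within the allowance of the second.\<close>

lemma split_relative_error:
  fixes x M a b :: real
  assumes le: "\<bar>x - L * M\<bar> \<le> M * (c0 * a + c1 * b)"
    and "0 < M" "1 \<le> L" "0 \<le> c0" "0 \<le> c1" "0 \<le> a" "0 \<le> b"
  obtains \<epsilon>1 \<epsilon>2 where "x = L * M * (1 + \<epsilon>1 + \<epsilon>2)" "\<bar>\<epsilon>1\<bar> \<le> max c0 c1 * b" "\<bar>\<epsilon>2\<bar> \<le> max c0 c1 * a"
proof -
  let ?C = "max c0 c1"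
  define \<epsilon> where "\<epsilon> = x / (L * M) - 1"
  have x: "x = L * M * (1 + \<epsilon>)" using assms by (simp add: \<epsilon>_def)
  have "M * \<bar>\<epsilon>\<bar> \<le> L * (M * \<bar>\<epsilon>\<bar>)" using assms mult_right_mono[of 1 L "M * \<bar>\<epsilon>\<bar>"] by simp
  also have "\<dots> = \<bar>x - L * M\<bar>" using assms by (simp add: x abs_mult algebra_simps flip: right_diff_distrib)
  finally have "M * \<bar>\<epsilon>\<bar> \<le> M * (c0 * a + c1 * b)" using le by linarith
  then have "\<bar>\<epsilon>\<bar> \<le> c0 * a + c1 * b" using assms by simp
  also have "\<dots> \<le> ?C * a + ?C * b" using assms by (intro add_mono mult_right_mono) auto
  finally have \<epsilon>: "\<bar>\<epsilon>\<bar> \<le> ?C * a + ?C * b" .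
  have nn: "0 \<le> ?C * a" "0 \<le> ?C * b" using assms by (auto intro!: mult_nonneg_nonneg simp: max_def)
  define \<epsilon>1 where "\<epsilon>1 = max (- (?C * b)) (min (?C * b) \<epsilon>)"
  have "\<bar>\<epsilon>1\<bar> \<le> ?C * b" "\<bar>\<epsilon> - \<epsilon>1\<bar> \<le> ?C * a"
    using \<epsilon> nn unfolding \<epsilon>1_def by linarith+
  then show ?thesis using x by (intro that[of \<epsilon>1 "\<epsilon> - \<epsilon>1"]) auto
qed

theorem corollary28:
  fixes l :: nat
    and v :: "int ^ 'n \<Rightarrow> complex" and V :: "real ^ 'n \<Rightarrow> complex"
    and q :: "int ^ 'n"
    and R0 \<delta> \<gamma> \<gamma>\<^sub>1 \<gamma>\<^sub>2 :: real
  assumes "l \<ge> 1" and "2 * l > CARD('n)"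
    and "V = trig_poly R0 v"
    and "\<And>x. V x \<in> \<real>" and "\<exists>x. V x \<noteq> 0"
    and "q \<noteq> 0" and "norm (lvec q) \<le> R0" and "v q \<noteq> 0"
    and "\<gamma>\<^sub>2 > 0"
    and "0 < 9 * \<delta>" and "9 * \<delta> < 2 * real l - real CARD('n)"
    and "2 * \<gamma>\<^sub>1 = 2 * real l - real CARD('n) - 8 * \<delta>"
    and "\<gamma> = min \<gamma>\<^sub>1 \<gamma>\<^sub>2"
  shows "\<exists>k\<^sub>0>0. \<exists>C. \<forall>X. resonant_family l V q \<delta> X \<longrightarrow>
    (\<forall>k>k\<^sub>0. \<forall>t\<^sub>0\<in>X k. \<forall>j. attached q \<delta> k t\<^sub>0 j \<longrightarrow>
      (\<forall>t\<in>cellK. dist t t\<^sub>0 < k powr (- real CARD('n) + 1 - 7 * \<delta>) \<longrightarrow>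
        (\<forall>(\<sigma>::real) (A::complex). \<bar>\<sigma>\<bar> * (norm A)\<^sup>2 < k powr (- \<gamma>\<^sub>2) \<longrightarrow>
          (\<forall>e\<in>{1, -1}.
            (\<forall>\<^sub>F t' in nhds t. lam_well_defined l V q j e \<sigma> A t') \<and>
            (\<exists>grad \<epsilon>\<^sub>1 \<epsilon>\<^sub>2.
               (lam l V q j e \<sigma> A has_derivative (\<lambda>h. complex_of_real (grad \<bullet> h))) (at t) \<and>
               norm grad = 2 * real l * k ^ (2 * l - 1) * (1 + \<epsilon>\<^sub>1 + \<epsilon>\<^sub>2) \<and>
               \<bar>\<epsilon>\<^sub>1\<bar> \<le> C * k powr (- \<gamma>) \<and> \<bar>\<epsilon>\<^sub>2\<bar> \<le> C * k powr (-1))))))"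
proof -
  \<comment> \<open>The exponent of the spectral gap. Since
    \<open>2 * \<gamma>\<^sub>1 = p - 2 * \<delta>\<close>, the exponent \<gamma> is below
    \<open>2 p\<close>, so the squared inverse gap is \<open>O(k powr - \<gamma>)\<close>.\<close>
  define p where "p = 2 * real l - real CARD('n) - 6 * \<delta>"
  have n1: "1 \<le> real CARD('n)" using zero_less_card_finite[where 'a = 'n] by linarith
  have p: "0 < p" "\<gamma> \<le> 2 * p" using assms by (auto simp: p_def min_def field_simps)
  have nz: "\<exists>x. trig_poly R0 v x \<noteq> 0" using assms(3,5) by simp
  let ?F = "{m :: int ^ 'n. 0 < norm (lvec m) \<and> norm (lvec m) \<le> R0}"
  note V_coeff = fcoeff_trig_poly[OF nz, folded assms(3)]
  have herm: "fcoeff V (- m) = cnj (fcoeff V m)" for m by (rule fcoeff_uminus_real[OF assms(4)])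
  have vq: "fcoeff V q \<noteq> 0" using assms(6-8) by (simp add: V_coeff(2) lvec_eq_0_iff)
  have v0: "fcoeff V 0 = 0" using lvec_eq_0_iff[of "0 :: int ^ 'n"] by (simp add: V_coeff(2))
  define v1 where "v1 = (\<Sum>m\<in>?F. norm (v m))"
  have V1: "(\<Sum>m\<in>G. norm (fcoeff V m)) \<le> v1" if "finite G" for G
  proof -
    have "(\<Sum>m\<in>G. norm (fcoeff V m)) = (\<Sum>m\<in>G. if m \<in> ?F then norm (v m) else 0)"
      by (intro sum.cong) (auto simp: V_coeff(2))
    also have "\<dots> = (\<Sum>m\<in>G \<inter> ?F. norm (v m))" using that by (rule sum.inter_restrict[symmetric])
    also have "\<dots> \<le> v1" unfolding v1_def by (intro sum_mono2 V_coeff(1)) auto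
    finally show ?thesis .
  qed
  have v1: "0 \<le> v1" unfolding v1_def by (rule sum_nonneg) simp
  \<comment> \<open>The index 0 and the sign 1 are placeholders: \<open>d\<close>,
    \<open>CD\<close>, \<open>CG\<close> and \<open>Cpert\<close> depend on neither, so threshold
    and constant are chosen before \<open>j\<close> and \<open>e\<close> are given.\<close>
  interpret m1: model l V q 0 1
    using assms(1,6) vq herm v0 by unfold_locales auto
  let ?d = "m1.d"
  define b where "b = 4 / ?d + 1"
  define y where "y = v1 + 1"
  \<comment> \<open>\<open>K0\<close> and \<open>K1\<close> are the factors of \<open>|c|\<close> in
    the two smallness conditions of the contraction.\<close>
  define K0 where "K0 = (?d * (8 * (1 + b * y)) * b)\<^sup>2"
  define K1 where "K1 = 2 * (?d * (8 * (1 + b * y)) * b) * (?d * ((8 * (1 + b * y))\<^sup>2 * (y + b) * b + 8 * (1 + b * y)))"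
  have d: "0 < ?d" by (rule m1.d_pos)
  have by1: "1 \<le> b" "1 \<le> y" using d v1 by (simp_all add: b_def y_def)
  have K0: "0 < K0" using by1 d unfolding K0_def by (intro zero_less_power mult_pos_pos add_pos_pos) auto
  have K1: "0 \<le> K1" using by1 d by (simp add: K1_def)
  \<comment> \<open>All smallness conditions as inequalities in \<open>k\<close> alone, with
    \<open>1 / g\<close> and \<beta> already replaced by powers of \<open>k\<close>.\<close>
  define good where "good k \<longleftrightarrow> 1 \<le> k \<and> 2 * (1 + norm (lvec q)) \<le> k \<and> norm (fcoeff V q) + ?d \<le> k \<and>
      4 * max 1 (3 * ?d) * k powr - p \<le> 1 \<and> 2 * K0 * k powr - \<gamma>\<^sub>2 \<le> 1 \<and>
      2 * b * y\<^sup>2 * (4 * k powr - p) + b\<^sup>2 * y * (2 * K0 * k powr - \<gamma>\<^sub>2) \<le> 1 / 2 \<and>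
      (y * (4 * k powr - p))\<^sup>2 \<le> 1 / 2 \<and> k powr - \<gamma>\<^sub>2 * K1 \<le> 1 / 2" for k :: real
  have "\<forall>\<^sub>F k in at_top. good k"
  proof -
    have small: "\<forall>\<^sub>F k in at_top. h k \<le> \<epsilon>" if "(h \<longlongrightarrow> 0) at_top" "0 < \<epsilon>" for h :: "real \<Rightarrow> real" and \<epsilon>
      using order_tendstoD(2)[OF that] by eventually_elim simp
    have lim: "((\<lambda>k::real. k powr - p) \<longlongrightarrow> 0) at_top" "((\<lambda>k::real. k powr - \<gamma>\<^sub>2) \<longlongrightarrow> 0) at_top"
      using p assms(9) by (auto intro!: tendsto_neg_powr filterlim_ident)
    show ?thesis
      unfolding good_def
      by (intro eventually_conj eventually_ge_at_top small tendsto_add_zero tendsto_null_power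
          tendsto_mult_right_zero tendsto_mult_left_zero lim) auto
  qed
  then obtain N where N: "\<And>k. N \<le> k \<Longrightarrow> good k" by (auto simp: eventually_at_top_linorder)
  \<comment> \<open>\<open>c0\<close> collects what is of relative order \<open>1 / k\<close>, and
    \<open>c1\<close> what carries the squared inverse gap; the factor 16 stems from
    \<open>g = k powr p / 4\<close>.\<close>
  define c0 where "c0 = m1.CD + 2 * real l * (real (2 * l - 1) * 2 ^ (2 * l - 1)) + 2 * m1.Cpert v1 * (2 * m1.CD / ?d\<^sup>2 + 4 * real l)"
  define c1 where "c1 = 16 * (2 * m1.Cpert v1 * (2 * real l * 4 ^ (2 * l - 1) + m1.CG))"
  have Cp: "0 \<le> m1.Cpert v1" using d v1 by (simp add: m1.Cpert_def Let_def)
  have c01: "0 \<le> c0" "0 \<le> c1"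
    using Cp m1.CD_nonneg m1.CG_nonneg by (simp_all add: c0_def c1_def)
  have main: "(\<forall>\<^sub>F t' in nhds t. lam_well_defined l V q j e \<sigma> A t') \<and>
      (\<exists>grad \<epsilon>\<^sub>1 \<epsilon>\<^sub>2. (lam l V q j e \<sigma> A has_derivative (\<lambda>h. complex_of_real (grad \<bullet> h))) (at t) \<and>
         norm grad = 2 * real l * k ^ (2 * l - 1) * (1 + \<epsilon>\<^sub>1 + \<epsilon>\<^sub>2) \<and>
         \<bar>\<epsilon>\<^sub>1\<bar> \<le> max c0 c1 * k powr (- \<gamma>) \<and> \<bar>\<epsilon>\<^sub>2\<bar> \<le> max c0 c1 * k powr (-1))"
    if X: "resonant_family l V q \<delta> X" and k: "max 1 N < k" and t0: "t0 \<in> X k" and j: "attached q \<delta> k t0 j"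
      and tt0: "dist t t0 < k powr (- real CARD('n) + 1 - 7 * \<delta>)"
      and \<sigma>A: "\<bar>\<sigma>\<bar> * (norm A)\<^sup>2 < k powr (- \<gamma>\<^sub>2)" and e: "e \<in> {1, -1}"
    for X k t0 j t \<sigma> A and e :: real
  proof -
    interpret m: model l V q j e
      using assms(1,6) vq herm v0 e by unfold_locales auto
    have gk: "1 \<le> k" "2 * (1 + norm (lvec q)) \<le> k" "norm (fcoeff V q) + ?d \<le> k"
      "4 * max 1 (3 * ?d) * k powr - p \<le> 1" "2 * K0 * k powr - \<gamma>\<^sub>2 \<le> 1"
      "2 * b * y\<^sup>2 * (4 * k powr - p) + b\<^sup>2 * y * (2 * K0 * k powr - \<gamma>\<^sub>2) \<le> 1 / 2"
      "(y * (4 * k powr - p))\<^sup>2 \<le> 1 / 2" "k powr - \<gamma>\<^sub>2 * K1 \<le> 1 / 2"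
      using N[of k] k unfolding good_def by auto
    \<comment> \<open>Half the radius on which \<open>resonant_family\<close> guarantees the
      gap.\<close>
    define r where "r = k powr (- real CARD('n) + 1 - 7 * \<delta>)"
    have r: "r \<le> 1" "0 < r"
      using powr_mono[of "- real CARD('n) + 1 - 7 * \<delta>" 0 k] n1 assms(10) gk(1) by (auto simp: r_def)
    \<comment> \<open>The hypothesis concerns points of the circle and gives a distance of at least
      \<open>2 g\<close>. Passing from the circle to any point of the disc of radius
      \<open>2 d\<close> costs at most \<open>3 d\<close>, which is at most
      \<open>g\<close>.\<close>
    define g where "g = k powr p / 4"
    have g_inv: "x / g = x * (4 * k powr - p)" for x
      using gk(1) by (simp add: g_def powr_minus field_simps)
    have "max 1 (3 * ?d) \<le> g"
      using gk(1,4) by (simp add: g_def powr_minus field_simps)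
    then have g: "1 \<le> g" "3 * ?d \<le> g" by auto
    have kj: "pn j t0 = k"
      using j by (simp add: attached_def Sq_def pn_def)
    have gap: "g \<le> norm (of_real (m.a i x - lam_hat l V q j e x) - \<zeta>)"
      if x: "x \<in> ball t0 r" and \<zeta>: "cmod \<zeta> \<le> 2 * ?d" and i: "i \<notin> m.P" for x \<zeta> i
    proof -
      let ?z = "of_real (lam_hat l V q j e x) + m.zeta 0"
      have "?z \<in> path_image (C1 l V q j e x)" unfolding m.path_image_C1 by force
      moreover have "dist x t0 < 2 * k powr (- real CARD('n) + 1 - 7 * \<delta>)"
        using x r(2) unfolding r_def[symmetric] mem_ball by (subst dist_commute) linarith
      moreover have "i \<noteq> j" "i \<noteq> j - q" using i by (auto simp: m.P_def)
      ultimately have "k powr p \<le> 2 * norm (of_real (pn i x ^ (2 * l)) - ?z)"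
        using X t0 j e gk(1) unfolding resonant_family_def p_def by auto
      then have "2 * g \<le> norm (of_real (m.a i x) - ?z)" by (simp add: g_def m.a_def)
      also have "\<dots> = norm ((of_real (m.a i x - lam_hat l V q j e x) - \<zeta>) + (\<zeta> - m.zeta 0))" by (simp add: algebra_simps)
      also have "\<dots> \<le> norm (of_real (m.a i x - lam_hat l V q j e x) - \<zeta>) + (norm \<zeta> + norm (m.zeta 0))"
        by (rule norm_triangle_le[OF add_left_mono[OF norm_triangle_ineq4]])
      finally show ?thesis using \<zeta> g by simp
    qed
    define c where "c = \<sigma> * (norm A)\<^sup>2"
    \<comment> \<open>Just large enough for \<open>|c| * K0 \<le> \<beta> / 2\<close>.\<close>
    define \<beta> where "\<beta> = 2 * K0 * k powr - \<gamma>\<^sub>2"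
    have c: "\<bar>c\<bar> \<le> k powr - \<gamma>\<^sub>2" using \<sigma>A by (simp add: c_def abs_mult)
    have \<beta>: "0 < \<beta>" "\<beta> \<le> 1" using K0 gk(1,5) by (simp_all add: \<beta>_def)
    have sm: "2 * b * y\<^sup>2 / g + b\<^sup>2 * y * \<beta> \<le> 1 / 2" "(y / g)\<^sup>2 \<le> 1 / 2"
      using gk(6,7) by (simp_all add: g_inv \<beta>_def)
    have "\<bar>c\<bar> * K0 \<le> \<beta> / 2" using mult_right_mono[OF c, of K0] K0 by (simp add: \<beta>_def mult.commute)
    moreover have "\<bar>c\<bar> * K1 \<le> 1 / 2" using mult_right_mono[OF c K1] gk(8) by linarith
    ultimately obtain G where der: "(lam l V q j e \<sigma> A has_derivative (\<lambda>h. of_real (G \<bullet> h))) (at t)"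
      and G: "norm (G - m.Glh t) \<le> 2 * m1.Cpert v1 * (2 * (m1.CD * k ^ (2 * l - 2) / ?d\<^sup>2)
        + (4 * real l + (2 * real l * 4 ^ (2 * l - 1) + m1.CG) * k ^ (2 * l - 1) / g\<^sup>2))"
      and wd: "\<forall>\<^sub>F t' in nhds t. lam_well_defined l V q j e \<sigma> A t'"
      using m.lam_gradient[OF gk(1-3) kj r(1) V_coeff(3)[symmetric] herm V1 g(1) gap c_def \<beta> sm[unfolded b_def y_def], of t]
        tt0 unfolding K0_def K1_def b_def y_def by (auto simp: r_def dist_commute)
    let ?a = "k powr (-1)" and ?b = "k powr (- \<gamma>)" and ?M = "k ^ (2 * l - 1)"
    have kpow: "k ^ (2 * l - 2) = ?M * ?a"
    proof -
      have "2 * l - 1 = Suc (2 * l - 2)" using assms(1) by simp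
      then show ?thesis using gk(1) by (simp only: power_Suc) (simp add: powr_minus)
    qed
    have k1: "1 \<le> k ^ (2 * l - 2)" using gk(1) by simp
    have "1 / g\<^sup>2 = 16 * (k powr - p * k powr - p)"
      using gk(1) by (simp add: g_def powr_minus power2_eq_square field_simps)
    also have "\<dots> = 16 * k powr (- (2 * p))" by (simp add: powr_add[symmetric])
    also have "\<dots> \<le> 16 * ?b" using p(2) gk(1) by (intro mult_left_mono powr_mono) auto
    finally have g2: "1 / g\<^sup>2 \<le> 16 * ?b" .
    let ?H = "2 * real l * 4 ^ (2 * l - 1) + m1.CG" and ?Cp = "m1.Cpert v1"
    have "?H * ?M / g\<^sup>2 = ?H * ?M * (1 / g\<^sup>2)" by simp
    also have "\<dots> \<le> ?H * ?M * (16 * ?b)"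
      using g2 m1.CG_nonneg gk(1) by (intro mult_left_mono) auto
    finally have t2: "?H * ?M / g\<^sup>2 \<le> ?H * ?M * (16 * ?b)" .
    \<comment> \<open>The part of the Lipschitz constant due to distant lattice points is bounded in
      \<open>k\<close> and is absorbed into the order \<open>k ^ (2 l - 2)\<close>.\<close>
    have "4 * real l \<le> 4 * real l * k ^ (2 * l - 2)" using k1 mult_left_mono[of 1 _ "4 * real l"] by simp
    then have "2 * ?Cp * (2 * (m1.CD * k ^ (2 * l - 2) / ?d\<^sup>2) + (4 * real l + ?H * ?M / g\<^sup>2))
        \<le> 2 * ?Cp * (2 * (m1.CD * k ^ (2 * l - 2) / ?d\<^sup>2) + (4 * real l * k ^ (2 * l - 2) + ?H * ?M * (16 * ?b)))"
      using t2 Cp by (intro mult_left_mono add_mono) auto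
    also have "\<dots> = 2 * ?Cp * (2 * m1.CD / ?d\<^sup>2 + 4 * real l) * k ^ (2 * l - 2) + c1 * ?M * ?b"
      by (simp add: c1_def algebra_simps)
    finally have "norm (G - m.Glh t) \<le> 2 * ?Cp * (2 * m1.CD / ?d\<^sup>2 + 4 * real l) * k ^ (2 * l - 2) + c1 * ?M * ?b"
      using G by linarith
    moreover have "\<bar>norm (m.Glh t) - 2 * real l * ?M\<bar> \<le>
        (m1.CD + 2 * real l * (real (2 * l - 1) * 2 ^ (2 * l - 1))) * k ^ (2 * l - 2)"
      using tt0 by (intro m.norm_Glh_bounds[OF gk(1,2) kj _ r(1)]) (simp add: r_def dist_commute)
    moreover have "\<bar>norm G - norm (m.Glh t)\<bar> \<le> norm (G - m.Glh t)" by (rule norm_triangle_ineq3)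
    ultimately have "\<bar>norm G - 2 * real l * ?M\<bar> \<le> c0 * k ^ (2 * l - 2) + c1 * ?M * ?b"
      unfolding c0_def distrib_right by linarith
    then have "\<bar>norm G - 2 * real l * ?M\<bar> \<le> ?M * (c0 * ?a + c1 * ?b)"
      unfolding kpow by (simp add: algebra_simps)
    then obtain \<epsilon>\<^sub>1 \<epsilon>\<^sub>2 where "norm G = 2 * real l * ?M * (1 + \<epsilon>\<^sub>1 + \<epsilon>\<^sub>2)"
      "\<bar>\<epsilon>\<^sub>1\<bar> \<le> max c0 c1 * ?b" "\<bar>\<epsilon>\<^sub>2\<bar> \<le> max c0 c1 * ?a"
      by (rule split_relative_error) (use assms(1) gk(1) c01 in auto)
    with der wd show ?thesis by blast
  qed
  show ?thesis
    by (intro exI[of _ "max 1 N"] exI[of _ "max c0 c1"] conjI[of "0 < max 1 N"] allI impI ballI) (simp, erule (6) main)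
qed

end
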